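(* Consider a stationary memoryless classical-quantum channel with input alphabet $\mathcal{X}=\{0,1,\dots,N\}$ such that for all $x\in\mathcal{X}$, $\operatorname{supp}(\sigma_x)\subseteq\operatorname{supp}(\sigma_0)$ and $\operatorname{supp}(\rho_x)\subseteq\operatorname{supp}(\rho_0)$, and such that $\rho_0$ is not a mixture of $\{\rho_x\}_{x\in\mathcal{X}\setminus\{0\}}$. Let $\tilde p$ be a probability distribution on $\mathcal{X}\setminus\{0\}$, let $\gamma_n=o(1)\cap\omega(\log n/\sqrt{n})$ and $\alpha_n=\gamma_n/\sqrt n$. Then for every $\varsigma\in(0,1)$ there exist constants $\varsigma_1,\varsigma_2,\varsigma_3>0$ such that for all sufficiently large $n$ there exists a coding scheme with $$\log M=(1-\varsigma)\gamma_n\sqrt n\sum_{x\ne0}\tilde p(x)D(\sigma_x\|\sigma_0),$$ $$\log K=\gamma_n\sqrt n\Big[\sum_{x\ne0}\tilde p(x)\big((1+\varsigma)D(\rho_x\|\rho_0)-(1-\varsigma)D(\sigma_x\|\sigma_0)\big)\Big]^+,$$ and $$\mathbb{P}_{\rm e}^B\le e^{-\varsigma_1\gamma_n\sqrt n},\quad \big|D(\bar\rho^n\|\rho_0^{\otimes n})-D(\rho_{\alpha_n}^{\otimes n}\|\rho_0^{\otimes n})\big|\le e^{-\varsigma_2\gamma_n\sqrt n},\quad D(\rho_{\alpha_n}^{\otimes n}\|\rho_0^{\otimes n})\le\varsigma_3\gamma_n^2.$$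
   Context: A stationary memoryless classical-quantum (cq) channel maps each input symbol $x$ of a finite alphabet $\mathcal{X}$ to density operators $\sigma_x$ at Bob and $\rho_x$ at Willie (finite-dimensional); symbol $0$ is the innocent symbol. An input sequence $\mathbf{x}$ produces $\sigma^n(\mathbf{x})=\sigma_{x_1}\otimes\cdots\otimes\sigma_{x_n}$ at Bob and $\rho^n(\mathbf{x})=\rho_{x_1}\otimes\cdots\otimes\rho_{x_n}$ at Willie. A coding scheme of blocklength $n$: codewords $\mathbf{x}(m,k)\in\mathcal{X}^n$, $m\in\{1,\dots,M\}$ (message), $k\in\{1,\dots,K\}$ (pre-shared secret), both uniform; for each $k$ Bob uses a decoding POVM $\{\Lambda_{m,k}\}_m$ and $\mathbb{P}_{\rm e}^B=\frac1M\sum_m(1-\operatorname{Tr}\{\Lambda_{m,k}\sigma^n(\mathbf{x}(m,k))\})$. Willie's average state is $\bar\rho^n=\frac{1}{MK}\sum_{m,k}\rho^n(\mathbf{x}(m,k))$. "$\rho_0$ is not a mixture of $\{\rho_x\}_{x\ne0}$" means there is no probability distribution $\pi$ on $\mathcal{X}\setminus\{0\}$ with $\rho_0=\sum_{x\ne0}\pi(x)\rho_x$. $\tilde\rho=\sum_{x\ne0}\tilde p(x)\rho_x$ and $\rho_{\alpha}=(1-\alpha)\rho_0+\alpha\tilde\rho$. $D(\rho\|\sigma)=\operatorname{Tr}\{\rho(\log\rho-\log\sigma)\}$; $[c]^+=\max\{c,0\}$. $\gamma_n=o(1)\cap\omega(\log n/\sqrt n)$ means $\gamma_n\to0$ and $\sqrt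 n\gamma_n/\log n\to\infty$.
   Formalization: Since M and K are integers, the equalities for log M and log K cannot hold exactly in general; M and K are taken to be the exponentials of the stated right-hand sides rounded up to the next integer. *)

theory Defs
  imports Complex_Main "Jordan_Normal_Form.Jordan_Normal_Form_Existence"
begin

definition mtrace :: "complex mat \<Rightarrow> complex" where
  "mtrace A = (\<Sum>i<dim_row A. A $$ (i,i))"

definition hermitian_mat :: "nat \<Rightarrow> complex mat \<Rightarrow> bool" where
  "hermitian_mat d A \<longleftrightarrow> A \<in> carrier_mat d d \<and> mat_adjoint A = A"

definition psd_mat :: "nat \<Rightarrow> complex mat \<Rightarrow> bool" where
  "psd_mat d A \<longleftrightarrow> hermitian_mat d A \<and>
     (\<forall>v \<in> carrier_vec d. 0 \<le> Re ((A *\<^sub>v v) \<bullet> conjugate v))"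

definition density_op :: "nat \<Rightarrow> complex mat \<Rightarrow> bool" where
  "density_op d A \<longleftrightarrow> psd_mat d A \<and> mtrace A = 1"

definition unitary_mat :: "nat \<Rightarrow> complex mat \<Rightarrow> bool" where
  "unitary_mat d U \<longleftrightarrow> U \<in> carrier_mat d d \<and> mat_adjoint U * U = 1\<^sub>m d"

definition supp :: "complex mat \<Rightarrow> complex vec set" where
  "supp A = {A *\<^sub>v v | v. v \<in> carrier_vec (dim_col A)}"

text \<open>Functional calculus for Hermitian matrices via a (chosen) spectral decomposition
  A = U diag(l) U^*, U unitary, l real.  Result is independent of the choice.\<close>
definition mat_fun :: "(real \<Rightarrow> real) \<Rightarrow> complex mat \<Rightarrow> complex mat" where
  "mat_fun f A =
     (let d = dim_row A;
          (U, l) = (SOME (U, l). unitary_mat d U \<and>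
                      A = U * mat_diag d (\<lambda>i. complex_of_real (l i)) * mat_adjoint U)
      in U * mat_diag d (\<lambda>i. complex_of_real (f (l i))) * mat_adjoint U)"

text \<open>Natural logarithm on the support (convention log 0 := 0 on the kernel).\<close>
definition ln_supp :: "real \<Rightarrow> real" where
  "ln_supp x = (if x > 0 then ln x else 0)"

definition mat_ln :: "complex mat \<Rightarrow> complex mat" where
  "mat_ln A = mat_fun ln_supp A"

definition qrel_ent :: "complex mat \<Rightarrow> complex mat \<Rightarrow> real" where
  "qrel_ent \<rho> \<sigma> = Re (mtrace (\<rho> * (mat_ln \<rho> - mat_ln \<sigma>)))"

definition kron :: "complex mat \<Rightarrow> complex mat \<Rightarrow> complex mat" where
  "kron A B = mat (dim_row A * dim_row B) (dim_col A * dim_col B)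
     (\<lambda>(i,j). A $$ (i div dim_row B, j div dim_col B) * B $$ (i mod dim_row B, j mod dim_col B))"

fun tensor_list :: "complex mat list \<Rightarrow> complex mat" where
  "tensor_list [] = 1\<^sub>m 1"
| "tensor_list (A # As) = kron A (tensor_list As)"

definition tensor_pow :: "complex mat \<Rightarrow> nat \<Rightarrow> complex mat" where
  "tensor_pow A n = tensor_list (replicate n A)"

definition chan_out :: "(nat \<Rightarrow> complex mat) \<Rightarrow> nat \<Rightarrow> (nat \<Rightarrow> nat) \<Rightarrow> complex mat" where
  "chan_out W n x = tensor_list (map (\<lambda>i. W (x i)) [0..<n])"

definition mat_sum :: "nat \<Rightarrow> ('i \<Rightarrow> complex mat) \<Rightarrow> 'i set \<Rightarrow> complex mat" where
  "mat_sum d F S = mat d d (\<lambda>(i,j). \<Sum>s\<in>S. F s $$ (i,j))"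

definition is_mixture :: "nat \<Rightarrow> nat \<Rightarrow> (nat \<Rightarrow> complex mat) \<Rightarrow> bool" where
  "is_mixture d N \<rho> \<longleftrightarrow> (\<exists>\<pi> :: nat \<Rightarrow> real.
      (\<forall>x\<in>{1..N}. 0 \<le> \<pi> x) \<and> (\<Sum>x=1..N. \<pi> x) = 1 \<and>
      \<rho> 0 = mat_sum d (\<lambda>x. complex_of_real (\<pi> x) \<cdot>\<^sub>m \<rho> x) {1..N})"

definition mix_state :: "nat \<Rightarrow> nat \<Rightarrow> (nat \<Rightarrow> real) \<Rightarrow> (nat \<Rightarrow> complex mat) \<Rightarrow> complex mat" where
  "mix_state d N p \<rho> = mat_sum d (\<lambda>x. complex_of_real (p x) \<cdot>\<^sub>m \<rho> x) {1..N}"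

definition rho_alpha :: "nat \<Rightarrow> nat \<Rightarrow> (nat \<Rightarrow> real) \<Rightarrow> (nat \<Rightarrow> complex mat) \<Rightarrow> real \<Rightarrow> complex mat" where
  "rho_alpha d N p \<rho> \<alpha> =
     complex_of_real (1 - \<alpha>) \<cdot>\<^sub>m \<rho> 0 + complex_of_real \<alpha> \<cdot>\<^sub>m mix_state d N p \<rho>"

definition bob_error ::
  "nat \<Rightarrow> (nat \<Rightarrow> complex mat) \<Rightarrow> nat \<Rightarrow> (nat \<Rightarrow> nat \<Rightarrow> nat \<Rightarrow> nat)
     \<Rightarrow> (nat \<Rightarrow> nat \<Rightarrow> complex mat) \<Rightarrow> nat \<Rightarrow> real" where
  "bob_error n \<sigma> M cw \<Lambda> k =
     (1 / real M) * (\<Sum>m<M. 1 - Re (mtrace (\<Lambda> m k * chan_out \<sigma> n (cw m k))))"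

definition willie_avg ::
  "nat \<Rightarrow> nat \<Rightarrow> (nat \<Rightarrow> complex mat) \<Rightarrow> nat \<Rightarrow> nat \<Rightarrow> (nat \<Rightarrow> nat \<Rightarrow> nat \<Rightarrow> nat) \<Rightarrow> complex mat" where
  "willie_avg dW n \<rho> M K cw =
     complex_of_real (1 / (real M * real K)) \<cdot>\<^sub>m
       mat_sum (dW ^ n) (\<lambda>(m,k). chan_out \<rho> n (cw m k)) ({..<M} \<times> {..<K})"

definition coding_scheme ::
  "nat \<Rightarrow> nat \<Rightarrow> nat \<Rightarrow> nat \<Rightarrow> nat \<Rightarrow> (nat \<Rightarrow> nat \<Rightarrow> nat \<Rightarrow> nat)
     \<Rightarrow> (nat \<Rightarrow> nat \<Rightarrow> complex mat) \<Rightarrow> bool" where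
  "coding_scheme N dB n M K cw \<Lambda> \<longleftrightarrow>
     1 \<le> M \<and> 1 \<le> K \<and>
     (\<forall>m<M. \<forall>k<K. \<forall>i<n. cw m k i \<le> N) \<and>
     (\<forall>k<K. (\<forall>m<M. psd_mat (dB ^ n) (\<Lambda> m k)) \<and>
             mat_sum (dB ^ n) (\<lambda>m. \<Lambda> m k) {..<M} = 1\<^sub>m (dB ^ n))"

end

theory Submission imports Defs
begin

text \<open>
  The codewords are drawn independently with i.i.d. letters, a non-innocent letter \<open>y\<close> having
  probability \<open>\<alpha> * p y\<close>. Both the reliability and the covertness bound rest on a Chernoff
  estimate whose exponent is proportional to the expected number \<open>n * \<alpha>\<close> of non-innocent letters.

  Bob tests sequentially, for each message, the projection onto the span of the typical eigenvectors
  of the codeword state, cut down to typical eigenvectors of the innocent state, and Gao's union bound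
  controls the error. The confusion probability is a rank bound times an eigenvalue bound; here
  Bob's average state is replaced by \<open>(1 + \<delta>) * \<sigma>\<^sub>0\<close>, but only at the positions where the codeword
  is not innocent, so that the loss is exponential in \<open>n * \<alpha>\<close> and not in \<open>n\<close>.

  For Willie, each codeword state is truncated to typical eigenvectors, and the variance of the
  average of the truncated states is estimated in the Hilbert-Schmidt norm weighted by the inverse of
  the innocent state. By Cauchy-Schwarz this bounds the trace distance between Willie's average
  state and \<open>\<rho>\<^sub>\<alpha>\<close> to the power \<open>n\<close>, and a continuity estimate turns this into a bound on the
  difference of relative entropies; the polynomial factor \<open>n\<close> it costs is absorbed because
  \<open>\<gamma>\<^sub>n\<close> exceeds every multiple of \<open>ln n / sqrt n\<close>.

  Averaging over the random choice yields one code that is good for Willie and, on average over the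
  keys, for Bob. The few keys with a large decoding error reuse the codewords of a good key, which
  hardly changes Willie's average state.
\<close>

section \<open>Operators on finite index sets\<close>

text \<open>Non-innocent letters number about \<open>\<gamma> n * sqrt n\<close>, far fewer than
  \<open>n\<close>, so a constant factor may be lost per non-innocent position but never per
  position. This is why everything is written in an eigenbasis of the innocent state: at an innocent
  position the eigenvectors of a codeword state are unit vectors, so truncation keeps that letter
  exactly and spends no threshold on it. A test built from such vectors is block diagonal in the
  letters at innocent positions. There Bob's average state, which need not commute with the innocent
  one, is seen only through its diagonal, which sums to 1. The rates: a confusion has probability
  about \<open>exp (- n \<alpha> DB)\<close>, and \<open>1 - s\<close> leaves room for
  \<open>M\<close> messages; Willie's variance is about \<open>exp (n \<alpha> DW) / (M K)\<close>,
  and the bracket in log K makes \<open>M K\<close> at least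
  \<open>exp ((1 + s) n \<alpha> DW)\<close>. The gap \<open>s * DW\<close> is a true gain because
  \<open>DW > 0\<close>, which is where the innocent state not being a mixture enters. The bound by
  \<gamma>^2 has another origin: the chi-square divergence of the mixed state is of second order in
  \<alpha>.\<close>

text \<open>Operators are kernels \<open>'a \<Rightarrow> 'a \<Rightarrow> complex\<close> on a finite index set rather than matrices: tensor
  powers are then indexed by functions in \<open>PiE\<close>, without mixed-radix arithmetic. In \<open>onb\<close> and
  \<open>spectral\<close>, \<open>U a i\<close> is the \<open>a\<close>-th entry of the \<open>i\<close>-th vector.\<close>

definition ip :: "'a set \<Rightarrow> ('a \<Rightarrow> complex) \<Rightarrow> ('a \<Rightarrow> complex) \<Rightarrow> complex" where
  "ip S u v = (\<Sum>a\<in>S. cnj (u a) * v a)"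

definition nsq :: "'a set \<Rightarrow> ('a \<Rightarrow> complex) \<Rightarrow> real" where
  "nsq S u = (\<Sum>a\<in>S. (cmod (u a))\<^sup>2)"

definition qform :: "'a set \<Rightarrow> ('a \<Rightarrow> 'a \<Rightarrow> complex) \<Rightarrow> ('a \<Rightarrow> complex) \<Rightarrow> complex" where
  "qform S A u = (\<Sum>a\<in>S. \<Sum>b\<in>S. cnj (u a) * A a b * u b)"

definition onb :: "'a set \<Rightarrow> 'i set \<Rightarrow> ('a \<Rightarrow> 'i \<Rightarrow> complex) \<Rightarrow> bool" where
  "onb S I U \<longleftrightarrow> finite S \<and> finite I \<and>
     (\<forall>i\<in>I. \<forall>j\<in>I. (\<Sum>a\<in>S. cnj (U a i) * U a j) = of_bool (i = j)) \<and>
     (\<forall>a\<in>S. \<forall>b\<in>S. (\<Sum>i\<in>I. U a i * cnj (U b i)) = of_bool (a = b))"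

definition spectral ::
  "'a set \<Rightarrow> 'i set \<Rightarrow> ('a \<Rightarrow> 'a \<Rightarrow> complex) \<Rightarrow> ('a \<Rightarrow> 'i \<Rightarrow> complex) \<Rightarrow> ('i \<Rightarrow> real) \<Rightarrow> bool" where
  "spectral S I A U l \<longleftrightarrow> onb S I U \<and>
     (\<forall>a\<in>S. \<forall>b\<in>S. A a b = (\<Sum>i\<in>I. of_real (l i) * U a i * cnj (U b i)))"

lemma onbD:
  assumes "onb S I U"
  shows "finite S" "finite I"
    "\<And>i j. i \<in> I \<Longrightarrow> j \<in> I \<Longrightarrow> (\<Sum>a\<in>S. cnj (U a i) * U a j) = of_bool (i = j)"
    "\<And>a b. a \<in> S \<Longrightarrow> b \<in> S \<Longrightarrow> (\<Sum>i\<in>I. U a i * cnj (U b i)) = of_bool (a = b)"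
  using assms unfolding onb_def by blast+

lemma spectralD:
  assumes "spectral S I A U l"
  shows "onb S I U" "finite S" "finite I"
    "\<And>a b. a \<in> S \<Longrightarrow> b \<in> S \<Longrightarrow> A a b = (\<Sum>i\<in>I. of_real (l i) * U a i * cnj (U b i))"
  using assms onbD unfolding spectral_def by blast+

lemma cmod_sq: "complex_of_real ((cmod z)\<^sup>2) = cnj z * z"
  using complex_norm_square[of z] by (simp add: mult.commute)

lemma ip_self: "ip S u u = of_real (nsq S u)"
  unfolding ip_def nsq_def of_real_sum cmod_sq ..

lemma nsq_nonneg: "0 \<le> nsq S u"
  unfolding nsq_def by (simp add: sum_nonneg)

lemma ip_cnj: "cnj (ip S u v) = ip S v u"
  unfolding ip_def by (simp add: mult.commute)

lemma onb_adjoint: "onb S I U \<Longrightarrow> onb I S (\<lambda>i a. cnj (U a i))"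
  unfolding onb_def by (auto simp: mult.commute)

lemma onb_col_norm:
  assumes "onb S I U" "i \<in> I"
  shows "nsq S (\<lambda>a. U a i) = 1"
proof -
  have "complex_of_real (nsq S (\<lambda>a. U a i)) = 1"
    unfolding nsq_def of_real_sum cmod_sq using onbD(3)[OF assms(1) assms(2) assms(2)] by simp
  thus ?thesis by (simp only: of_real_eq_1_iff)
qed

lemma onb_row_norm:
  assumes "onb S I U" "a \<in> S"
  shows "(\<Sum>i\<in>I. (cmod (U a i))\<^sup>2) = 1"
  using onb_col_norm[OF onb_adjoint[OF assms(1)] assms(2)] by (simp add: nsq_def)

lemma sum_of_bool_eq:
  assumes "finite A" "a \<in> A"
  shows "(\<Sum>x\<in>A. of_bool (x = a) * f x) = (f a :: 'b :: semiring_1)"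
    "(\<Sum>x\<in>A. of_bool (a = x) * f x) = f a"
    "(\<Sum>x\<in>A. f x * of_bool (x = a)) = f a"
    "(\<Sum>x\<in>A. f x * of_bool (a = x)) = f a"
  using assms by (simp_all add: of_bool_def if_distrib if_distribR sum.delta sum.delta' cong: if_cong)

lemma onb_expand:
  assumes "onb S I U" "a \<in> S"
  shows "(\<Sum>i\<in>I. U a i * (\<Sum>b\<in>S. cnj (U b i) * v b)) = v a"
proof -
  have "(\<Sum>i\<in>I. U a i * (\<Sum>b\<in>S. cnj (U b i) * v b)) = (\<Sum>b\<in>S. (\<Sum>i\<in>I. U a i * cnj (U b i)) * v b)"
    by (simp add: sum_distrib_left sum_distrib_right mult.assoc sum.swap[of _ I])
  also have "\<dots> = (\<Sum>b\<in>S. of_bool (a = b) * v b)"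
    by (intro sum.cong refl) (simp add: onbD(4)[OF assms(1) assms(2)])
  finally show ?thesis using sum_of_bool_eq(2)[OF onbD(1)[OF assms(1)] assms(2)] by simp
qed

lemma onb_ip_coords:
  assumes "onb S I U"
  shows "ip I (\<lambda>i. \<Sum>a\<in>S. cnj (U a i) * u a) (\<lambda>i. \<Sum>a\<in>S. cnj (U a i) * v a) = ip S u v"
proof -
  have "ip I (\<lambda>i. \<Sum>a\<in>S. cnj (U a i) * u a) (\<lambda>i. \<Sum>a\<in>S. cnj (U a i) * v a)
     = (\<Sum>i\<in>I. \<Sum>a\<in>S. cnj (u a) * (U a i * (\<Sum>b\<in>S. cnj (U b i) * v b)))"
    unfolding ip_def by (simp add: sum_distrib_right mult.assoc mult.left_commute[of "U _ _"] mult.commute[of "U _ _" "cnj _"])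
  also have "\<dots> = (\<Sum>a\<in>S. cnj (u a) * (\<Sum>i\<in>I. U a i * (\<Sum>b\<in>S. cnj (U b i) * v b)))"
    by (subst sum.swap) (simp add: sum_distrib_left)
  also have "\<dots> = ip S u v"
    unfolding ip_def by (intro sum.cong refl) (simp add: onb_expand[OF assms])
  finally show ?thesis .
qed

lemma parseval:
  assumes "onb S I U"
  shows "(\<Sum>i\<in>I. (cmod (\<Sum>a\<in>S. cnj (U a i) * v a))\<^sup>2) = nsq S v"
proof -
  have "complex_of_real (nsq I (\<lambda>i. \<Sum>a\<in>S. cnj (U a i) * v a)) = of_real (nsq S v)"
    using onb_ip_coords[OF assms, of v v] by (simp add: ip_self)
  thus ?thesis by (simp only: of_real_eq_iff) (simp add: nsq_def)
qed

text \<open>Parseval for either basis gives one of the two orthogonality relations. The squared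
  moduli of the overlaps thus form a doubly stochastic matrix, on which all relative entropy
  estimates rest.\<close>

lemma onb_overlap:
  assumes "onb S I U" "onb S K V"
  shows "onb I K (\<lambda>i k. \<Sum>a\<in>S. cnj (U a i) * V a k)"
proof -
  have 1: "(\<Sum>i\<in>I. cnj (\<Sum>a\<in>S. cnj (U a i) * V a k) * (\<Sum>a\<in>S. cnj (U a i) * V a k')) = of_bool (k = k')"
    if "k \<in> K" "k' \<in> K" for k k'
    using onb_ip_coords[OF assms(1), of "\<lambda>a. V a k" "\<lambda>a. V a k'"] onbD(3)[OF assms(2) that]
    by (simp add: ip_def)
  have 2: "(\<Sum>k\<in>K. (\<Sum>a\<in>S. cnj (U a i) * V a k) * cnj (\<Sum>a\<in>S. cnj (U a j) * V a k)) = of_bool (i = j)"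
    if "i \<in> I" "j \<in> I" for i j
  proof -
    have "(\<Sum>k\<in>K. (\<Sum>a\<in>S. cnj (U a i) * V a k) * cnj (\<Sum>a\<in>S. cnj (U a j) * V a k))
      = cnj (ip K (\<lambda>k. \<Sum>a\<in>S. cnj (V a k) * U a j) (\<lambda>k. \<Sum>a\<in>S. cnj (V a k) * U a i))"
      unfolding ip_def by (simp add: mult_ac)
    also have "\<dots> = cnj (ip S (\<lambda>a. U a j) (\<lambda>a. U a i))"
      by (simp only: onb_ip_coords[OF assms(2)])
    also have "\<dots> = of_bool (i = j)"
      using onbD(3)[OF assms(1) that(2) that(1)] by (simp add: ip_def of_bool_def)
    finally show ?thesis .
  qed
  show ?thesis unfolding onb_def using 1 2 onbD[OF assms(1)] onbD[OF assms(2)] by blast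
qed

section \<open>Tensor products of orthonormal bases and of spectral decompositions\<close>

lemma of_bool_prod_PiE:
  assumes "finite X" "i \<in> PiE X I" "j \<in> PiE X I"
  shows "(\<Prod>x\<in>X. of_bool (i x = j x)) = (of_bool (i = j) :: 'c :: comm_semiring_1)"
proof (cases "i = j")
  case False
  then obtain x where "x \<in> X" "i x \<noteq> j x" using PiE_ext[OF assms(2,3)] by blast
  with assms(1) False show ?thesis by (subst prod_zero) auto
qed simp

lemma onb_PiE:
  assumes X: "finite X" and o: "\<And>x. x \<in> X \<Longrightarrow> onb (S x) (I x) (U x)"
  shows "onb (PiE X S) (PiE X I) (\<lambda>a i. \<Prod>x\<in>X. U x (a x) (i x))"
proof -
  note f = onbD(1,2)[OF o]
  have 1: "(\<Sum>a\<in>PiE X S. cnj (\<Prod>x\<in>X. U x (a x) (i x)) * (\<Prod>x\<in>X. U x (a x) (j x))) = of_bool (i = j)"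
    if "i \<in> PiE X I" "j \<in> PiE X I" for i j
  proof -
    have "(\<Sum>a\<in>PiE X S. cnj (\<Prod>x\<in>X. U x (a x) (i x)) * (\<Prod>x\<in>X. U x (a x) (j x)))
       = (\<Prod>x\<in>X. \<Sum>a\<in>S x. cnj (U x a (i x)) * U x a (j x))"
      by (simp add: prod.distrib prod_sum_PiE[OF X] f)
    also have "\<dots> = (\<Prod>x\<in>X. of_bool (i x = j x))"
      by (intro prod.cong refl onbD(3)[OF o]) (use that in \<open>auto simp: PiE_iff\<close>)
    finally show ?thesis using of_bool_prod_PiE[OF X that] by simp
  qed
  have 2: "(\<Sum>i\<in>PiE X I. (\<Prod>x\<in>X. U x (a x) (i x)) * cnj (\<Prod>x\<in>X. U x (b x) (i x))) = of_bool (a = b)"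
    if "a \<in> PiE X S" "b \<in> PiE X S" for a b
  proof -
    have "(\<Sum>i\<in>PiE X I. (\<Prod>x\<in>X. U x (a x) (i x)) * cnj (\<Prod>x\<in>X. U x (b x) (i x)))
       = (\<Prod>x\<in>X. \<Sum>i\<in>I x. U x (a x) i * cnj (U x (b x) i))"
      by (simp add: prod.distrib prod_sum_PiE[OF X] f)
    also have "\<dots> = (\<Prod>x\<in>X. of_bool (a x = b x))"
      by (intro prod.cong refl onbD(4)[OF o]) (use that in \<open>auto simp: PiE_iff\<close>)
    finally show ?thesis using of_bool_prod_PiE[OF X that] by simp
  qed
  show ?thesis unfolding onb_def using 1 2 f by (simp add: finite_PiE X)
qed

lemma spectral_PiE:
  assumes X: "finite X" and s: "\<And>x. x \<in> X \<Longrightarrow> spectral (S x) (I x) (A x) (U x) (l x)"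
  shows "spectral (PiE X S) (PiE X I) (\<lambda>a b. \<Prod>x\<in>X. A x (a x) (b x))
           (\<lambda>a i. \<Prod>x\<in>X. U x (a x) (i x)) (\<lambda>i. \<Prod>x\<in>X. l x (i x))"
proof -
  have "(\<Prod>x\<in>X. A x (a x) (b x)) = (\<Sum>i\<in>PiE X I. of_real (\<Prod>x\<in>X. l x (i x)) *
      (\<Prod>x\<in>X. U x (a x) (i x)) * cnj (\<Prod>x\<in>X. U x (b x) (i x)))"
    if "a \<in> PiE X S" "b \<in> PiE X S" for a b
  proof -
    have "(\<Prod>x\<in>X. A x (a x) (b x)) = (\<Prod>x\<in>X. \<Sum>i\<in>I x. of_real (l x i) * U x (a x) i * cnj (U x (b x) i))"
      by (intro prod.cong refl spectralD(4)[OF s]) (use that in \<open>auto simp: PiE_iff\<close>)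
    also have "\<dots> = (\<Sum>i\<in>PiE X I. \<Prod>x\<in>X. of_real (l x (i x)) * U x (a x) (i x) * cnj (U x (b x) (i x)))"
      by (rule prod_sum_PiE[OF X spectralD(3)[OF s]])
    finally show ?thesis by (simp add: prod.distrib)
  qed
  moreover have "onb (PiE X S) (PiE X I) (\<lambda>a i. \<Prod>x\<in>X. U x (a x) (i x))"
    using X spectralD(1)[OF s] by (rule onb_PiE)
  ultimately show ?thesis unfolding spectral_def by blast
qed

lemma onb_reindex:
  assumes "bij_betw h T S" "onb S I U"
  shows "onb T I (\<lambda>a. U (h a))"
proof -
  have 1: "(\<Sum>a\<in>T. cnj (U (h a) i) * U (h a) j) = (\<Sum>a\<in>S. cnj (U a i) * U a j)" for i j
    by (rule sum.reindex_bij_betw[OF assms(1)])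
  have 2: "finite T" using assms bij_betw_finite onbD(1) by blast
  have 3: "h a \<in> S" if "a \<in> T" for a using assms(1) that by (auto simp: bij_betw_def)
  have 4: "(h a = h b) = (a = b)" if "a \<in> T" "b \<in> T" for a b
    using assms(1) that by (auto simp: bij_betw_def inj_on_def)
  have 5: "(\<Sum>i\<in>I. U (h a) i * cnj (U (h b) i)) = of_bool (a = b)" if "a \<in> T" "b \<in> T" for a b
    using onbD(4)[OF assms(2) 3 3, OF that] 4[OF that] by simp
  show ?thesis
    unfolding onb_def 1 using 2 5 onbD(2,3)[OF assms(2)] by blast
qed

lemma spectral_reindex:
  assumes "bij_betw h T S" "spectral S I A U l"
  shows "spectral T I (\<lambda>a b. A (h a) (h b)) (\<lambda>a. U (h a)) l"
  unfolding spectral_def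
  using onb_reindex[OF assms(1) spectralD(1)[OF assms(2)]] spectralD(4)[OF assms(2)]
    bij_betw_apply[OF assms(1)] by blast

section \<open>Quadratic forms, traces and changes of basis of a spectral decomposition\<close>

lemma qform_spectral:
  assumes "spectral S I A U l"
  shows "qform S A u = of_real (\<Sum>i\<in>I. l i * (cmod (\<Sum>a\<in>S. cnj (U a i) * u a))\<^sup>2)"
proof -
  have "qform S A u = (\<Sum>a\<in>S. \<Sum>b\<in>S. \<Sum>i\<in>I. of_real (l i) * (cnj (u a) * U a i * (cnj (U b i) * u b)))"
    unfolding qform_def
    by (intro sum.cong refl) (simp add: spectralD(4)[OF assms] sum_distrib_left sum_distrib_right mult_ac)
  also have "\<dots> = (\<Sum>i\<in>I. \<Sum>a\<in>S. \<Sum>b\<in>S. of_real (l i) * (cnj (u a) * U a i * (cnj (U b i) * u b)))"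
    by (simp add: sum.swap[of _ S I])
  also have "\<dots> = (\<Sum>i\<in>I. of_real (l i) * (cnj (\<Sum>a\<in>S. cnj (U a i) * u a) * (\<Sum>b\<in>S. cnj (U b i) * u b)))"
    by (simp add: sum_distrib_left sum_distrib_right mult_ac)
  finally show ?thesis by (simp add: cmod_sq[symmetric] del: cnj_sum)
qed

lemma qform_diff: "qform S (\<lambda>a b. A a b - B a b) u = qform S A u - qform S B u"
  unfolding qform_def by (simp add: algebra_simps sum_subtractf)

lemma qform_eigenvector:
  assumes "spectral S I A U l" "i \<in> I"
  shows "qform S A (\<lambda>a. U a i) = of_real (l i)"
proof -
  have "(\<Sum>j\<in>I. l j * (cmod (\<Sum>a\<in>S. cnj (U a j) * U a i))\<^sup>2) = (\<Sum>j\<in>I. l j * of_bool (j = i))"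
    by (intro sum.cong refl) (simp add: onbD(3)[OF spectralD(1)[OF assms(1)] _ assms(2)])
  also have "\<dots> = l i" by (rule sum_of_bool_eq(3)[OF spectralD(3)[OF assms(1)] assms(2)])
  finally show ?thesis unfolding qform_spectral[OF assms(1)] by (simp only:)
qed

lemma trace_spectral:
  assumes "spectral S I A U l"
  shows "(\<Sum>a\<in>S. A a a) = of_real (\<Sum>i\<in>I. l i)"
proof -
  have "(\<Sum>a\<in>S. A a a) = (\<Sum>a\<in>S. \<Sum>i\<in>I. of_real (l i) * (cnj (U a i) * U a i))"
    by (intro sum.cong refl) (simp add: spectralD(4)[OF assms] mult_ac)
  also have "\<dots> = (\<Sum>i\<in>I. of_real (l i) * (\<Sum>a\<in>S. cnj (U a i) * U a i))"
    by (subst sum.swap) (simp add: sum_distrib_left)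
  also have "\<dots> = (\<Sum>i\<in>I. of_real (l i))"
    by (intro sum.cong refl) (simp add: onbD(3)[OF spectralD(1)[OF assms]])
  finally show ?thesis by simp
qed

lemma spectral_change_basis:
  assumes "spectral S I A U l" "onb S K V"
  shows "spectral K I (\<lambda>k k'. \<Sum>a\<in>S. \<Sum>b\<in>S. cnj (V a k) * A a b * V b k')
           (\<lambda>k i. \<Sum>a\<in>S. cnj (V a k) * U a i) l"
proof -
  have "(\<Sum>a\<in>S. \<Sum>b\<in>S. cnj (V a k) * A a b * V b k')
     = (\<Sum>i\<in>I. of_real (l i) * (\<Sum>a\<in>S. cnj (V a k) * U a i) * cnj (\<Sum>a\<in>S. cnj (V a k') * U a i))" for k k'
  proof -
    have "(\<Sum>a\<in>S. \<Sum>b\<in>S. cnj (V a k) * A a b * V b k')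
      = (\<Sum>a\<in>S. \<Sum>b\<in>S. \<Sum>i\<in>I. of_real (l i) * (cnj (V a k) * U a i * (cnj (U b i) * V b k')))"
      by (intro sum.cong refl) (simp add: spectralD(4)[OF assms(1)] sum_distrib_left sum_distrib_right mult_ac)
    also have "\<dots> = (\<Sum>i\<in>I. \<Sum>a\<in>S. \<Sum>b\<in>S. of_real (l i) * (cnj (V a k) * U a i * (cnj (U b i) * V b k')))"
      by (simp add: sum.swap[of _ S I])
    finally show ?thesis by (simp add: sum_distrib_left sum_distrib_right mult_ac)
  qed
  thus ?thesis unfolding spectral_def
    using onb_overlap[OF assms(2) spectralD(1)[OF assms(1)]] by blast
qed

section \<open>The spectral theorem for matrices\<close>

abbreviation ent :: "complex mat \<Rightarrow> nat \<Rightarrow> nat \<Rightarrow> complex" where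
  "ent A \<equiv> (\<lambda>a b. A $$ (a, b))"

lemma mat_adjoint_carrier: "A \<in> carrier_mat n m \<Longrightarrow> mat_adjoint A \<in> carrier_mat m n"
  unfolding mat_adjoint_def by auto

lemma mat_adjoint_index:
  assumes "A \<in> carrier_mat n m" "i < m" "j < n"
  shows "mat_adjoint A $$ (i, j) = cnj (A $$ (j, i))"
  using assms unfolding mat_adjoint_def by (subst mat_of_rows_index) auto

lemma hermitian_mat_index:
  assumes "hermitian_mat d A" "i < d" "j < d"
  shows "A $$ (i, j) = cnj (A $$ (j, i))"
  using assms mat_adjoint_index[of A d d i j] unfolding hermitian_mat_def by simp

lemma mult_mat_index:
  assumes "A \<in> carrier_mat n m" "B \<in> carrier_mat m k" "i < n" "j < k"
  shows "(A * B) $$ (i, j) = (\<Sum>l<m. A $$ (i, l) * B $$ (l, j))"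
  using assms by (auto simp: scalar_prod_def lessThan_atLeast0 intro!: sum.cong)

lemma mtrace_eq: "A \<in> carrier_mat n m \<Longrightarrow> mtrace A = (\<Sum>i<n. A $$ (i, i))"
  unfolding mtrace_def by auto

lemma mtrace_mult:
  assumes "A \<in> carrier_mat n m" "B \<in> carrier_mat m n"
  shows "mtrace (A * B) = (\<Sum>i<n. \<Sum>l<m. A $$ (i, l) * B $$ (l, i))"
proof -
  have "mtrace (A * B) = (\<Sum>i<n. (A * B) $$ (i, i))"
    using assms by (intro mtrace_eq[of _ n n]) auto
  also have "\<dots> = (\<Sum>i<n. \<Sum>l<m. A $$ (i, l) * B $$ (l, i))"
    by (intro sum.cong refl mult_mat_index[OF assms]) auto
  finally show ?thesis .
qed

lemma mtrace_comm:
  assumes "A \<in> carrier_mat n m" "B \<in> carrier_mat m n"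
  shows "mtrace (A * B) = mtrace (B * A)"
  unfolding mtrace_mult[OF assms] mtrace_mult[OF assms(2,1)]
  by (subst sum.swap) (simp add: mult.commute)

text \<open>A Schur decomposition is a similarity, so it preserves the trace, and its diagonal lists
  the roots of the characteristic polynomial. The lemma is used by contradiction, to force an
  eigenvalue other than \<open>c\<close>.\<close>

lemma trace_single_eigenvalue:
  fixes A :: "complex mat"
  assumes A: "A \<in> carrier_mat n n" and c: "\<And>k. eigenvalue A k \<Longrightarrow> k = c"
  shows "mtrace A = of_nat n * c"
proof -
  obtain es where es: "char_poly A = (\<Prod>a\<leftarrow>es. [:- a, 1:])" "length es = n"
    using char_poly_factorized[OF A] by blast
  obtain B P Q where "schur_decomposition A es = (B, P, Q)"
    by (cases "schur_decomposition A es") auto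
  from schur_decomposition[OF A es(1) this]
  have sim: "similar_mat_wit A B P Q" and diag: "diag_mat B = es" by auto
  note w = similar_mat_witD2[OF A sim]
  have all_c: "e = c" if "e \<in> set es" for e
  proof -
    have "poly (char_poly A) e = 0"
      unfolding es(1) poly_prod_list using that by (induction es) auto
    thus ?thesis using c eigenvalue_root_char_poly[OF A] by blast
  qed
  have "mtrace A = mtrace (P * (B * Q))"
    using w by (simp add: assoc_mult_mat[of P n n B n Q n])
  also have "\<dots> = mtrace (B * Q * P)"
    by (rule mtrace_comm) (use w in auto)
  also have "\<dots> = mtrace (B * (Q * P))"
    using w by (simp add: assoc_mult_mat[of B n n Q n P n])
  also have "\<dots> = mtrace B" using w by simp
  also have "\<dots> = (\<Sum>i<n. es ! i)"
    unfolding diag[symmetric] mtrace_eq[OF w(5)] using w(5)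
    by (intro sum.cong refl) (auto simp: diag_mat_def)
  also have "\<dots> = (\<Sum>i<n. c)"
    by (intro sum.cong refl all_c) (simp add: es(2))
  finally show ?thesis by simp
qed

text \<open>Shifting the eigenvalues of the eigenvectors found so far to a value \<open>c\<close> that is
  incompatible with the trace forces an eigenvalue different from \<open>c\<close>, and its eigenvectors are
  orthogonal to all previous ones.\<close>
lemma hermitian_new_eigenvector:
  assumes h: "hermitian_mat D A" and k: "k < D"
    and o: "\<And>i j. i < k \<Longrightarrow> j < k \<Longrightarrow> ip {..<D} (u i) (u j) = of_bool (i = j)"
    and e: "\<And>i a. i < k \<Longrightarrow> a < D \<Longrightarrow> (\<Sum>b<D. A $$ (a, b) * u i b) = of_real (l i) * u i a"
  shows "\<exists>v m. nsq {..<D} v = 1 \<and> (\<forall>i<k. ip {..<D} (u i) v = 0) \<and>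
    (\<forall>a<D. (\<Sum>b<D. A $$ (a, b) * v b) = complex_of_real m * v a)"
proof -
  have A: "A \<in> carrier_mat D D" using h unfolding hermitian_mat_def by blast
  \<comment> \<open>The average of the trace left for the remaining \<open>D - k\<close>
    eigenvalues, plus 1. Were \<open>c\<close> the only eigenvalue of the shifted matrix, it would
    have to equal that average. The real part makes all shifts real, which keeps the shifted matrix
    Hermitian.\<close>
  define c where "c = Re ((mtrace A - (\<Sum>i<k. of_real (l i))) / (of_nat D - of_nat k)) + 1"
  define A' where "A' = mat D D (\<lambda>(a, b). A $$ (a, b) + (\<Sum>i<k. of_real (c - l i) * u i a * cnj (u i b)))"
  have A': "A' \<in> carrier_mat D D" unfolding A'_def by simp
  have "mtrace A' = mtrace A + (\<Sum>a<D. \<Sum>i<k. of_real (c - l i) * u i a * cnj (u i a))"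
    unfolding mtrace_eq[OF A] mtrace_eq[OF A'] sum.distrib[symmetric]
    by (intro sum.cong refl) (simp add: A'_def)
  also have "(\<Sum>a<D. \<Sum>i<k. of_real (c - l i) * u i a * cnj (u i a))
      = (\<Sum>i<k. of_real (c - l i) * ip {..<D} (u i) (u i))"
    unfolding ip_def by (subst sum.swap) (simp add: sum_distrib_left mult_ac)
  also have "\<dots> = of_nat k * of_real c - (\<Sum>i<k. of_real (l i))"
    by (simp add: o sum_subtractf)
  finally have tr: "mtrace A' = mtrace A - (\<Sum>i<k. of_real (l i)) + of_nat k * of_real c" by simp
  have "\<exists>m. eigenvalue A' m \<and> m \<noteq> of_real c"
  proof (rule ccontr)
    assume "\<not> ?thesis"
    hence "mtrace A' = of_nat D * of_real c" using trace_single_eigenvalue[OF A'] by blast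
    with tr have "mtrace A - (\<Sum>i<k. of_real (l i)) = (of_nat D - of_nat k) * of_real c"
      by (simp add: algebra_simps)
    moreover have nz: "(of_nat D - of_nat k :: complex) \<noteq> 0" using k by simp
    ultimately have "(mtrace A - (\<Sum>i<k. of_real (l i))) / (of_nat D - of_nat k) = of_real c"
      by simp
    thus False unfolding c_def by (metis Re_complex_of_real add_cancel_right_right zero_neq_one)
  qed
  then obtain m x where m: "m \<noteq> of_real c" and x: "eigenvector A' x m"
    unfolding eigenvalue_def by blast
  have xc: "x \<in> carrier_vec D" "x \<noteq> 0\<^sub>v D" "A' *\<^sub>v x = m \<cdot>\<^sub>v x"
    using x A' unfolding eigenvector_def by auto
  define v where "v = (\<lambda>a. x $ a)"
  have A'v: "(\<Sum>b<D. A' $$ (a, b) * v b) = m * v a" if "a < D" for a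
  proof -
    have "(A' *\<^sub>v x) $ a = (\<Sum>b<D. A' $$ (a, b) * v b)"
      using that A' xc(1) unfolding v_def by (auto simp: scalar_prod_def lessThan_atLeast0)
    thus ?thesis using xc that unfolding v_def by simp
  qed
  have split: "(\<Sum>b<D. A' $$ (a, b) * w b) = (\<Sum>b<D. A $$ (a, b) * w b)
      + (\<Sum>i<k. of_real (c - l i) * u i a * ip {..<D} (u i) w)" if "a < D" for a w
  proof -
    have "(\<Sum>b<D. A' $$ (a, b) * w b) = (\<Sum>b<D. A $$ (a, b) * w b
      + (\<Sum>i<k. of_real (c - l i) * u i a * (cnj (u i b) * w b)))"
      unfolding A'_def using that
      by (intro sum.cong refl) (simp add: distrib_right sum_distrib_right mult.assoc del: of_real_diff)
    also have "\<dots> = (\<Sum>b<D. A $$ (a, b) * w b)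
      + (\<Sum>b<D. \<Sum>i<k. of_real (c - l i) * u i a * (cnj (u i b) * w b))"
      by (rule sum.distrib)
    also have "(\<Sum>b<D. \<Sum>i<k. of_real (c - l i) * u i a * (cnj (u i b) * w b))
      = (\<Sum>i<k. of_real (c - l i) * u i a * ip {..<D} (u i) w)"
      unfolding ip_def sum_distrib_left by (rule sum.swap)
    finally show ?thesis .
  qed
  have herm': "A' $$ (a, b) = cnj (A' $$ (b, a))" if "a < D" "b < D" for a b
    unfolding A'_def using that by (simp add: hermitian_mat_index[OF h that, symmetric] mult_ac)
  have sym: "(\<Sum>a<D. cnj (p a) * (\<Sum>b<D. B $$ (a, b) * q b))
      = cnj (\<Sum>a<D. cnj (q a) * (\<Sum>b<D. B $$ (a, b) * p b))"
    if "\<And>a b. a < D \<Longrightarrow> b < D \<Longrightarrow> B $$ (a, b) = cnj (B $$ (b, a))" for p q and B :: "complex mat"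
  proof -
    have "(\<Sum>a<D. cnj (p a) * (\<Sum>b<D. B $$ (a, b) * q b))
        = (\<Sum>a<D. \<Sum>b<D. cnj (p a) * cnj (B $$ (b, a)) * q b)"
      unfolding sum_distrib_left mult.assoc by (intro sum.cong refl) (subst that, auto)
    also have "\<dots> = (\<Sum>b<D. \<Sum>a<D. cnj (p a) * cnj (B $$ (b, a)) * q b)" by (rule sum.swap)
    finally show ?thesis by (simp add: sum_distrib_left mult_ac)
  qed
  \<comment> \<open>\<open>m\<close> is not yet known to be real. It is enough that \<open>c\<close>
    is: evaluated from the other side, the Hermitian form produces \<open>of_real c\<close> instead
    of \<open>m\<close>.\<close>
  have orth: "ip {..<D} (u i) v = 0" if i: "i < k" for i
  proof -
    have A'u: "(\<Sum>b<D. A' $$ (a, b) * u i b) = of_real c * u i a" if "a < D" for a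
    proof -
      have "(\<Sum>j<k. of_real (c - l j) * u j a * ip {..<D} (u j) (u i))
          = (\<Sum>j<k. (of_real (c - l j) * u j a) * of_bool (j = i))"
        using i by (intro sum.cong refl) (simp add: o)
      also have "\<dots> = of_real (c - l i) * u i a" by (rule sum_of_bool_eq(3)) (use i in auto)
      finally show ?thesis unfolding split[OF that] e[OF i that] by (simp add: algebra_simps)
    qed
    have eq: "(\<Sum>a<D. cnj (p a) * (\<Sum>b<D. A' $$ (a, b) * q b)) = r * ip {..<D} p q"
      if "\<And>a. a < D \<Longrightarrow> (\<Sum>b<D. A' $$ (a, b) * q b) = r * q a" for p q r
      unfolding ip_def sum_distrib_left[of r] by (intro sum.cong refl) (simp add: that)
    have "m * ip {..<D} (u i) v = (\<Sum>a<D. cnj (u i a) * (\<Sum>b<D. A' $$ (a, b) * v b))"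
      by (rule eq[symmetric, OF A'v])
    also have "\<dots> = cnj (\<Sum>a<D. cnj (v a) * (\<Sum>b<D. A' $$ (a, b) * u i b))"
      by (rule sym[OF herm'])
    also have "\<dots> = of_real c * ip {..<D} (u i) v"
      by (subst eq[OF A'u]) (simp_all add: ip_cnj)
    finally show ?thesis using m by simp
  qed
  have Av: "(\<Sum>b<D. A $$ (a, b) * v b) = m * v a" if "a < D" for a
    using split[OF that, of v] A'v[OF that] by (simp add: orth)
  have v0: "nsq {..<D} v > 0"
  proof -
    obtain a where "a < D" "x $ a \<noteq> 0" using xc(1,2) by (metis carrier_vecD eq_vecI index_zero_vec)
    hence "0 < (cmod (v a))\<^sup>2" "a \<in> {..<D}" unfolding v_def by auto
    thus ?thesis unfolding nsq_def by (intro sum_pos2[of _ a]) auto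
  qed
  have eq: "(\<Sum>a<D. cnj (v a) * (\<Sum>b<D. A $$ (a, b) * v b)) = m * of_real (nsq {..<D} v)"
    unfolding ip_self[symmetric] ip_def sum_distrib_left[of m]
    by (intro sum.cong refl) (simp add: Av)
  have "m * of_real (nsq {..<D} v) = (\<Sum>a<D. cnj (v a) * (\<Sum>b<D. A $$ (a, b) * v b))"
    by (rule eq[symmetric])
  also have "\<dots> = cnj (\<Sum>a<D. cnj (v a) * (\<Sum>b<D. A $$ (a, b) * v b))"
    by (rule sym[OF hermitian_mat_index[OF h]])
  also have "\<dots> = cnj m * of_real (nsq {..<D} v)"
    unfolding eq by simp
  finally have "m = cnj m" using v0 by simp
  hence mr: "m = of_real (Re m)" by (metis Reals_cnj_iff of_real_Re)
  define w where "w = (\<lambda>a. of_real (1 / sqrt (nsq {..<D} v)) * v a)"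
  have w1: "nsq {..<D} w = 1"
  proof -
    have "nsq {..<D} w = (1 / sqrt (nsq {..<D} v))\<^sup>2 * nsq {..<D} v"
      unfolding nsq_def w_def norm_mult power_mult_distrib sum_distrib_left[symmetric] norm_of_real power2_abs ..
    thus ?thesis using v0 by (simp add: power_divide)
  qed
  have w2: "ip {..<D} (u i) w = 0" if "i < k" for i
  proof -
    have "ip {..<D} (u i) w = of_real (1 / sqrt (nsq {..<D} v)) * ip {..<D} (u i) v"
      unfolding ip_def w_def by (simp add: sum_distrib_left mult_ac)
    thus ?thesis using orth[OF that] by simp
  qed
  have w3: "(\<Sum>b<D. A $$ (a, b) * w b) = of_real (Re m) * w a" if "a < D" for a
  proof -
    have "(\<Sum>b<D. A $$ (a, b) * w b) = of_real (1 / sqrt (nsq {..<D} v)) * (\<Sum>b<D. A $$ (a, b) * v b)"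
      unfolding w_def by (simp add: sum_distrib_left mult_ac)
    also have "\<dots> = of_real (1 / sqrt (nsq {..<D} v)) * (of_real (Re m) * v a)"
      using Av[OF that] mr by simp
    finally show ?thesis unfolding w_def by (simp add: mult_ac)
  qed
  show ?thesis using w1 w2 w3 by blast
qed

lemma unitary_onb:
  assumes "unitary_mat D U"
  shows "onb {..<D} {..<D} (ent U)"
proof -
  have U: "U \<in> carrier_mat D D" "mat_adjoint U * U = 1\<^sub>m D" using assms unfolding unitary_mat_def by auto
  note U' = mat_adjoint_carrier[OF U(1)]
  have "U * mat_adjoint U = 1\<^sub>m D" by (rule mat_mult_left_right_inverse[OF U' U(1,2)])
  hence "(\<Sum>i<D. U $$ (a, i) * cnj (U $$ (b, i))) = of_bool (a = b)" if "a < D" "b < D" for a b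
    using mult_mat_index[OF U(1) U', of a b] that by (simp add: mat_adjoint_index[OF U(1)] of_bool_def)
  moreover have "(\<Sum>a<D. cnj (U $$ (a, i)) * U $$ (a, j)) = of_bool (i = j)" if "i < D" "j < D" for i j
    using mult_mat_index[OF U' U(1), of i j] that by (simp add: mat_adjoint_index[OF U(1)] U(2) of_bool_def)
  ultimately show ?thesis unfolding onb_def by simp
qed

lemma orthonormal_onb:
  assumes "\<And>i j. i < D \<Longrightarrow> j < D \<Longrightarrow> ip {..<D} (u i) (u j) = of_bool (i = j)"
  shows "unitary_mat D (mat D D (\<lambda>(a, i). u i a))" "onb {..<D} {..<D} (\<lambda>a i. u i a)"
proof -
  let ?U = "mat D D (\<lambda>(a, i). u i a)"
  have U: "?U \<in> carrier_mat D D" by simp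
  note U' = mat_adjoint_carrier[OF U]
  have "(mat_adjoint ?U * ?U) $$ (i, j) = 1\<^sub>m D $$ (i, j)" if "i < D" "j < D" for i j
    using mult_mat_index[OF U' U that] assms[OF that] that
    by (simp add: mat_adjoint_index[OF U] ip_def)
  hence "mat_adjoint ?U * ?U = 1\<^sub>m D" using U' by (intro eq_matI) auto
  thus 1: "unitary_mat D ?U" unfolding unitary_mat_def using U by blast
  have "onb {..<D} {..<D} (ent ?U)" by (rule unitary_onb[OF 1])
  thus "onb {..<D} {..<D} (\<lambda>a i. u i a)" unfolding onb_def by simp
qed

text \<open>Eigenvectors are collected one at a time; once there are \<open>D\<close> of them,
  completeness of the basis rebuilds the entries of \<open>A\<close> from its action on
  them.\<close>

theorem spectral_theorem:
  assumes h: "hermitian_mat D A"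
  shows "\<exists>U l. spectral {..<D} {..<D} (ent A) U l"
proof -
  have A: "A \<in> carrier_mat D D" using h unfolding hermitian_mat_def by blast
  define P where "P k u l \<longleftrightarrow> (\<forall>i<k. \<forall>j<k. ip {..<D} (u i) (u j) = of_bool (i = j)) \<and>
     (\<forall>i<k. \<forall>a<D. (\<Sum>b<D. A $$ (a, b) * u i b) = of_real (l i) * u i a)"
    for k and u :: "nat \<Rightarrow> nat \<Rightarrow> complex" and l :: "nat \<Rightarrow> real"
  have "k \<le> D \<Longrightarrow> \<exists>u l. P k u l" for k
  proof (induction k)
    case 0
    show ?case by (simp add: P_def)
  next
    case (Suc k)
    then obtain u l where "P k u l" by auto
    hence o: "\<And>i j. i < k \<Longrightarrow> j < k \<Longrightarrow> ip {..<D} (u i) (u j) = of_bool (i = j)"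
      and e: "\<And>i a. i < k \<Longrightarrow> a < D \<Longrightarrow> (\<Sum>b<D. A $$ (a, b) * u i b) = of_real (l i) * u i a"
      unfolding P_def by blast+
    from Suc.prems have "k < D" by simp
    from hermitian_new_eigenvector[OF h this, of u l, OF o e]
    obtain v m where v: "nsq {..<D} v = 1" "\<forall>i<k. ip {..<D} (u i) v = 0"
        "\<forall>a<D. (\<Sum>b<D. A $$ (a, b) * v b) = complex_of_real m * v a"
      by blast
    have vo: "ip {..<D} v (u i) = 0" if "i < k" for i
      using v(2) that ip_cnj[of "{..<D}" "u i" v] by simp
    have "ip {..<D} ((u(k := v)) i) ((u(k := v)) j) = of_bool (i = j)" if "i < Suc k" "j < Suc k" for i j
      using that o v(2) vo v(1) ip_self[of "{..<D}" v] by (auto simp: less_Suc_eq)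
    moreover have "(\<Sum>b<D. A $$ (a, b) * (u(k := v)) i b) = of_real ((l(k := m)) i) * (u(k := v)) i a"
      if "i < Suc k" "a < D" for i a
      using that e v(3) by (auto simp: less_Suc_eq)
    ultimately have "P (Suc k) (u(k := v)) (l(k := m))" unfolding P_def by blast
    thus ?case by blast
  qed
  then obtain u l where "P D u l" by blast
  hence o: "\<And>i j. i < D \<Longrightarrow> j < D \<Longrightarrow> ip {..<D} (u i) (u j) = of_bool (i = j)"
    and e: "\<And>i a. i < D \<Longrightarrow> a < D \<Longrightarrow> (\<Sum>b<D. A $$ (a, b) * u i b) = of_real (l i) * u i a"
    unfolding P_def by blast+
  have onb: "onb {..<D} {..<D} (\<lambda>a i. u i a)" by (rule orthonormal_onb(2)[OF o])
  have "A $$ (a, b) = (\<Sum>i<D. of_real (l i) * u i a * cnj (u i b))" if "a < D" "b < D" for a b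
  proof -
    have "(\<Sum>i<D. of_real (l i) * u i a * cnj (u i b)) = (\<Sum>i<D. (\<Sum>c<D. A $$ (a, c) * u i c) * cnj (u i b))"
      by (intro sum.cong refl) (simp add: e that)
    also have "\<dots> = (\<Sum>c<D. A $$ (a, c) * (\<Sum>i<D. u i c * cnj (u i b)))"
      by (simp add: sum_distrib_left sum_distrib_right mult.assoc) (rule sum.swap)
    also have "\<dots> = (\<Sum>c<D. A $$ (a, c) * of_bool (c = b))"
      by (intro sum.cong refl) (use onbD(4)[OF onb] that in simp)
    also have "\<dots> = A $$ (a, b)" by (rule sum_of_bool_eq(3)) (use that in auto)
    finally show ?thesis by simp
  qed
  thus ?thesis unfolding spectral_def using onb by blast
qed

text \<open>Both sides are the matrix element of \<open>A\<close> between the two eigenvectors.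
  Hence eigenvectors with different eigenvalues do not overlap.\<close>

lemma spectral_commute:
  assumes U: "spectral S I A U l" and V: "spectral S K A V m" and ik: "i \<in> I" "k \<in> K"
  shows "of_real (l i) * (\<Sum>a\<in>S. cnj (U a i) * V a k) = (\<Sum>a\<in>S. cnj (U a i) * V a k) * of_real (m k)"
proof -
  have left: "(\<Sum>a\<in>S. cnj (U a i) * A a b) = of_real (l i) * cnj (U b i)" if "b \<in> S" for b
  proof -
    have "(\<Sum>a\<in>S. cnj (U a i) * A a b) = (\<Sum>a\<in>S. \<Sum>j\<in>I. (cnj (U a i) * U a j) * (of_real (l j) * cnj (U b j)))"
      by (intro sum.cong refl) (simp add: spectralD(4)[OF U _ that] sum_distrib_left mult_ac)
    also have "\<dots> = (\<Sum>j\<in>I. (\<Sum>a\<in>S. cnj (U a i) * U a j) * (of_real (l j) * cnj (U b j)))"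
      by (subst sum.swap) (simp add: sum_distrib_right)
    also have "\<dots> = (\<Sum>j\<in>I. of_bool (i = j) * (of_real (l j) * cnj (U b j)))"
      by (intro sum.cong refl) (simp add: onbD(3)[OF spectralD(1)[OF U] ik(1)])
    finally show ?thesis using sum_of_bool_eq(2)[OF spectralD(3)[OF U] ik(1)] by simp
  qed
  have right: "(\<Sum>b\<in>S. A a b * V b k) = V a k * of_real (m k)" if "a \<in> S" for a
  proof -
    have "(\<Sum>b\<in>S. A a b * V b k) = (\<Sum>b\<in>S. \<Sum>j\<in>K. (of_real (m j) * V a j) * (cnj (V b j) * V b k))"
      by (intro sum.cong refl) (simp add: spectralD(4)[OF V that] sum_distrib_left sum_distrib_right mult_ac)
    also have "\<dots> = (\<Sum>j\<in>K. (of_real (m j) * V a j) * (\<Sum>b\<in>S. cnj (V b j) * V b k))"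
      by (subst sum.swap) (simp add: sum_distrib_left)
    also have "\<dots> = (\<Sum>j\<in>K. (of_real (m j) * V a j) * of_bool (j = k))"
      by (intro sum.cong refl) (simp add: onbD(3)[OF spectralD(1)[OF V] _ ik(2)])
    also have "\<dots> = of_real (m k) * V a k" by (rule sum_of_bool_eq(3)[OF spectralD(3)[OF V] ik(2)])
    finally show ?thesis by (simp only: mult.commute)
  qed
  have "(\<Sum>b\<in>S. (\<Sum>a\<in>S. cnj (U a i) * A a b) * V b k) = (\<Sum>a\<in>S. cnj (U a i) * (\<Sum>b\<in>S. A a b * V b k))"
    by (simp add: sum_distrib_left sum_distrib_right mult.assoc) (rule sum.swap)
  thus ?thesis by (simp add: left right sum_distrib_left sum_distrib_right mult.assoc)
qed

text \<open>Expanding one basis in the other puts an overlap next to \<open>l\<close>, and the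
  hypothesis allows \<open>l\<close> to be exchanged for \<open>m\<close> there. This serves both
  the uniqueness of the functional calculus and the equality case of Klein's inequality.\<close>

lemma onb_diag_eq:
  assumes U: "onb S I U" and V: "onb S K V" and ab: "a \<in> S" "b \<in> S"
    and comm: "\<And>i k. i \<in> I \<Longrightarrow> k \<in> K \<Longrightarrow> (\<Sum>a\<in>S. cnj (U a i) * V a k) = 0 \<or> l i = m k"
  shows "(\<Sum>i\<in>I. complex_of_real (l i) * U a i * cnj (U b i)) = (\<Sum>k\<in>K. of_real (m k) * V a k * cnj (V b k))"
proof -
  define W where "W i k = (\<Sum>a\<in>S. cnj (U a i) * V a k)" for i k
  have comm': "of_real (l i) * W i k = W i k * of_real (m k)" if "i \<in> I" "k \<in> K" for i k
    using comm[OF that, folded W_def] by auto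
  have eb: "cnj (U b i) = (\<Sum>k\<in>K. W i k * cnj (V b k))" if "i \<in> I" for i
  proof -
    have "U b i = (\<Sum>k\<in>K. V b k * (\<Sum>c\<in>S. cnj (V c k) * U c i))"
      by (rule onb_expand[OF V ab(2), symmetric])
    thus ?thesis unfolding W_def by (simp add: mult_ac)
  qed
  have ea: "(\<Sum>i\<in>I. U a i * W i k) = V a k" for k
    unfolding W_def by (rule onb_expand[OF U ab(1)])
  have "(\<Sum>i\<in>I. of_real (l i) * U a i * cnj (U b i))
      = (\<Sum>i\<in>I. \<Sum>k\<in>K. U a i * (of_real (l i) * W i k) * cnj (V b k))"
    by (intro sum.cong refl) (simp add: eb sum_distrib_left mult_ac)
  also have "\<dots> = (\<Sum>i\<in>I. \<Sum>k\<in>K. (U a i * W i k) * (of_real (m k) * cnj (V b k)))"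
    by (intro sum.cong refl) (simp only: comm' mult.assoc)
  also have "\<dots> = (\<Sum>k\<in>K. (\<Sum>i\<in>I. U a i * W i k) * (of_real (m k) * cnj (V b k)))"
    by (subst sum.swap) (simp add: sum_distrib_right)
  finally show ?thesis by (simp add: ea mult_ac)
qed

lemma spectral_function_unique:
  assumes U: "spectral S I A U l" and V: "spectral S K A V m" and ab: "a \<in> S" "b \<in> S"
  shows "(\<Sum>i\<in>I. complex_of_real (f (l i)) * U a i * cnj (U b i)) = (\<Sum>k\<in>K. of_real (f (m k)) * V a k * cnj (V b k))"
proof (rule onb_diag_eq[OF spectralD(1)[OF U] spectralD(1)[OF V] ab])
  fix i k assume "i \<in> I" "k \<in> K"
  from spectral_commute[OF U V this]
  show "(\<Sum>a\<in>S. cnj (U a i) * V a k) = 0 \<or> f (l i) = f (m k)" by auto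
qed

lemma mult_diag_index:
  assumes "U \<in> carrier_mat d d" "a < d" "b < d"
  shows "(U * mat_diag d f * mat_adjoint U) $$ (a, b) = (\<Sum>i<d. f i * U $$ (a, i) * cnj (U $$ (b, i)))"
proof -
  have "(U * mat_diag d f) $$ (a, i) = f i * U $$ (a, i)" if "i < d" for i
    using assms that by (subst mat_diag_mult_right[of _ d]) (auto simp: mult.commute)
  moreover have "U * mat_diag d f \<in> carrier_mat d d" using assms by auto
  ultimately show ?thesis
    using mult_mat_index[of "U * mat_diag d f" d d "mat_adjoint U" d a b] assms
    by (auto simp: mat_adjoint_index[OF assms(1)] mat_adjoint_carrier intro!: sum.cong)
qed

text \<open>\<open>mat_fun\<close> goes through an unspecified decomposition picked by
  \<open>SOME\<close>. From here on any decomposition will do, also one indexed by a set of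
  functions, and the choice never reappears.\<close>

lemma mat_fun_spectral:
  assumes A: "A \<in> carrier_mat D D" and s: "spectral {..<D} I (ent A) V m"
  shows "mat_fun f A \<in> carrier_mat D D"
    "\<And>a b. a < D \<Longrightarrow> b < D \<Longrightarrow> mat_fun f A $$ (a, b) = (\<Sum>i\<in>I. of_real (f (m i)) * V a i * cnj (V b i))"
proof -
  define P where "P U l \<longleftrightarrow> unitary_mat D U \<and>
     A = U * mat_diag D (\<lambda>i. complex_of_real (l i)) * mat_adjoint U" for U l
  have dim: "dim_row A = D" using A by simp
  have herm: "hermitian_mat D A"
    unfolding hermitian_mat_def
  proof (intro conjI A eq_matI)
    fix i j assume ij: "i < dim_row A" "j < dim_col A"
    hence "mat_adjoint A $$ (i, j) = cnj (A $$ (j, i))" using A by (intro mat_adjoint_index) auto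
    thus "mat_adjoint A $$ (i, j) = A $$ (i, j)"
      using ij A spectralD(4)[OF s, of i j] spectralD(4)[OF s, of j i] by (simp add: mult_ac)
  qed (use mat_adjoint_carrier[OF A] A in auto)
  obtain U0 l0 where s0: "spectral {..<D} {..<D} (ent A) U0 l0" using spectral_theorem[OF herm] by blast
  have "P (mat D D (\<lambda>(a, i). U0 a i)) l0"
    unfolding P_def
  proof
    show "unitary_mat D (mat D D (\<lambda>(a, i). U0 a i))"
      using onbD(3)[OF spectralD(1)[OF s0]] by (intro orthonormal_onb(1)) (auto simp: ip_def)
    let ?U = "mat D D (\<lambda>(a, i). U0 a i)"
    show "A = ?U * mat_diag D (\<lambda>i. complex_of_real (l0 i)) * mat_adjoint ?U"
    proof (rule eq_matI)
      fix i j assume "i < dim_row (?U * mat_diag D (\<lambda>i. complex_of_real (l0 i)) * mat_adjoint ?U)"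
        "j < dim_col (?U * mat_diag D (\<lambda>i. complex_of_real (l0 i)) * mat_adjoint ?U)"
      hence ij: "i < D" "j < D" using mat_adjoint_carrier[of ?U D D] by auto
      show "A $$ (i, j) = (?U * mat_diag D (\<lambda>i. complex_of_real (l0 i)) * mat_adjoint ?U) $$ (i, j)"
        using ij spectralD(4)[OF s0, of i j] by (subst mult_diag_index) auto
    qed (use A mat_adjoint_carrier[of ?U D D] in auto)
  qed
  hence ex: "\<exists>x. case x of (U, l) \<Rightarrow> P U l" by auto
  obtain U l where Ul: "(SOME (U, l). P U l) = (U, l)" by fastforce
  have "case (SOME (U, l). P U l) of (U, l) \<Rightarrow> P U l" by (rule someI_ex[OF ex])
  hence PUl: "P U l" unfolding Ul by simp
  have U: "U \<in> carrier_mat D D" using PUl unfolding P_def unitary_mat_def by blast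
  have eq: "mat_fun f A = U * mat_diag D (\<lambda>i. complex_of_real (f (l i))) * mat_adjoint U"
    using Ul unfolding mat_fun_def dim Let_def P_def by simp
  have "ent A a b = (\<Sum>i<D. of_real (l i) * ent U a i * cnj (ent U b i))" if "a < D" "b < D" for a b
    using PUl mult_diag_index[OF U that] unfolding P_def by simp
  hence sU: "spectral {..<D} {..<D} (ent A) (ent U) l"
    unfolding spectral_def using PUl unitary_onb unfolding P_def by blast
  show "mat_fun f A \<in> carrier_mat D D" unfolding eq using U mat_adjoint_carrier[OF U] by auto
  show "mat_fun f A $$ (a, b) = (\<Sum>i\<in>I. of_real (f (m i)) * V a i * cnj (V b i))" if "a < D" "b < D" for a b
    unfolding eq mult_diag_index[OF U that]
    using spectral_function_unique[OF sU s, of a b f] that by simp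
qed

section \<open>Relative entropy\<close>

text \<open>With overlaps <u_i, v_k> this is the classical relative entropy of the Nussbaum-Szkola
  distributions \<open>l i * |<u_i, v_k>|^2\<close> and \<open>m k * |<u_i, v_k>|^2\<close> on
  pairs; it reduces quantum estimates to termwise scalar ones.\<close>

definition relent ::
  "'a set \<Rightarrow> 'i set \<Rightarrow> 'k set \<Rightarrow> ('a \<Rightarrow> 'i \<Rightarrow> complex) \<Rightarrow> ('i \<Rightarrow> real) \<Rightarrow> ('a \<Rightarrow> 'k \<Rightarrow> complex) \<Rightarrow> ('k \<Rightarrow> real) \<Rightarrow> real" where
  "relent S I K U l V m = (\<Sum>i\<in>I. \<Sum>k\<in>K. (cmod (\<Sum>a\<in>S. cnj (U a i) * V a k))\<^sup>2 * (l i * (ln_supp (l i) - ln_supp (m k))))"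

lemma trace_spectral_product:
  assumes A: "spectral S I A U l" and B: "onb S K V"
    and B': "\<And>a b. a \<in> S \<Longrightarrow> b \<in> S \<Longrightarrow> B a b = (\<Sum>k\<in>K. of_real (m k) * V a k * cnj (V b k))"
  shows "(\<Sum>a\<in>S. \<Sum>b\<in>S. A a b * B b a)
    = of_real (\<Sum>i\<in>I. \<Sum>k\<in>K. (cmod (\<Sum>a\<in>S. cnj (U a i) * V a k))\<^sup>2 * (l i * m k))"
proof -
  have "(\<Sum>a\<in>S. \<Sum>b\<in>S. A a b * B b a)
     = (\<Sum>a\<in>S. \<Sum>b\<in>S. \<Sum>k\<in>K. of_real (m k) * (cnj (V a k) * A a b * V b k))"
    by (intro sum.cong refl) (simp add: B' sum_distrib_left mult_ac)
  also have "\<dots> = (\<Sum>a\<in>S. \<Sum>k\<in>K. \<Sum>b\<in>S. of_real (m k) * (cnj (V a k) * A a b * V b k))"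
    by (intro sum.cong refl sum.swap)
  also have "\<dots> = (\<Sum>k\<in>K. of_real (m k) * qform S A (\<lambda>a. V a k))"
    unfolding qform_def sum_distrib_left by (rule sum.swap)
  also have "\<dots> = (\<Sum>k\<in>K. \<Sum>i\<in>I. of_real ((cmod (\<Sum>a\<in>S. cnj (U a i) * V a k))\<^sup>2 * (l i * m k)))"
    unfolding qform_spectral[OF A] of_real_mult[symmetric] of_real_sum[symmetric] sum_distrib_left
    by (simp add: mult_ac)
  also have "\<dots> = (\<Sum>i\<in>I. \<Sum>k\<in>K. of_real ((cmod (\<Sum>a\<in>S. cnj (U a i) * V a k))\<^sup>2 * (l i * m k)))"
    by (rule sum.swap)
  finally show ?thesis by simp
qed

lemma qrel_ent_spectral:
  assumes A: "A \<in> carrier_mat D D" "spectral {..<D} I (ent A) U l"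
    and B: "B \<in> carrier_mat D D" "spectral {..<D} K (ent B) V m"
  shows "qrel_ent A B = relent {..<D} I K U l V m"
proof -
  note fA = mat_fun_spectral[OF A, where f = ln_supp] and fB = mat_fun_spectral[OF B, where f = ln_supp]
  have "mtrace (A * (mat_ln A - mat_ln B)) = (\<Sum>a<D. \<Sum>b<D. ent A a b * (mat_fun ln_supp A $$ (b, a)))
      - (\<Sum>a<D. \<Sum>b<D. ent A a b * (mat_fun ln_supp B $$ (b, a)))"
    unfolding mat_ln_def using fA(1) fB(1) A(1)
    by (subst mtrace_mult[of _ D D]) (auto simp: sum_subtractf[symmetric] algebra_simps intro!: sum.cong)
  also have "(\<Sum>a<D. \<Sum>b<D. ent A a b * (mat_fun ln_supp A $$ (b, a)))
      = of_real (\<Sum>i\<in>I. \<Sum>k\<in>I. (cmod (\<Sum>a<D. cnj (U a i) * U a k))\<^sup>2 * (l i * ln_supp (l k)))"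
    by (rule trace_spectral_product[OF A(2) spectralD(1)[OF A(2)]]) (simp add: fA)
  also have "(\<Sum>i\<in>I. \<Sum>k\<in>I. (cmod (\<Sum>a<D. cnj (U a i) * U a k))\<^sup>2 * (l i * ln_supp (l k)))
      = (\<Sum>i\<in>I. \<Sum>k\<in>I. of_bool (i = k) * (l i * ln_supp (l k)))"
    by (intro sum.cong refl) (simp add: onbD(3)[OF spectralD(1)[OF A(2)]])
  also have "\<dots> = (\<Sum>i\<in>I. l i * ln_supp (l i))"
    by (intro sum.cong refl sum_of_bool_eq(2)) (use spectralD(3)[OF A(2)] in auto)
  also have "(\<Sum>a<D. \<Sum>b<D. ent A a b * (mat_fun ln_supp B $$ (b, a)))
      = of_real (\<Sum>i\<in>I. \<Sum>k\<in>K. (cmod (\<Sum>a<D. cnj (U a i) * V a k))\<^sup>2 * (l i * ln_supp (m k)))"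
    by (rule trace_spectral_product[OF A(2) spectralD(1)[OF B(2)]]) (simp add: fB)
  finally have eq: "qrel_ent A B = (\<Sum>i\<in>I. l i * ln_supp (l i))
     - (\<Sum>i\<in>I. \<Sum>k\<in>K. (cmod (\<Sum>a<D. cnj (U a i) * V a k))\<^sup>2 * (l i * ln_supp (m k)))"
    unfolding qrel_ent_def by simp
  \<comment> \<open>The squared overlaps with a fixed eigenvector of \<open>A\<close> sum to 1, so
    the entropy term can be spread over \<open>K\<close> to match the double sum.\<close>
  have "(\<Sum>i\<in>I. l i * ln_supp (l i))
      = (\<Sum>i\<in>I. \<Sum>k\<in>K. (cmod (\<Sum>a<D. cnj (U a i) * V a k))\<^sup>2 * (l i * ln_supp (l i)))"
    by (intro sum.cong refl)
       (simp add: sum_distrib_right[symmetric]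
         onb_row_norm[OF onb_overlap[OF spectralD(1)[OF A(2)] spectralD(1)[OF B(2)]]])
  thus ?thesis unfolding eq relent_def right_diff_distrib sum_subtractf by simp
qed


text \<open>\<open>kron\<close> splits an index by div and mod, so iterating it reads off base
  \<open>d\<close> digits, the first letter being the most significant. One bijection serves all
  families \<open>A\<close>, so operators and eigenvectors can be reindexed alike.\<close>

lemma tensor_digits:
  "\<exists>dg. bij_betw dg {..<d ^ n} (PiE {..<n} (\<lambda>_. {..<d})) \<and>
     (\<forall>A. (\<forall>i<n. A i \<in> carrier_mat d d) \<longrightarrow>
        tensor_list (map A [0..<n]) \<in> carrier_mat (d ^ n) (d ^ n) \<and>
        (\<forall>a<d ^ n. \<forall>b<d ^ n. tensor_list (map A [0..<n]) $$ (a, b) = (\<Prod>i<n. A i $$ (dg a i, dg b i))))"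
proof (induction n)
  case 0
  have "bij_betw (\<lambda>_ _. undefined) {..<d ^ 0} (PiE {..<0::nat} (\<lambda>_. {..<d}))"
    unfolding bij_betw_def by (simp add: PiE_empty_domain lessThan_Suc)
  thus ?case by (intro exI[of _ "\<lambda>_ _. undefined"]) auto
next
  case (Suc n)
  define good where "good dg \<longleftrightarrow> (\<forall>A. (\<forall>i<n. A i \<in> carrier_mat d d) \<longrightarrow>
        tensor_list (map A [0..<n]) \<in> carrier_mat (d ^ n) (d ^ n) \<and>
        (\<forall>a<d ^ n. \<forall>b<d ^ n. tensor_list (map A [0..<n]) $$ (a, b) = (\<Prod>i<n. A i $$ (dg a i, dg b i))))" for dg
  have "\<exists>dg. bij_betw dg {..<d ^ n} (PiE {..<n} (\<lambda>_. {..<d})) \<and> good dg"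
    unfolding good_def by (rule Suc.IH)
  then obtain dg where bij: "bij_betw dg {..<d ^ n} (PiE {..<n} (\<lambda>_. {..<d}))"
    and ten: "good dg"
    by blast
  define dg' where "dg' a = (\<lambda>i. case i of 0 \<Rightarrow> a div d ^ n | Suc j \<Rightarrow> dg (a mod d ^ n) j)" for a
  have dm: "a div d ^ n < d" "a mod d ^ n < d ^ n" if "a < d ^ Suc n" for a
  proof -
    have "0 < d" using that by (cases d) auto
    thus "a div d ^ n < d" "a mod d ^ n < d ^ n" using that by (simp_all add: less_mult_imp_div_less)
  qed
  have dgP: "dg a \<in> PiE {..<n} (\<lambda>_. {..<d})" if "a < d ^ n" for a
    using bij that by (auto simp: bij_betw_def)
  have und: "dg a i = undefined" if "a < d ^ n" "i \<ge> n" for a i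
    using dgP[OF that(1)] that(2) by (auto simp: PiE_def extensional_def)
  have bij': "bij_betw dg' {..<d ^ Suc n} (PiE {..<Suc n} (\<lambda>_. {..<d}))"
  proof (rule bij_betw_imageI)
    show inj: "inj_on dg' {..<d ^ Suc n}"
    proof (rule inj_onI)
      fix a b assume ab: "a \<in> {..<d ^ Suc n}" "b \<in> {..<d ^ Suc n}" and eq: "dg' a = dg' b"
      have "a div d ^ n = b div d ^ n" using fun_cong[OF eq, of 0] by (simp add: dg'_def)
      moreover have "dg (a mod d ^ n) = dg (b mod d ^ n)"
        using fun_cong[OF eq, of "Suc _"] by (intro ext) (simp add: dg'_def)
      hence "a mod d ^ n = b mod d ^ n"
        using bij dm ab unfolding bij_betw_def inj_on_def by auto
      ultimately show "a = b" by (metis div_mult_mod_eq)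
    qed
    have sub: "dg' ` {..<d ^ Suc n} \<subseteq> PiE {..<Suc n} (\<lambda>_. {..<d})"
    proof (rule image_subsetI)
      fix a assume "a \<in> {..<d ^ Suc n}"
      hence a: "a div d ^ n < d" "a mod d ^ n < d ^ n" using dm by auto
      show "dg' a \<in> PiE {..<Suc n} (\<lambda>_. {..<d})"
        using a(1) dgP[OF a(2)] und[OF a(2)]
        by (auto simp: dg'_def PiE_def extensional_def Pi_def split: nat.splits)
    qed
    \<comment> \<open>Injectivity and equal cardinalities give surjectivity without constructing an
      inverse.\<close>
    have "card (dg' ` {..<d ^ Suc n}) = card (PiE {..<Suc n} (\<lambda>_. {..<d}))"
      unfolding card_image[OF inj] by (simp add: card_PiE)
    thus "dg' ` {..<d ^ Suc n} = PiE {..<Suc n} (\<lambda>_. {..<d})"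
      by (intro card_subset_eq sub finite_PiE) auto
  qed
  have "tensor_list (map A [0..<Suc n]) \<in> carrier_mat (d ^ Suc n) (d ^ Suc n) \<and>
        (\<forall>a<d ^ Suc n. \<forall>b<d ^ Suc n. tensor_list (map A [0..<Suc n]) $$ (a, b) = (\<Prod>i<Suc n. A i $$ (dg' a i, dg' b i)))"
    if A: "\<forall>i<Suc n. A i \<in> carrier_mat d d" for A
  proof -
    let ?T = "tensor_list (map (\<lambda>i. A (Suc i)) [0..<n])"
    have T: "?T \<in> carrier_mat (d ^ n) (d ^ n)"
      "\<And>a b. a < d ^ n \<Longrightarrow> b < d ^ n \<Longrightarrow> ?T $$ (a, b) = (\<Prod>i<n. A (Suc i) $$ (dg a i, dg b i))"
      using ten[unfolded good_def, rule_format, of "\<lambda>i. A (Suc i)"] A by auto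
    have "map A [0..<Suc n] = A 0 # map (\<lambda>i. A (Suc i)) [0..<n]"
      by (simp add: map_upt_Suc del: upt_Suc)
    hence eq: "tensor_list (map A [0..<Suc n]) = kron (A 0) ?T" by simp
    have A0: "A 0 \<in> carrier_mat d d" using A by blast
    have "kron (A 0) ?T $$ (a, b) = (\<Prod>i<Suc n. A i $$ (dg' a i, dg' b i))"
      if "a < d ^ Suc n" "b < d ^ Suc n" for a b
      using that A0 T dm[OF that(1)] dm[OF that(2)] unfolding kron_def
      by (simp add: prod.lessThan_Suc_shift dg'_def del: prod.lessThan_Suc)
    thus ?thesis unfolding eq using A0 T(1) by (auto simp: kron_def)
  qed
  with bij' show ?case by (intro exI[of _ dg'] conjI allI impI) auto
qed

section \<open>Klein's inequality, its equality case and the chi-square bound\<close>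

lemma ln_supp_ge:
  assumes "0 \<le> x" "0 \<le> y" "y = 0 \<Longrightarrow> x = 0"
  shows "x - y \<le> x * (ln_supp x - ln_supp y)"
proof (cases "x = 0")
  case False
  hence xy: "0 < x" "0 < y" using assms(1-3) by (auto simp: less_le)
  have "ln (y / x) \<le> y / x - 1" using xy by (intro ln_le_minus_one) simp
  hence "x * (ln y - ln x) \<le> x * (y / x - 1)" using xy by (intro mult_left_mono) (simp_all add: ln_div)
  thus ?thesis using xy by (simp add: ln_supp_def algebra_simps)
qed (use assms in simp)

lemma ln_supp_ge_eq:
  assumes "0 \<le> x" "0 \<le> y" "y = 0 \<Longrightarrow> x = 0" "x * (ln_supp x - ln_supp y) = x - y"
  shows "x = y"
proof (cases "x = 0")
  case False
  hence xy: "0 < x" "0 < y" using assms(1-3) by (auto simp: less_le)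
  have "x * (ln x - ln y) = x - y" using assms(4) xy by (simp add: ln_supp_def)
  hence "ln x - ln y = 1 - y / x" using xy by (simp add: field_simps)
  hence "ln (y / x) = y / x - 1" using xy by (simp add: ln_div)
  hence "y / x = 1" using xy by (intro ln_eq_minus_one) simp_all
  thus ?thesis using xy by simp
qed (use assms in simp)

lemma ln_supp_le:
  assumes "0 \<le> x" "0 \<le> y" "y = 0 \<Longrightarrow> x = 0"
  shows "x * (ln_supp x - ln_supp y) \<le> x\<^sup>2 / y - x"
proof (cases "x = 0")
  case False
  hence xy: "0 < x" "0 < y" using assms(1-3) by (auto simp: less_le)
  have "ln (x / y) \<le> x / y - 1" using xy by (intro ln_le_minus_one) simp
  hence "x * (ln x - ln y) \<le> x * (x / y - 1)" using xy by (intro mult_left_mono) (simp_all add: ln_div)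
  thus ?thesis using xy by (simp add: ln_supp_def algebra_simps power2_eq_square)
qed simp

text \<open>Support inclusion in spectral form: an eigenvector of the first operator with nonzero
  eigenvalue is orthogonal to the kernel of the second. It excludes the terms where
  \<open>ln_supp\<close> would stand in for an infinite logarithm.\<close>

definition dominated ::
  "'a set \<Rightarrow> 'i set \<Rightarrow> 'k set \<Rightarrow> ('a \<Rightarrow> 'i \<Rightarrow> complex) \<Rightarrow> ('i \<Rightarrow> real) \<Rightarrow> ('a \<Rightarrow> 'k \<Rightarrow> complex) \<Rightarrow> ('k \<Rightarrow> real) \<Rightarrow> bool" where
  "dominated S I K U l V m \<longleftrightarrow>
     (\<forall>i\<in>I. \<forall>k\<in>K. m k = 0 \<longrightarrow> l i = 0 \<or> (\<Sum>a\<in>S. cnj (U a i) * V a k) = 0)"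

lemma overlap_sums:
  assumes "onb S I U" "onb S K V"
  shows "i \<in> I \<Longrightarrow> (\<Sum>k\<in>K. (cmod (\<Sum>a\<in>S. cnj (U a i) * V a k))\<^sup>2) = 1"
    "k \<in> K \<Longrightarrow> (\<Sum>i\<in>I. (cmod (\<Sum>a\<in>S. cnj (U a i) * V a k))\<^sup>2) = 1"
  using onb_row_norm[OF onb_overlap[OF assms]] onb_col_norm[OF onb_overlap[OF assms]]
  by (simp_all add: nsq_def)

lemma overlap_sum_diff:
  assumes "onb S I U" "onb S K V"
  shows "(\<Sum>i\<in>I. \<Sum>k\<in>K. (cmod (\<Sum>a\<in>S. cnj (U a i) * V a k))\<^sup>2 * (l i - m k)) = sum l I - sum m K"
proof -
  have "(\<Sum>i\<in>I. \<Sum>k\<in>K. (cmod (\<Sum>a\<in>S. cnj (U a i) * V a k))\<^sup>2 * l i) = sum l I"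
    by (simp add: sum_distrib_right[symmetric] overlap_sums[OF assms])
  moreover have "(\<Sum>i\<in>I. \<Sum>k\<in>K. (cmod (\<Sum>a\<in>S. cnj (U a i) * V a k))\<^sup>2 * m k) = sum m K"
    by (subst sum.swap) (simp add: sum_distrib_right[symmetric] overlap_sums[OF assms])
  ultimately show ?thesis by (simp add: right_diff_distrib sum_subtractf)
qed

text \<open>Klein's inequality: the scalar bound \<open>ln z <= z - 1\<close> holds termwise, and
  the doubly stochastic overlaps sum the linear terms to a difference of traces.\<close>

lemma relent_ge:
  assumes o: "onb S I U" "onb S K V" and dom: "dominated S I K U l V m"
    and nn: "\<And>i. i \<in> I \<Longrightarrow> 0 \<le> l i" "\<And>k. k \<in> K \<Longrightarrow> 0 \<le> m k"
  shows "sum l I - sum m K \<le> relent S I K U l V m"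
proof -
  have "(cmod (\<Sum>a\<in>S. cnj (U a i) * V a k))\<^sup>2 * (l i - m k)
      \<le> (cmod (\<Sum>a\<in>S. cnj (U a i) * V a k))\<^sup>2 * (l i * (ln_supp (l i) - ln_supp (m k)))"
    if "i \<in> I" "k \<in> K" for i k
  proof (cases "(\<Sum>a\<in>S. cnj (U a i) * V a k) = 0")
    case False
    with dom that have "m k = 0 \<Longrightarrow> l i = 0" unfolding dominated_def by blast
    thus ?thesis by (intro mult_left_mono ln_supp_ge nn that) auto
  qed simp
  hence "(\<Sum>i\<in>I. \<Sum>k\<in>K. (cmod (\<Sum>a\<in>S. cnj (U a i) * V a k))\<^sup>2 * (l i - m k)) \<le> relent S I K U l V m"
    unfolding relent_def by (intro sum_mono) auto
  thus ?thesis unfolding overlap_sum_diff[OF o] .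
qed

text \<open>All terms of Klein's inequality are nonnegative, so a vanishing total makes each an
  equality; wherever two eigenvectors overlap, the scalar equality case identifies their
  eigenvalues.\<close>

lemma relent_eq_zero:
  assumes o: "onb S I U" "onb S K V" and dom: "dominated S I K U l V m"
    and nn: "\<And>i. i \<in> I \<Longrightarrow> 0 \<le> l i" "\<And>k. k \<in> K \<Longrightarrow> 0 \<le> m k"
    and tr: "sum l I = sum m K" and z: "relent S I K U l V m \<le> 0"
    and ik: "i \<in> I" "k \<in> K"
  shows "(\<Sum>a\<in>S. cnj (U a i) * V a k) = 0 \<or> l i = m k"
proof (rule disjCI)
  assume ne: "l i \<noteq> m k"
  define h where "h i k = (cmod (\<Sum>a\<in>S. cnj (U a i) * V a k))\<^sup>2 * (l i * (ln_supp (l i) - ln_supp (m k)) - (l i - m k))" for i k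
  have h0: "0 \<le> h i k" if "i \<in> I" "k \<in> K" for i k
  proof (cases "(\<Sum>a\<in>S. cnj (U a i) * V a k) = 0")
    case False
    with dom that have "m k = 0 \<Longrightarrow> l i = 0" unfolding dominated_def by blast
    hence "l i - m k \<le> l i * (ln_supp (l i) - ln_supp (m k))" by (intro ln_supp_ge nn that)
    thus ?thesis unfolding h_def by simp
  qed (simp add: h_def)
  note fin = onbD(2)[OF o(1)] onbD(2)[OF o(2)]
  have "(\<Sum>i\<in>I. \<Sum>k\<in>K. h i k) = relent S I K U l V m - (sum l I - sum m K)"
    unfolding h_def relent_def overlap_sum_diff[OF o, symmetric] by (simp only: sum_subtractf right_diff_distrib)
  hence "(\<Sum>i\<in>I. \<Sum>k\<in>K. h i k) \<le> 0" using tr z by simp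
  moreover have "(\<Sum>i\<in>I. \<Sum>k\<in>K. h i k) \<ge> (\<Sum>k\<in>K. h i k)"
    by (rule member_le_sum[OF ik(1) _ fin(1)]) (auto intro: sum_nonneg h0)
  moreover have "(\<Sum>k\<in>K. h i k) \<ge> h i k"
    by (rule member_le_sum[OF ik(2) _ fin(2)]) (use ik h0 in auto)
  ultimately have "h i k = 0" using h0[OF ik] by linarith
  show "(\<Sum>a\<in>S. cnj (U a i) * V a k) = 0"
  proof (rule ccontr)
    assume nz: "(\<Sum>a\<in>S. cnj (U a i) * V a k) \<noteq> 0"
    with dom ik have d: "m k = 0 \<Longrightarrow> l i = 0" unfolding dominated_def by blast
    from nz \<open>h i k = 0\<close> have "l i * (ln_supp (l i) - ln_supp (m k)) = l i - m k" unfolding h_def by simp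
    from ln_supp_ge_eq[OF nn(1)[OF ik(1)] nn(2)[OF ik(2)] d this] have "l i = m k" .
    with ne show False ..
  qed
qed

lemma spectral_row_norm:
  assumes "spectral S I A U l" "a \<in> S"
  shows "(\<Sum>b\<in>S. (cmod (A a b))\<^sup>2) = (\<Sum>i\<in>I. (l i)\<^sup>2 * (cmod (U a i))\<^sup>2)"
proof -
  have "cmod (A a b) = cmod (\<Sum>i\<in>I. cnj (cnj (U b i)) * (of_real (l i) * cnj (U a i)))" if "b \<in> S" for b
  proof -
    have "cnj (A a b) = (\<Sum>i\<in>I. cnj (cnj (U b i)) * (of_real (l i) * cnj (U a i)))"
      by (simp add: spectralD(4)[OF assms that] mult_ac)
    thus ?thesis by (metis complex_mod_cnj)
  qed
  hence "(\<Sum>b\<in>S. (cmod (A a b))\<^sup>2) = (\<Sum>b\<in>S. (cmod (\<Sum>i\<in>I. cnj (cnj (U b i)) * (of_real (l i) * cnj (U a i))))\<^sup>2)"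
    by simp
  also have "\<dots> = nsq I (\<lambda>i. of_real (l i) * cnj (U a i))"
    by (rule parseval[OF onb_adjoint[OF spectralD(1)[OF assms(1)]]])
  finally show ?thesis by (simp add: nsq_def norm_mult power_mult_distrib)
qed

text \<open>The scalar logarithm bound is used in the other direction, and
  \<open>spectral_row_norm\<close> then removes the eigenvectors of \<open>A\<close>: only its
  entries in the basis \<open>V\<close> remain, a form that factorises over tensor powers.\<close>

lemma relent_le_chi2:
  assumes A: "spectral S I A U l" and V: "onb S K V" and dom: "dominated S I K U l V m"
    and nn: "\<And>i. i \<in> I \<Longrightarrow> 0 \<le> l i" "\<And>k. k \<in> K \<Longrightarrow> 0 \<le> m k"
  shows "relent S I K U l V m
    \<le> (\<Sum>k\<in>K. \<Sum>k'\<in>K. (cmod (\<Sum>a\<in>S. \<Sum>b\<in>S. cnj (V a k) * A a b * V b k'))\<^sup>2 / m k) - sum l I"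
proof -
  define W where "W i k = (\<Sum>a\<in>S. cnj (U a i) * V a k)" for i k
  have "relent S I K U l V m \<le> (\<Sum>i\<in>I. \<Sum>k\<in>K. (cmod (W i k))\<^sup>2 * ((l i)\<^sup>2 / m k - l i))"
    unfolding relent_def W_def[symmetric]
  proof (intro sum_mono)
    fix i k assume ik: "i \<in> I" "k \<in> K"
    show "(cmod (W i k))\<^sup>2 * (l i * (ln_supp (l i) - ln_supp (m k))) \<le> (cmod (W i k))\<^sup>2 * ((l i)\<^sup>2 / m k - l i)"
    proof (cases "W i k = 0")
      case False
      with dom ik have "m k = 0 \<Longrightarrow> l i = 0" unfolding dominated_def W_def by blast
      thus ?thesis by (intro mult_left_mono ln_supp_le nn ik) auto
    qed simp
  qed
  also have "\<dots> = (\<Sum>i\<in>I. \<Sum>k\<in>K. (cmod (W i k))\<^sup>2 * (l i)\<^sup>2 / m k) - (\<Sum>i\<in>I. \<Sum>k\<in>K. (cmod (W i k))\<^sup>2 * l i)"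
    by (simp add: right_diff_distrib sum_subtractf)
  also have "(\<Sum>i\<in>I. \<Sum>k\<in>K. (cmod (W i k))\<^sup>2 * l i) = sum l I"
    unfolding W_def by (simp add: sum_distrib_right[symmetric] overlap_sums[OF spectralD(1)[OF A] V])
  also have "(\<Sum>i\<in>I. \<Sum>k\<in>K. (cmod (W i k))\<^sup>2 * (l i)\<^sup>2 / m k) = (\<Sum>k\<in>K. (\<Sum>i\<in>I. (l i)\<^sup>2 * (cmod (W i k))\<^sup>2) / m k)"
    by (subst sum.swap) (simp add: sum_divide_distrib mult.commute)
  also have "\<dots> = (\<Sum>k\<in>K. (\<Sum>k'\<in>K. (cmod (\<Sum>a\<in>S. \<Sum>b\<in>S. cnj (V a k) * A a b * V b k'))\<^sup>2) / m k)"
  proof (intro sum.cong refl arg_cong2[where f = "(/)"])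
    fix k assume k: "k \<in> K"
    have "cmod (W i k) = cmod (\<Sum>a\<in>S. cnj (V a k) * U a i)" for i
    proof -
      have "cnj (W i k) = (\<Sum>a\<in>S. cnj (V a k) * U a i)" unfolding W_def by (simp add: mult.commute)
      thus ?thesis by (metis complex_mod_cnj)
    qed
    thus "(\<Sum>i\<in>I. (l i)\<^sup>2 * (cmod (W i k))\<^sup>2)
        = (\<Sum>k'\<in>K. (cmod (\<Sum>a\<in>S. \<Sum>b\<in>S. cnj (V a k) * A a b * V b k'))\<^sup>2)"
      using spectral_row_norm[OF spectral_change_basis[OF A V] k] by simp
  qed
  finally show ?thesis by (simp add: sum_divide_distrib)
qed

text \<open>The second term is linear in \<open>A\<close> and sees only its diagonal in the basis
  \<open>V\<close>, so continuity in \<open>A\<close> is delicate only for the entropy term.\<close>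

lemma relent_split:
  assumes A: "spectral S I A U l" and V: "onb S K V"
  shows "relent S I K U l V m = (\<Sum>i\<in>I. l i * ln_supp (l i)) - (\<Sum>k\<in>K. Re (qform S A (\<lambda>a. V a k)) * ln_supp (m k))"
proof -
  have "relent S I K U l V m = (\<Sum>i\<in>I. \<Sum>k\<in>K. (cmod (\<Sum>a\<in>S. cnj (U a i) * V a k))\<^sup>2 * (l i * ln_supp (l i)))
     - (\<Sum>i\<in>I. \<Sum>k\<in>K. (cmod (\<Sum>a\<in>S. cnj (U a i) * V a k))\<^sup>2 * (l i * ln_supp (m k)))"
    unfolding relent_def by (simp add: right_diff_distrib sum_subtractf)
  also have "(\<Sum>i\<in>I. \<Sum>k\<in>K. (cmod (\<Sum>a\<in>S. cnj (U a i) * V a k))\<^sup>2 * (l i * ln_supp (l i))) = (\<Sum>i\<in>I. l i * ln_supp (l i))"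
    by (simp add: sum_distrib_right[symmetric] overlap_sums[OF spectralD(1)[OF A] V])
  also have "(\<Sum>i\<in>I. \<Sum>k\<in>K. (cmod (\<Sum>a\<in>S. cnj (U a i) * V a k))\<^sup>2 * (l i * ln_supp (m k)))
      = (\<Sum>k\<in>K. Re (qform S A (\<lambda>a. V a k)) * ln_supp (m k))"
    unfolding qform_spectral[OF A] Re_complex_of_real sum_distrib_right
    by (subst sum.swap) (simp add: mult_ac)
  finally show ?thesis .
qed

text \<open>Klein's inequality is applied to \<open>B\<close> mixed with a small multiple of the identity; the mixture
  keeps the eigenvectors of \<open>B\<close>, so its logarithm is explicit and bounded.\<close>
lemma entropy_diff_le:
  assumes A: "spectral S I A U l" and B: "spectral S K B V m"
    and l: "\<And>i. i \<in> I \<Longrightarrow> 0 \<le> l i" "sum l I = 1"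
    and m: "\<And>k. k \<in> K \<Longrightarrow> 0 \<le> m k" "sum m K = 1"
    and e: "0 < e" "e < 1"
    and tn: "(\<Sum>k\<in>K. cmod (qform S (\<lambda>a b. A a b - B a b) (\<lambda>a. V a k))) \<le> \<eta>"
  shows "(\<Sum>k\<in>K. m k * ln_supp (m k)) - (\<Sum>i\<in>I. l i * ln_supp (l i)) \<le> \<eta> * ln (card K / e) - ln (1 - e)"
proof -
  define d where "d = real (card K)"
  have finK: "finite K" by (rule spectralD(3)[OF B])
  have K: "K \<noteq> {}" using m(2) by auto
  hence d: "1 \<le> d" unfolding d_def using finK by (simp add: Suc_le_eq card_gt_0_iff)
  \<comment> \<open>The uniform part keeps \<open>m'\<close> above \<open>e / d\<close>, so its
    logarithm is at most \<open>ln (d / e)\<close> in size; the factor \<open>1 - e\<close> is paid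
    for by \<open>- ln (1 - e)\<close>.\<close>
  define m' where "m' k = (1 - e) * m k + e / d" for k
  have ed: "e / d > 0" "e / d \<le> e" using e d by (simp_all add: field_simps)
  have m1: "m k \<le> 1" if "k \<in> K" for k
    unfolding m(2)[symmetric] by (rule member_le_sum[OF that _ finK]) (use m in auto)
  have m'1: "e / d \<le> m' k" if "k \<in> K" for k
    unfolding m'_def using m(1)[OF that] e by simp
  have m'2: "m' k \<le> 1" if "k \<in> K" for k
  proof -
    have "(1 - e) * m k \<le> (1 - e) * 1" using m1[OF that] e by (intro mult_left_mono) auto
    thus ?thesis unfolding m'_def using ed by simp
  qed
  have m'0: "0 < m' k" if "k \<in> K" for k using m'1[OF that] ed by linarith
  have "sum m' K = (1 - e) * sum m K + d * (e / d)"
    unfolding m'_def sum.distrib sum_distrib_left[symmetric] by (simp add: d_def)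
  hence m's: "sum m' K = 1" using d m(2) by simp
  have "dominated S I K U l V m'" unfolding dominated_def using m'0 by (metis less_irrefl)
  from relent_ge[OF spectralD(1)[OF A] spectralD(1)[OF B] this l(1)] m'0
  have "0 \<le> relent S I K U l V m'" using l(2) m's by (auto intro: less_imp_le)
  hence klein: "(\<Sum>k\<in>K. Re (qform S A (\<lambda>a. V a k)) * ln_supp (m' k)) \<le> (\<Sum>i\<in>I. l i * ln_supp (l i))"
    unfolding relent_split[OF A spectralD(1)[OF B]] by simp
  have term_ge: "m k * ln_supp (m k) + m k * ln (1 - e) - cmod (qform S (\<lambda>a b. A a b - B a b) (\<lambda>a. V a k)) * ln (d / e)
      \<le> Re (qform S A (\<lambda>a. V a k)) * ln_supp (m' k)" if k: "k \<in> K" for k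
  proof -
    define q where "q = qform S (\<lambda>a b. A a b - B a b) (\<lambda>a. V a k)"
    have Req: "Re (qform S A (\<lambda>a. V a k)) = m k + Re q"
      unfolding q_def qform_diff qform_eigenvector[OF B k] by simp
    have lm': "ln_supp (m' k) = ln (m' k)" using m'0[OF k] by (simp add: ln_supp_def)
    have up: "ln (m' k) \<le> 0" using m'2[OF k] m'0[OF k] by simp
    have "ln (e / d) \<le> ln (m' k)" using m'1[OF k] ed m'0[OF k] by simp
    hence lo: "- ln (d / e) \<le> ln (m' k)" using e d by (simp add: ln_div)
    have "\<bar>Re q * ln (m' k)\<bar> \<le> cmod q * ln (d / e)"
      unfolding abs_mult using up lo by (intro mult_mono abs_Re_le_cmod) auto
    hence 1: "- (cmod q * ln (d / e)) \<le> Re q * ln (m' k)" by linarith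
    have 2: "m k * ln_supp (m k) + m k * ln (1 - e) \<le> m k * ln (m' k)"
    proof (cases "m k = 0")
      case False
      hence mp: "0 < m k" using m(1)[OF k] by simp
      have "ln ((1 - e) * m k) \<le> ln (m' k)" unfolding m'_def using mp e ed
        by (subst ln_le_cancel_iff) (auto intro: add_pos_pos)
      hence "ln (m k) + ln (1 - e) \<le> ln (m' k)" using mp e by (simp add: ln_mult)
      hence "m k * (ln (m k) + ln (1 - e)) \<le> m k * ln (m' k)" using mp by (intro mult_left_mono) auto
      thus ?thesis using mp by (simp add: ln_supp_def algebra_simps)
    qed simp
    show ?thesis using 1 2 unfolding Req lm' q_def[symmetric] by (simp add: algebra_simps)
  qed
  have ln0: "0 \<le> ln (d / e)" using e d by (intro ln_ge_zero) (simp add: field_simps)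
  have "(\<Sum>k\<in>K. m k * ln_supp (m k)) + ln (1 - e) - \<eta> * ln (d / e)
     \<le> (\<Sum>k\<in>K. m k * ln_supp (m k)) + sum m K * ln (1 - e)
       - (\<Sum>k\<in>K. cmod (qform S (\<lambda>a b. A a b - B a b) (\<lambda>a. V a k))) * ln (d / e)"
    using mult_right_mono[OF tn ln0] m(2) by simp
  also have "\<dots> = (\<Sum>k\<in>K. m k * ln_supp (m k) + m k * ln (1 - e)
       - cmod (qform S (\<lambda>a b. A a b - B a b) (\<lambda>a. V a k)) * ln (d / e))"
    by (simp add: sum.distrib sum_subtractf sum_distrib_right)
  also have "\<dots> \<le> (\<Sum>k\<in>K. Re (qform S A (\<lambda>a. V a k)) * ln_supp (m' k))"
    by (intro sum_mono term_ge)
  finally show ?thesis using klein unfolding d_def by linarith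
qed

section \<open>Density matrices in spectral form and continuity of relative entropy\<close>

lemma psd_mat_qform:
  "psd_mat D A \<longleftrightarrow> hermitian_mat D A \<and> (\<forall>v. 0 \<le> Re (qform {..<D} (ent A) v))"
proof -
  have eq: "(A *\<^sub>v v) \<bullet> conjugate v = qform {..<D} (ent A) (\<lambda>a. v $ a)"
    if A: "A \<in> carrier_mat D D" and v: "v \<in> carrier_vec D" for v
  proof -
    have "(A *\<^sub>v v) \<bullet> conjugate v = (\<Sum>a<D. (\<Sum>b<D. A $$ (a, b) * v $ b) * cnj (v $ a))"
      using A v by (auto simp: scalar_prod_def lessThan_atLeast0 intro!: sum.cong)
    thus ?thesis unfolding qform_def by (simp add: sum_distrib_left mult_ac)
  qed
  have q: "qform {..<D} (ent A) v = qform {..<D} (ent A) (\<lambda>a. vec D v $ a)" for v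
    unfolding qform_def by (intro sum.cong refl) auto
  show ?thesis
  proof
    assume p: "psd_mat D A"
    hence h: "hermitian_mat D A" and A: "A \<in> carrier_mat D D" unfolding psd_mat_def hermitian_mat_def by auto
    have "0 \<le> Re (qform {..<D} (ent A) v)" for v
    proof -
      have "vec D v \<in> carrier_vec D" by simp
      from eq[OF A this] q[of v] p this show ?thesis unfolding psd_mat_def by metis
    qed
    with h show "hermitian_mat D A \<and> (\<forall>v. 0 \<le> Re (qform {..<D} (ent A) v))" by blast
  next
    assume "hermitian_mat D A \<and> (\<forall>v. 0 \<le> Re (qform {..<D} (ent A) v))"
    thus "psd_mat D A" using eq unfolding psd_mat_def hermitian_mat_def by auto
  qed
qed

lemma density_op_spectral:
  assumes "density_op D A"
  obtains U l where "spectral {..<D} {..<D} (ent A) U l" "\<And>i. i < D \<Longrightarrow> 0 \<le> l i" "(\<Sum>i<D. l i) = 1"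
proof -
  have h: "hermitian_mat D A" "\<And>v. 0 \<le> Re (qform {..<D} (ent A) v)" "mtrace A = 1" and A: "A \<in> carrier_mat D D"
    using assms unfolding density_op_def psd_mat_qform hermitian_mat_def by auto
  obtain U l where s: "spectral {..<D} {..<D} (ent A) U l" using spectral_theorem[OF h(1)] by blast
  have "0 \<le> l i" if "i < D" for i
    using h(2)[of "\<lambda>a. U a i"] qform_eigenvector[OF s, of i] that by simp
  moreover have "complex_of_real (\<Sum>i<D. l i) = 1"
    using trace_spectral[OF s] h(3) mtrace_eq[OF A] by simp
  hence "(\<Sum>i<D. l i) = 1" by (simp only: of_real_eq_1_iff)
  ultimately show ?thesis using that s by blast
qed

lemma density_op_carrier: "density_op D A \<Longrightarrow> A \<in> carrier_mat D D"
  unfolding density_op_def psd_mat_def hermitian_mat_def by blast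

lemma spectral_density_op:
  assumes A: "A \<in> carrier_mat D D" and s: "spectral {..<D} I (ent A) U l"
    and l: "\<And>i. i \<in> I \<Longrightarrow> 0 \<le> l i" "sum l I = 1"
  shows "density_op D A"
proof -
  have "mat_adjoint A = A"
  proof (rule eq_matI)
    fix i j assume ij: "i < dim_row A" "j < dim_col A"
    hence "mat_adjoint A $$ (i, j) = cnj (A $$ (j, i))" using A by (intro mat_adjoint_index) auto
    thus "mat_adjoint A $$ (i, j) = A $$ (i, j)"
      using ij A spectralD(4)[OF s, of i j] spectralD(4)[OF s, of j i] by (simp add: mult_ac)
  qed (use mat_adjoint_carrier[OF A] A in auto)
  moreover have "0 \<le> Re (qform {..<D} (ent A) v)" for v
    unfolding qform_spectral[OF s] by (auto intro!: sum_nonneg mult_nonneg_nonneg l)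
  moreover have "mtrace A = 1" using trace_spectral[OF s] mtrace_eq[OF A] l(2) by simp
  ultimately show ?thesis unfolding density_op_def psd_mat_qform hermitian_mat_def using A by blast
qed

text \<open>\<open>A\<close> maps its eigenvector into the range of \<open>B\<close>, and a kernel
  eigenvector of the Hermitian \<open>B\<close> is orthogonal to that range.\<close>

lemma supp_dominated:
  assumes A: "A \<in> carrier_mat D D" "spectral {..<D} I (ent A) U l"
    and B: "B \<in> carrier_mat D D" "spectral {..<D} K (ent B) V m"
    and sub: "supp A \<subseteq> supp B"
  shows "dominated {..<D} I K U l V m"
  unfolding dominated_def
proof (intro ballI impI)
  fix i k assume i: "i \<in> I" and k: "k \<in> K" and m0: "m k = 0"
  have "A *\<^sub>v vec D (\<lambda>a. U a i) \<in> supp A" unfolding supp_def using A(1) by auto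
  then obtain w where w: "w \<in> carrier_vec D" "A *\<^sub>v vec D (\<lambda>a. U a i) = B *\<^sub>v w"
    using sub B(1) unfolding supp_def by auto
  have Bw: "(B *\<^sub>v w) $ a = (\<Sum>b<D. B $$ (a, b) * w $ b)" if "a < D" for a
    using that B(1) w(1) by (auto simp: scalar_prod_def lessThan_atLeast0)
  have Av: "(A *\<^sub>v vec D (\<lambda>a. U a i)) $ a = (\<Sum>b<D. A $$ (a, b) * U b i)" if "a < D" for a
    using that A(1) by (auto simp: scalar_prod_def lessThan_atLeast0)
  have VB: "(\<Sum>a<D. cnj (V a k) * B $$ (a, b)) = 0" if b: "b < D" for b
  proof -
    have "(\<Sum>a<D. cnj (V a k) * B $$ (a, b)) = (\<Sum>a<D. \<Sum>j\<in>K. (cnj (V a k) * V a j) * (of_real (m j) * cnj (V b j)))"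
      using b by (intro sum.cong refl) (simp add: spectralD(4)[OF B(2)] sum_distrib_left mult_ac)
    also have "\<dots> = (\<Sum>j\<in>K. (\<Sum>a<D. cnj (V a k) * V a j) * (of_real (m j) * cnj (V b j)))"
      by (subst sum.swap) (simp add: sum_distrib_right)
    also have "\<dots> = (\<Sum>j\<in>K. of_bool (k = j) * (of_real (m j) * cnj (V b j)))"
      by (intro sum.cong refl) (simp add: onbD(3)[OF spectralD(1)[OF B(2)] k])
    also have "\<dots> = 0" using m0 by (intro sum.neutral) auto
    finally show ?thesis .
  qed
  have AU: "(\<Sum>b<D. A $$ (a, b) * U b i) = of_real (l i) * U a i" if a: "a < D" for a
  proof -
    have "(\<Sum>b<D. A $$ (a, b) * U b i) = (\<Sum>b<D. \<Sum>j\<in>I. (of_real (l j) * U a j) * (cnj (U b j) * U b i))"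
      using a by (intro sum.cong refl) (simp add: spectralD(4)[OF A(2)] sum_distrib_left sum_distrib_right mult_ac)
    also have "\<dots> = (\<Sum>j\<in>I. (of_real (l j) * U a j) * (\<Sum>b<D. cnj (U b j) * U b i))"
      by (subst sum.swap) (simp add: sum_distrib_left)
    also have "\<dots> = (\<Sum>j\<in>I. (of_real (l j) * U a j) * of_bool (j = i))"
      by (intro sum.cong refl) (simp add: onbD(3)[OF spectralD(1)[OF A(2)] _ i])
    also have "\<dots> = of_real (l i) * U a i" by (rule sum_of_bool_eq(3)[OF spectralD(3)[OF A(2)] i])
    finally show ?thesis .
  qed
  have "(\<Sum>a<D. cnj (V a k) * (of_real (l i) * U a i)) = (\<Sum>a<D. cnj (V a k) * (\<Sum>b<D. B $$ (a, b) * w $ b))"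
    by (intro sum.cong refl) (use AU Av Bw w(2) in auto)
  also have "\<dots> = (\<Sum>b<D. (\<Sum>a<D. cnj (V a k) * B $$ (a, b)) * w $ b)"
    by (simp add: sum_distrib_left sum_distrib_right mult.assoc) (rule sum.swap)
  also have "\<dots> = 0" by (simp add: VB)
  finally have "of_real (l i) * (\<Sum>a<D. cnj (V a k) * U a i) = 0"
    by (simp add: sum_distrib_left mult_ac)
  hence "l i = 0 \<or> cnj (\<Sum>a<D. cnj (V a k) * U a i) = 0"
    by (simp only: mult_eq_0_iff of_real_eq_0_iff complex_cnj_zero_iff)
  thus "l i = 0 \<or> (\<Sum>a<D. cnj (U a i) * V a k) = 0" by (simp add: mult.commute)
qed

text \<open>Closeness is measured by the quadratic forms of the difference, summed over an arbitrary
  orthonormal basis; this stands for the trace norm. Klein's inequality controls the entropies in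
  both directions, in the eigenbases of \<open>B\<close> and of \<open>A\<close>, and the cross term
  with \<open>T\<close> is linear. The basis \<open>V\<close> has its own index set, hence its
  separate hypothesis.\<close>

lemma qrel_ent_continuity:
  assumes A: "density_op D A" and B: "density_op D B"
    and T: "T \<in> carrier_mat D D" "spectral {..<D} K (ent T) V t"
    and e: "0 < e" "e < 1"
    and tn: "\<And>u. onb {..<D} {..<D} u \<Longrightarrow>
       (\<Sum>i<D. cmod (qform {..<D} (\<lambda>a b. ent A a b - ent B a b) (\<lambda>a. u a i))) \<le> \<eta>"
    and tnV: "(\<Sum>k\<in>K. cmod (qform {..<D} (\<lambda>a b. ent A a b - ent B a b) (\<lambda>a. V a k))) \<le> \<eta>"
    and c: "\<And>k. k \<in> K \<Longrightarrow> \<bar>ln_supp (t k)\<bar> \<le> c" "0 \<le> c"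
  shows "\<bar>qrel_ent A T - qrel_ent B T\<bar> \<le> \<eta> * (ln (D / e) + c) - ln (1 - e)"
proof -
  obtain U l where Us: "spectral {..<D} {..<D} (ent A) U l" "\<And>i. i < D \<Longrightarrow> 0 \<le> l i" "(\<Sum>i<D. l i) = 1"
    using density_op_spectral[OF A] by blast
  obtain W m where Ws: "spectral {..<D} {..<D} (ent B) W m" "\<And>i. i < D \<Longrightarrow> 0 \<le> m i" "(\<Sum>i<D. m i) = 1"
    using density_op_spectral[OF B] by blast
  have swap: "cmod (qform {..<D} (\<lambda>a b. ent B a b - ent A a b) u) = cmod (qform {..<D} (\<lambda>a b. ent A a b - ent B a b) u)" for u
    unfolding qform_diff by (rule norm_minus_commute)
  have 1: "(\<Sum>i<D. m i * ln_supp (m i)) - (\<Sum>i<D. l i * ln_supp (l i)) \<le> \<eta> * ln (D / e) - ln (1 - e)"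
    using entropy_diff_le[OF Us(1) Ws(1) _ Us(3) _ Ws(3) e tn[OF spectralD(1)[OF Ws(1)]]] Us(2) Ws(2) by simp
  have 2: "(\<Sum>i<D. l i * ln_supp (l i)) - (\<Sum>i<D. m i * ln_supp (m i)) \<le> \<eta> * ln (D / e) - ln (1 - e)"
    using entropy_diff_le[OF Ws(1) Us(1) _ Ws(3) _ Us(3) e, of \<eta>] tn[OF spectralD(1)[OF Us(1)]] Us(2) Ws(2)
    by (simp add: swap)
  have "\<bar>\<Sum>k\<in>K. Re (qform {..<D} (\<lambda>a b. ent A a b - ent B a b) (\<lambda>a. V a k)) * ln_supp (t k)\<bar>
      \<le> (\<Sum>k\<in>K. cmod (qform {..<D} (\<lambda>a b. ent A a b - ent B a b) (\<lambda>a. V a k)) * c)"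
    by (intro order_trans[OF sum_abs] sum_mono) (auto simp: abs_mult intro!: mult_mono abs_Re_le_cmod c)
  also have "\<dots> \<le> \<eta> * c" unfolding sum_distrib_right[symmetric] by (intro mult_right_mono tnV c)
  finally have 3: "\<bar>\<Sum>k\<in>K. Re (qform {..<D} (\<lambda>a b. ent A a b - ent B a b) (\<lambda>a. V a k)) * ln_supp (t k)\<bar> \<le> \<eta> * c" .
  have 4: "(\<Sum>k\<in>K. Re (qform {..<D} (\<lambda>a b. ent A a b - ent B a b) (\<lambda>a. V a k)) * ln_supp (t k))
    = (\<Sum>k\<in>K. Re (qform {..<D} (ent A) (\<lambda>a. V a k)) * ln_supp (t k))
      - (\<Sum>k\<in>K. Re (qform {..<D} (ent B) (\<lambda>a. V a k)) * ln_supp (t k))"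
    unfolding qform_diff by (simp add: left_diff_distrib sum_subtractf)
  have "qrel_ent A T - qrel_ent B T = ((\<Sum>i<D. l i * ln_supp (l i)) - (\<Sum>i<D. m i * ln_supp (m i)))
     - (\<Sum>k\<in>K. Re (qform {..<D} (\<lambda>a b. ent A a b - ent B a b) (\<lambda>a. V a k)) * ln_supp (t k))"
    unfolding 4 qrel_ent_spectral[OF density_op_carrier[OF A] Us(1) T] qrel_ent_spectral[OF density_op_carrier[OF B] Ws(1) T]
      relent_split[OF Us(1) spectralD(1)[OF T(2)]] relent_split[OF Ws(1) spectralD(1)[OF T(2)]]
    by simp
  thus ?thesis using 1 2 3 by (simp add: distrib_left abs_le_iff)
qed

section \<open>Sequential decoding\<close>

lemma sum_cauchy_schwarz:
  fixes f g :: "'a \<Rightarrow> real"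
  shows "(\<Sum>i\<in>A. f i * g i)\<^sup>2 \<le> (\<Sum>i\<in>A. (f i)\<^sup>2) * (\<Sum>i\<in>A. (g i)\<^sup>2)"
proof -
  have "0 \<le> (\<Sum>i\<in>A. \<Sum>j\<in>A. (f i * g j - f j * g i)\<^sup>2)" by (intro sum_nonneg) auto
  also have "\<dots> = (\<Sum>i\<in>A. \<Sum>j\<in>A. (f i)\<^sup>2 * (g j)\<^sup>2) + (\<Sum>i\<in>A. \<Sum>j\<in>A. (f j)\<^sup>2 * (g i)\<^sup>2)
      - 2 * (\<Sum>i\<in>A. \<Sum>j\<in>A. (f i * g i) * (f j * g j))"
    unfolding sum.distrib[symmetric] sum_subtractf[symmetric] sum_distrib_left
    by (intro sum.cong refl) (simp add: power2_eq_square algebra_simps)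
  also have "(\<Sum>i\<in>A. \<Sum>j\<in>A. (f j)\<^sup>2 * (g i)\<^sup>2) = (\<Sum>i\<in>A. \<Sum>j\<in>A. (f i)\<^sup>2 * (g j)\<^sup>2)"
    by (rule sum.swap)
  finally show ?thesis
    unfolding power2_eq_square[of "sum _ _"] sum_product by simp
qed

lemma sum_cauchy_schwarz_sqrt:
  fixes f g :: "'a \<Rightarrow> real"
  shows "(\<Sum>i\<in>A. f i * g i) \<le> sqrt (\<Sum>i\<in>A. (f i)\<^sup>2) * sqrt (\<Sum>i\<in>A. (g i)\<^sup>2)"
  unfolding real_sqrt_mult[symmetric] by (rule real_le_rsqrt[OF sum_cauchy_schwarz])

lemma ip_cauchy_schwarz: "cmod (ip S u v) \<le> sqrt (nsq S u) * sqrt (nsq S v)"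
proof -
  have "cmod (ip S u v) \<le> (\<Sum>a\<in>S. cmod (u a) * cmod (v a))"
    unfolding ip_def by (rule order_trans[OF norm_sum]) (simp add: norm_mult)
  also have "\<dots> \<le> sqrt (nsq S u) * sqrt (nsq S v)"
    unfolding nsq_def by (rule sum_cauchy_schwarz_sqrt)
  finally show ?thesis .
qed

lemma ip_diff_right: "ip S u (\<lambda>a. v a - w a) = ip S u v - ip S u w"
  and ip_diff_left: "ip S (\<lambda>a. v a - w a) u = ip S v u - ip S w u"
  unfolding ip_def by (simp_all add: algebra_simps sum_subtractf)

text \<open>Projections are described by their effect on inner products over \<open>S\<close>:
  values outside \<open>S\<close> are unconstrained, so an equation \<open>R (R v) = R v\<close>
  between functions would ask too much.\<close>

definition orthop :: "'a set \<Rightarrow> (('a \<Rightarrow> complex) \<Rightarrow> 'a \<Rightarrow> complex) \<Rightarrow> bool" where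
  "orthop S R \<longleftrightarrow> (\<forall>u v. ip S (R u) v = ip S u (R v) \<and> ip S (R u) (R v) = ip S u (R v))"

lemma orthopD:
  assumes "orthop S R"
  shows "ip S (R u) v = ip S u (R v)" "ip S (R u) (R v) = ip S u (R v)"
  using assms unfolding orthop_def by blast+

lemma orthop_compl:
  assumes "orthop S R"
  shows "orthop S (\<lambda>v a. v a - R v a)"
  unfolding orthop_def ip_diff_right ip_diff_left
proof (intro allI)
  fix u v
  note e = orthopD[OF assms, of u v]
  show "ip S u v - ip S (R u) v = ip S u v - ip S u (R v) \<and>
    ip S u v - ip S (R u) v - (ip S u (R v) - ip S (R u) (R v)) = ip S u v - ip S u (R v)"
    unfolding e by simp
qed

text \<open>Kept in polarised form because the matrix entries of a POVM, and not only its quadratic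
  forms, have to add up.\<close>

lemma orthop_pythagoras:
  assumes "orthop S R"
  shows "ip S (R u) (R v) + ip S (\<lambda>a. u a - R u a) (\<lambda>a. v a - R v a) = ip S u v"
  unfolding ip_diff_right ip_diff_left orthopD[OF assms, of u v] by simp

lemma orthop_nsq:
  assumes "orthop S R"
  shows "nsq S (R v) + nsq S (\<lambda>a. v a - R v a) = nsq S v"
proof -
  have "complex_of_real (nsq S (R v) + nsq S (\<lambda>a. v a - R v a)) = of_real (nsq S v)"
    unfolding of_real_add ip_self[symmetric] by (rule orthop_pythagoras[OF assms])
  thus ?thesis by (simp only: of_real_eq_iff)
qed

primrec chain :: "(nat \<Rightarrow> ('a \<Rightarrow> complex) \<Rightarrow> 'a \<Rightarrow> complex) \<Rightarrow> nat \<Rightarrow> ('a \<Rightarrow> complex) \<Rightarrow> 'a \<Rightarrow> complex" where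
  "chain R 0 v = v"
| "chain R (Suc j) v = R j (chain R j v)"

text \<open>The vectors \<open>d j\<close> lost at the successive steps have squared norms
  telescoping to the total loss, and their inner products with \<open>v\<close> see only the part of
  \<open>v\<close> that \<open>R j\<close> removes. Cauchy-Schwarz then bounds the inner product of
  \<open>v\<close> with its total change, and elementary algebra converts this into a bound on the
  loss itself.\<close>

lemma gao_union_bound:
  assumes R: "\<And>j. j < m \<Longrightarrow> orthop S (R j)"
  shows "nsq S v - nsq S (chain R m v) \<le> 4 * (\<Sum>j<m. nsq S (\<lambda>a. v a - R j v a))"
proof -
  define w where "w j = chain R j v" for j
  define d where "d j = (\<lambda>a. w j a - w (Suc j) a)" for j
  define E where "E = (\<Sum>j<m. nsq S (\<lambda>a. v a - R j v a))"
  have w0: "w 0 = v" and wS: "w (Suc j) = R j (w j)" for j unfolding w_def by simp_all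
  have pyth: "nsq S (d j) = nsq S (w j) - nsq S (w (Suc j))" if "j < m" for j
    using orthop_nsq[OF R[OF that], of "w j"] unfolding d_def wS by simp
  have tel: "(\<Sum>j<m. nsq S (d j)) = nsq S v - nsq S (w m)"
  proof -
    have "(\<Sum>j<m. nsq S (d j)) = (\<Sum>j<m. nsq S (w j) - nsq S (w (Suc j)))"
      by (intro sum.cong refl pyth) auto
    thus ?thesis using sum_lessThan_telescope'[of "\<lambda>j. nsq S (w j)" m] by (simp add: w0)
  qed
  \<comment> \<open>\<open>d j\<close> is orthogonal to the range of \<open>R j\<close>.\<close>
  have step: "ip S v (d j) = ip S (\<lambda>a. v a - R j v a) (d j)" if "j < m" for j
    unfolding d_def wS ip_diff_right ip_diff_left orthopD[OF R[OF that], of v "w j"] by simp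
  have "ip S v v - ip S v (w m) = (\<Sum>j<m. ip S v (w j) - ip S v (w (Suc j)))"
    using sum_lessThan_telescope'[of "\<lambda>j. ip S v (w j)" m] by (simp add: w0)
  also have "\<dots> = (\<Sum>j<m. ip S v (d j))" unfolding d_def ip_diff_right ..
  finally have "cmod (ip S v v - ip S v (w m)) \<le> (\<Sum>j<m. cmod (ip S v (d j)))"
    by (simp add: norm_sum)
  also have "\<dots> \<le> (\<Sum>j<m. sqrt (nsq S (\<lambda>a. v a - R j v a)) * sqrt (nsq S (d j)))"
    by (intro sum_mono) (use step ip_cauchy_schwarz in \<open>metis lessThan_iff\<close>)
  also have "\<dots> \<le> sqrt (\<Sum>j<m. (sqrt (nsq S (\<lambda>a. v a - R j v a)))\<^sup>2) * sqrt (\<Sum>j<m. (sqrt (nsq S (d j)))\<^sup>2)"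
    by (rule sum_cauchy_schwarz_sqrt)
  also have "\<dots> = sqrt E * sqrt (nsq S v - nsq S (w m))"
    unfolding E_def tel[symmetric] by (simp add: nsq_nonneg)
  finally have 1: "cmod (ip S v v - ip S v (w m)) \<le> sqrt E * sqrt (nsq S v - nsq S (w m))" .
  define p q where "p = sqrt (nsq S v)" and "q = sqrt (nsq S (w m))"
  have p2: "p\<^sup>2 = nsq S v" and q2: "q\<^sup>2 = nsq S (w m)" and pq0: "0 \<le> p" "0 \<le> q"
    unfolding p_def q_def by (simp_all add: nsq_nonneg)
  have "0 \<le> (\<Sum>j<m. nsq S (d j))" by (intro sum_nonneg nsq_nonneg)
  hence le: "q \<le> p" unfolding p_def q_def tel by simp
  have E0: "0 \<le> E" unfolding E_def by (intro sum_nonneg nsq_nonneg)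
  have "p\<^sup>2 - p * q \<le> Re (ip S v v - ip S v (w m))"
  proof -
    have "Re (ip S v (w m)) \<le> p * q"
      using ip_cauchy_schwarz[of S v "w m"] complex_Re_le_cmod[of "ip S v (w m)"]
      unfolding p_def q_def by linarith
    thus ?thesis unfolding ip_self p2 by simp
  qed
  also have "\<dots> \<le> sqrt E * sqrt (p\<^sup>2 - q\<^sup>2)"
    using 1 complex_Re_le_cmod[of "ip S v v - ip S v (w m)"] unfolding p2 q2 by linarith
  finally have 2: "p\<^sup>2 - p * q \<le> sqrt E * sqrt (p\<^sup>2 - q\<^sup>2)" .
  \<comment> \<open>Squaring the last inequality and cancelling \<open>p - q\<close> leaves
    \<open>p^2 * (p - q) <= E * (p + q)\<close>; one more factor \<open>p + q\<close>, which is at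
    most \<open>2 * p\<close>, produces the constant 4.\<close>
  have "p\<^sup>2 - q\<^sup>2 \<le> 4 * E"
  proof (cases "p = q")
    case False
    hence lt: "q < p" using le by simp
    hence p0: "0 < p" using pq0 by simp
    have "0 \<le> p\<^sup>2 - p * q" using lt p0 by (simp add: power2_eq_square)
    hence "(p\<^sup>2 - p * q)\<^sup>2 \<le> (sqrt E * sqrt (p\<^sup>2 - q\<^sup>2))\<^sup>2" by (intro power_mono 2)
    also have "\<dots> = E * (p\<^sup>2 - q\<^sup>2)"
      using E0 pq0 le by (simp add: power_mult_distrib power_mono)
    finally have "(p - q) * (p\<^sup>2 * (p - q)) \<le> (p - q) * (E * (p + q))"
      by (simp add: power2_eq_square algebra_simps)
    hence "p\<^sup>2 * (p - q) \<le> E * (p + q)" using lt by simp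
    hence "p\<^sup>2 * (p - q) * (p + q) \<le> E * (p + q) * (p + q)" using pq0 by (intro mult_right_mono) auto
    also have "\<dots> \<le> E * ((2 * p) * (2 * p))"
    proof -
      have "(p + q) * (p + q) \<le> (2 * p) * (2 * p)" using pq0 le by (intro mult_mono) auto
      thus ?thesis unfolding mult.assoc[of E] by (rule mult_left_mono[OF _ E0])
    qed
    finally have "p\<^sup>2 * (p\<^sup>2 - q\<^sup>2) \<le> p\<^sup>2 * (4 * E)" by (simp add: power2_eq_square algebra_simps)
    thus ?thesis using p0 by simp
  qed (use E0 in simp)
  thus ?thesis unfolding p2 q2 w_def E_def .
qed

definition app :: "'a set \<Rightarrow> ('a \<Rightarrow> 'a \<Rightarrow> complex) \<Rightarrow> ('a \<Rightarrow> complex) \<Rightarrow> 'a \<Rightarrow> complex" where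
  "app S P v = (\<lambda>a. \<Sum>b\<in>S. P a b * v b)"

definition proj :: "'a set \<Rightarrow> ('a \<Rightarrow> 'a \<Rightarrow> complex) \<Rightarrow> bool" where
  "proj S P \<longleftrightarrow> finite S \<and> (\<forall>a\<in>S. \<forall>b\<in>S. P a b = cnj (P b a)) \<and>
     (\<forall>a\<in>S. \<forall>b\<in>S. (\<Sum>c\<in>S. P a c * P c b) = P a b)"

lemma ip_app_hermitian:
  assumes "\<And>a b. a \<in> S \<Longrightarrow> b \<in> S \<Longrightarrow> P a b = cnj (P b a)"
  shows "ip S (app S P u) v = ip S u (app S P v)"
proof -
  have "ip S (app S P u) v = (\<Sum>a\<in>S. \<Sum>b\<in>S. cnj (u b) * (P b a * v a))"
    unfolding ip_def app_def cnj_sum sum_distrib_right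
  proof (intro sum.cong refl)
    fix a b assume "a \<in> S" "b \<in> S"
    hence "P b a = cnj (P a b)" by (intro assms)
    thus "cnj (P a b * u b) * v a = cnj (u b) * (P b a * v a)" by simp
  qed
  also have "\<dots> = ip S u (app S P v)"
    unfolding ip_def app_def sum_distrib_left by (rule sum.swap)
  finally show ?thesis .
qed

lemma app_app: "app S P (app S Q v) a = (\<Sum>b\<in>S. (\<Sum>c\<in>S. P a c * Q c b) * v b)"
  unfolding app_def sum_distrib_left sum_distrib_right mult.assoc by (rule sum.swap)

lemma proj_idem:
  assumes "proj S P" "a \<in> S"
  shows "app S P (app S P v) a = app S P v a"
proof -
  have "(\<Sum>c\<in>S. P a c * P c b) = P a b" if "b \<in> S" for b
    using assms that unfolding proj_def by blast
  thus ?thesis unfolding app_app by (simp add: app_def)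
qed

lemma ip_cong: "(\<And>a. a \<in> S \<Longrightarrow> u a = u' a) \<Longrightarrow> (\<And>a. a \<in> S \<Longrightarrow> v a = v' a) \<Longrightarrow> ip S u v = ip S u' v'"
  unfolding ip_def by (intro sum.cong) auto

lemma proj_orthop:
  assumes "proj S P"
  shows "orthop S (app S P)"
proof -
  have h: "ip S (app S P u) v = ip S u (app S P v)" for u v
    by (rule ip_app_hermitian) (use assms in \<open>unfold proj_def, blast\<close>)
  have "ip S (app S P u) (app S P v) = ip S u (app S P v)" for u v
    unfolding h by (intro ip_cong refl proj_idem[OF assms])
  thus ?thesis unfolding orthop_def using h by blast
qed

definition trp :: "'a set \<Rightarrow> ('a \<Rightarrow> 'a \<Rightarrow> complex) \<Rightarrow> ('a \<Rightarrow> 'a \<Rightarrow> complex) \<Rightarrow> real" where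
  "trp S P A = Re (\<Sum>a\<in>S. \<Sum>b\<in>S. P a b * A b a)"

lemma trp_spectral_qform:
  assumes "spectral S I A U l"
  shows "trp S P A = (\<Sum>i\<in>I. l i * Re (qform S P (\<lambda>a. U a i)))"
proof -
  have "(\<Sum>a\<in>S. \<Sum>b\<in>S. P a b * A b a)
     = (\<Sum>a\<in>S. \<Sum>b\<in>S. \<Sum>i\<in>I. of_real (l i) * (cnj (U a i) * P a b * U b i))"
    by (intro sum.cong refl) (simp add: spectralD(4)[OF assms] sum_distrib_left mult_ac)
  also have "\<dots> = (\<Sum>a\<in>S. \<Sum>i\<in>I. \<Sum>b\<in>S. of_real (l i) * (cnj (U a i) * P a b * U b i))"
    by (intro sum.cong refl sum.swap)
  also have "\<dots> = (\<Sum>i\<in>I. of_real (l i) * qform S P (\<lambda>a. U a i))"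
    unfolding qform_def sum_distrib_left by (rule sum.swap)
  finally show ?thesis unfolding trp_def by simp
qed

lemma proj_qform:
  assumes "proj S P"
  shows "Re (qform S P v) = nsq S (app S P v)"
proof -
  have "qform S P v = ip S v (app S P v)"
    unfolding qform_def ip_def app_def by (simp add: sum_distrib_left mult_ac)
  also have "\<dots> = of_real (nsq S (app S P v))"
    unfolding ip_self[symmetric] by (rule orthopD(2)[OF proj_orthop[OF assms], symmetric])
  finally show ?thesis by simp
qed

lemma trp_proj:
  assumes "spectral S I A U l" "proj S P"
  shows "trp S P A = (\<Sum>i\<in>I. l i * nsq S (app S P (\<lambda>a. U a i)))"
  unfolding trp_spectral_qform[OF assms(1)] proj_qform[OF assms(2)] ..

lemma trp_proj_compl:
  assumes s: "spectral S I A U l" and P: "proj S P" and l: "sum l I = 1"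
  shows "1 - trp S P A = (\<Sum>i\<in>I. l i * nsq S (\<lambda>a. U a i - app S P (\<lambda>a. U a i) a))"
proof -
  have "nsq S (\<lambda>a. U a i - app S P (\<lambda>a. U a i) a) = 1 - nsq S (app S P (\<lambda>a. U a i))" if "i \<in> I" for i
    using orthop_nsq[OF proj_orthop[OF P], of "\<lambda>a. U a i"] onb_col_norm[OF spectralD(1)[OF s] that] by simp
  thus ?thesis unfolding trp_proj[OF s P] by (simp add: right_diff_distrib sum_subtractf l)
qed

definition lin_on :: "'a set \<Rightarrow> (('a \<Rightarrow> complex) \<Rightarrow> 'a \<Rightarrow> complex) \<Rightarrow> bool" where
  "lin_on S L \<longleftrightarrow> (\<forall>v. \<forall>c\<in>S. L v c = (\<Sum>a\<in>S. v a * L (\<lambda>x. of_bool (x = a)) c))"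

lemma lin_on_id: "finite S \<Longrightarrow> lin_on S (\<lambda>v. v)"
  unfolding lin_on_def by (simp add: sum_of_bool_eq)

lemma lin_on_app:
  assumes "lin_on S L"
  shows "lin_on S (\<lambda>v. app S P (L v))"
proof -
  have "app S P (L v) c = (\<Sum>a\<in>S. v a * app S P (L (\<lambda>x. of_bool (x = a))) c)" for v c
  proof -
    have "app S P (L v) c = (\<Sum>d\<in>S. \<Sum>a\<in>S. v a * (P c d * L (\<lambda>x. of_bool (x = a)) d))"
      unfolding app_def
    proof (intro sum.cong refl)
      fix d assume "d \<in> S"
      hence "L v d = (\<Sum>a\<in>S. v a * L (\<lambda>x. of_bool (x = a)) d)" using assms unfolding lin_on_def by blast
      thus "P c d * L v d = (\<Sum>a\<in>S. v a * (P c d * L (\<lambda>x. of_bool (x = a)) d))"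
        by (simp add: sum_distrib_left mult_ac)
    qed
    also have "\<dots> = (\<Sum>a\<in>S. v a * app S P (L (\<lambda>x. of_bool (x = a))) c)"
      unfolding app_def sum_distrib_left by (rule sum.swap)
    finally show ?thesis .
  qed
  thus ?thesis unfolding lin_on_def by blast
qed

lemma lin_on_diff:
  assumes "lin_on S L" "lin_on S L'"
  shows "lin_on S (\<lambda>v a. L v a - L' v a)"
  unfolding lin_on_def right_diff_distrib sum_subtractf
proof (intro allI ballI arg_cong2[where f = "(-)"])
  fix v c assume "c \<in> S"
  thus "L v c = (\<Sum>a\<in>S. v a * L (\<lambda>x. of_bool (x = a)) c)"
    "L' v c = (\<Sum>a\<in>S. v a * L' (\<lambda>x. of_bool (x = a)) c)"
    using assms unfolding lin_on_def by blast+
qed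

text \<open>The kernel on the left is that of the adjoint of \<open>L\<close> times
  \<open>L\<close>. POVM elements are formed as such Gram kernels, which makes them Hermitian and
  positive at once.\<close>

lemma qform_gram:
  assumes "lin_on S L"
  shows "qform S (\<lambda>a b. ip S (L (\<lambda>x. of_bool (x = a))) (L (\<lambda>x. of_bool (x = b)))) v = of_real (nsq S (L v))"
proof -
  let ?e = "\<lambda>a x. of_bool (x = a) :: complex"
  have "ip S (L v) (L v) = (\<Sum>c\<in>S. (\<Sum>a\<in>S. cnj (v a) * cnj (L (?e a) c)) * (\<Sum>b\<in>S. v b * L (?e b) c))"
    unfolding ip_def
  proof (intro sum.cong refl)
    fix c assume "c \<in> S"
    hence eq: "L v c = (\<Sum>a\<in>S. v a * L (?e a) c)" using assms unfolding lin_on_def by blast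
    show "cnj (L v c) * L v c = (\<Sum>a\<in>S. cnj (v a) * cnj (L (?e a) c)) * (\<Sum>b\<in>S. v b * L (?e b) c)"
      unfolding eq by simp
  qed
  also have "\<dots> = (\<Sum>c\<in>S. \<Sum>a\<in>S. \<Sum>b\<in>S. cnj (v a) * (cnj (L (?e a) c) * L (?e b) c) * v b)"
    unfolding sum_product by (intro sum.cong refl) (simp add: mult_ac)
  also have "\<dots> = (\<Sum>a\<in>S. \<Sum>c\<in>S. \<Sum>b\<in>S. cnj (v a) * (cnj (L (?e a) c) * L (?e b) c) * v b)"
    by (rule sum.swap)
  also have "\<dots> = (\<Sum>a\<in>S. \<Sum>b\<in>S. \<Sum>c\<in>S. cnj (v a) * (cnj (L (?e a) c) * L (?e b) c) * v b)"
    by (intro sum.cong refl sum.swap)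
  also have "\<dots> = qform S (\<lambda>a b. ip S (L (?e a)) (L (?e b))) v"
    unfolding qform_def ip_def by (simp only: sum_distrib_left sum_distrib_right)
  finally show ?thesis unfolding ip_self ..
qed

text \<open>Sequential decoding: measure \<open>P 0\<close>, \<open>P 1\<close>, ... in turn and announce the first success; the
  outcome without any success is attributed to message \<open>0\<close> to complete the POVM.\<close>
lemma sequential_decoder:
  fixes M :: nat
  assumes P: "\<And>m. m < M \<Longrightarrow> proj {..<D} (P m)" and M: "1 \<le> M"
  shows "\<exists>\<Lambda>. (\<forall>m<M. psd_mat D (\<Lambda> m)) \<and> mat_sum D \<Lambda> {..<M} = 1\<^sub>m D \<and>
     (\<forall>m<M. \<forall>A. density_op D A \<longrightarrow> 1 - Re (mtrace (\<Lambda> m * A))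
        \<le> 4 * ((1 - trp {..<D} (P m) (ent A)) + (\<Sum>j<m. trp {..<D} (P j) (ent A))))"
proof -
  define R where "R j v = (\<lambda>a. v a - app {..<D} (P j) v a)" for j :: nat and v
  define C where "C m v = app {..<D} (P m) (chain R m v)" for m v
  define e :: "nat \<Rightarrow> nat \<Rightarrow> complex" where "e a = (\<lambda>x. of_bool (x = a))" for a
  define G where "G m a b = ip {..<D} (C m (e a)) (C m (e b))" for m a b
  define Z where "Z a b = ip {..<D} (chain R M (e a)) (chain R M (e b))" for a b
  define \<Lambda> where "\<Lambda> m = mat D D (\<lambda>(a, b). G m a b + of_bool (m = 0) * Z a b)" for m
  have ent\<Lambda>: "\<Lambda> m $$ (a, b) = G m a b + of_bool (m = 0) * Z a b" if "a < D" "b < D" for m a b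
    unfolding \<Lambda>_def using that by simp
  have c\<Lambda>: "\<Lambda> m \<in> carrier_mat D D" for m unfolding \<Lambda>_def by simp
  have linR: "lin_on {..<D} (\<lambda>v. chain R m v)" for m
  proof (induction m)
    case (Suc m)
    have "lin_on {..<D} (\<lambda>v a. chain R m v a - app {..<D} (P m) (chain R m v) a)"
      by (intro lin_on_diff lin_on_app Suc)
    thus ?case unfolding chain.simps unfolding R_def .
  qed (simp add: lin_on_id)
  have linC: "lin_on {..<D} (C m)" for m unfolding C_def by (intro lin_on_app linR)
  have qG: "qform {..<D} (G m) v = of_real (nsq {..<D} (C m v))" for m v
    unfolding G_def e_def by (rule qform_gram[OF linC])
  have qZ: "qform {..<D} Z v = of_real (nsq {..<D} (chain R M v))" for v
    unfolding Z_def e_def by (rule qform_gram[OF linR])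
  have q\<Lambda>: "qform {..<D} (ent (\<Lambda> m)) v = of_real (nsq {..<D} (C m v) + of_bool (m = 0) * nsq {..<D} (chain R M v))" for m v
  proof -
    have "qform {..<D} (ent (\<Lambda> m)) v = qform {..<D} (G m) v + of_bool (m = 0) * qform {..<D} Z v"
      unfolding qform_def by (simp add: ent\<Lambda> sum.distrib sum_distrib_left algebra_simps)
    thus ?thesis unfolding qG qZ by simp
  qed
  have herm: "hermitian_mat D (\<Lambda> m)" for m
  proof -
    have "mat_adjoint (\<Lambda> m) $$ (a, b) = \<Lambda> m $$ (a, b)" if "a < D" "b < D" for a b
    proof -
      have "cnj (G m b a) = G m a b" "cnj (Z b a) = Z a b" unfolding G_def Z_def ip_cnj by simp_all
      thus ?thesis using that by (simp add: mat_adjoint_index[OF c\<Lambda>] ent\<Lambda>)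
    qed
    hence "mat_adjoint (\<Lambda> m) = \<Lambda> m" using c\<Lambda>[of m] mat_adjoint_carrier[OF c\<Lambda>[of m]] by (intro eq_matI) auto
    thus ?thesis unfolding hermitian_mat_def using c\<Lambda> by blast
  qed
  have psd: "psd_mat D (\<Lambda> m)" for m
    unfolding psd_mat_qform q\<Lambda> using herm by (auto intro!: add_nonneg_nonneg nsq_nonneg)
  \<comment> \<open>Acceptance and rejection in test \<open>k\<close> split the inner product by
    Pythagoras, so nothing is lost up to the final remainder.\<close>
  have tel: "k \<le> M \<Longrightarrow> (\<Sum>m<k. ip {..<D} (C m u) (C m v)) + ip {..<D} (chain R k u) (chain R k v) = ip {..<D} u v" for k u v
  proof (induction k)
    case (Suc k)
    have "ip {..<D} (C k u) (C k v) + ip {..<D} (chain R (Suc k) u) (chain R (Suc k) v) = ip {..<D} (chain R k u) (chain R k v)"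
      unfolding C_def chain.simps R_def using Suc.prems by (intro orthop_pythagoras proj_orthop P) simp
    with Suc show ?case by (simp add: add.assoc)
  qed simp
  have sum1: "mat_sum D \<Lambda> {..<M} = 1\<^sub>m D"
  proof (rule eq_matI)
    fix a b assume ab: "a < dim_row (1\<^sub>m D)" "b < dim_col (1\<^sub>m D)"
    hence ab': "a < D" "b < D" by auto
    have "mat_sum D \<Lambda> {..<M} $$ (a, b) = (\<Sum>m<M. G m a b + of_bool (m = 0) * Z a b)"
      unfolding mat_sum_def using ab' by (simp add: ent\<Lambda>)
    also have "\<dots> = (\<Sum>m<M. G m a b) + (\<Sum>m<M. of_bool (m = 0) * Z a b)" by (rule sum.distrib)
    also have "(\<Sum>m<M. of_bool (m = 0) * Z a b) = Z a b" by (rule sum_of_bool_eq(1)) (use M in auto)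
    also have "(\<Sum>m<M. G m a b) + Z a b = ip {..<D} (e a) (e b)"
      unfolding G_def Z_def by (rule tel) simp
    also have "\<dots> = (\<Sum>x<D. of_bool (x = a) * of_bool (x = b))"
      unfolding ip_def e_def by (intro sum.cong refl) simp
    also have "\<dots> = of_bool (a = b)" by (rule sum_of_bool_eq(1)) (use ab' in auto)
    finally show "mat_sum D \<Lambda> {..<M} $$ (a, b) = 1\<^sub>m D $$ (a, b)" using ab' by simp
  qed (auto simp: mat_sum_def)
  have err: "1 - Re (mtrace (\<Lambda> m * A)) \<le> 4 * ((1 - trp {..<D} (P m) (ent A)) + (\<Sum>j<m. trp {..<D} (P j) (ent A)))"
    if m: "m < M" and A: "density_op D A" for m A
  proof -
    obtain U l where s: "spectral {..<D} {..<D} (ent A) U l" and l: "\<And>i. i < D \<Longrightarrow> 0 \<le> l i" "(\<Sum>i<D. l i) = 1"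
      using density_op_spectral[OF A] by blast
    \<comment> \<open>Announcing \<open>m\<close> means \<open>m\<close> rejections followed by one
      acceptance. With the acceptance as the last projection of the chain, the union bound covers
      both kinds of error.\<close>
    define Rm where "Rm j = (if j = m then app {..<D} (P m) else R j)" for j
    have ch: "j \<le> m \<Longrightarrow> chain Rm j v = chain R j v" for j v
      by (induction j) (auto simp: Rm_def)
    hence Cm: "C m v = chain Rm (Suc m) v" for v unfolding C_def by (simp add: Rm_def)
    have oR: "orthop {..<D} (Rm j)" if "j < Suc m" for j
    proof (cases "j = m")
      case False
      hence "orthop {..<D} (R j)" unfolding R_def using that m by (intro orthop_compl proj_orthop P) simp
      thus ?thesis unfolding Rm_def using False by simp
    qed (use m in \<open>auto simp: Rm_def intro: proj_orthop P\<close>)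
    have ub: "1 - nsq {..<D} (C m (\<lambda>a. U a i)) \<le> 4 * (nsq {..<D} (\<lambda>a. U a i - app {..<D} (P m) (\<lambda>a. U a i) a)
         + (\<Sum>j<m. nsq {..<D} (app {..<D} (P j) (\<lambda>a. U a i))))" if i: "i < D" for i
    proof -
      have "nsq {..<D} (\<lambda>a. U a i) - nsq {..<D} (C m (\<lambda>a. U a i))
         \<le> 4 * (\<Sum>j<Suc m. nsq {..<D} (\<lambda>a. U a i - Rm j (\<lambda>a. U a i) a))"
        unfolding Cm by (rule gao_union_bound[OF oR])
      also have "nsq {..<D} (\<lambda>a. U a i) = 1" using onb_col_norm[OF spectralD(1)[OF s]] i by simp
      \<comment> \<open>A rejection \<open>R j\<close> removes exactly the component accepted by
        \<open>P j\<close>, so its share of the bound is the confusion with message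
        \<open>j\<close>.\<close>
      also have "(\<Sum>j<Suc m. nsq {..<D} (\<lambda>a. U a i - Rm j (\<lambda>a. U a i) a))
         = nsq {..<D} (\<lambda>a. U a i - app {..<D} (P m) (\<lambda>a. U a i) a) + (\<Sum>j<m. nsq {..<D} (app {..<D} (P j) (\<lambda>a. U a i)))"
        by (simp add: Rm_def R_def)
      finally show ?thesis .
    qed
    have tr: "Re (mtrace (\<Lambda> m * A)) = (\<Sum>i<D. l i * Re (qform {..<D} (ent (\<Lambda> m)) (\<lambda>a. U a i)))"
      using trp_spectral_qform[OF s, of "ent (\<Lambda> m)"] mtrace_mult[OF c\<Lambda>[of m] density_op_carrier[OF A]]
      unfolding trp_def by simp
    have "1 - Re (mtrace (\<Lambda> m * A)) = (\<Sum>i<D. l i * (1 - Re (qform {..<D} (ent (\<Lambda> m)) (\<lambda>a. U a i))))"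
      unfolding tr right_diff_distrib sum_subtractf using l(2) by simp
    also have "\<dots> \<le> (\<Sum>i<D. l i * (4 * (nsq {..<D} (\<lambda>a. U a i - app {..<D} (P m) (\<lambda>a. U a i) a)
         + (\<Sum>j<m. nsq {..<D} (app {..<D} (P j) (\<lambda>a. U a i))))))"
    proof (intro sum_mono mult_left_mono)
      fix i assume "i \<in> {..<D}"
      hence i: "i < D" by simp
      have "0 \<le> of_bool (m = 0) * nsq {..<D} (chain R M (\<lambda>a. U a i))" by (simp add: nsq_nonneg)
      thus "1 - Re (qform {..<D} (ent (\<Lambda> m)) (\<lambda>a. U a i)) \<le> 4 * (nsq {..<D} (\<lambda>a. U a i - app {..<D} (P m) (\<lambda>a. U a i) a)
         + (\<Sum>j<m. nsq {..<D} (app {..<D} (P j) (\<lambda>a. U a i))))"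
        using ub[OF i] unfolding q\<Lambda> by simp
      show "0 \<le> l i" using l i by simp
    qed
    also have "\<dots> = 4 * ((\<Sum>i<D. l i * nsq {..<D} (\<lambda>a. U a i - app {..<D} (P m) (\<lambda>a. U a i) a))
         + (\<Sum>i<D. \<Sum>j<m. l i * nsq {..<D} (app {..<D} (P j) (\<lambda>a. U a i))))"
      by (simp add: sum_distrib_left sum.distrib algebra_simps)
    also have "(\<Sum>i<D. \<Sum>j<m. l i * nsq {..<D} (app {..<D} (P j) (\<lambda>a. U a i))) = (\<Sum>j<m. trp {..<D} (P j) (ent A))"
    proof -
      have "(\<Sum>i<D. \<Sum>j<m. l i * nsq {..<D} (app {..<D} (P j) (\<lambda>a. U a i)))
          = (\<Sum>j<m. \<Sum>i<D. l i * nsq {..<D} (app {..<D} (P j) (\<lambda>a. U a i)))" by (rule sum.swap)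
      also have "\<dots> = (\<Sum>j<m. trp {..<D} (P j) (ent A))"
        by (intro sum.cong refl) (use m in \<open>simp add: trp_proj[OF s P]\<close>)
      finally show ?thesis .
    qed
    also have "(\<Sum>i<D. l i * nsq {..<D} (\<lambda>a. U a i - app {..<D} (P m) (\<lambda>a. U a i) a)) = 1 - trp {..<D} (P m) (ent A)"
      using trp_proj_compl[OF s P[OF m]] l(2) by simp
    finally show ?thesis .
  qed
  show ?thesis using psd sum1 err by blast
qed

section \<open>Projections onto typical eigenvectors\<close>

text \<open>Gram-Schmidt: each vector adds the rank one projection onto its component orthogonal to
  the range so far. This component stays on \<open>G\<close> and within one label, so the projection
  remains block diagonal and its weighted trace grows by at most \<open>thr\<close> at that label.
  The trace bound is thus a rank count.\<close>

lemma span_projection: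
  assumes S: "finite S" and L: "finite L"
    and v: "\<And>l k. l \<in> L \<Longrightarrow> k \<in> S \<Longrightarrow> v l k \<noteq> 0 \<Longrightarrow> k \<in> G \<and> lab k = c l"
    and t: "\<And>k. k \<in> S \<Longrightarrow> k \<in> G \<Longrightarrow> t k \<le> thr (lab k)"
    and thr: "\<And>l. l \<in> L \<Longrightarrow> 0 \<le> (thr (c l) :: real)"
  shows "\<exists>P. proj S P \<and> (\<forall>k\<in>S. \<forall>k'\<in>S. P k k' \<noteq> 0 \<longrightarrow> k \<in> G \<and> k' \<in> G \<and> lab k = lab k') \<and>
    (\<forall>l\<in>L. \<forall>k\<in>S. app S P (v l) k = v l k) \<and> (\<Sum>k\<in>S. t k * Re (P k k)) \<le> (\<Sum>l\<in>L. thr (c l))"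
  using L v thr
proof (induction L rule: finite_induct)
  case empty
  have "proj S (\<lambda>_ _. 0)" using S by (simp add: proj_def)
  thus ?case by (intro exI[of _ "\<lambda>_ _. 0"]) auto
next
  case (insert l L)
  obtain P where P: "proj S P"
    and sup: "\<And>k k'. k \<in> S \<Longrightarrow> k' \<in> S \<Longrightarrow> P k k' \<noteq> 0 \<Longrightarrow> k \<in> G \<and> k' \<in> G \<and> lab k = lab k'"
    and fixv: "\<And>l k. l \<in> L \<Longrightarrow> k \<in> S \<Longrightarrow> app S P (v l) k = v l k"
    and tr: "(\<Sum>k\<in>S. t k * Re (P k k)) \<le> (\<Sum>l\<in>L. thr (c l))"
  proof -
    have "\<exists>P. proj S P \<and> (\<forall>k\<in>S. \<forall>k'\<in>S. P k k' \<noteq> 0 \<longrightarrow> k \<in> G \<and> k' \<in> G \<and> lab k = lab k') \<and>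
      (\<forall>l\<in>L. \<forall>k\<in>S. app S P (v l) k = v l k) \<and> (\<Sum>k\<in>S. t k * Re (P k k)) \<le> (\<Sum>l\<in>L. thr (c l))"
      by (rule insert.IH) (use insert.prems in auto)
    thus ?thesis using that by blast
  qed
  have herm: "P a b = cnj (P b a)" if "a \<in> S" "b \<in> S" for a b using P that unfolding proj_def by blast
  have idem: "(\<Sum>c\<in>S. P a c * P c b) = P a b" if "a \<in> S" "b \<in> S" for a b
    using P that unfolding proj_def by blast
  define w where "w k = v l k - app S P (v l) k" for k
  define n where "n = nsq S w"
  have vl: "k \<in> G \<and> lab k = c l" if "k \<in> S" "v l k \<noteq> 0" for k using insert.prems(1)[of l k] that by auto
  have wsup: "k \<in> G \<and> lab k = c l" if k: "k \<in> S" and nz: "w k \<noteq> 0" for k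
  proof (cases "v l k = 0")
    case True
    hence "(\<Sum>k'\<in>S. P k k' * v l k') \<noteq> 0" using nz unfolding w_def app_def by simp
    then obtain k' where "k' \<in> S" "P k k' * v l k' \<noteq> 0" by (meson sum.not_neutral_contains_not_neutral)
    thus ?thesis using sup[OF k, of k'] vl[of k'] by auto
  qed (use vl k in blast)
  have Pw: "(\<Sum>b\<in>S. P a b * w b) = 0" if "a \<in> S" for a
    using proj_idem[OF P that, of "v l"] unfolding w_def app_def by (simp add: right_diff_distrib sum_subtractf)
  have wP: "(\<Sum>a\<in>S. cnj (w a) * P a b) = 0" if b: "b \<in> S" for b
  proof -
    have "(\<Sum>a\<in>S. cnj (w a) * P a b) = cnj (\<Sum>a\<in>S. P b a * w a)"
      unfolding cnj_sum
    proof (intro sum.cong refl)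
      fix a assume "a \<in> S"
      from herm[OF this b] show "cnj (w a) * P a b = cnj (P b a * w a)" by simp
    qed
    thus ?thesis using Pw[OF b] by simp
  qed
  have wapp: "ip S w (app S P u) = 0" for u
  proof -
    have "ip S w (app S P u) = (\<Sum>b\<in>S. (\<Sum>a\<in>S. cnj (w a) * P a b) * u b)"
      unfolding ip_def app_def sum_distrib_left sum_distrib_right mult.assoc by (rule sum.swap)
    thus ?thesis by (simp add: wP)
  qed
  have ww: "ip S w w = of_real n" unfolding n_def by (rule ip_self)
  have weq: "w = (\<lambda>k. v l k - app S P (v l) k)" by (simp add: w_def fun_eq_iff)
  have wv: "ip S w (v l) = of_real n"
  proof -
    have "ip S w w = ip S w (v l) - ip S w (app S P (v l))"
      unfolding ip_diff_right[symmetric] weq[symmetric] ..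
    thus ?thesis using ww wapp by simp
  qed
  have wv': "ip S w (v j) = 0" if "j \<in> L" for j
  proof -
    have "ip S w (v j) = ip S w (app S P (v j))" by (intro ip_cong refl) (simp add: fixv that)
    thus ?thesis using wapp by simp
  qed
  show ?case
  proof (cases "n = 0")
    \<comment> \<open>The vector already lies in the range; its threshold is nonnegative, so the
      bound only gets weaker.\<close>
    case True
    have "w k = 0" if "k \<in> S" for k
      using True S that unfolding n_def nsq_def by (simp add: sum_nonneg_eq_0_iff)
    hence "app S P (v l) k = v l k" if "k \<in> S" for k using that unfolding w_def by simp
    moreover have "(\<Sum>k\<in>S. t k * Re (P k k)) \<le> (\<Sum>l\<in>insert l L. thr (c l))"
      using tr insert.hyps insert.prems(2)[of l] by simp
    ultimately show ?thesis using P sup fixv by (intro exI[of _ P]) auto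
  next
    case False
    hence n: "0 < n" using nsq_nonneg[of S w] unfolding n_def by linarith
    define Q where "Q a b = P a b + w a * cnj (w b) / of_real n" for a b
    have appQ: "app S Q u a = app S P u a + w a * ip S w u / of_real n" for u a
      unfolding app_def Q_def ip_def
      by (simp add: distrib_left sum.distrib sum_distrib_left sum_divide_distrib mult_ac)
    have "proj S Q"
      unfolding proj_def
    proof (intro conjI ballI S)
      fix a b assume ab: "a \<in> S" "b \<in> S"
      show "Q a b = cnj (Q b a)" unfolding Q_def using herm[OF ab] by simp
      have "(\<Sum>c\<in>S. Q a c * Q c b) = app S Q (\<lambda>c. Q c b) a" unfolding app_def ..
      also have "\<dots> = (\<Sum>c\<in>S. P a c * Q c b) + w a * (\<Sum>c\<in>S. cnj (w c) * Q c b) / of_real n"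
        unfolding appQ by (simp add: app_def ip_def)
      also have "(\<Sum>c\<in>S. P a c * Q c b) = (\<Sum>c\<in>S. P a c * P c b) + (\<Sum>c\<in>S. P a c * w c) * (cnj (w b) / of_real n)"
        unfolding Q_def by (simp add: distrib_left sum.distrib sum_distrib_right sum_divide_distrib mult.assoc)
      also have "\<dots> = P a b" using idem[OF ab] Pw[OF ab(1)] by simp
      also have "(\<Sum>c\<in>S. cnj (w c) * Q c b) = (\<Sum>c\<in>S. cnj (w c) * P c b) + ip S w w * (cnj (w b) / of_real n)"
        unfolding Q_def ip_def by (simp add: distrib_left sum.distrib sum_distrib_right sum_divide_distrib mult.assoc)
      also have "\<dots> = cnj (w b)" using wP[OF ab(2)] ww n by simp
      finally show "(\<Sum>c\<in>S. Q a c * Q c b) = Q a b" unfolding Q_def .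
    qed
    moreover have "k \<in> G \<and> k' \<in> G \<and> lab k = lab k'" if k: "k \<in> S" "k' \<in> S" "Q k k' \<noteq> 0" for k k'
    proof (cases "P k k' = 0")
      case True
      hence "w k \<noteq> 0" "w k' \<noteq> 0" using k(3) unfolding Q_def by auto
      thus ?thesis using wsup k by auto
    qed (use sup k in blast)
    moreover have "app S Q (v j) k = v j k" if "j \<in> insert l L" "k \<in> S" for j k
    proof (cases "j = l")
      case True
      thus ?thesis unfolding appQ using wv n by (simp add: w_def)
    next
      case False
      hence "j \<in> L" using that by simp
      thus ?thesis unfolding appQ using wv' fixv that by simp
    qed
    moreover have "(\<Sum>k\<in>S. t k * Re (Q k k)) \<le> (\<Sum>l\<in>insert l L. thr (c l))"
    proof -
      have ReQ: "Re (Q k k) = Re (P k k) + (cmod (w k))\<^sup>2 / n" for k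
      proof -
        have "Q k k = P k k + of_real ((cmod (w k))\<^sup>2 / n)"
          unfolding Q_def of_real_divide cmod_sq by (simp add: mult.commute)
        thus ?thesis by simp
      qed
      have "(\<Sum>k\<in>S. t k * ((cmod (w k))\<^sup>2 / n)) \<le> (\<Sum>k\<in>S. thr (c l) * ((cmod (w k))\<^sup>2 / n))"
      proof (intro sum_mono)
        fix k assume k: "k \<in> S"
        show "t k * ((cmod (w k))\<^sup>2 / n) \<le> thr (c l) * ((cmod (w k))\<^sup>2 / n)"
        proof (cases "w k = 0")
          case False
          from wsup[OF k False] have "t k \<le> thr (c l)" using t[OF k] by auto
          thus ?thesis using n by (intro mult_right_mono) auto
        qed simp
      qed
      also have "\<dots> = thr (c l)"
        unfolding sum_distrib_left[symmetric] sum_divide_distrib[symmetric] using n by (simp add: n_def nsq_def)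
      finally show ?thesis using tr insert.hyps
        by (simp add: ReQ distrib_left sum.distrib)
    qed
    ultimately show ?thesis by (intro exI[of _ Q]) blast
  qed
qed

lemma diag_spectral:
  assumes "spectral S I A U l" "k \<in> S"
  shows "A k k = of_real (\<Sum>i\<in>I. l i * (cmod (U k i))\<^sup>2)"
  unfolding spectralD(4)[OF assms(1,2,2)] of_real_sum of_real_mult complex_norm_square by (simp only: mult.assoc)

text \<open>\<open>P\<close> projects onto the span of the eigenvectors in \<open>GJ\<close> with
  the coordinates outside \<open>GK\<close> erased. It fixes the cut vectors, so an eigenvector in
  \<open>GJ\<close> fails by no more than the mass erased from it; averaged with the weights
  \<open>\<mu>\<close>, this is at most the diagonal of \<open>A\<close> outside
  \<open>GK\<close>.\<close>

lemma projection_test: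
  assumes A: "spectral S I A U \<mu>" and \<mu>: "\<And>j. j \<in> I \<Longrightarrow> 0 \<le> \<mu> j" "sum \<mu> I = 1"
    and GJ: "GJ \<subseteq> I"
    and lab: "\<And>j k. j \<in> GJ \<Longrightarrow> k \<in> S \<Longrightarrow> U k j \<noteq> 0 \<Longrightarrow> lab k = c j"
    and t: "\<And>k. k \<in> S \<Longrightarrow> k \<in> GK \<Longrightarrow> t k \<le> thr (lab k)"
    and thr: "\<And>j. j \<in> GJ \<Longrightarrow> 0 \<le> (thr (c j) :: real)"
  shows "\<exists>P. proj S P \<and> (\<forall>k\<in>S. \<forall>k'\<in>S. P k k' \<noteq> 0 \<longrightarrow> lab k = lab k') \<and>
    1 - trp S P A \<le> (\<Sum>j\<in>I - GJ. \<mu> j) + (\<Sum>k\<in>S - GK. Re (A k k)) \<and>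
    (\<Sum>k\<in>S. t k * Re (P k k)) \<le> (\<Sum>j\<in>GJ. thr (c j))"
proof -
  note fin = spectralD(2,3)[OF A]
  define v where "v j k = of_bool (k \<in> GK) * U k j" for j k
  have "\<exists>P. proj S P \<and> (\<forall>k\<in>S. \<forall>k'\<in>S. P k k' \<noteq> 0 \<longrightarrow> k \<in> GK \<and> k' \<in> GK \<and> lab k = lab k') \<and>
    (\<forall>l\<in>GJ. \<forall>k\<in>S. app S P (v l) k = v l k) \<and> (\<Sum>k\<in>S. t k * Re (P k k)) \<le> (\<Sum>l\<in>GJ. thr (c l))"
  proof (rule span_projection[where thr = thr and c = c and lab = lab, OF fin(1) finite_subset[OF GJ fin(2)]])
    fix j k assume jk: "j \<in> GJ" "k \<in> S" "v j k \<noteq> 0"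
    hence "k \<in> GK" "U k j \<noteq> 0" unfolding v_def by auto
    thus "k \<in> GK \<and> lab k = c j" using lab jk by blast
  qed (fact t, fact thr)
  then obtain P where P: "proj S P" "\<forall>k\<in>S. \<forall>k'\<in>S. P k k' \<noteq> 0 \<longrightarrow> k \<in> GK \<and> k' \<in> GK \<and> lab k = lab k'"
    and fixv: "\<And>j k. j \<in> GJ \<Longrightarrow> k \<in> S \<Longrightarrow> app S P (v j) k = v j k"
    and tr: "(\<Sum>k\<in>S. t k * Re (P k k)) \<le> (\<Sum>l\<in>GJ. thr (c l))" by blast
  have good: "nsq S (\<lambda>a. U a j - app S P (\<lambda>a. U a j) a) \<le> (\<Sum>k\<in>S - GK. (cmod (U k j))\<^sup>2)" if j: "j \<in> GJ" for j
  proof -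
    \<comment> \<open>The cut vector is fixed by \<open>P\<close>, so the eigenvector and its erased
      part leave the same residue.\<close>
    let ?u = "\<lambda>a. U a j - v j a"
    have "nsq S (\<lambda>a. U a j - app S P (\<lambda>a. U a j) a) = nsq S (\<lambda>a. ?u a - app S P ?u a)"
      unfolding nsq_def
    proof (intro sum.cong refl)
      fix a assume a: "a \<in> S"
      have "app S P ?u a = app S P (\<lambda>a. U a j) a - app S P (v j) a"
        unfolding app_def by (simp add: right_diff_distrib sum_subtractf)
      thus "(cmod (U a j - app S P (\<lambda>a. U a j) a))\<^sup>2 = (cmod (?u a - app S P ?u a))\<^sup>2"
        using fixv[OF j a] by simp
    qed
    also have "\<dots> \<le> nsq S ?u"
      using orthop_nsq[OF proj_orthop[OF P(1)], of ?u] nsq_nonneg[of S "app S P ?u"] by linarith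
    also have "\<dots> = (\<Sum>k\<in>S. if k \<in> S - GK then (cmod (U k j))\<^sup>2 else 0)"
      unfolding nsq_def v_def by (intro sum.cong refl) auto
    also have "\<dots> = (\<Sum>k\<in>S - GK. (cmod (U k j))\<^sup>2)"
      by (rule sum.mono_neutral_cong_right) (use fin(1) in auto)
    finally show ?thesis .
  qed
  have bad: "nsq S (\<lambda>a. U a j - app S P (\<lambda>a. U a j) a) \<le> 1" if "j \<in> I" for j
    using orthop_nsq[OF proj_orthop[OF P(1)], of "\<lambda>a. U a j"] nsq_nonneg[of S "app S P (\<lambda>a. U a j)"]
      onb_col_norm[OF spectralD(1)[OF A] that] by linarith
  have "1 - trp S P A = (\<Sum>j\<in>I. \<mu> j * nsq S (\<lambda>a. U a j - app S P (\<lambda>a. U a j) a))"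
    by (rule trp_proj_compl[OF A P(1) \<mu>(2)])
  also have "\<dots> = (\<Sum>j\<in>I - GJ. \<mu> j * nsq S (\<lambda>a. U a j - app S P (\<lambda>a. U a j) a))
      + (\<Sum>j\<in>GJ. \<mu> j * nsq S (\<lambda>a. U a j - app S P (\<lambda>a. U a j) a))"
    by (rule sum.subset_diff[OF GJ fin(2)])
  also have "\<dots> \<le> (\<Sum>j\<in>I - GJ. \<mu> j) + (\<Sum>j\<in>GJ. \<mu> j * (\<Sum>k\<in>S - GK. (cmod (U k j))\<^sup>2))"
  proof (intro add_mono sum_mono)
    fix j assume "j \<in> I - GJ"
    thus "\<mu> j * nsq S (\<lambda>a. U a j - app S P (\<lambda>a. U a j) a) \<le> \<mu> j"
      using bad \<mu>(1) by (intro mult_left_le) auto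
  next
    fix j assume "j \<in> GJ"
    thus "\<mu> j * nsq S (\<lambda>a. U a j - app S P (\<lambda>a. U a j) a) \<le> \<mu> j * (\<Sum>k\<in>S - GK. (cmod (U k j))\<^sup>2)"
      using \<mu>(1) GJ by (intro mult_left_mono good) auto
  qed
  also have "(\<Sum>j\<in>GJ. \<mu> j * (\<Sum>k\<in>S - GK. (cmod (U k j))\<^sup>2)) \<le> (\<Sum>j\<in>I. \<mu> j * (\<Sum>k\<in>S - GK. (cmod (U k j))\<^sup>2))"
    using \<mu>(1) by (intro sum_mono2 fin GJ mult_nonneg_nonneg sum_nonneg) auto
  also have "\<dots> = (\<Sum>k\<in>S - GK. \<Sum>j\<in>I. \<mu> j * (cmod (U k j))\<^sup>2)"
    unfolding sum_distrib_left by (rule sum.swap)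
  also have "\<dots> = (\<Sum>k\<in>S - GK. Re (A k k))"
    by (intro sum.cong refl) (simp add: diag_spectral[OF A])
  finally have err: "1 - trp S P A \<le> (\<Sum>j\<in>I - GJ. \<mu> j) + (\<Sum>k\<in>S - GK. Re (A k k))" by simp
  show ?thesis using P tr err by (intro exI[of _ P]) blast
qed

text \<open>A factorisation of \<open>A\<close> turns the trace into a sum of squares, so a
  subfamily of the factors gives a smaller trace.\<close>

lemma trp_gram:
  assumes P: "proj S P" and R: "finite R"
    and A: "\<And>a b. a \<in> S \<Longrightarrow> b \<in> S \<Longrightarrow> A a b = (\<Sum>r\<in>R. f r a * cnj (f r b))"
  shows "trp S P A = (\<Sum>r\<in>R. nsq S (app S P (f r)))"
proof -
  have "(\<Sum>a\<in>S. \<Sum>b\<in>S. P a b * A b a) = (\<Sum>a\<in>S. \<Sum>b\<in>S. \<Sum>r\<in>R. cnj (f r a) * P a b * f r b)"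
    by (intro sum.cong refl) (simp add: A sum_distrib_left mult_ac)
  also have "\<dots> = (\<Sum>a\<in>S. \<Sum>r\<in>R. \<Sum>b\<in>S. cnj (f r a) * P a b * f r b)"
    by (intro sum.cong refl sum.swap)
  also have "\<dots> = (\<Sum>r\<in>R. qform S P (f r))"
    unfolding qform_def by (rule sum.swap)
  finally show ?thesis unfolding trp_def by (simp add: proj_qform[OF P])
qed

text \<open>Both tensor powers expand over products of eigenvectors of \<open>A i\<close> and of \<open>C i\<close>; the expansion
  of the smaller operator is a subfamily of that of the larger one.\<close>
lemma trp_tensor_mono:
  fixes K :: "'x \<Rightarrow> 'k set"
  assumes X: "finite X" and P: "proj (PiE X S) P"
    and A: "\<And>i. i \<in> X \<Longrightarrow> spectral (S i) (I i) (A i) (U i) (l i)" "\<And>i j. i \<in> X \<Longrightarrow> j \<in> I i \<Longrightarrow> 0 \<le> l i j"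
    and C: "\<And>i. i \<in> X \<Longrightarrow> spectral (S i) (K i) (C i) (V i) (m i)" "\<And>i j. i \<in> X \<Longrightarrow> j \<in> K i \<Longrightarrow> 0 \<le> m i j"
  shows "trp (PiE X S) P (\<lambda>a b. \<Prod>i\<in>X. A i (a i) (b i)) \<le> trp (PiE X S) P (\<lambda>a b. \<Prod>i\<in>X. A i (a i) (b i) + C i (a i) (b i))"
proof -
  define f where "f i r a = (case r of Inl j \<Rightarrow> of_real (sqrt (l i j)) * U i a j | Inr j \<Rightarrow> of_real (sqrt (m i j)) * V i a j)" for i r a
  \<comment> \<open>The empty right summand gives \<open>RA\<close> the type of \<open>RB\<close>,
    so that the index set of the first expansion is a subset of that of the second.\<close>
  define RA where "RA i = I i <+> ({} :: 'k set)" for i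
  define RB where "RB i = I i <+> K i" for i
  have fin: "finite (RA i)" "finite (RB i)" if "i \<in> X" for i
    unfolding RA_def RB_def using spectralD(3)[OF A(1)[OF that]] spectralD(3)[OF C(1)[OF that]] by auto
  have sq: "complex_of_real (sqrt z) * x * cnj (of_real (sqrt z) * y) = of_real z * x * cnj y" if "0 \<le> z" for z x y
  proof -
    have "complex_of_real (sqrt z) * of_real (sqrt z) = of_real z"
      unfolding of_real_mult[symmetric] using that by simp
    hence "complex_of_real (sqrt z) * of_real (sqrt z) * (x * cnj y) = of_real z * (x * cnj y)" by simp
    thus ?thesis by (simp add: mult_ac)
  qed
  have Ai: "A i a b = (\<Sum>r\<in>RA i. f i r a * cnj (f i r b))" if i: "i \<in> X" and "a \<in> S i" "b \<in> S i" for i a b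
  proof -
    have "(\<Sum>r\<in>RA i. f i r a * cnj (f i r b)) = (\<Sum>j\<in>I i. f i (Inl j) a * cnj (f i (Inl j) b))"
      unfolding RA_def using spectralD(3)[OF A(1)[OF i]] by (simp add: sum.Plus)
    also have "\<dots> = A i a b"
      unfolding spectralD(4)[OF A(1)[OF i] that(2,3)] by (intro sum.cong refl) (simp add: f_def sq A(2) i del: complex_cnj_mult)
    finally show ?thesis ..
  qed
  have Bi: "A i a b + C i a b = (\<Sum>r\<in>RB i. f i r a * cnj (f i r b))" if i: "i \<in> X" and "a \<in> S i" "b \<in> S i" for i a b
  proof -
    have "(\<Sum>r\<in>RB i. f i r a * cnj (f i r b)) = (\<Sum>j\<in>I i. f i (Inl j) a * cnj (f i (Inl j) b)) + (\<Sum>j\<in>K i. f i (Inr j) a * cnj (f i (Inr j) b))"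
      unfolding RB_def using spectralD(3)[OF A(1)[OF i]] spectralD(3)[OF C(1)[OF i]] by (simp add: sum.Plus)
    also have "\<dots> = A i a b + C i a b"
      unfolding spectralD(4)[OF A(1)[OF i] that(2,3)] spectralD(4)[OF C(1)[OF i] that(2,3)]
      by (intro arg_cong2[where f = "(+)"] sum.cong refl) (simp_all add: f_def sq A(2) C(2) i del: complex_cnj_mult)
    finally show ?thesis ..
  qed
  define g where "g r a = (\<Prod>i\<in>X. f i (r i) (a i))" for r a
  have expand: "(\<Prod>i\<in>X. B i (a i) (b i)) = (\<Sum>r\<in>PiE X R. g r a * cnj (g r b))"
    if "\<And>i a b. i \<in> X \<Longrightarrow> a \<in> S i \<Longrightarrow> b \<in> S i \<Longrightarrow> B i a b = (\<Sum>r\<in>R i. f i r a * cnj (f i r b))"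
      "\<And>i. i \<in> X \<Longrightarrow> finite (R i)" "a \<in> PiE X S" "b \<in> PiE X S" for B R a b
  proof -
    have "(\<Prod>i\<in>X. B i (a i) (b i)) = (\<Prod>i\<in>X. \<Sum>r\<in>R i. f i r (a i) * cnj (f i r (b i)))"
      by (intro prod.cong refl that(1)) (use that(3,4) in \<open>auto simp: PiE_iff\<close>)
    also have "\<dots> = (\<Sum>r\<in>PiE X R. \<Prod>i\<in>X. f i (r i) (a i) * cnj (f i (r i) (b i)))"
      by (rule prod_sum_PiE[OF X that(2)])
    finally show ?thesis unfolding g_def by (simp add: prod.distrib)
  qed
  have "trp (PiE X S) P (\<lambda>a b. \<Prod>i\<in>X. A i (a i) (b i)) = (\<Sum>r\<in>PiE X RA. nsq (PiE X S) (app (PiE X S) P (g r)))"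
    by (rule trp_gram[OF P finite_PiE[OF X fin(1)] expand[OF Ai fin(1)]])
  also have "\<dots> \<le> (\<Sum>r\<in>PiE X RB. nsq (PiE X S) (app (PiE X S) P (g r)))"
  proof (rule sum_mono2)
    show "PiE X RA \<subseteq> PiE X RB" by (intro PiE_mono) (auto simp: RA_def RB_def)
  qed (auto intro: finite_PiE X fin nsq_nonneg)
  also have "\<dots> = trp (PiE X S) P (\<lambda>a b. \<Prod>i\<in>X. A i (a i) (b i) + C i (a i) (b i))"
    by (rule trp_gram[OF P finite_PiE[OF X fin(2)] expand[OF Bi fin(2)], symmetric])
  finally show ?thesis .
qed

text \<open>The label of a coordinate is its restriction to the innocent positions. Innocent
  eigenvectors are unit vectors here, so every eigenvector of the codeword state lives on one label
  and the projection is block diagonal. For the confusion bound \<open>sa\<close> is kept at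
  innocent positions and replaced elsewhere by the larger diagonal operator
  \<open>(1 + \<delta>) * t\<close>; the hypothesis on \<open>lc\<close> says that it is larger.
  \<open>e1\<close> bounds inverse eigenvalues, hence the rank, and \<open>e2\<close> the dominating
  diagonal.\<close>

lemma tensor_test:
  fixes x :: "nat \<Rightarrow> nat" and n d :: nat and t q :: "nat \<Rightarrow> real"
  defines "J \<equiv> PiE {..<n} (\<lambda>_. {..<d})"
  assumes s: "\<And>i. i < n \<Longrightarrow> spectral {..<d} {..<d} (s (x i)) (W (x i)) (\<mu> (x i))"
    and \<mu>: "\<And>i j. i < n \<Longrightarrow> j < d \<Longrightarrow> 0 \<le> \<mu> (x i) j" "\<And>i. i < n \<Longrightarrow> (\<Sum>j<d. \<mu> (x i) j) = 1"
    and W0: "\<And>k j. k < d \<Longrightarrow> j < d \<Longrightarrow> W 0 k j = of_bool (k = j)"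
    and sa: "spectral {..<d} {..<d} sa Ua la" "\<And>j. j < d \<Longrightarrow> 0 \<le> la j" "(\<Sum>j<d. la j) = 1"
    and C: "spectral {..<d} {..<d} (\<lambda>k k'. of_bool (k = k') * of_real ((1 + \<delta>) * t k) - sa k k') Uc lc"
      "\<And>j. j < d \<Longrightarrow> 0 \<le> lc j"
    and t: "\<And>k. k < d \<Longrightarrow> 0 \<le> t k" and \<delta>: "0 \<le> \<delta>"
    and e: "0 \<le> e1" "0 \<le> e2"
  shows "\<exists>P. proj J P \<and>
     1 - trp J P (\<lambda>a b. \<Prod>i<n. s (x i) (a i) (b i))
       \<le> (\<Sum>j\<in>{j\<in>J. (\<Prod>i<n. if x i = 0 then 1 else 1 / \<mu> (x i) (j i)) > e1}. \<Prod>i<n. \<mu> (x i) (j i))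
         + (\<Sum>k\<in>{k\<in>J. (\<Prod>i<n. if x i = 0 then 1 else (1 + \<delta>) * t (k i)) > e2}. \<Prod>i<n. Re (s (x i) (k i) (k i))) \<and>
     trp J P (\<lambda>a b. \<Prod>i<n. sa (a i) (b i)) \<le> e1 * e2"
proof -
  define q where "q k = Re (sa k k)" for k
  \<comment> \<open>Positivity is demanded separately because a division by zero yields 0 and would
    pass the threshold. The eigenvectors excluded in this way have weight zero.\<close>
  define GJ where "GJ = {j\<in>J. (\<Prod>i<n. if x i = 0 then 1 else 1 / \<mu> (x i) (j i)) \<le> e1 \<and> (\<forall>i<n. x i \<noteq> 0 \<longrightarrow> 0 < \<mu> (x i) (j i))}"
  define GK where "GK = {k\<in>J. (\<Prod>i<n. if x i = 0 then 1 else (1 + \<delta>) * t (k i)) \<le> e2}"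
  define lab where "lab k = (\<lambda>i. if i < n \<and> x i = 0 then k i else 0)" for k :: "nat \<Rightarrow> nat"
  define \<omega> where "\<omega> i k k' = sa k k' + (if x i = 0 then 0 else of_bool (k = k') * of_real ((1 + \<delta>) * t k) - sa k k')" for i k k'
  define tt where "tt k = (\<Prod>i<n. if x i = 0 then q (k i) else (1 + \<delta>) * t (k i))" for k
  define thr where "thr c = e2 * (\<Prod>i<n. if x i = 0 then q (c i) else 1)" for c
  have finJ: "finite J" unfolding J_def by (intro finite_PiE) auto
  have Jd: "j i < d" if "j \<in> J" "i < n" for i j using that unfolding J_def by (auto simp: PiE_iff)
  have q0: "0 \<le> q k" and qs: "sa k k = of_real (q k)" if "k < d" for k
  proof -
    have "sa k k = of_real (\<Sum>i<d. la i * (cmod (Ua k i))\<^sup>2)" using diag_spectral[OF sa(1)] that by simp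
    thus "0 \<le> q k" "sa k k = of_real (q k)" unfolding q_def using sa(2) by (auto intro!: sum_nonneg)
  qed
  have qsum: "(\<Sum>k<d. q k) = 1"
    using arg_cong[OF trace_spectral[OF sa(1)], of Re] sa(3) unfolding q_def by simp
  have \<omega>diag: "\<omega> i k k = of_real (if x i = 0 then q k else (1 + \<delta>) * t k)" if "k < d" for i k
    unfolding \<omega>_def using qs[OF that] by simp
  have sJ: "spectral J J (\<lambda>a b. \<Prod>i<n. s (x i) (a i) (b i)) (\<lambda>a j. \<Prod>i<n. W (x i) (a i) (j i)) (\<lambda>j. \<Prod>i<n. \<mu> (x i) (j i))"
    unfolding J_def by (rule spectral_PiE) (auto intro: s)
  have musum: "(\<Sum>j\<in>J. \<Prod>i<n. \<mu> (x i) (j i)) = 1"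
    unfolding J_def by (subst prod_sum_PiE[symmetric]) (auto simp: \<mu>)
  have "\<exists>P. proj J P \<and> (\<forall>k\<in>J. \<forall>k'\<in>J. P k k' \<noteq> 0 \<longrightarrow> lab k = lab k') \<and>
    1 - trp J P (\<lambda>a b. \<Prod>i<n. s (x i) (a i) (b i)) \<le> (\<Sum>j\<in>J - GJ. \<Prod>i<n. \<mu> (x i) (j i))
       + (\<Sum>k\<in>J - GK. Re (\<Prod>i<n. s (x i) (k i) (k i))) \<and>
    (\<Sum>k\<in>J. tt k * Re (P k k)) \<le> (\<Sum>j\<in>GJ. thr (lab j))"
  proof (rule projection_test[OF sJ])
    fix j assume "j \<in> J"
    thus "0 \<le> (\<Prod>i<n. \<mu> (x i) (j i))" using Jd by (intro prod_nonneg) (auto intro: \<mu>)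
  next
    fix j k assume jk: "j \<in> GJ" "k \<in> J" and nz: "(\<Prod>i<n. W (x i) (k i) (j i)) \<noteq> 0"
    have "k i = j i" if "i < n" "x i = 0" for i
    proof -
      from nz have "W (x i) (k i) (j i) \<noteq> 0" using that(1) by auto
      moreover have "k i < d" "j i < d" using Jd that(1) jk(2) jk(1) unfolding GJ_def by auto
      ultimately show ?thesis using W0[of "k i" "j i"] that(2) by (auto simp: of_bool_def split: if_splits)
    qed
    thus "lab k = lab j" unfolding lab_def by auto
  next
    fix k assume k: "k \<in> J" "k \<in> GK"
    have "tt k = (\<Prod>i<n. if x i = 0 then 1 else (1 + \<delta>) * t (k i)) * (\<Prod>i<n. if x i = 0 then q (k i) else 1)"
      unfolding tt_def prod.distrib[symmetric] by (intro prod.cong) auto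
    also have "\<dots> \<le> e2 * (\<Prod>i<n. if x i = 0 then q (k i) else 1)"
      using k Jd[OF k(1)] unfolding GK_def by (intro mult_right_mono prod_nonneg) (auto intro: q0)
    also have "(\<Prod>i<n. if x i = 0 then q (k i) else 1) = (\<Prod>i<n. if x i = 0 then q (lab k i) else 1)"
      by (intro prod.cong) (auto simp: lab_def)
    finally show "tt k \<le> thr (lab k)" unfolding thr_def .
  next
    fix j assume "j \<in> GJ"
    hence "j \<in> J" unfolding GJ_def by simp
    thus "0 \<le> thr (lab j)" unfolding thr_def using e(2) Jd
      by (intro mult_nonneg_nonneg prod_nonneg) (auto simp: lab_def intro: q0)
  qed (use musum in \<open>auto simp: GJ_def\<close>)
  then obtain P where P: "proj J P" and sup: "\<And>k k'. k \<in> J \<Longrightarrow> k' \<in> J \<Longrightarrow> P k k' \<noteq> 0 \<Longrightarrow> lab k = lab k'"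
    and err: "1 - trp J P (\<lambda>a b. \<Prod>i<n. s (x i) (a i) (b i)) \<le> (\<Sum>j\<in>J - GJ. \<Prod>i<n. \<mu> (x i) (j i))
       + (\<Sum>k\<in>J - GK. Re (\<Prod>i<n. s (x i) (k i) (k i)))"
    and tr: "(\<Sum>k\<in>J. tt k * Re (P k k)) \<le> (\<Sum>j\<in>GJ. thr (lab j))" by blast
  have e1: "(\<Sum>j\<in>J - GJ. \<Prod>i<n. \<mu> (x i) (j i))
    \<le> (\<Sum>j\<in>{j\<in>J. (\<Prod>i<n. if x i = 0 then 1 else 1 / \<mu> (x i) (j i)) > e1}. \<Prod>i<n. \<mu> (x i) (j i))"
  proof -
    have "(\<Sum>j\<in>J - GJ. \<Prod>i<n. \<mu> (x i) (j i))
      = (\<Sum>j\<in>{j\<in>J. (\<Prod>i<n. if x i = 0 then 1 else 1 / \<mu> (x i) (j i)) > e1}. \<Prod>i<n. \<mu> (x i) (j i))"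
    proof (rule sum.mono_neutral_right)
      show "\<forall>j\<in>J - GJ - {j\<in>J. (\<Prod>i<n. if x i = 0 then 1 else 1 / \<mu> (x i) (j i)) > e1}. (\<Prod>i<n. \<mu> (x i) (j i)) = 0"
      proof
        fix j assume j: "j \<in> J - GJ - {j\<in>J. (\<Prod>i<n. if x i = 0 then 1 else 1 / \<mu> (x i) (j i)) > e1}"
        then obtain i where i: "i < n" "\<not> 0 < \<mu> (x i) (j i)" unfolding GJ_def by (auto simp: not_less)
        have "0 \<le> \<mu> (x i) (j i)" using i(1) j Jd \<mu>(1) by blast
        thus "(\<Prod>i<n. \<mu> (x i) (j i)) = 0" using i by (intro prod_zero) auto
      qed
    qed (use finJ in \<open>auto simp: GJ_def\<close>)
    thus ?thesis by simp
  qed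
  have Rs: "Re (\<Prod>i<n. s (x i) (k i) (k i)) = (\<Prod>i<n. Re (s (x i) (k i) (k i)))" if "k \<in> J" for k
  proof -
    have "s (x i) (k i) (k i) = of_real (Re (s (x i) (k i) (k i)))" if "i < n" for i
      using diag_spectral[OF s[OF that], of "k i"] Jd[OF \<open>k \<in> J\<close> that] by simp
    hence "(\<Prod>i<n. s (x i) (k i) (k i)) = of_real (\<Prod>i<n. Re (s (x i) (k i) (k i)))"
      unfolding of_real_prod by (intro prod.cong) auto
    thus ?thesis by (simp only: Re_complex_of_real)
  qed
  have e2: "(\<Sum>k\<in>J - GK. Re (\<Prod>i<n. s (x i) (k i) (k i)))
     = (\<Sum>k\<in>{k\<in>J. (\<Prod>i<n. if x i = 0 then 1 else (1 + \<delta>) * t (k i)) > e2}. \<Prod>i<n. Re (s (x i) (k i) (k i)))"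
    by (intro sum.cong) (auto simp: GK_def Rs)
  have "trp J P (\<lambda>a b. \<Prod>i<n. sa (a i) (b i)) \<le> trp J P (\<lambda>a b. \<Prod>i<n. \<omega> i (a i) (b i))"
    unfolding J_def \<omega>_def
  proof (rule trp_tensor_mono)
    show "proj (PiE {..<n} (\<lambda>_. {..<d})) P" using P unfolding J_def .
    show "spectral {..<d} {..<d} sa Ua la" for i by (rule sa)
    show "spectral {..<d} {..<d} (\<lambda>k k'. if x i = 0 then 0 else of_bool (k = k') * of_real ((1 + \<delta>) * t k) - sa k k')
        Uc (\<lambda>j. if x i = 0 then 0 else lc j)" for i
      using C(1) unfolding spectral_def by auto
  qed (auto intro: sa C)
  \<comment> \<open>Distinct coordinates with the same label differ at a non-innocent position,
    where \<open>\<omega>\<close> is diagonal; so all off-diagonal terms vanish.\<close>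
  also have "trp J P (\<lambda>a b. \<Prod>i<n. \<omega> i (a i) (b i)) = (\<Sum>k\<in>J. tt k * Re (P k k))"
  proof -
    have "(\<Sum>a\<in>J. \<Sum>b\<in>J. P a b * (\<Prod>i<n. \<omega> i (b i) (a i))) = (\<Sum>a\<in>J. \<Sum>b\<in>J. of_bool (a = b) * (P a b * of_real (tt b)))"
    proof (intro sum.cong refl)
      fix a b assume ab: "a \<in> J" "b \<in> J"
      show "P a b * (\<Prod>i<n. \<omega> i (b i) (a i)) = of_bool (a = b) * (P a b * of_real (tt b))"
      proof (cases "a = b")
        case True
        have "(\<Prod>i<n. \<omega> i (b i) (b i)) = of_real (tt b)"
          unfolding tt_def of_real_prod by (intro prod.cong refl \<omega>diag) (use ab Jd in auto)
        thus ?thesis using True by simp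
      next
        case False
        show ?thesis
        proof (cases "P a b = 0")
          case nz: False
          hence l: "lab a = lab b" using sup ab by blast
          obtain i where i: "i < n" "a i \<noteq> b i"
            using False PiE_ext[of a "{..<n}" "\<lambda>_. {..<d}" b] ab unfolding J_def by auto
          have "x i \<noteq> 0"
          proof
            assume "x i = 0"
            thus False using fun_cong[OF l, of i] i unfolding lab_def by simp
          qed
          hence "\<omega> i (b i) (a i) = 0" using i unfolding \<omega>_def by simp
          thus ?thesis using i(1) False by (simp add: prod_zero_iff)  blast
        qed simp
      qed
    qed
    also have "\<dots> = (\<Sum>a\<in>J. P a a * of_real (tt a))"
      by (intro sum.cong refl sum_of_bool_eq(2) finJ)
    finally show ?thesis unfolding trp_def by (simp add: mult.commute)
  qed
  also note tr
  also have "(\<Sum>j\<in>GJ. thr (lab j)) \<le> (\<Sum>j\<in>GJ. e1 * e2 * (\<Prod>i<n. if x i = 0 then q (j i) else \<mu> (x i) (j i)))"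
  proof (intro sum_mono)
    fix j assume j: "j \<in> GJ"
    hence jJ: "j \<in> J" and jp: "\<And>i. i < n \<Longrightarrow> x i \<noteq> 0 \<Longrightarrow> 0 < \<mu> (x i) (j i)"
      and je: "(\<Prod>i<n. if x i = 0 then 1 else 1 / \<mu> (x i) (j i)) \<le> e1" unfolding GJ_def by auto
    \<comment> \<open>Rank is traded for weight: a vector of \<open>GJ\<close> counts 1, and 1 is at
      most \<open>e1\<close> times the product of its eigenvalues at non-innocent positions.\<close>
    have "1 = (\<Prod>i<n. if x i = 0 then 1 else 1 / \<mu> (x i) (j i)) * (\<Prod>i<n. if x i = 0 then 1 else \<mu> (x i) (j i))"
      unfolding prod.distrib[symmetric] by (intro prod.neutral[symmetric]) (use jp in force)
    also have "\<dots> \<le> e1 * (\<Prod>i<n. if x i = 0 then 1 else \<mu> (x i) (j i))"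
      using jp by (intro mult_right_mono je prod_nonneg) (auto intro: less_imp_le)
    finally have one: "1 \<le> e1 * (\<Prod>i<n. if x i = 0 then 1 else \<mu> (x i) (j i))" .
    have "0 \<le> e2 * (\<Prod>i<n. if x i = 0 then q (j i) else 1)"
      using e(2) Jd[OF jJ] by (intro mult_nonneg_nonneg prod_nonneg) (auto intro: q0)
    from mult_left_mono[OF one this]
    have "e2 * (\<Prod>i<n. if x i = 0 then q (j i) else 1)
       \<le> e1 * e2 * ((\<Prod>i<n. if x i = 0 then q (j i) else 1) * (\<Prod>i<n. if x i = 0 then 1 else \<mu> (x i) (j i)))"
      by (simp add: mult_ac)
    also have "(\<Prod>i<n. if x i = 0 then q (j i) else 1) * (\<Prod>i<n. if x i = 0 then 1 else \<mu> (x i) (j i))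
        = (\<Prod>i<n. if x i = 0 then q (j i) else \<mu> (x i) (j i))"
      unfolding prod.distrib[symmetric] by (intro prod.cong) auto
    also have "(\<Prod>i<n. if x i = 0 then q (j i) else 1) = (\<Prod>i<n. if x i = 0 then q (lab j i) else 1)"
      by (intro prod.cong) (auto simp: lab_def)
    finally show "thr (lab j) \<le> e1 * e2 * (\<Prod>i<n. if x i = 0 then q (j i) else \<mu> (x i) (j i))"
      unfolding thr_def .
  qed
  also have "\<dots> \<le> (\<Sum>j\<in>J. e1 * e2 * (\<Prod>i<n. if x i = 0 then q (j i) else \<mu> (x i) (j i)))"
    using e Jd by (intro sum_mono2 finJ mult_nonneg_nonneg prod_nonneg) (auto simp: GJ_def intro: q0 \<mu>)
  also have "\<dots> = e1 * e2 * (\<Prod>i<n. \<Sum>j<d. if x i = 0 then q j else \<mu> (x i) j)"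
    unfolding sum_distrib_left[symmetric] J_def
    by (subst prod_sum_PiE[of "{..<n}" "\<lambda>_. {..<d}" "\<lambda>i j. if x i = 0 then q j else \<mu> (x i) j"]) auto
  \<comment> \<open>\<open>q\<close> and every \<open>\<mu> (x i)\<close> are probability vectors,
    so each position, innocent or not, contributes the factor 1.\<close>
  also have "(\<Prod>i<n. \<Sum>j<d. if x i = 0 then q j else \<mu> (x i) j) = 1"
  proof (intro prod.neutral ballI)
    fix i assume "i \<in> {..<n}"
    thus "(\<Sum>j<d. if x i = 0 then q j else \<mu> (x i) j) = 1" by (cases "x i = 0") (simp_all add: qsum \<mu>)
  qed
  finally have typeII: "trp J P (\<lambda>a b. \<Prod>i<n. sa (a i) (b i)) \<le> e1 * e2" by simp
  have typeI: "1 - trp J P (\<lambda>a b. \<Prod>i<n. s (x i) (a i) (b i))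
       \<le> (\<Sum>j\<in>{j\<in>J. (\<Prod>i<n. if x i = 0 then 1 else 1 / \<mu> (x i) (j i)) > e1}. \<Prod>i<n. \<mu> (x i) (j i))
         + (\<Sum>k\<in>{k\<in>J. (\<Prod>i<n. if x i = 0 then 1 else (1 + \<delta>) * t (k i)) > e2}. \<Prod>i<n. Re (s (x i) (k i) (k i)))"
    using err e1 unfolding e2 by linarith
  show ?thesis using P typeI typeII by blast
qed

section \<open>Random codes\<close>

text \<open>Expectation over codebooks whose entries are independent with common law
  \<open>w\<close>. All sets are finite, so a weighted sum takes the place of measure
  theory.\<close>

definition pexp :: "'l set \<Rightarrow> 'c set \<Rightarrow> ('c \<Rightarrow> real) \<Rightarrow> (('l \<Rightarrow> 'c) \<Rightarrow> real) \<Rightarrow> real" where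
  "pexp L C w F = (\<Sum>f\<in>PiE L (\<lambda>_. C). (\<Prod>l\<in>L. w (f l)) * F f)"

lemma pexp_add: "pexp L C w (\<lambda>f. F f + G f) = pexp L C w F + pexp L C w G"
  unfolding pexp_def by (simp add: distrib_left sum.distrib)

lemma pexp_cmult: "pexp L C w (\<lambda>f. c * F f) = c * pexp L C w F"
  unfolding pexp_def by (simp add: sum_distrib_left mult_ac)

lemma pexp_sum: "pexp L C w (\<lambda>f. \<Sum>a\<in>A. F a f) = (\<Sum>a\<in>A. pexp L C w (F a))"
  unfolding pexp_def sum_distrib_left by (rule sum.swap)

context
  fixes L :: "'l set" and C :: "'c set" and w :: "'c \<Rightarrow> real"
  assumes finL: "finite L" and finC: "finite C"
    and w0: "\<And>x. x \<in> C \<Longrightarrow> 0 \<le> w x" and w1: "sum w C = 1"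
begin

lemma pexp_prod: "pexp L C w (\<lambda>f. \<Prod>l\<in>L. h l (f l)) = (\<Prod>l\<in>L. \<Sum>x\<in>C. w x * h l x)"
  unfolding pexp_def by (subst prod_sum_PiE[OF finL]) (auto simp: finC prod.distrib)

lemma pexp_weight_nonneg: "f \<in> PiE L (\<lambda>_. C) \<Longrightarrow> 0 \<le> (\<Prod>l\<in>L. w (f l))"
  by (intro prod_nonneg) (auto simp: PiE_iff intro: w0)

lemma pexp_const: "pexp L C w (\<lambda>_. c) = c"
  using pexp_prod[of "\<lambda>_ _. 1"] pexp_cmult[of L C w c "\<lambda>_. 1"] by (simp add: w1)

lemma pexp_witness:
  assumes "pexp L C w F \<le> c"
  shows "\<exists>f\<in>PiE L (\<lambda>_. C). F f \<le> c"
proof (rule ccontr)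
  assume "\<not> ?thesis"
  hence gt: "c < F f" if "f \<in> PiE L (\<lambda>_. C)" for f using that by auto
  have one: "(\<Sum>f\<in>PiE L (\<lambda>_. C). \<Prod>l\<in>L. w (f l)) = 1"
    using pexp_const[of 1] unfolding pexp_def by simp
  have "\<exists>f\<in>PiE L (\<lambda>_. C). (\<Prod>l\<in>L. w (f l)) \<noteq> 0"
  proof (rule ccontr)
    assume "\<not> ?thesis"
    hence "(\<Sum>f\<in>PiE L (\<lambda>_. C). \<Prod>l\<in>L. w (f l)) = 0" by (intro sum.neutral) auto
    with one show False by simp
  qed
  then obtain f where f: "f \<in> PiE L (\<lambda>_. C)" "(\<Prod>l\<in>L. w (f l)) \<noteq> 0" by blast
  have "(\<Sum>f\<in>PiE L (\<lambda>_. C). (\<Prod>l\<in>L. w (f l)) * c) < pexp L C w F"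
    unfolding pexp_def
  proof (rule sum_strict_mono_ex1)
    show "finite (PiE L (\<lambda>_. C))" by (intro finite_PiE finL finC)
    show "\<forall>f\<in>PiE L (\<lambda>_. C). (\<Prod>l\<in>L. w (f l)) * c \<le> (\<Prod>l\<in>L. w (f l)) * F f"
      by (intro ballI mult_left_mono less_imp_le[OF gt] pexp_weight_nonneg)
    show "\<exists>f\<in>PiE L (\<lambda>_. C). (\<Prod>l\<in>L. w (f l)) * c < (\<Prod>l\<in>L. w (f l)) * F f"
    proof (rule bexI[OF mult_strict_left_mono f(1)])
      show "0 < (\<Prod>l\<in>L. w (f l))" using f(2) pexp_weight_nonneg[OF f(1)] by linarith
    qed (rule gt[OF f(1)])
  qed
  thus False using assms unfolding sum_distrib_right[symmetric] one by simp
qed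

lemma pexp_marginal:
  assumes "a \<in> L"
  shows "pexp L C w (\<lambda>f. h (f a)) = (\<Sum>x\<in>C. w x * h x)"
proof -
  have "pexp L C w (\<lambda>f. h (f a)) = pexp L C w (\<lambda>f. \<Prod>l\<in>L. if l = a then h (f l) else 1)"
    using assms finL by (simp add: prod.delta)
  also have "\<dots> = (\<Prod>l\<in>L. \<Sum>x\<in>C. w x * (if l = a then h x else 1))"
    by (rule pexp_prod[of "\<lambda>l x. if l = a then h x else 1"])
  also have "\<dots> = (\<Prod>l\<in>L. if l = a then \<Sum>x\<in>C. w x * h x else 1)"
    by (intro prod.cong) (auto simp: w1)
  finally show ?thesis using assms finL by (simp add: prod.delta)
qed

lemma pexp_marginal_prod:
  assumes ab: "a \<in> L" "b \<in> L" "a \<noteq> b"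
  shows "pexp L C w (\<lambda>f. g (f a) * h (f b)) = (\<Sum>x\<in>C. w x * g x) * (\<Sum>x\<in>C. w x * h x)"
proof -
  have two: "(\<Prod>l\<in>L. (if l = a then u l else 1) * (if l = b then v l else 1)) = u a * v b" for u v :: "'l \<Rightarrow> real"
    using ab finL by (simp add: prod.distrib prod.delta)
  have "pexp L C w (\<lambda>f. g (f a) * h (f b)) = pexp L C w (\<lambda>f. \<Prod>l\<in>L. (if l = a then g (f l) else 1) * (if l = b then h (f l) else 1))"
    by (simp only: two)
  also have "\<dots> = (\<Prod>l\<in>L. \<Sum>x\<in>C. w x * ((if l = a then g x else 1) * (if l = b then h x else 1)))"
    by (rule pexp_prod[of "\<lambda>l x. (if l = a then g x else 1) * (if l = b then h x else 1)"])
  also have "\<dots> = (\<Prod>l\<in>L. (if l = a then \<Sum>x\<in>C. w x * g x else 1) * (if l = b then \<Sum>x\<in>C. w x * h x else 1))"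
    using ab(3) by (intro prod.cong) (auto simp: w1)
  finally show ?thesis by (simp only: two)
qed

lemma pexp_marginal2:
  assumes ab: "a \<in> L" "b \<in> L" "a \<noteq> b"
  shows "pexp L C w (\<lambda>f. h (f a) (f b)) = (\<Sum>x\<in>C. \<Sum>y\<in>C. w x * w y * h x y)"
proof -
  have "pexp L C w (\<lambda>f. h (f a) (f b))
      = pexp L C w (\<lambda>f. \<Sum>x\<in>C. \<Sum>y\<in>C. h x y * (of_bool (f a = x) * of_bool (f b = y)))"
    unfolding pexp_def
  proof (intro sum.cong refl arg_cong2[where f = "(*)"])
    fix f assume "f \<in> PiE L (\<lambda>_. C)"
    hence C: "f a \<in> C" "f b \<in> C" using ab by (auto simp: PiE_iff)
    have "(\<Sum>x\<in>C. \<Sum>y\<in>C. h x y * (of_bool (f a = x) * of_bool (f b = y)))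
        = (\<Sum>x\<in>C. (\<Sum>y\<in>C. h x y * of_bool (f b = y)) * of_bool (f a = x))"
      unfolding sum_distrib_right by (intro sum.cong refl) (simp only: mult_ac)
    thus "h (f a) (f b) = (\<Sum>x\<in>C. \<Sum>y\<in>C. h x y * (of_bool (f a = x) * of_bool (f b = y)))"
      unfolding sum_of_bool_eq(4)[OF finC C(1)] sum_of_bool_eq(4)[OF finC C(2)] by simp
  qed
  also have "\<dots> = (\<Sum>x\<in>C. \<Sum>y\<in>C. h x y * ((\<Sum>z\<in>C. w z * of_bool (z = x)) * (\<Sum>z\<in>C. w z * of_bool (z = y))))"
    unfolding pexp_sum pexp_cmult
    by (intro sum.cong refl arg_cong2[where f = "(*)"]
      pexp_marginal_prod[OF ab, of "\<lambda>z. of_bool (z = _)" "\<lambda>z. of_bool (z = _)"])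
  also have "\<dots> = (\<Sum>x\<in>C. \<Sum>y\<in>C. w x * w y * h x y)"
    by (intro sum.cong refl) (simp only: sum_of_bool_eq(3)[OF finC] mult_ac)
  finally show ?thesis .
qed

text \<open>Distinct entries are independent, so after centring only the diagonal of the double sum
  survives, and centring does not increase the second moment.\<close>

lemma pexp_variance:
  assumes L: "L \<noteq> {}"
  shows "pexp L C w (\<lambda>f. ((\<Sum>l\<in>L. z (f l)) / card L - (\<Sum>x\<in>C. w x * z x))\<^sup>2) \<le> (\<Sum>x\<in>C. w x * (z x)\<^sup>2) / card L"
proof -
  define b where "b = (\<Sum>x\<in>C. w x * z x)"
  define y where "y x = z x - b" for x
  define n where "n = real (card L)"
  have n: "0 < n" unfolding n_def using L finL by (simp add: card_gt_0_iff)
  have y0: "(\<Sum>x\<in>C. w x * y x) = 0"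
    unfolding y_def by (simp add: right_diff_distrib sum_subtractf b_def[symmetric] sum_distrib_right[symmetric] w1)
  have y2: "(\<Sum>x\<in>C. w x * (y x)\<^sup>2) \<le> (\<Sum>x\<in>C. w x * (z x)\<^sup>2)"
  proof -
    have "(\<Sum>x\<in>C. w x * (y x)\<^sup>2) = (\<Sum>x\<in>C. w x * (z x)\<^sup>2 - 2 * b * (w x * z x) + b\<^sup>2 * w x)"
      unfolding y_def by (intro sum.cong refl) (simp add: power2_eq_square algebra_simps)
    also have "\<dots> = (\<Sum>x\<in>C. w x * (z x)\<^sup>2) - 2 * b * b + b\<^sup>2"
      by (simp add: sum.distrib sum_subtractf sum_distrib_left[symmetric] w1 b_def[symmetric])
    finally show ?thesis by (simp add: power2_eq_square)
  qed
  have "((\<Sum>l\<in>L. z (f l)) / n - b)\<^sup>2 = (1 / n\<^sup>2) * (\<Sum>l\<in>L. \<Sum>l'\<in>L. y (f l) * y (f l'))" for f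
  proof -
    have "(\<Sum>l\<in>L. z (f l)) / n - b = (\<Sum>l\<in>L. y (f l)) / n"
      unfolding y_def using n by (simp add: sum_subtractf n_def[symmetric] diff_divide_distrib)
    thus ?thesis by (simp add: power_divide power2_eq_square sum_product)
  qed
  hence "pexp L C w (\<lambda>f. ((\<Sum>l\<in>L. z (f l)) / n - b)\<^sup>2)
      = (1 / n\<^sup>2) * (\<Sum>l\<in>L. \<Sum>l'\<in>L. pexp L C w (\<lambda>f. y (f l) * y (f l')))"
    by (simp only: pexp_cmult pexp_sum)
  also have "(\<Sum>l\<in>L. \<Sum>l'\<in>L. pexp L C w (\<lambda>f. y (f l) * y (f l')))
      = (\<Sum>l\<in>L. \<Sum>l'\<in>L. of_bool (l = l') * (\<Sum>x\<in>C. w x * (y x)\<^sup>2))"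
  proof (intro sum.cong refl)
    fix l l' assume ll: "l \<in> L" "l' \<in> L"
    show "pexp L C w (\<lambda>f. y (f l) * y (f l')) = of_bool (l = l') * (\<Sum>x\<in>C. w x * (y x)\<^sup>2)"
    proof (cases "l = l'")
      case True
      thus ?thesis using pexp_marginal[OF ll(1), of "\<lambda>x. y x * y x"] by (simp add: power2_eq_square)
    qed (use pexp_marginal_prod[OF ll] y0 in simp)
  qed
  also have "\<dots> = (\<Sum>l\<in>L. \<Sum>x\<in>C. w x * (y x)\<^sup>2)"
    by (intro sum.cong refl sum_of_bool_eq(2) finL)
  also have "\<dots> = n * (\<Sum>x\<in>C. w x * (y x)\<^sup>2)" by (simp add: n_def)
  also have "(1 / n\<^sup>2) * (n * (\<Sum>x\<in>C. w x * (y x)\<^sup>2)) = (\<Sum>x\<in>C. w x * (y x)\<^sup>2) / n"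
    using n by (simp add: power2_eq_square)
  also have "\<dots> \<le> (\<Sum>x\<in>C. w x * (z x)\<^sup>2) / n" using y2 n by (intro divide_right_mono) auto
  finally show ?thesis unfolding b_def n_def .
qed

lemma pexp_variance_complex:
  fixes z :: "'c \<Rightarrow> complex"
  assumes L: "L \<noteq> {}"
  shows "pexp L C w (\<lambda>f. (cmod ((\<Sum>l\<in>L. z (f l)) / of_nat (card L) - (\<Sum>x\<in>C. of_real (w x) * z x)))\<^sup>2)
     \<le> (\<Sum>x\<in>C. w x * (cmod (z x))\<^sup>2) / card L"
proof -
  have "(cmod ((\<Sum>l\<in>L. z (f l)) / of_nat (card L) - (\<Sum>x\<in>C. of_real (w x) * z x)))\<^sup>2
     = ((\<Sum>l\<in>L. Re (z (f l))) / card L - (\<Sum>x\<in>C. w x * Re (z x)))\<^sup>2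
      + ((\<Sum>l\<in>L. Im (z (f l))) / card L - (\<Sum>x\<in>C. w x * Im (z x)))\<^sup>2" for f
    unfolding cmod_power2 by simp
  hence "pexp L C w (\<lambda>f. (cmod ((\<Sum>l\<in>L. z (f l)) / of_nat (card L) - (\<Sum>x\<in>C. of_real (w x) * z x)))\<^sup>2)
     \<le> (\<Sum>x\<in>C. w x * (Re (z x))\<^sup>2) / card L + (\<Sum>x\<in>C. w x * (Im (z x))\<^sup>2) / card L"
    using pexp_variance[OF L, of "\<lambda>x. Re (z x)"] pexp_variance[OF L, of "\<lambda>x. Im (z x)"]
    by (simp only: pexp_add)
  also have "\<dots> = (\<Sum>x\<in>C. w x * (cmod (z x))\<^sup>2) / card L"
    by (simp add: cmod_power2 distrib_left sum.distrib add_divide_distrib)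
  finally show ?thesis .
qed

end

text \<open>As a function of \<theta> the left side vanishes at 0 with derivative -\<epsilon>, so it
  is negative for a small \<theta>. It contains the moment generating function minus 1, and not its
  logarithm, because a sparse letter has generating function
  \<open>1 + \<alpha> * (m - 1)\<close>.\<close>

lemma chernoff_exponent:
  fixes w v :: "'a \<Rightarrow> real"
  assumes A: "finite A" and w: "\<And>a. a \<in> A \<Longrightarrow> 0 \<le> w a" "sum w A = 1"
    and v: "\<And>a. a \<in> A \<Longrightarrow> 0 < w a \<Longrightarrow> 0 < v a" and \<epsilon>: "0 < \<epsilon>"
  shows "\<exists>\<theta>>0. \<exists>\<kappa>>0. (\<Sum>a\<in>A. w a * v a powr \<theta>) - 1 - \<theta> * ((\<Sum>a\<in>A. w a * ln (v a)) + \<epsilon>) \<le> - \<kappa>"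
proof -
  define F where "F \<theta> = (\<Sum>a\<in>A. w a * exp (\<theta> * ln (v a))) - 1 - \<theta> * ((\<Sum>a\<in>A. w a * ln (v a)) + \<epsilon>)" for \<theta>
  have "(F has_real_derivative (\<Sum>a\<in>A. w a * (exp (0 * ln (v a)) * ln (v a))) - 0 - ((\<Sum>a\<in>A. w a * ln (v a)) + \<epsilon>)) (at 0)"
    unfolding F_def by (auto intro!: derivative_eq_intros simp: mult_ac)
  hence "DERIV F 0 :> - \<epsilon>" by simp
  from DERIV_neg_dec_right[OF this] obtain d where d: "0 < d" "\<And>h. 0 < h \<Longrightarrow> h < d \<Longrightarrow> F (0 + h) < F 0" using \<epsilon> by auto
  have F0: "F 0 = 0" unfolding F_def by (simp add: w)
  have neg: "F (d / 2) < 0" using d(2)[of "d / 2"] d(1) F0 by simp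
  have "(\<Sum>a\<in>A. w a * v a powr (d / 2)) = (\<Sum>a\<in>A. w a * exp (d / 2 * ln (v a)))"
  proof (intro sum.cong refl)
    fix a assume a: "a \<in> A"
    show "w a * v a powr (d / 2) = w a * exp (d / 2 * ln (v a))"
    proof (cases "w a = 0")
      case False
      hence "0 < v a" using v[OF a] w(1)[OF a] by simp
      thus ?thesis by (simp add: powr_def)
    qed simp
  qed
  hence "(\<Sum>a\<in>A. w a * v a powr (d / 2)) - 1 - d / 2 * ((\<Sum>a\<in>A. w a * ln (v a)) + \<epsilon>) \<le> - (- F (d / 2))"
    unfolding F_def by simp
  thus ?thesis using d(1) neg by (intro exI[of _ "d / 2"] conjI exI[of _ "- F (d / 2)"]) auto
qed

definition sparse :: "(nat \<Rightarrow> real) \<Rightarrow> real \<Rightarrow> nat \<Rightarrow> real" where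
  "sparse p \<alpha> y = (if y = 0 then 1 - \<alpha> else \<alpha> * p y)"

lemma sum_atMost_split: "(\<Sum>y\<le>N. f y) = f 0 + (\<Sum>y=1..N. f (y::nat))" for f :: "nat \<Rightarrow> 'b :: comm_monoid_add"
  by (subst sum.atMost_shift) (simp add: sum.shift_bounds_Suc_ivl[symmetric] sum.atLeast_Suc_lessThan_Suc_shift atLeast0LessThan[symmetric] atLeastLessThanSuc_atLeastAtMost[symmetric])

lemma sparse_prob:
  assumes "0 \<le> \<alpha>" "\<alpha> \<le> 1" "\<And>y. y \<in> {1..N} \<Longrightarrow> 0 \<le> p y" "(\<Sum>y=1..N. p y) = 1"
  shows "\<And>y. y \<le> N \<Longrightarrow> 0 \<le> sparse p \<alpha> y" "(\<Sum>y\<le>N. sparse p \<alpha> y) = 1"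
proof -
  show "0 \<le> sparse p \<alpha> y" if "y \<le> N" for y using assms(1,2) assms(3)[of y] that unfolding sparse_def by auto
  have "(\<Sum>y=1..N. sparse p \<alpha> y) = (\<Sum>y=1..N. \<alpha> * p y)" by (intro sum.cong) (auto simp: sparse_def)
  also have "\<dots> = \<alpha>" unfolding sum_distrib_left[symmetric] assms(4) by simp
  finally show "(\<Sum>y\<le>N. sparse p \<alpha> y) = 1" unfolding sum_atMost_split by (simp add: sparse_def)
qed

text \<open>The innocent letter has value \<open>1\<close>, so it does not contribute to the product and the
  exponent scales with the expected number \<open>n * \<alpha>\<close> of non-innocent letters.\<close>
lemma sparse_tail:
  fixes u v :: "nat \<Rightarrow> nat \<Rightarrow> real"
  assumes p: "\<And>y. y \<in> {1..N} \<Longrightarrow> 0 \<le> p y" "(\<Sum>y=1..N. p y) = 1"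
    and u: "\<And>y j. y \<le> N \<Longrightarrow> j < d \<Longrightarrow> 0 \<le> u y j" "\<And>y. y \<le> N \<Longrightarrow> (\<Sum>j<d. u y j) = 1"
    and v: "\<And>y j. y \<in> {1..N} \<Longrightarrow> j < d \<Longrightarrow> 0 \<le> v y j" "\<And>y j. y \<in> {1..N} \<Longrightarrow> j < d \<Longrightarrow> 0 < u y j \<Longrightarrow> 0 < v y j"
    and \<epsilon>: "0 < \<epsilon>" and B: "B = (\<Sum>y=1..N. p y * (\<Sum>j<d. u y j * ln (v y j))) + \<epsilon>"
  shows "\<exists>\<kappa>>0. \<forall>n \<alpha>. 0 \<le> \<alpha> \<and> \<alpha> \<le> 1 \<longrightarrow>
    (\<Sum>x\<in>PiE {..<n} (\<lambda>_. {..N}). (\<Prod>i<n. sparse p \<alpha> (x i)) *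
      (\<Sum>j\<in>{j\<in>PiE {..<n} (\<lambda>_. {..<d}). (\<Prod>i<n. if x i = 0 then 1 else v (x i) (j i)) > exp (real n * \<alpha> * B)}.
         \<Prod>i<n. u (x i) (j i))) \<le> exp (- \<kappa> * (real n * \<alpha>))"
proof -
  define A where "A = {1..N} \<times> {..<d}"
  have sumA: "(\<Sum>(y, j)\<in>A. h y j) = (\<Sum>y=1..N. \<Sum>j<d. h y j)" for h :: "nat \<Rightarrow> nat \<Rightarrow> real"
    unfolding A_def by (simp add: sum.cartesian_product)
  have "\<exists>\<theta>>0. \<exists>\<kappa>>0. (\<Sum>a\<in>A. (case a of (y, j) \<Rightarrow> p y * u y j) * (case a of (y, j) \<Rightarrow> v y j) powr \<theta>) - 1
     - \<theta> * ((\<Sum>a\<in>A. (case a of (y, j) \<Rightarrow> p y * u y j) * ln (case a of (y, j) \<Rightarrow> v y j)) + \<epsilon>) \<le> - \<kappa>"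
  proof (rule chernoff_exponent[OF _ _ _ _ \<epsilon>])
    show "finite A" unfolding A_def by simp
    show "(\<Sum>(y, j)\<in>A. p y * u y j) = 1"
    proof -
      have "(\<Sum>y=1..N. p y * (\<Sum>j<d. u y j)) = (\<Sum>y=1..N. p y)" by (intro sum.cong refl) (simp add: u)
      thus ?thesis unfolding sumA sum_distrib_left[symmetric] p(2) .
    qed
  next
    fix a assume a: "a \<in> A"
    thus "0 \<le> (case a of (y, j) \<Rightarrow> p y * u y j)" using p u unfolding A_def by auto
    assume w: "0 < (case a of (y, j) \<Rightarrow> p y * u y j)"
    obtain y j where yj: "a = (y, j)" by (cases a)
    have y: "y \<in> {1..N}" "j < d" using a unfolding yj A_def by auto
    hence "0 \<le> u y j" "u y j \<noteq> 0" using u(1)[of y j] w unfolding yj by auto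
    thus "0 < (case a of (y, j) \<Rightarrow> v y j)" using v(2)[OF y] unfolding yj by simp
  qed
  then obtain \<theta> \<kappa> where \<theta>: "0 < \<theta>" and \<kappa>: "0 < \<kappa>"
    and le: "(\<Sum>(y, j)\<in>A. p y * u y j * v y j powr \<theta>) - 1 - \<theta> * ((\<Sum>(y, j)\<in>A. p y * u y j * ln (v y j)) + \<epsilon>) \<le> - \<kappa>"
    by (auto simp: case_prod_unfold)
  define m where "m = (\<Sum>y=1..N. p y * (\<Sum>j<d. u y j * v y j powr \<theta>))"
  have mk: "m - 1 - \<theta> * B \<le> - \<kappa>"
    using le unfolding sumA m_def B by (simp add: sum_distrib_left mult.assoc)
  define V where "V y j = (if y = 0 then 1 else v y j)" for y j
  have V0: "0 \<le> V y j" if "y \<le> N" "j < d" for y j using v(1)[of y j] that unfolding V_def by auto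
  show ?thesis
  proof (intro exI[of _ \<kappa>] conjI \<kappa> allI impI)
    fix n :: nat and \<alpha> :: real assume \<alpha>: "0 \<le> \<alpha> \<and> \<alpha> \<le> 1"
    define g where "g = real n * \<alpha>"
    define e where "e = exp (g * B)"
    define X where "X = PiE {..<n} (\<lambda>_. {..N})"
    define J where "J = PiE {..<n} (\<lambda>_. {..<d})"
    have finJ: "finite J" unfolding J_def by (intro finite_PiE) auto
    have Jd: "j i < d" if "j \<in> J" "i < n" for i j using that unfolding J_def by (auto simp: PiE_iff)
    have XN: "x i \<le> N" if "x \<in> X" "i < n" for i x using that unfolding X_def by (auto simp: PiE_iff)
    have sp: "0 \<le> sparse p \<alpha> y" if "y \<le> N" for y using sparse_prob(1)[of \<alpha> N p y] \<alpha> p that by auto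
    have e0: "0 < e" unfolding e_def by simp
    \<comment> \<open>Markov's inequality for the power \<theta> of the product, whose mean
      factorises over positions.\<close>
    have inner: "(\<Sum>j\<in>{j\<in>J. (\<Prod>i<n. V (x i) (j i)) > e}. \<Prod>i<n. u (x i) (j i))
       \<le> e powr (- \<theta>) * (\<Prod>i<n. \<Sum>j<d. u (x i) j * V (x i) j powr \<theta>)" if x: "x \<in> X" for x
    proof -
      have un: "0 \<le> (\<Prod>i<n. u (x i) (j i))" if "j \<in> J" for j
        using XN[OF x] Jd[OF that] by (intro prod_nonneg) (auto intro: u)
      have Vn: "0 \<le> (\<Prod>i<n. V (x i) (j i))" if "j \<in> J" for j
        using XN[OF x] Jd[OF that] by (intro prod_nonneg) (auto intro: V0)
      have "(\<Sum>j\<in>{j\<in>J. (\<Prod>i<n. V (x i) (j i)) > e}. \<Prod>i<n. u (x i) (j i))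
         \<le> (\<Sum>j\<in>{j\<in>J. (\<Prod>i<n. V (x i) (j i)) > e}. e powr (- \<theta>) * ((\<Prod>i<n. u (x i) (j i)) * (\<Prod>i<n. V (x i) (j i)) powr \<theta>))"
      proof (intro sum_mono)
        fix j assume j: "j \<in> {j\<in>J. (\<Prod>i<n. V (x i) (j i)) > e}"
        have "e powr \<theta> \<le> (\<Prod>i<n. V (x i) (j i)) powr \<theta>" using j e0 \<theta> by (intro powr_mono2) auto
        hence "e powr (- \<theta>) * e powr \<theta> \<le> e powr (- \<theta>) * (\<Prod>i<n. V (x i) (j i)) powr \<theta>" by (intro mult_left_mono) auto
        hence "1 \<le> e powr (- \<theta>) * (\<Prod>i<n. V (x i) (j i)) powr \<theta>" using e0 by (simp add: powr_add[symmetric])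
        from mult_left_mono[OF this un[of j]] j
        show "(\<Prod>i<n. u (x i) (j i)) \<le> e powr (- \<theta>) * ((\<Prod>i<n. u (x i) (j i)) * (\<Prod>i<n. V (x i) (j i)) powr \<theta>)"
          by (simp add: mult_ac)
      qed
      also have "\<dots> \<le> (\<Sum>j\<in>J. e powr (- \<theta>) * ((\<Prod>i<n. u (x i) (j i)) * (\<Prod>i<n. V (x i) (j i)) powr \<theta>))"
        by (intro sum_mono2 finJ) (auto intro!: mult_nonneg_nonneg un)
      also have "\<dots> = (\<Sum>j\<in>J. e powr (- \<theta>) * (\<Prod>i<n. u (x i) (j i) * V (x i) (j i) powr \<theta>))"
      proof (intro sum.cong refl)
        fix j assume j: "j \<in> J"
        have "(\<Prod>i<n. V (x i) (j i)) powr \<theta> = (\<Prod>i<n. V (x i) (j i) powr \<theta>)"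
          by (rule prod_powr_distrib)
        thus "e powr (- \<theta>) * ((\<Prod>i<n. u (x i) (j i)) * (\<Prod>i<n. V (x i) (j i)) powr \<theta>)
          = e powr (- \<theta>) * (\<Prod>i<n. u (x i) (j i) * V (x i) (j i) powr \<theta>)" by (simp add: prod.distrib)
      qed
      also have "\<dots> = e powr (- \<theta>) * (\<Prod>i<n. \<Sum>j<d. u (x i) j * V (x i) j powr \<theta>)"
        unfolding sum_distrib_left[symmetric] J_def by (subst prod_sum_PiE) auto
      finally show ?thesis .
    qed
    have "(\<Sum>x\<in>X. (\<Prod>i<n. sparse p \<alpha> (x i)) * (\<Sum>j\<in>{j\<in>J. (\<Prod>i<n. V (x i) (j i)) > e}. \<Prod>i<n. u (x i) (j i)))
       \<le> (\<Sum>x\<in>X. (\<Prod>i<n. sparse p \<alpha> (x i)) * (e powr (- \<theta>) * (\<Prod>i<n. \<Sum>j<d. u (x i) j * V (x i) j powr \<theta>)))"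
      using XN by (intro sum_mono mult_left_mono inner prod_nonneg) (auto intro: sp)
    also have "\<dots> = e powr (- \<theta>) * (\<Sum>x\<in>X. \<Prod>i<n. sparse p \<alpha> (x i) * (\<Sum>j<d. u (x i) j * V (x i) j powr \<theta>))"
      unfolding sum_distrib_left[of "e powr (- \<theta>)"] prod.distrib by (simp only: mult.left_commute)
    also have "(\<Sum>x\<in>X. \<Prod>i<n. sparse p \<alpha> (x i) * (\<Sum>j<d. u (x i) j * V (x i) j powr \<theta>))
        = (\<Sum>y\<le>N. sparse p \<alpha> y * (\<Sum>j<d. u y j * V y j powr \<theta>)) ^ n"
      unfolding X_def by (subst prod_sum_PiE[symmetric, of "{..<n}" "\<lambda>_. {..N}" "\<lambda>_ y. sparse p \<alpha> y * (\<Sum>j<d. u y j * V y j powr \<theta>)"]) auto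
    also have "(\<Sum>y\<le>N. sparse p \<alpha> y * (\<Sum>j<d. u y j * V y j powr \<theta>)) = 1 + \<alpha> * (m - 1)"
    proof -
      have "(\<Sum>y=1..N. sparse p \<alpha> y * (\<Sum>j<d. u y j * V y j powr \<theta>)) = \<alpha> * m"
        unfolding m_def sum_distrib_left by (intro sum.cong refl) (auto simp: sparse_def V_def mult_ac)
      moreover have "sparse p \<alpha> 0 * (\<Sum>j<d. u 0 j * V 0 j powr \<theta>) = 1 - \<alpha>"
        by (simp add: sparse_def V_def u)
      ultimately show ?thesis unfolding sum_atMost_split by (simp add: algebra_simps)
    qed
    \<comment> \<open>By \<open>1 + y <= exp y\<close> the length enters only through
      \<open>n * \<alpha>\<close>.\<close>
    also have "e powr (- \<theta>) * (1 + \<alpha> * (m - 1)) ^ n \<le> exp (- \<theta> * (g * B)) * exp (g * (m - 1))"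
    proof (intro mult_mono)
      have m0: "0 \<le> m" unfolding m_def by (intro sum_nonneg mult_nonneg_nonneg) (auto intro: p u)
      have "0 \<le> 1 + \<alpha> * (m - 1)" using \<alpha> mult_nonneg_nonneg[OF _ m0, of \<alpha>] by (simp add: algebra_simps)
      hence "(1 + \<alpha> * (m - 1)) ^ n \<le> exp (\<alpha> * (m - 1)) ^ n" by (intro power_mono exp_ge_add_one_self) auto
      also have "\<dots> = exp (g * (m - 1))" unfolding g_def by (simp add: exp_of_nat_mult[symmetric] mult_ac)
      finally show "(1 + \<alpha> * (m - 1)) ^ n \<le> exp (g * (m - 1))" .
      show "0 \<le> (1 + \<alpha> * (m - 1)) ^ n" using \<open>0 \<le> 1 + \<alpha> * (m - 1)\<close> by simp
    qed (auto simp: e_def powr_def)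
    also have "\<dots> = exp (g * (m - 1 - \<theta> * B))" by (simp add: exp_add[symmetric] algebra_simps)
    also have "\<dots> \<le> exp (- \<kappa> * g)"
    proof -
      have "g * (m - 1 - \<theta> * B) \<le> g * (- \<kappa>)" using mk \<alpha> unfolding g_def by (intro mult_left_mono) auto
      thus ?thesis by (simp add: mult.commute)
    qed
    finally show "(\<Sum>x\<in>PiE {..<n} (\<lambda>_. {..N}). (\<Prod>i<n. sparse p \<alpha> (x i)) *
      (\<Sum>j\<in>{j\<in>PiE {..<n} (\<lambda>_. {..<d}). (\<Prod>i<n. if x i = 0 then 1 else v (x i) (j i)) > exp (real n * \<alpha> * B)}.
         \<Prod>i<n. u (x i) (j i))) \<le> exp (- \<kappa> * (real n * \<alpha>))"
      unfolding V_def X_def J_def e_def g_def .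
  qed
qed

section \<open>Truncation and the weighted Hilbert-Schmidt norm\<close>

lemma onb_cnj: "onb S I U \<Longrightarrow> onb S I (\<lambda>a i. cnj (U a i))"
proof -
  assume o: "onb S I U"
  have "(\<Sum>a\<in>S. cnj (cnj (U a i)) * cnj (U a j)) = of_bool (i = j)" if "i \<in> I" "j \<in> I" for i j
    using arg_cong[OF onbD(3)[OF o that], of cnj] by simp
  moreover have "(\<Sum>i\<in>I. cnj (U a i) * cnj (cnj (U b i))) = of_bool (a = b)" if "a \<in> S" "b \<in> S" for a b
    using arg_cong[OF onbD(4)[OF o that], of cnj] by simp
  ultimately show ?thesis using onbD(1,2)[OF o] unfolding onb_def by blast
qed

lemma parseval':
  assumes "onb S I U"
  shows "(\<Sum>i\<in>I. (cmod (\<Sum>a\<in>S. v a * U a i))\<^sup>2) = nsq S v"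
  using parseval[OF onb_cnj[OF assms], of v] by (simp add: mult.commute)

text \<open>Cauchy-Schwarz after inserting \<open>sqrt (t k) / sqrt (t k)\<close>, which the
  vanishing rows make harmless where \<open>t k = 0\<close>. For a probability vector
  \<open>t\<close> the trace norm is thus bounded by the Hilbert-Schmidt norm with weight
  \<open>1 / t\<close>.\<close>

lemma qform_weighted_bound:
  fixes t :: "'a \<Rightarrow> real"
  assumes u: "onb S I u" and t: "\<And>k. k \<in> S \<Longrightarrow> 0 \<le> t k"
    and X: "\<And>k k'. k \<in> S \<Longrightarrow> k' \<in> S \<Longrightarrow> t k = 0 \<Longrightarrow> X k k' = 0"
  shows "(\<Sum>i\<in>I. cmod (qform S X (\<lambda>k. u k i))) \<le> sqrt (\<Sum>k\<in>S. t k) * sqrt (\<Sum>k\<in>S. \<Sum>k'\<in>S. (cmod (X k k'))\<^sup>2 / t k)"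
proof -
  define y where "y k i = cmod (\<Sum>k'\<in>S. X k k' * u k' i)" for k i
  note fin = onbD(1,2)[OF u]
  have "cmod (qform S X (\<lambda>k. u k i)) \<le> (\<Sum>k\<in>S. (sqrt (t k) * cmod (u k i)) * (y k i / sqrt (t k)))" for i
  proof -
    have "qform S X (\<lambda>k. u k i) = (\<Sum>k\<in>S. cnj (u k i) * (\<Sum>k'\<in>S. X k k' * u k' i))"
      unfolding qform_def by (simp add: sum_distrib_left mult.assoc)
    hence "cmod (qform S X (\<lambda>k. u k i)) \<le> (\<Sum>k\<in>S. cmod (u k i) * y k i)"
      unfolding y_def using norm_sum[of "\<lambda>k. cnj (u k i) * (\<Sum>k'\<in>S. X k k' * u k' i)" S] by (simp add: norm_mult)
    also have "\<dots> = (\<Sum>k\<in>S. (sqrt (t k) * cmod (u k i)) * (y k i / sqrt (t k)))"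
    proof (intro sum.cong refl)
      fix k assume k: "k \<in> S"
      show "cmod (u k i) * y k i = (sqrt (t k) * cmod (u k i)) * (y k i / sqrt (t k))"
      proof (cases "t k = 0")
        case True
        hence "y k i = 0" unfolding y_def using X[OF k] by simp
        thus ?thesis by simp
      qed (use t[OF k] in simp)
    qed
    finally show ?thesis .
  qed
  hence "(\<Sum>i\<in>I. cmod (qform S X (\<lambda>k. u k i))) \<le> (\<Sum>i\<in>I. \<Sum>k\<in>S. (sqrt (t k) * cmod (u k i)) * (y k i / sqrt (t k)))"
    by (intro sum_mono)
  also have "\<dots> = (\<Sum>(i, k)\<in>I \<times> S. (sqrt (t k) * cmod (u k i)) * (y k i / sqrt (t k)))"
    by (rule sum.cartesian_product)
  also have "\<dots> \<le> sqrt (\<Sum>(i, k)\<in>I \<times> S. (sqrt (t k) * cmod (u k i))\<^sup>2) * sqrt (\<Sum>(i, k)\<in>I \<times> S. (y k i / sqrt (t k))\<^sup>2)"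
    unfolding case_prod_unfold by (rule sum_cauchy_schwarz_sqrt)
  also have "(\<Sum>(i, k)\<in>I \<times> S. (sqrt (t k) * cmod (u k i))\<^sup>2) = (\<Sum>k\<in>S. t k)"
  proof -
    have "(\<Sum>(i, k)\<in>I \<times> S. (sqrt (t k) * cmod (u k i))\<^sup>2) = (\<Sum>i\<in>I. \<Sum>k\<in>S. (sqrt (t k) * cmod (u k i))\<^sup>2)"
      by (rule sum.cartesian_product[symmetric])
    also have "\<dots> = (\<Sum>k\<in>S. \<Sum>i\<in>I. (sqrt (t k) * cmod (u k i))\<^sup>2)"
      by (rule sum.swap)
    also have "\<dots> = (\<Sum>k\<in>S. t k * (\<Sum>i\<in>I. (cmod (u k i))\<^sup>2))"
      unfolding sum_distrib_left by (intro sum.cong refl) (simp add: power_mult_distrib t)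
    finally show ?thesis by (simp add: onb_row_norm[OF u])
  qed
  also have "(\<Sum>(i, k)\<in>I \<times> S. (y k i / sqrt (t k))\<^sup>2) = (\<Sum>k\<in>S. \<Sum>k'\<in>S. (cmod (X k k'))\<^sup>2 / t k)"
  proof -
    have "(\<Sum>(i, k)\<in>I \<times> S. (y k i / sqrt (t k))\<^sup>2) = (\<Sum>i\<in>I. \<Sum>k\<in>S. (y k i / sqrt (t k))\<^sup>2)"
      by (rule sum.cartesian_product[symmetric])
    also have "\<dots> = (\<Sum>k\<in>S. \<Sum>i\<in>I. (y k i / sqrt (t k))\<^sup>2)" by (rule sum.swap)
    also have "\<dots> = (\<Sum>k\<in>S. (\<Sum>i\<in>I. (y k i)\<^sup>2) / t k)"
      unfolding sum_divide_distrib by (intro sum.cong refl) (simp add: power_divide t)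
    also have "\<dots> = (\<Sum>k\<in>S. nsq S (X k) / t k)" unfolding y_def parseval'[OF u] ..
    finally show ?thesis unfolding nsq_def sum_divide_distrib .
  qed
  finally show ?thesis .
qed

text \<open>The compression to the coordinates \<open>GK\<close> of the part of a state carried by
  the eigenvectors in \<open>GJ\<close>; the cut acts on both sides, which keeps it
  Hermitian.\<close>

definition trunc :: "'i set \<Rightarrow> 'a set \<Rightarrow> ('i \<Rightarrow> real) \<Rightarrow> ('a \<Rightarrow> 'i \<Rightarrow> complex) \<Rightarrow> 'a \<Rightarrow> 'a \<Rightarrow> complex" where
  "trunc GJ GK \<mu> U k k' = (\<Sum>j\<in>GJ. of_real (\<mu> j) * (of_bool (k \<in> GK) * U k j) * cnj (of_bool (k' \<in> GK) * U k' j))"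

text \<open>A gentle measurement estimate. Eigenvectors outside \<open>GJ\<close> cost their weight.
  For the others \<open>|x|^2 - |y|^2\<close> is at most \<open>|x - y| * (|x| + |y|)\<close> in
  size, and Cauchy-Schwarz turns this into twice the square root of the erased mass
  \<open>\<delta> j\<close>.\<close>

lemma trunc_distance:
  assumes R: "spectral S I R U \<mu>" and \<mu>: "\<And>j. j \<in> I \<Longrightarrow> 0 \<le> \<mu> j" "sum \<mu> I = 1" and GJ: "GJ \<subseteq> I"
    and u: "onb S I' u"
  shows "(\<Sum>i\<in>I'. cmod (qform S (\<lambda>a b. R a b - trunc GJ GK \<mu> U a b) (\<lambda>k. u k i)))
    \<le> (\<Sum>j\<in>I - GJ. \<mu> j) + 2 * sqrt (\<Sum>k\<in>S - GK. Re (R k k))"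
proof -
  note fin = spectralD(2,3)[OF R]
  have finGJ: "finite GJ" using GJ fin(2) by (rule finite_subset)
  define \<phi> where "\<phi> j k = of_bool (k \<in> GK) * U k j" for j k
  define x where "x i j = (\<Sum>k\<in>S. cnj (u k i) * U k j)" for i j
  define y where "y i j = (\<Sum>k\<in>S. cnj (u k i) * \<phi> j k)" for i j
  define \<delta> where "\<delta> j = (\<Sum>k\<in>S - GK. (cmod (U k j))\<^sup>2)" for j
  have nU: "nsq S (\<lambda>k. U k j) = 1" if "j \<in> I" for j by (rule onb_col_norm[OF spectralD(1)[OF R] that])
  have n\<phi>: "nsq S (\<phi> j) \<le> 1" if "j \<in> I" for j
  proof -
    have "nsq S (\<phi> j) \<le> nsq S (\<lambda>k. U k j)"
      unfolding nsq_def \<phi>_def by (intro sum_mono) (auto simp: norm_mult)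
    thus ?thesis using nU[OF that] by simp
  qed
  have xs: "(\<Sum>i\<in>I'. (cmod (x i j))\<^sup>2) = 1" if "j \<in> I" for j
    unfolding x_def parseval[OF u] by (rule nU[OF that])
  have ys: "(\<Sum>i\<in>I'. (cmod (y i j))\<^sup>2) \<le> 1" if "j \<in> I" for j
    unfolding y_def parseval[OF u] by (rule n\<phi>[OF that])
  have \<delta>0: "0 \<le> \<delta> j" for j unfolding \<delta>_def by (intro sum_nonneg) auto
  have xys: "(\<Sum>i\<in>I'. (cmod (x i j - y i j))\<^sup>2) = \<delta> j" for j
  proof -
    have "(\<Sum>i\<in>I'. (cmod (x i j - y i j))\<^sup>2) = nsq S (\<lambda>k. U k j - \<phi> j k)"
      unfolding x_def y_def sum_subtractf[symmetric] right_diff_distrib[symmetric] by (rule parseval[OF u])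
    also have "\<dots> = (\<Sum>k\<in>S. if k \<in> S - GK then (cmod (U k j))\<^sup>2 else 0)"
      unfolding nsq_def \<phi>_def by (intro sum.cong refl) auto
    also have "\<dots> = \<delta> j" unfolding \<delta>_def
      by (rule sum.mono_neutral_cong_right) (use fin(1) in auto)
    finally show ?thesis .
  qed
  have qR: "qform S R (\<lambda>k. u k i) = of_real (\<Sum>j\<in>I. \<mu> j * (cmod (x i j))\<^sup>2)" for i
  proof -
    have "cmod (\<Sum>a\<in>S. cnj (U a j) * u a i) = cmod (x i j)" for j
    proof -
      have "cnj (\<Sum>a\<in>S. cnj (U a j) * u a i) = x i j" unfolding x_def by (simp add: mult.commute)
      thus ?thesis by (metis complex_mod_cnj)
    qed
    thus ?thesis unfolding qform_spectral[OF R] by simp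
  qed
  have qA: "qform S (trunc GJ GK \<mu> U) (\<lambda>k. u k i) = of_real (\<Sum>j\<in>GJ. \<mu> j * (cmod (y i j))\<^sup>2)" for i
  proof -
    have "qform S (trunc GJ GK \<mu> U) (\<lambda>k. u k i)
       = (\<Sum>a\<in>S. \<Sum>b\<in>S. \<Sum>j\<in>GJ. of_real (\<mu> j) * ((cnj (u a i) * \<phi> j a) * cnj (cnj (u b i) * \<phi> j b)))"
      unfolding qform_def trunc_def \<phi>_def
      by (intro sum.cong refl) (simp add: sum_distrib_left sum_distrib_right mult_ac)
    also have "\<dots> = (\<Sum>a\<in>S. \<Sum>j\<in>GJ. \<Sum>b\<in>S. of_real (\<mu> j) * ((cnj (u a i) * \<phi> j a) * cnj (cnj (u b i) * \<phi> j b)))"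
      by (intro sum.cong refl sum.swap)
    also have "\<dots> = (\<Sum>j\<in>GJ. \<Sum>a\<in>S. \<Sum>b\<in>S. of_real (\<mu> j) * ((cnj (u a i) * \<phi> j a) * cnj (cnj (u b i) * \<phi> j b)))"
      by (rule sum.swap)
    also have "\<dots> = (\<Sum>j\<in>GJ. of_real (\<mu> j) * (y i j * cnj (y i j)))"
      unfolding y_def cnj_sum sum_product by (simp only: sum_distrib_left)
    finally show ?thesis by (simp add: complex_norm_square[symmetric] del: of_real_power)
  qed
  have split: "(\<Sum>j\<in>I. h j) = (\<Sum>j\<in>I - GJ. h j) + (\<Sum>j\<in>GJ. h j)" for h :: "'b \<Rightarrow> real"
    by (rule sum.subset_diff[OF GJ fin(2)])
  have pt: "cmod (qform S (\<lambda>a b. R a b - trunc GJ GK \<mu> U a b) (\<lambda>k. u k i))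
     \<le> (\<Sum>j\<in>I - GJ. \<mu> j * (cmod (x i j))\<^sup>2) + (\<Sum>j\<in>GJ. \<mu> j * (cmod (x i j - y i j) * (cmod (x i j) + cmod (y i j))))" for i
  proof -
    have "cmod (qform S (\<lambda>a b. R a b - trunc GJ GK \<mu> U a b) (\<lambda>k. u k i))
       = \<bar>(\<Sum>j\<in>I - GJ. \<mu> j * (cmod (x i j))\<^sup>2) + (\<Sum>j\<in>GJ. \<mu> j * ((cmod (x i j))\<^sup>2 - (cmod (y i j))\<^sup>2))\<bar>"
      unfolding qform_diff qR qA split of_real_diff[symmetric] norm_of_real
      by (simp add: right_diff_distrib sum_subtractf)
    also have "\<dots> \<le> \<bar>\<Sum>j\<in>I - GJ. \<mu> j * (cmod (x i j))\<^sup>2\<bar> + \<bar>\<Sum>j\<in>GJ. \<mu> j * ((cmod (x i j))\<^sup>2 - (cmod (y i j))\<^sup>2)\<bar>"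
      by (rule abs_triangle_ineq)
    also have "\<bar>\<Sum>j\<in>I - GJ. \<mu> j * (cmod (x i j))\<^sup>2\<bar> = (\<Sum>j\<in>I - GJ. \<mu> j * (cmod (x i j))\<^sup>2)"
      using \<mu> by (intro abs_of_nonneg sum_nonneg mult_nonneg_nonneg) auto
    also have "\<bar>\<Sum>j\<in>GJ. \<mu> j * ((cmod (x i j))\<^sup>2 - (cmod (y i j))\<^sup>2)\<bar>
        \<le> (\<Sum>j\<in>GJ. \<mu> j * (cmod (x i j - y i j) * (cmod (x i j) + cmod (y i j))))"
    proof (intro order_trans[OF sum_abs] sum_mono)
      fix j assume j: "j \<in> GJ"
      have "(cmod (x i j))\<^sup>2 - (cmod (y i j))\<^sup>2 = (cmod (x i j) - cmod (y i j)) * (cmod (x i j) + cmod (y i j))"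
        by (simp add: power2_eq_square algebra_simps)
      hence "\<bar>(cmod (x i j))\<^sup>2 - (cmod (y i j))\<^sup>2\<bar> = \<bar>cmod (x i j) - cmod (y i j)\<bar> * (cmod (x i j) + cmod (y i j))"
        by (simp add: abs_mult)
      also have "\<dots> \<le> cmod (x i j - y i j) * (cmod (x i j) + cmod (y i j))"
        by (intro mult_right_mono norm_triangle_ineq3) auto
      finally show "\<bar>\<mu> j * ((cmod (x i j))\<^sup>2 - (cmod (y i j))\<^sup>2)\<bar>
          \<le> \<mu> j * (cmod (x i j - y i j) * (cmod (x i j) + cmod (y i j)))"
        using \<mu>(1) j GJ unfolding abs_mult by (auto intro!: mult_mono)
    qed
    finally show ?thesis by linarith
  qed
  have one: "(\<Sum>i\<in>I'. cmod (x i j - y i j) * (cmod (x i j) + cmod (y i j))) \<le> 2 * sqrt (\<delta> j)" if j: "j \<in> I" for j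
  proof -
    have "(\<Sum>i\<in>I'. cmod (x i j - y i j) * (cmod (x i j) + cmod (y i j)))
      \<le> sqrt (\<Sum>i\<in>I'. (cmod (x i j - y i j))\<^sup>2) * sqrt (\<Sum>i\<in>I'. (cmod (x i j) + cmod (y i j))\<^sup>2)"
      by (rule sum_cauchy_schwarz_sqrt)
    hence 1: "(\<Sum>i\<in>I'. cmod (x i j - y i j) * (cmod (x i j) + cmod (y i j)))
      \<le> sqrt (\<delta> j) * sqrt (\<Sum>i\<in>I'. (cmod (x i j) + cmod (y i j))\<^sup>2)" unfolding xys .
    have "(\<Sum>i\<in>I'. (cmod (x i j) + cmod (y i j))\<^sup>2) \<le> (\<Sum>i\<in>I'. 2 * (cmod (x i j))\<^sup>2 + 2 * (cmod (y i j))\<^sup>2)"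
    proof (intro sum_mono)
      fix i
      have "0 \<le> (cmod (x i j) - cmod (y i j))\<^sup>2" by simp
      thus "(cmod (x i j) + cmod (y i j))\<^sup>2 \<le> 2 * (cmod (x i j))\<^sup>2 + 2 * (cmod (y i j))\<^sup>2"
        by (simp add: power2_eq_square algebra_simps)
    qed
    also have "\<dots> \<le> 4"
      using xs[OF j] ys[OF j] by (simp add: sum.distrib sum_distrib_left[symmetric])
    finally have "sqrt (\<Sum>i\<in>I'. (cmod (x i j) + cmod (y i j))\<^sup>2) \<le> sqrt 4" by (rule real_sqrt_le_mono)
    hence "sqrt (\<delta> j) * sqrt (\<Sum>i\<in>I'. (cmod (x i j) + cmod (y i j))\<^sup>2) \<le> sqrt (\<delta> j) * 2"
      by (intro mult_left_mono) (auto simp: \<delta>0)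
    with 1 show ?thesis by linarith
  qed
  have "(\<Sum>i\<in>I'. cmod (qform S (\<lambda>a b. R a b - trunc GJ GK \<mu> U a b) (\<lambda>k. u k i)))
     \<le> (\<Sum>i\<in>I'. (\<Sum>j\<in>I - GJ. \<mu> j * (cmod (x i j))\<^sup>2) + (\<Sum>j\<in>GJ. \<mu> j * (cmod (x i j - y i j) * (cmod (x i j) + cmod (y i j)))))"
    by (intro sum_mono pt)
  also have "\<dots> = (\<Sum>j\<in>I - GJ. \<mu> j * (\<Sum>i\<in>I'. (cmod (x i j))\<^sup>2))
       + (\<Sum>j\<in>GJ. \<mu> j * (\<Sum>i\<in>I'. cmod (x i j - y i j) * (cmod (x i j) + cmod (y i j))))"
    unfolding sum.distrib sum_distrib_left by (intro arg_cong2[where f = "(+)"] sum.swap)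
  also have "\<dots> \<le> (\<Sum>j\<in>I - GJ. \<mu> j * 1) + (\<Sum>j\<in>GJ. \<mu> j * (2 * sqrt (\<delta> j)))"
    using \<mu>(1) GJ xs one by (intro add_mono sum_mono mult_left_mono) auto
  \<comment> \<open>Splitting \<open>\<mu> j\<close> into two square roots prepares the
    Cauchy-Schwarz step that moves the average under the root.\<close>
  also have "(\<Sum>j\<in>GJ. \<mu> j * (2 * sqrt (\<delta> j))) = 2 * (\<Sum>j\<in>GJ. sqrt (\<mu> j) * sqrt (\<mu> j * \<delta> j))"
    unfolding sum_distrib_left
  proof (intro sum.cong refl)
    fix j assume "j \<in> GJ"
    hence "0 \<le> \<mu> j" using \<mu>(1) GJ by auto
    hence "sqrt (\<mu> j) * sqrt (\<mu> j) = \<mu> j" by simp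
    thus "\<mu> j * (2 * sqrt (\<delta> j)) = 2 * (sqrt (\<mu> j) * sqrt (\<mu> j * \<delta> j))"
      unfolding real_sqrt_mult by (metis mult.assoc mult.left_commute)
  qed
  finally have main: "(\<Sum>i\<in>I'. cmod (qform S (\<lambda>a b. R a b - trunc GJ GK \<mu> U a b) (\<lambda>k. u k i)))
     \<le> (\<Sum>j\<in>I - GJ. \<mu> j) + 2 * (\<Sum>j\<in>GJ. sqrt (\<mu> j) * sqrt (\<mu> j * \<delta> j))" by simp
  have "(\<Sum>j\<in>GJ. sqrt (\<mu> j) * sqrt (\<mu> j * \<delta> j)) \<le> sqrt (\<Sum>j\<in>GJ. (sqrt (\<mu> j))\<^sup>2) * sqrt (\<Sum>j\<in>GJ. (sqrt (\<mu> j * \<delta> j))\<^sup>2)"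
    by (rule sum_cauchy_schwarz_sqrt)
  also have "\<dots> \<le> 1 * sqrt (\<Sum>k\<in>S - GK. Re (R k k))"
  proof (intro mult_mono real_sqrt_le_mono)
    have "(\<Sum>j\<in>GJ. (sqrt (\<mu> j))\<^sup>2) = (\<Sum>j\<in>GJ. \<mu> j)" using \<mu>(1) GJ by (intro sum.cong) auto
    also have "\<dots> \<le> sum \<mu> I" using \<mu>(1) by (intro sum_mono2 fin GJ) auto
    finally show "sqrt (\<Sum>j\<in>GJ. (sqrt (\<mu> j))\<^sup>2) \<le> 1" using \<mu>(2) by simp
    have "(\<Sum>j\<in>GJ. (sqrt (\<mu> j * \<delta> j))\<^sup>2) = (\<Sum>j\<in>GJ. \<mu> j * \<delta> j)"
      using \<mu>(1) GJ \<delta>0 by (intro sum.cong) auto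
    also have "\<dots> \<le> (\<Sum>j\<in>I. \<mu> j * \<delta> j)" using \<mu>(1) \<delta>0 by (intro sum_mono2 fin GJ) auto
    also have "\<dots> = (\<Sum>k\<in>S - GK. \<Sum>j\<in>I. \<mu> j * (cmod (U k j))\<^sup>2)"
      unfolding \<delta>_def sum_distrib_left by (rule sum.swap)
    also have "\<dots> = (\<Sum>k\<in>S - GK. Re (R k k))"
      by (intro sum.cong refl) (simp add: diag_spectral[OF R])
    finally show "(\<Sum>j\<in>GJ. (sqrt (\<mu> j * \<delta> j))\<^sup>2) \<le> (\<Sum>k\<in>S - GK. Re (R k k))" .
  qed (auto intro: sum_nonneg \<delta>0)
  finally show ?thesis using main by simp
qed

text \<open>By Parseval the squared norm of a row is the sum of \<open>(l j)^2 * |U k j|^2\<close>.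
  One factor \<open>l j\<close> is traded for \<open>E * t k\<close>, which cancels the weight; the
  other one sums to at most the trace 1.\<close>

lemma trunc_chi2:
  fixes t :: "'a \<Rightarrow> real"
  assumes U: "onb S I U" and \<mu>: "\<And>j. j \<in> I \<Longrightarrow> 0 \<le> \<mu> j" "sum \<mu> I = 1" and GJ: "GJ \<subseteq> I" and E: "0 \<le> E"
    and c: "\<And>j k. j \<in> GJ \<Longrightarrow> k \<in> S \<Longrightarrow> k \<in> GK \<Longrightarrow> U k j \<noteq> 0 \<Longrightarrow> 0 < t k \<and> \<mu> j \<le> E * t k"
    and t: "\<And>k. k \<in> S \<Longrightarrow> 0 \<le> t k"
  shows "(\<Sum>k\<in>S. \<Sum>k'\<in>S. (cmod (trunc GJ GK \<mu> U k k'))\<^sup>2 / t k) \<le> E"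
proof -
  note fin = onbD(1,2)[OF U]
  define l where "l j = (if j \<in> GJ then \<mu> j else 0)" for j
  define Z where "Z k k' = (\<Sum>j\<in>I. of_real (l j) * U k j * cnj (U k' j))" for k k'
  have sZ: "spectral S I Z U l" unfolding spectral_def Z_def using U by blast
  have tr: "trunc GJ GK \<mu> U k k' = of_bool (k \<in> GK) * of_bool (k' \<in> GK) * Z k k'" for k k'
  proof -
    have "Z k k' = (\<Sum>j\<in>GJ. of_real (\<mu> j) * U k j * cnj (U k' j))"
      unfolding Z_def l_def by (rule sum.mono_neutral_cong_right) (use fin(2) GJ in auto)
    thus ?thesis unfolding trunc_def by (auto simp: of_bool_def)
  qed
  have row: "(\<Sum>k'\<in>S. (cmod (trunc GJ GK \<mu> U k k'))\<^sup>2 / t k) \<le> E * (\<Sum>j\<in>I. \<mu> j * (cmod (U k j))\<^sup>2)" if k: "k \<in> S" for k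
  proof (cases "k \<in> GK")
    case True
    have "(\<Sum>k'\<in>S. (cmod (trunc GJ GK \<mu> U k k'))\<^sup>2 / t k) \<le> (\<Sum>k'\<in>S. (cmod (Z k k'))\<^sup>2 / t k)"
      using t[OF k] by (intro sum_mono divide_right_mono) (auto simp: tr norm_mult)
    also have "\<dots> = (\<Sum>j\<in>I. (l j)\<^sup>2 * (cmod (U k j))\<^sup>2) / t k"
      unfolding sum_divide_distrib[symmetric] spectral_row_norm[OF sZ k] ..
    also have "\<dots> \<le> (\<Sum>j\<in>I. E * (\<mu> j * (cmod (U k j))\<^sup>2))"
      unfolding sum_divide_distrib
    proof (intro sum_mono)
      fix j assume j: "j \<in> I"
      show "(l j)\<^sup>2 * (cmod (U k j))\<^sup>2 / t k \<le> E * (\<mu> j * (cmod (U k j))\<^sup>2)"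
      proof (cases "j \<in> GJ \<and> U k j \<noteq> 0")
        case jg: True
        with c[OF _ k True] have ck: "0 < t k" "\<mu> j \<le> E * t k" by auto
        have "(\<mu> j)\<^sup>2 \<le> \<mu> j * (E * t k)" using mult_left_mono[OF ck(2) \<mu>(1)[OF j]] by (simp add: power2_eq_square)
        hence "(\<mu> j)\<^sup>2 / t k \<le> E * \<mu> j" using ck(1) by (simp add: divide_le_eq mult_ac)
        hence "(\<mu> j)\<^sup>2 / t k * (cmod (U k j))\<^sup>2 \<le> E * \<mu> j * (cmod (U k j))\<^sup>2" by (intro mult_right_mono) auto
        thus ?thesis using jg unfolding l_def by (simp add: mult_ac)
      next
        case False
        thus ?thesis using E \<mu>(1)[OF j] unfolding l_def by auto
      qed
    qed
    finally show ?thesis by (simp add: sum_distrib_left)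
  next
    case False
    have "0 \<le> E * (\<Sum>j\<in>I. \<mu> j * (cmod (U k j))\<^sup>2)"
      using E \<mu>(1) by (intro mult_nonneg_nonneg sum_nonneg) auto
    thus ?thesis using False by (simp add: tr)
  qed
  have "(\<Sum>k\<in>S. \<Sum>k'\<in>S. (cmod (trunc GJ GK \<mu> U k k'))\<^sup>2 / t k) \<le> (\<Sum>k\<in>S. E * (\<Sum>j\<in>I. \<mu> j * (cmod (U k j))\<^sup>2))"
    by (intro sum_mono row)
  also have "\<dots> = E * (\<Sum>j\<in>I. \<mu> j * (\<Sum>k\<in>S. (cmod (U k j))\<^sup>2))"
    unfolding sum_distrib_left[symmetric] by (subst sum.swap) (simp add: sum_distrib_left)
  also have "\<dots> = E" using onb_col_norm[OF U] \<mu>(2) by (simp add: nsq_def)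
  finally show ?thesis .
qed

section \<open>Spectral decompositions of kernels and changes of basis\<close>

lemma spectral_kernel:
  fixes d :: nat
  assumes "\<And>a b. a < d \<Longrightarrow> b < d \<Longrightarrow> A a b = cnj (A b a)"
  shows "\<exists>U l. spectral {..<d} {..<d} A U l"
proof -
  let ?M = "mat d d (\<lambda>(a, b). A a b)"
  have "hermitian_mat d ?M"
    unfolding hermitian_mat_def
  proof (intro conjI)
    show "mat_adjoint ?M = ?M"
    proof (rule eq_matI)
      fix i j assume "i < dim_row ?M" "j < dim_col ?M"
      hence ij: "i < d" "j < d" by auto
      have "mat_adjoint ?M $$ (i, j) = cnj (?M $$ (j, i))" by (rule mat_adjoint_index[OF _ ij]) simp
      thus "mat_adjoint ?M $$ (i, j) = ?M $$ (i, j)" using ij assms[OF ij] by simp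
    qed (use mat_adjoint_carrier[of ?M d d] in auto)
  qed simp
  from spectral_theorem[OF this] obtain U l where "spectral {..<d} {..<d} (ent ?M) U l" by blast
  hence "spectral {..<d} {..<d} A U l" unfolding spectral_def by simp
  thus ?thesis by blast
qed

lemma spectral_kernel_psd:
  fixes d :: nat
  assumes "\<And>a b. a < d \<Longrightarrow> b < d \<Longrightarrow> A a b = cnj (A b a)" "\<And>v. 0 \<le> Re (qform {..<d} A v)"
  shows "\<exists>U l. spectral {..<d} {..<d} A U l \<and> (\<forall>i<d. 0 \<le> l i)"
proof -
  obtain U l where s: "spectral {..<d} {..<d} A U l" using spectral_kernel[of d A, OF assms(1)] by blast
  have "0 \<le> l i" if "i < d" for i
    using assms(2)[of "\<lambda>a. U a i"] qform_eigenvector[OF s, of i] that by simp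
  thus ?thesis using s by blast
qed

lemma spectral_hermitian:
  assumes "spectral S I A U l" "a \<in> S" "b \<in> S"
  shows "A a b = cnj (A b a)"
  unfolding spectralD(4)[OF assms(1,2,3)] spectralD(4)[OF assms(1,3,2)] by (simp add: mult_ac)

lemma qform_change_basis:
  assumes B: "onb S K B"
  shows "qform K (\<lambda>k k'. \<Sum>a\<in>S. \<Sum>b\<in>S. cnj (B a k) * A a b * B b k') (\<lambda>k. \<Sum>a\<in>S. cnj (B a k) * u a) = qform S A u"
proof -
  define w where "w k = (\<Sum>a\<in>S. cnj (B a k) * u a)" for k
  have w: "(\<Sum>k\<in>K. B a k * w k) = u a" if "a \<in> S" for a unfolding w_def by (rule onb_expand[OF B that])
  have "qform K (\<lambda>k k'. \<Sum>a\<in>S. \<Sum>b\<in>S. cnj (B a k) * A a b * B b k') w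
    = (\<Sum>k\<in>K. \<Sum>k'\<in>K. \<Sum>a\<in>S. \<Sum>b\<in>S. cnj (B a k * w k) * A a b * (B b k' * w k'))"
    unfolding qform_def by (simp add: sum_distrib_left sum_distrib_right mult_ac)
  also have "\<dots> = (\<Sum>k\<in>K. \<Sum>a\<in>S. \<Sum>k'\<in>K. \<Sum>b\<in>S. cnj (B a k * w k) * A a b * (B b k' * w k'))"
    by (intro sum.cong refl sum.swap)
  also have "\<dots> = (\<Sum>a\<in>S. \<Sum>k\<in>K. \<Sum>k'\<in>K. \<Sum>b\<in>S. cnj (B a k * w k) * A a b * (B b k' * w k'))"
    by (rule sum.swap)
  also have "\<dots> = (\<Sum>a\<in>S. \<Sum>k\<in>K. \<Sum>b\<in>S. \<Sum>k'\<in>K. cnj (B a k * w k) * A a b * (B b k' * w k'))"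
    by (intro sum.cong refl sum.swap)
  also have "\<dots> = (\<Sum>a\<in>S. \<Sum>b\<in>S. \<Sum>k\<in>K. \<Sum>k'\<in>K. cnj (B a k * w k) * A a b * (B b k' * w k'))"
    by (intro sum.cong refl sum.swap)
  also have "\<dots> = (\<Sum>a\<in>S. \<Sum>b\<in>S. cnj (\<Sum>k\<in>K. B a k * w k) * A a b * (\<Sum>k'\<in>K. B b k' * w k'))"
  proof (intro sum.cong refl)
    fix a b
    have eq: "(\<Sum>k\<in>K. c k) * r * (\<Sum>k\<in>K. e k) = (\<Sum>k\<in>K. \<Sum>k'\<in>K. c k * r * e k')" for c e and r :: complex
      unfolding sum_distrib_right by (simp only: sum_distrib_left)
    show "(\<Sum>k\<in>K. \<Sum>k'\<in>K. cnj (B a k * w k) * A a b * (B b k' * w k'))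
      = cnj (\<Sum>k\<in>K. B a k * w k) * A a b * (\<Sum>k'\<in>K. B b k' * w k')"
      unfolding cnj_sum eq ..
  qed
  also have "\<dots> = qform S A u"
    unfolding qform_def by (intro sum.cong refl) (simp add: w)
  finally show ?thesis unfolding w_def .
qed

lemma proj_change_basis:
  assumes B: "onb S K B" and P: "proj K P"
  defines "P' \<equiv> \<lambda>a b. \<Sum>k\<in>K. \<Sum>k'\<in>K. B a k * P k k' * cnj (B b k')"
  shows "proj S P'"
    "trp S P' A = trp K P (\<lambda>k k'. \<Sum>a\<in>S. \<Sum>b\<in>S. cnj (B a k) * A a b * B b k')"
proof -
  have fin: "finite S" "finite K" using onbD[OF B] by auto
  have idem: "(\<Sum>c\<in>K. P k c * P c k') = P k k'" if "k \<in> K" "k' \<in> K" for k k' using P that unfolding proj_def by blast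
  have herm: "P k k' = cnj (P k' k)" if "k \<in> K" "k' \<in> K" for k k' using P that unfolding proj_def by blast
  have h: "P' a b = cnj (P' b a)" for a b
  proof -
    have "cnj (P' b a) = (\<Sum>k\<in>K. \<Sum>k'\<in>K. B a k' * cnj (P k k') * cnj (B b k))"
      unfolding P'_def by (simp add: mult_ac)
    also have "\<dots> = (\<Sum>k'\<in>K. \<Sum>k\<in>K. B a k' * cnj (P k k') * cnj (B b k))" by (rule sum.swap)
    also have "\<dots> = P' a b"
      unfolding P'_def
    proof (intro sum.cong refl)
      fix k' k assume "k' \<in> K" "k \<in> K"
      from herm[OF this] show "B a k' * cnj (P k k') * cnj (B b k) = B a k' * P k' k * cnj (B b k)" by simp
    qed
    finally show ?thesis ..
  qed
  define Q where "Q k b = (\<Sum>k'\<in>K. P k k' * cnj (B b k'))" for k b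
  have P'Q: "P' a b = (\<Sum>k\<in>K. B a k * Q k b)" for a b
    unfolding P'_def Q_def by (simp add: sum_distrib_left mult.assoc)
  have BP': "(\<Sum>c\<in>S. cnj (B c k) * P' c b) = Q k b" if k: "k \<in> K" for k b
  proof -
    have "(\<Sum>c\<in>S. cnj (B c k) * P' c b) = (\<Sum>j\<in>K. (\<Sum>c\<in>S. cnj (B c k) * B c j) * Q j b)"
      unfolding P'Q sum_distrib_left sum_distrib_right mult.assoc by (rule sum.swap)
    also have "\<dots> = (\<Sum>j\<in>K. of_bool (k = j) * Q j b)"
      by (intro sum.cong refl) (simp add: onbD(3)[OF B k])
    also have "\<dots> = Q k b" by (rule sum_of_bool_eq(2)[OF fin(2) k])
    finally show ?thesis .
  qed
  have i: "(\<Sum>c\<in>S. P' a c * P' c b) = P' a b" for a b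
  proof -
    have "(\<Sum>c\<in>S. P' a c * P' c b) = (\<Sum>c\<in>S. \<Sum>k\<in>K. \<Sum>k'\<in>K. B a k * P k k' * (cnj (B c k') * P' c b))"
    proof (intro sum.cong refl)
      fix c
      have "P' a c = (\<Sum>k\<in>K. \<Sum>k'\<in>K. B a k * P k k' * cnj (B c k'))" unfolding P'_def ..
      thus "P' a c * P' c b = (\<Sum>k\<in>K. \<Sum>k'\<in>K. B a k * P k k' * (cnj (B c k') * P' c b))"
        by (simp only: sum_distrib_right mult.assoc)
    qed
    also have "\<dots> = (\<Sum>k\<in>K. \<Sum>c\<in>S. \<Sum>k'\<in>K. B a k * P k k' * (cnj (B c k') * P' c b))"
      by (rule sum.swap)
    also have "\<dots> = (\<Sum>k\<in>K. \<Sum>k'\<in>K. \<Sum>c\<in>S. B a k * P k k' * (cnj (B c k') * P' c b))"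
      by (intro sum.cong refl sum.swap)
    also have "\<dots> = (\<Sum>k\<in>K. \<Sum>k'\<in>K. B a k * P k k' * Q k' b)"
      unfolding sum_distrib_left[symmetric] by (intro sum.cong refl) (simp add: BP')
    also have "\<dots> = (\<Sum>k\<in>K. B a k * Q k b)"
    proof (intro sum.cong refl)
      fix k assume k: "k \<in> K"
      have "(\<Sum>k'\<in>K. P k k' * Q k' b) = (\<Sum>j\<in>K. (\<Sum>k'\<in>K. P k k' * P k' j) * cnj (B b j))"
        unfolding Q_def sum_distrib_left sum_distrib_right mult.assoc by (rule sum.swap)
      also have "\<dots> = Q k b" unfolding Q_def by (intro sum.cong refl) (simp add: idem[OF k])
      finally have "B a k * (\<Sum>k'\<in>K. P k k' * Q k' b) = B a k * Q k b" by simp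
      thus "(\<Sum>k'\<in>K. B a k * P k k' * Q k' b) = B a k * Q k b" by (simp add: sum_distrib_left mult.assoc)
    qed
    finally show ?thesis unfolding P'Q .
  qed
  show "proj S P'" unfolding proj_def using fin(1) h i by blast
  have "(\<Sum>a\<in>S. \<Sum>b\<in>S. P' a b * A b a) = (\<Sum>a\<in>S. \<Sum>b\<in>S. \<Sum>k\<in>K. \<Sum>k'\<in>K. P k k' * (cnj (B b k') * A b a * B a k))"
    unfolding P'_def by (intro sum.cong refl) (simp add: sum_distrib_left sum_distrib_right mult_ac)
  also have "\<dots> = (\<Sum>a\<in>S. \<Sum>k\<in>K. \<Sum>b\<in>S. \<Sum>k'\<in>K. P k k' * (cnj (B b k') * A b a * B a k))"
    by (intro sum.cong refl sum.swap)
  also have "\<dots> = (\<Sum>k\<in>K. \<Sum>a\<in>S. \<Sum>b\<in>S. \<Sum>k'\<in>K. P k k' * (cnj (B b k') * A b a * B a k))"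
    by (rule sum.swap)
  also have "\<dots> = (\<Sum>k\<in>K. \<Sum>a\<in>S. \<Sum>k'\<in>K. \<Sum>b\<in>S. P k k' * (cnj (B b k') * A b a * B a k))"
    by (intro sum.cong refl sum.swap)
  also have "\<dots> = (\<Sum>k\<in>K. \<Sum>k'\<in>K. \<Sum>a\<in>S. \<Sum>b\<in>S. P k k' * (cnj (B b k') * A b a * B a k))"
    by (intro sum.cong refl sum.swap)
  also have "\<dots> = (\<Sum>k\<in>K. \<Sum>k'\<in>K. \<Sum>b\<in>S. \<Sum>a\<in>S. P k k' * (cnj (B b k') * A b a * B a k))"
    by (intro sum.cong refl sum.swap)
  also have "\<dots> = (\<Sum>k\<in>K. \<Sum>k'\<in>K. P k k' * (\<Sum>a\<in>S. \<Sum>b\<in>S. cnj (B a k') * A a b * B b k))"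
    by (simp only: sum_distrib_left)
  finally show "trp S P' A = trp K P (\<lambda>k k'. \<Sum>a\<in>S. \<Sum>b\<in>S. cnj (B a k) * A a b * B b k')"
    unfolding trp_def by simp
qed

lemma tensor_coords:
  fixes n d :: nat
  assumes bij: "bij_betw dg S (PiE {..<n} (\<lambda>_. {..<d}))"
  shows "(\<Sum>a\<in>S. \<Sum>b\<in>S. cnj (\<Prod>i<n. V (dg a i) (k i)) * (\<Prod>i<n. A i (dg a i) (dg b i)) * (\<Prod>i<n. V (dg b i) (k' i)))
    = (\<Prod>i<n. \<Sum>a<d. \<Sum>b<d. cnj (V a (k i)) * A i a b * V b (k' i) :: complex)"
proof -
  let ?J = "PiE {..<n} (\<lambda>_. {..<d})"
  have "(\<Sum>a\<in>S. \<Sum>b\<in>S. cnj (\<Prod>i<n. V (dg a i) (k i)) * (\<Prod>i<n. A i (dg a i) (dg b i)) * (\<Prod>i<n. V (dg b i) (k' i)))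
    = (\<Sum>a\<in>?J. \<Sum>b\<in>?J. cnj (\<Prod>i<n. V (a i) (k i)) * (\<Prod>i<n. A i (a i) (b i)) * (\<Prod>i<n. V (b i) (k' i)))"
    by (subst sum.reindex_bij_betw[OF bij, symmetric], intro sum.cong refl, subst sum.reindex_bij_betw[OF bij, symmetric]) simp
  also have "\<dots> = (\<Sum>a\<in>?J. \<Sum>b\<in>?J. \<Prod>i<n. cnj (V (a i) (k i)) * A i (a i) (b i) * V (b i) (k' i))"
    by (simp add: prod.distrib)
  also have "\<dots> = (\<Sum>a\<in>?J. \<Prod>i<n. \<Sum>b<d. cnj (V (a i) (k i)) * A i (a i) b * V b (k' i))"
    by (intro sum.cong refl) (subst prod_sum_PiE, auto)
  also have "\<dots> = (\<Prod>i<n. \<Sum>a<d. \<Sum>b<d. cnj (V a (k i)) * A i a b * V b (k' i))"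
    by (subst prod_sum_PiE) auto
  finally show ?thesis .
qed

section \<open>Memoryless channels in the eigenbasis of the innocent state\<close>

definition coords :: "'a set \<Rightarrow> ('a \<Rightarrow> 'k \<Rightarrow> complex) \<Rightarrow> ('a \<Rightarrow> 'a \<Rightarrow> complex) \<Rightarrow> 'k \<Rightarrow> 'k \<Rightarrow> complex" where
  "coords S B A k k' = (\<Sum>a\<in>S. \<Sum>b\<in>S. cnj (B a k) * A a b * B b k')"

text \<open>One digit bijection is fixed for all \<open>d\<close> and \<open>n\<close>, so that
  channel outputs, tensor powers and product bases refer to the same coordinates.\<close>

definition digits :: "nat \<Rightarrow> nat \<Rightarrow> nat \<Rightarrow> nat \<Rightarrow> nat" where
  "digits d n = (SOME dg. bij_betw dg {..<d ^ n} (PiE {..<n} (\<lambda>_. {..<d})) \<and>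
     (\<forall>A. (\<forall>i<n. A i \<in> carrier_mat d d) \<longrightarrow>
        tensor_list (map A [0..<n]) \<in> carrier_mat (d ^ n) (d ^ n) \<and>
        (\<forall>a<d ^ n. \<forall>b<d ^ n. tensor_list (map A [0..<n]) $$ (a, b) = (\<Prod>i<n. A i $$ (dg a i, dg b i)))))"

lemma digits:
  shows "bij_betw (digits d n) {..<d ^ n} (PiE {..<n} (\<lambda>_. {..<d}))"
    and "(\<And>i. i < n \<Longrightarrow> A i \<in> carrier_mat d d) \<Longrightarrow> tensor_list (map A [0..<n]) \<in> carrier_mat (d ^ n) (d ^ n)"
    and "(\<And>i. i < n \<Longrightarrow> A i \<in> carrier_mat d d) \<Longrightarrow> a < d ^ n \<Longrightarrow> b < d ^ n \<Longrightarrow>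
       tensor_list (map A [0..<n]) $$ (a, b) = (\<Prod>i<n. A i $$ (digits d n a i, digits d n b i))"
  using someI_ex[OF tensor_digits[of d n], folded digits_def] by blast+

lemma tensor_list_spectral:
  assumes A: "\<And>i. i < n \<Longrightarrow> A i \<in> carrier_mat d d"
    and s: "\<And>i. i < n \<Longrightarrow> spectral {..<d} {..<d} (ent (A i)) (U i) (l i)"
  shows "spectral {..<d ^ n} (PiE {..<n} (\<lambda>_. {..<d})) (ent (tensor_list (map A [0..<n])))
    (\<lambda>a j. \<Prod>i<n. U i (digits d n a i) (j i)) (\<lambda>j. \<Prod>i<n. l i (j i))"
proof -
  have "spectral (PiE {..<n} (\<lambda>_. {..<d})) (PiE {..<n} (\<lambda>_. {..<d})) (\<lambda>a b. \<Prod>i<n. ent (A i) (a i) (b i))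
    (\<lambda>a j. \<Prod>i<n. U i (a i) (j i)) (\<lambda>j. \<Prod>i<n. l i (j i))"
    by (rule spectral_PiE) (auto intro: s)
  from spectral_reindex[OF digits(1) this]
  show ?thesis unfolding spectral_def using digits(3)[OF A] by simp
qed

lemma tensor_list_density_op:
  assumes A: "\<And>i. i < n \<Longrightarrow> density_op d (A i)"
  shows "density_op (d ^ n) (tensor_list (map A [0..<n]))"
proof -
  have "\<forall>i. \<exists>U l. i < n \<longrightarrow> spectral {..<d} {..<d} (ent (A i)) U l \<and> (\<forall>j<d. 0 \<le> l j) \<and> (\<Sum>j<d. l j) = 1"
    using density_op_spectral[OF A] by metis
  then obtain U l where s: "\<And>i. i < n \<Longrightarrow> spectral {..<d} {..<d} (ent (A i)) (U i) (l i)"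
    and l: "\<And>i j. i < n \<Longrightarrow> j < d \<Longrightarrow> 0 \<le> l i j" "\<And>i. i < n \<Longrightarrow> (\<Sum>j<d. l i j) = 1" by metis
  note c = density_op_carrier[OF A]
  show ?thesis
  proof (rule spectral_density_op[OF digits(2)[OF c] tensor_list_spectral[OF c s]])
    fix j assume "j \<in> PiE {..<n} (\<lambda>_. {..<d})"
    thus "0 \<le> (\<Prod>i<n. l i (j i))" by (intro prod_nonneg) (auto simp: PiE_iff intro: l)
  next
    show "(\<Sum>j\<in>PiE {..<n} (\<lambda>_. {..<d}). \<Prod>i<n. l i (j i)) = 1"
      by (subst prod_sum_PiE[symmetric]) (auto simp: l)
  qed
qed

lemma tensor_list_coords:
  assumes A: "\<And>i. i < n \<Longrightarrow> A i \<in> carrier_mat d d"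
  shows "coords {..<d ^ n} (\<lambda>a k. \<Prod>i<n. V (digits d n a i) (k i)) (ent (tensor_list (map A [0..<n]))) k k'
    = (\<Prod>i<n. coords {..<d} V (ent (A i)) (k i) (k' i))"
proof -
  have "coords {..<d ^ n} (\<lambda>a k. \<Prod>i<n. V (digits d n a i) (k i)) (ent (tensor_list (map A [0..<n]))) k k'
    = (\<Sum>a<d ^ n. \<Sum>b<d ^ n. cnj (\<Prod>i<n. V (digits d n a i) (k i)) * (\<Prod>i<n. ent (A i) (digits d n a i) (digits d n b i))
        * (\<Prod>i<n. V (digits d n b i) (k' i)))"
    unfolding coords_def by (intro sum.cong refl) (simp add: digits(3)[OF A])
  also have "\<dots> = (\<Prod>i<n. coords {..<d} V (ent (A i)) (k i) (k' i))"
    unfolding coords_def by (rule tensor_coords[OF digits(1)])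
  finally show ?thesis .
qed

lemma coords_linear:
  assumes "\<And>a b. a \<in> S \<Longrightarrow> b \<in> S \<Longrightarrow> A a b = (\<Sum>y\<in>Y. c y * F y a b)"
  shows "coords S B A k k' = (\<Sum>y\<in>Y. c y * coords S B (F y) k k')"
proof -
  have "coords S B A k k' = (\<Sum>a\<in>S. \<Sum>b\<in>S. \<Sum>y\<in>Y. c y * (cnj (B a k) * F y a b * B b k'))"
    unfolding coords_def by (intro sum.cong refl) (simp add: assms sum_distrib_left sum_distrib_right mult_ac)
  also have "\<dots> = (\<Sum>a\<in>S. \<Sum>y\<in>Y. \<Sum>b\<in>S. c y * (cnj (B a k) * F y a b * B b k'))"
    by (intro sum.cong refl sum.swap)
  also have "\<dots> = (\<Sum>y\<in>Y. \<Sum>a\<in>S. \<Sum>b\<in>S. c y * (cnj (B a k) * F y a b * B b k'))"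
    by (rule sum.swap)
  finally show ?thesis unfolding coords_def by (simp only: sum_distrib_left)
qed

lemma rho_alpha_index:
  assumes c: "\<And>y. y \<le> N \<Longrightarrow> W y \<in> carrier_mat d d" and ab: "a < d" "b < d"
  shows "rho_alpha d N p W \<alpha> $$ (a, b) = (\<Sum>y\<le>N. of_real (sparse p \<alpha> y) * W y $$ (a, b))"
proof -
  have "(\<Sum>y=1..N. of_real (sparse p \<alpha> y) * W y $$ (a, b)) = (\<Sum>y=1..N. of_real \<alpha> * (of_real (p y) * W y $$ (a, b)))"
    by (intro sum.cong refl) (simp add: sparse_def mult.assoc)
  moreover have "mix_state d N p W $$ (a, b) = (\<Sum>y=1..N. of_real (p y) * W y $$ (a, b))"
  proof -
    have "(of_real (p y) \<cdot>\<^sub>m W y) $$ (a, b) = of_real (p y) * W y $$ (a, b)" if "y \<in> {1..N}" for y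
      using c[of y] that ab by auto
    thus ?thesis unfolding mix_state_def mat_sum_def using ab by simp
  qed
  moreover have "mix_state d N p W \<in> carrier_mat d d" unfolding mix_state_def mat_sum_def by simp
  ultimately show ?thesis
    unfolding rho_alpha_def sum_atMost_split using c[of 0] ab
    by (simp add: sparse_def sum_distrib_left del: of_real_diff)
qed

lemma rho_alpha_carrier:
  assumes "\<And>y. y \<le> N \<Longrightarrow> W y \<in> carrier_mat d d"
  shows "rho_alpha d N p W \<alpha> \<in> carrier_mat d d"
  unfolding rho_alpha_def mix_state_def mat_sum_def using assms[of 0] by simp

lemma density_op_mixture:
  assumes A: "\<And>y. y \<in> Y \<Longrightarrow> density_op d (F y)" and w: "\<And>y. y \<in> Y \<Longrightarrow> 0 \<le> w y" "sum w Y = 1"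
    and M: "M \<in> carrier_mat d d" "\<And>a b. a < d \<Longrightarrow> b < d \<Longrightarrow> M $$ (a, b) = (\<Sum>y\<in>Y. of_real (w y) * F y $$ (a, b))"
  shows "density_op d M"
proof -
  have c: "F y \<in> carrier_mat d d" "hermitian_mat d (F y)" "mtrace (F y) = 1" "\<And>v. 0 \<le> Re (qform {..<d} (ent (F y)) v)"
    if "y \<in> Y" for y using A[OF that] unfolding density_op_def psd_mat_qform hermitian_mat_def by auto
  have "mat_adjoint M = M"
  proof (rule eq_matI)
    fix i j assume "i < dim_row M" "j < dim_col M"
    hence ij: "i < d" "j < d" using M by auto
    have "mat_adjoint M $$ (i, j) = cnj (M $$ (j, i))" by (rule mat_adjoint_index[OF M(1) ij])
    also have "\<dots> = (\<Sum>y\<in>Y. of_real (w y) * cnj (F y $$ (j, i)))" unfolding M(2)[OF ij(2,1)] by simp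
    also have "\<dots> = M $$ (i, j)"
      unfolding M(2)[OF ij] by (intro sum.cong refl) (simp add: hermitian_mat_index[OF c(2) ij, symmetric])
    finally show "mat_adjoint M $$ (i, j) = M $$ (i, j)" .
  qed (use mat_adjoint_carrier[OF M(1)] M(1) in auto)
  moreover have "0 \<le> Re (qform {..<d} (ent M) v)" for v
  proof -
    have "qform {..<d} (ent M) v = (\<Sum>a<d. \<Sum>b<d. \<Sum>y\<in>Y. of_real (w y) * (cnj (v a) * F y $$ (a, b) * v b))"
      unfolding qform_def by (intro sum.cong refl) (simp add: M(2) sum_distrib_left sum_distrib_right mult_ac)
    also have "\<dots> = (\<Sum>a<d. \<Sum>y\<in>Y. \<Sum>b<d. of_real (w y) * (cnj (v a) * F y $$ (a, b) * v b))"
      by (intro sum.cong refl sum.swap)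
    also have "\<dots> = (\<Sum>y\<in>Y. \<Sum>a<d. \<Sum>b<d. of_real (w y) * (cnj (v a) * F y $$ (a, b) * v b))" by (rule sum.swap)
    also have "\<dots> = (\<Sum>y\<in>Y. of_real (w y) * qform {..<d} (ent (F y)) v)"
      unfolding qform_def by (simp only: sum_distrib_left)
    finally show ?thesis using c(4) w(1) by (auto intro!: sum_nonneg)
  qed
  moreover have "mtrace M = 1"
  proof -
    have "mtrace M = (\<Sum>a<d. \<Sum>y\<in>Y. of_real (w y) * F y $$ (a, a))" unfolding mtrace_eq[OF M(1)] using M(2) by simp
    also have "\<dots> = (\<Sum>y\<in>Y. of_real (w y) * (\<Sum>a<d. F y $$ (a, a)))" by (subst sum.swap) (simp add: sum_distrib_left)
    also have "\<dots> = (\<Sum>y\<in>Y. of_real (w y))" by (intro sum.cong refl) (use c mtrace_eq in force)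
    finally show ?thesis using w(2) by (simp flip: of_real_sum)
  qed
  ultimately show ?thesis unfolding density_op_def psd_mat_qform hermitian_mat_def using M(1) by blast
qed

text \<open>Instantiated for Bob and for Willie. The decompositions are parameters, so one
  eigenbasis of the innocent state is fixed throughout. The codeword set and the codeword law depend
  only on \<open>N\<close> and \<open>p\<close>; hence both instances share them and a single random
  code serves both receivers.\<close>

locale cq_channel =
  fixes d N :: nat and W :: "nat \<Rightarrow> complex mat"
    and U :: "nat \<Rightarrow> nat \<Rightarrow> nat \<Rightarrow> complex" and \<mu> :: "nat \<Rightarrow> nat \<Rightarrow> real" and p :: "nat \<Rightarrow> real"
  assumes W: "\<And>x. x \<le> N \<Longrightarrow> density_op d (W x)"
    and sp: "\<And>x. x \<le> N \<Longrightarrow> spectral {..<d} {..<d} (ent (W x)) (U x) (\<mu> x)"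
    and \<mu>0: "\<And>x j. x \<le> N \<Longrightarrow> j < d \<Longrightarrow> 0 \<le> \<mu> x j"
    and \<mu>1: "\<And>x. x \<le> N \<Longrightarrow> (\<Sum>j<d. \<mu> x j) = 1"
    and supp: "\<And>x. x \<le> N \<Longrightarrow> supp (W x) \<subseteq> supp (W 0)"
    and p0: "\<And>y. y \<in> {1..N} \<Longrightarrow> 0 \<le> p y" and p1: "(\<Sum>y=1..N. p y) = 1"
begin

text \<open>All operators are written in the eigenbasis \<open>V\<close> of the innocent state, with eigenvalues \<open>t\<close>:
  \<open>s x\<close> is the state \<open>W x\<close>, \<open>G x\<close> its eigenvectors; \<open>sn\<close> and \<open>tn\<close> belong to \<open>n\<close> channel uses, and \<open>B\<close>
  is the change of basis for them. \<open>w\<close> is the law of a random codeword.\<close>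

abbreviation V :: "nat \<Rightarrow> nat \<Rightarrow> complex" where "V \<equiv> U 0"
abbreviation t :: "nat \<Rightarrow> real" where "t \<equiv> \<mu> 0"

definition s :: "nat \<Rightarrow> nat \<Rightarrow> nat \<Rightarrow> complex" where "s x = coords {..<d} V (ent (W x))"
definition G :: "nat \<Rightarrow> nat \<Rightarrow> nat \<Rightarrow> complex" where "G x k j = (\<Sum>a<d. cnj (V a k) * U x a j)"
definition J :: "nat \<Rightarrow> (nat \<Rightarrow> nat) set" where "J n = PiE {..<n} (\<lambda>_. {..<d})"
definition X :: "nat \<Rightarrow> (nat \<Rightarrow> nat) set" where "X n = PiE {..<n} (\<lambda>_. {..N})"
definition B :: "nat \<Rightarrow> nat \<Rightarrow> (nat \<Rightarrow> nat) \<Rightarrow> complex" where "B n a k = (\<Prod>i<n. V (digits d n a i) (k i))"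
definition w :: "real \<Rightarrow> nat \<Rightarrow> (nat \<Rightarrow> nat) \<Rightarrow> real" where "w \<alpha> n x = (\<Prod>i<n. sparse p \<alpha> (x i))"
definition sn :: "nat \<Rightarrow> (nat \<Rightarrow> nat) \<Rightarrow> (nat \<Rightarrow> nat) \<Rightarrow> (nat \<Rightarrow> nat) \<Rightarrow> complex" where
  "sn n x k k' = (\<Prod>i<n. s (x i) (k i) (k' i))"
definition tn :: "nat \<Rightarrow> (nat \<Rightarrow> nat) \<Rightarrow> real" where "tn n k = (\<Prod>i<n. t (k i))"
definition Dbar :: real where "Dbar = (\<Sum>y=1..N. p y * qrel_ent (W y) (W 0))"

lemmas carrier = density_op_carrier[OF W]

lemma Vonb: "onb {..<d} {..<d} V" by (rule spectralD(1)[OF sp]) simp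

lemma s_spectral: "x \<le> N \<Longrightarrow> spectral {..<d} {..<d} (s x) (G x) (\<mu> x)"
  using spectral_change_basis[OF sp Vonb] unfolding s_def coords_def G_def by blast

lemma G0: "k < d \<Longrightarrow> j < d \<Longrightarrow> G 0 k j = of_bool (k = j)"
  unfolding G_def using onbD(3)[OF Vonb] by simp

lemma s0: "k < d \<Longrightarrow> k' < d \<Longrightarrow> s 0 k k' = of_bool (k = k') * of_real (t k)"
proof -
  assume k: "k < d" "k' < d"
  have "s 0 k k' = (\<Sum>j<d. of_bool (k = j) * (of_real (t j) * cnj (G 0 k' j)))"
    unfolding spectralD(4)[OF s_spectral[of 0], of k k', simplified, OF k]
    by (intro sum.cong refl) (simp add: G0 k)
  also have "\<dots> = of_real (t k) * cnj (G 0 k' k)" by (rule sum_of_bool_eq(2)) (use k in auto)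
  finally show ?thesis using G0[of k' k] k by (auto simp: of_bool_def)
qed

lemma G_zero: "x \<le> N \<Longrightarrow> k < d \<Longrightarrow> j < d \<Longrightarrow> t k = 0 \<Longrightarrow> \<mu> x j = 0 \<or> G x k j = 0"
proof -
  assume a: "x \<le> N" "k < d" "j < d" "t k = 0"
  have "dominated {..<d} {..<d} {..<d} (U x) (\<mu> x) V t"
    by (rule supp_dominated[OF carrier[OF a(1)] sp[OF a(1)] carrier sp supp[OF a(1)]]) auto
  hence "\<mu> x j = 0 \<or> (\<Sum>b<d. cnj (U x b j) * V b k) = 0" using a unfolding dominated_def by auto
  moreover have "cnj (\<Sum>b<d. cnj (U x b j) * V b k) = G x k j" unfolding G_def by (simp add: mult.commute)
  ultimately show ?thesis by (metis complex_cnj_zero_iff)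
qed

text \<open>Support inclusion kills a row, eigenvector by eigenvector; the column follows by
  Hermitian symmetry.\<close>

lemma s_zero:
  assumes x: "x \<le> N" and k: "k < d" "k' < d" and z: "t k = 0 \<or> t k' = 0"
  shows "s x k k' = 0"
proof -
  have row: "s x k k' = 0" if "k < d" "k' < d" "t k = 0" for k k'
    unfolding spectralD(4)[OF s_spectral[OF x], of k k', simplified, OF that(1,2)]
    by (intro sum.neutral) (use G_zero[OF x that(1) _ that(3)] in auto)
  show ?thesis
  proof (cases "t k = 0")
    case False
    hence "s x k' k = 0" using z k row by blast
    thus ?thesis using spectral_hermitian[OF s_spectral[OF x], of k k'] k by simp
  qed (use row k in blast)
qed

lemma s_diag: "x \<le> N \<Longrightarrow> k < d \<Longrightarrow> 0 \<le> Re (s x k k)" "x \<le> N \<Longrightarrow> k < d \<Longrightarrow> s x k k = of_real (Re (s x k k))"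
  using diag_spectral[OF s_spectral, of x k] \<mu>0[of x] by (auto intro!: sum_nonneg)

lemma s_diag_sum: "x \<le> N \<Longrightarrow> (\<Sum>k<d. Re (s x k k)) = 1"
  using arg_cong[OF trace_spectral[OF s_spectral], of x Re] \<mu>1[of x] by simp

text \<open>The two sums are the means of the logarithms that two thresholds will control
  separately: that of the eigenvalues of the state, and that of the innocent eigenvalues under its
  diagonal.\<close>

lemma qrel_ent_eq:
  assumes "x \<le> N"
  shows "qrel_ent (W x) (W 0) = (\<Sum>j<d. \<mu> x j * ln_supp (\<mu> x j)) - (\<Sum>k<d. Re (s x k k) * ln_supp (t k))"
proof -
  have "qform {..<d} (ent (W x)) (\<lambda>a. V a k) = s x k k" for k
    unfolding qform_def s_def coords_def ..
  thus ?thesis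
    unfolding qrel_ent_spectral[OF carrier[OF assms] sp[OF assms] carrier[of 0, simplified] sp[of 0, simplified]]
      relent_split[OF sp[OF assms] Vonb] by simp
qed

lemma Jfin: "finite (J n)" unfolding J_def by (intro finite_PiE) auto

lemma Jd: "k \<in> J n \<Longrightarrow> i < n \<Longrightarrow> k i < d" unfolding J_def by (auto simp: PiE_iff)

lemma Xfin: "finite (X n)" unfolding X_def by (intro finite_PiE) auto

lemma XN: "x \<in> X n \<Longrightarrow> i < n \<Longrightarrow> x i \<le> N" unfolding X_def by (auto simp: PiE_iff)

lemma Bonb: "onb {..<d ^ n} (J n) (B n)"
proof -
  have "onb (PiE {..<n} (\<lambda>_. {..<d})) (PiE {..<n} (\<lambda>_. {..<d})) (\<lambda>a k. \<Prod>i<n. V (a i) (k i))"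
    by (rule onb_PiE) (auto intro: Vonb)
  from onb_reindex[OF digits(1) this] show ?thesis unfolding J_def B_def .
qed

lemma chan_coords:
  assumes "\<And>i. i < n \<Longrightarrow> x i \<le> N"
  shows "coords {..<d ^ n} (B n) (ent (chan_out W n x)) k k' = sn n x k k'"
  unfolding chan_out_def sn_def s_def B_def by (rule tensor_list_coords) (use carrier assms in auto)

lemma chan_density: "(\<And>i. i < n \<Longrightarrow> x i \<le> N) \<Longrightarrow> density_op (d ^ n) (chan_out W n x)"
  unfolding chan_out_def by (rule tensor_list_density_op) (use W in auto)

lemma sn_spectral:
  assumes "\<And>i. i < n \<Longrightarrow> x i \<le> N"
  shows "spectral (J n) (J n) (sn n x) (\<lambda>k j. \<Prod>i<n. G (x i) (k i) (j i)) (\<lambda>j. \<Prod>i<n. \<mu> (x i) (j i))"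
  unfolding J_def sn_def[abs_def] by (rule spectral_PiE) (use assms s_spectral in auto)

lemma \<mu>n:
  assumes "\<And>i. i < n \<Longrightarrow> x i \<le> N"
  shows "j \<in> J n \<Longrightarrow> 0 \<le> (\<Prod>i<n. \<mu> (x i) (j i))" "(\<Sum>j\<in>J n. \<Prod>i<n. \<mu> (x i) (j i)) = 1"
proof -
  show "0 \<le> (\<Prod>i<n. \<mu> (x i) (j i))" if "j \<in> J n"
    using Jd[OF that] assms by (intro prod_nonneg) (auto intro: \<mu>0)
  show "(\<Sum>j\<in>J n. \<Prod>i<n. \<mu> (x i) (j i)) = 1"
    unfolding J_def by (subst prod_sum_PiE[symmetric]) (auto simp: \<mu>1 assms)
qed

lemma tn_nonneg: "k \<in> J n \<Longrightarrow> 0 \<le> tn n k"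
  unfolding tn_def using Jd by (intro prod_nonneg) (auto intro: \<mu>0)

lemma tn_sum: "(\<Sum>k\<in>J n. tn n k) = 1"
  using \<mu>n(2)[of n "\<lambda>_. 0"] unfolding tn_def by simp

lemma w_prob:
  assumes "0 \<le> \<alpha>" "\<alpha> \<le> 1"
  shows "x \<in> X n \<Longrightarrow> 0 \<le> w \<alpha> n x" "(\<Sum>x\<in>X n. w \<alpha> n x) = 1"
proof -
  note sp = sparse_prob[OF assms, of N p, OF p0 p1]
  show "0 \<le> w \<alpha> n x" if "x \<in> X n" unfolding w_def using XN[OF that] by (intro prod_nonneg) (auto intro: sp(1))
  have one: "(\<Sum>y\<le>N. sparse p \<alpha> y) = 1" by (rule sparse_prob(2)[OF assms p0 p1])
  show "(\<Sum>x\<in>X n. w \<alpha> n x) = 1"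
    unfolding w_def X_def
    by (subst prod_sum_PiE[symmetric, of "{..<n}" "\<lambda>_. {..N}" "\<lambda>_. sparse p \<alpha>"]) (simp_all add: one)
qed

definition sa :: "real \<Rightarrow> nat \<Rightarrow> nat \<Rightarrow> complex" where
  "sa \<alpha> k k' = (\<Sum>y\<le>N. of_real (sparse p \<alpha> y) * s y k k')"

text \<open>The letters are independent, so the average codeword state is a tensor power: the
  product distributes over the one-letter sums.\<close>

lemma sn_average:
  "(\<Prod>i<n. sa \<alpha> (k i) (k' i)) = (\<Sum>x\<in>X n. of_real (w \<alpha> n x) * sn n x k k')"
proof -
  have "(\<Prod>i<n. sa \<alpha> (k i) (k' i)) = (\<Sum>x\<in>X n. \<Prod>i<n. of_real (sparse p \<alpha> (x i)) * s (x i) (k i) (k' i))"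
    unfolding sa_def X_def by (rule prod_sum_PiE) auto
  thus ?thesis unfolding w_def sn_def by (simp add: prod.distrib)
qed

lemma sa_coords: "sa \<alpha> k k' = coords {..<d} V (ent (rho_alpha d N p W \<alpha>)) k k'"
  unfolding sa_def s_def by (rule coords_linear[symmetric]) (auto intro: rho_alpha_index carrier)

lemma rho_alpha_density:
  assumes "0 \<le> \<alpha>" "\<alpha> \<le> 1"
  shows "density_op d (rho_alpha d N p W \<alpha>)"
  by (rule density_op_mixture[where Y = "{..N}" and w = "sparse p \<alpha>" and F = W])
     (use sparse_prob[OF assms, of N p, OF p0 p1] rho_alpha_carrier[OF carrier] rho_alpha_index[OF carrier] W in auto)

lemma tensor_pow_map: "tensor_pow A n = tensor_list (map (\<lambda>_. A) [0..<n])"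
  unfolding tensor_pow_def by (simp add: map_replicate_const)

lemma rho_alpha_pow_density:
  assumes "0 \<le> \<alpha>" "\<alpha> \<le> 1"
  shows "density_op (d ^ n) (tensor_pow (rho_alpha d N p W \<alpha>) n)"
  unfolding tensor_pow_map by (rule tensor_list_density_op[OF rho_alpha_density[OF assms]])

lemma rho_alpha_pow_coords:
  "coords {..<d ^ n} (B n) (ent (tensor_pow (rho_alpha d N p W \<alpha>) n)) k k' = (\<Prod>i<n. sa \<alpha> (k i) (k' i))"
  unfolding tensor_pow_map sa_coords B_def by (rule tensor_list_coords[OF rho_alpha_carrier[OF carrier]])

lemma sa_spectral:
  assumes "0 \<le> \<alpha>" "\<alpha> \<le> 1"
  obtains Ua la where "spectral {..<d} {..<d} (sa \<alpha>) Ua la" "\<And>j. j < d \<Longrightarrow> 0 \<le> la j" "(\<Sum>j<d. la j) = 1"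
proof -
  obtain Ur l where s: "spectral {..<d} {..<d} (ent (rho_alpha d N p W \<alpha>)) Ur l" "\<And>i. i < d \<Longrightarrow> 0 \<le> l i" "(\<Sum>i<d. l i) = 1"
    using density_op_spectral[OF rho_alpha_density[OF assms]] by blast
  have "spectral {..<d} {..<d} (sa \<alpha>) (\<lambda>k i. \<Sum>a<d. cnj (V a k) * Ur a i) l"
    using spectral_change_basis[OF s(1) Vonb] unfolding sa_coords[abs_def] coords_def .
  thus ?thesis using that s by blast
qed

lemma support_constant: "\<exists>K\<ge>1. \<forall>k<d. 0 < t k \<longrightarrow> 1 \<le> K * t k"
proof -
  \<comment> \<open>Larger than every inverse eigenvalue; zero eigenvalues contribute
    \<open>1 / 0 = 0\<close>.\<close>
  define K where "K = 1 + (\<Sum>k<d. 1 / t k)"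
  have t0: "0 \<le> t k" if "k < d" for k using \<mu>0[of 0 k] that by simp
  have "1 \<le> K" unfolding K_def using t0 by (auto intro!: sum_nonneg)
  moreover have "1 \<le> K * t k" if k: "k < d" "0 < t k" for k
  proof -
    have "1 / t k \<le> (\<Sum>k<d. 1 / t k)" by (rule member_le_sum) (use k t0 in auto)
    hence "1 / t k \<le> K" unfolding K_def by simp
    thus ?thesis using k(2) by (simp add: divide_le_eq)
  qed
  ultimately show ?thesis by blast
qed

text \<open>A state is below the identity, and on the support of the innocent state the identity is
  below \<open>K * W 0\<close>; the vector is first cut down to this support. In operator terms the
  result is \<open>W x <= K * W 0\<close>.\<close>

lemma qform_s_le:
  assumes x: "x \<le> N" and K: "\<And>k. k < d \<Longrightarrow> 0 < t k \<Longrightarrow> 1 \<le> K * t k" "0 \<le> K"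
  shows "Re (qform {..<d} (s x) v) \<le> K * (\<Sum>k<d. t k * (cmod (v k))\<^sup>2)"
proof -
  define v' where "v' k = (if t k = 0 then 0 else v k)" for k
  have "qform {..<d} (s x) v = qform {..<d} (s x) v'"
    unfolding qform_def v'_def by (intro sum.cong refl) (auto simp: s_zero[OF x])
  hence "Re (qform {..<d} (s x) v) = (\<Sum>j<d. \<mu> x j * (cmod (\<Sum>a<d. cnj (G x a j) * v' a))\<^sup>2)"
    unfolding qform_spectral[OF s_spectral[OF x]] by simp
  also have "\<dots> \<le> (\<Sum>j<d. (cmod (\<Sum>a<d. cnj (G x a j) * v' a))\<^sup>2)"
  proof (intro sum_mono mult_left_le_one_le)
    fix j assume j: "j \<in> {..<d}"
    show "\<mu> x j \<le> 1" unfolding \<mu>1[OF x, symmetric] by (rule member_le_sum[OF j]) (use \<mu>0[OF x] in auto)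
  qed (use \<mu>0[OF x] in auto)
  also have "\<dots> = nsq {..<d} v'" by (rule parseval[OF spectralD(1)[OF s_spectral[OF x]]])
  also have "\<dots> \<le> (\<Sum>k<d. K * (t k * (cmod (v k))\<^sup>2))"
    unfolding nsq_def
  proof (intro sum_mono)
    fix k assume "k \<in> {..<d}"
    hence k: "k < d" by simp
    show "(cmod (v' k))\<^sup>2 \<le> K * (t k * (cmod (v k))\<^sup>2)"
    proof (cases "t k = 0")
      case False
      hence "1 \<le> K * t k" using \<mu>0[of 0 k] k K(1)[OF k] by simp
      from mult_right_mono[OF this, of "(cmod (v k))\<^sup>2"] show ?thesis using False by (simp add: v'_def mult.assoc)
    qed (simp add: v'_def)
  qed
  finally show ?thesis by (simp add: sum_distrib_left)
qed

text \<open>The average letter state is at most \<open>1 - \<alpha> + \<alpha> * K\<close> times the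
  innocent one. The difference is delivered as a decomposition with nonnegative eigenvalues, the
  form in which the monotonicity of tensor products takes it.\<close>

lemma sa_dominated:
  assumes \<alpha>: "0 \<le> \<alpha>" "\<alpha> \<le> 1" and K: "\<And>k. k < d \<Longrightarrow> 0 < t k \<Longrightarrow> 1 \<le> K * t k" "0 \<le> K" and \<delta>: "\<alpha> * K \<le> \<delta>"
  obtains Uc lc where "spectral {..<d} {..<d} (\<lambda>k k'. of_bool (k = k') * of_real ((1 + \<delta>) * t k) - sa \<alpha> k k') Uc lc"
    "\<And>j. j < d \<Longrightarrow> 0 \<le> lc j"
proof -
  let ?C = "\<lambda>k k'. of_bool (k = k') * of_real ((1 + \<delta>) * t k) - sa \<alpha> k k'"
  obtain Ua la where sas: "spectral {..<d} {..<d} (sa \<alpha>) Ua la" using sa_spectral[OF \<alpha>] by blast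
  have herm: "?C a b = cnj (?C b a)" if "a < d" "b < d" for a b
    using spectral_hermitian[OF sas, of a b] that by (auto simp: of_bool_def)
  have "0 \<le> Re (qform {..<d} ?C v)" for v
  proof -
    define T where "T = (\<Sum>k<d. t k * (cmod (v k))\<^sup>2)"
    have qd: "qform {..<d} (\<lambda>k k'. of_bool (k = k') * of_real (c * t k)) v = of_real (c * T)" for c
    proof -
      have "qform {..<d} (\<lambda>k k'. of_bool (k = k') * of_real (c * t k)) v
         = (\<Sum>a<d. \<Sum>b<d. of_bool (a = b) * (cnj (v a) * of_real (c * t a) * v b))"
        unfolding qform_def by (intro sum.cong refl) (simp add: mult_ac)
      also have "\<dots> = (\<Sum>a<d. cnj (v a) * of_real (c * t a) * v a)"
        by (intro sum.cong refl sum_of_bool_eq(2)) auto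
      also have "\<dots> = of_real (\<Sum>a<d. c * (t a * (cmod (v a))\<^sup>2))"
        unfolding of_real_sum of_real_mult cmod_sq by (intro sum.cong refl) (simp add: mult_ac)
      finally show ?thesis unfolding T_def sum_distrib_left .
    qed
    have qsa: "qform {..<d} (sa \<alpha>) v = (\<Sum>y\<le>N. of_real (sparse p \<alpha> y) * qform {..<d} (s y) v)"
    proof -
      have "qform {..<d} (sa \<alpha>) v = (\<Sum>a<d. \<Sum>b<d. \<Sum>y\<le>N. of_real (sparse p \<alpha> y) * (cnj (v a) * s y a b * v b))"
        unfolding qform_def sa_def by (intro sum.cong refl) (simp add: sum_distrib_left sum_distrib_right mult_ac)
      also have "\<dots> = (\<Sum>a<d. \<Sum>y\<le>N. \<Sum>b<d. of_real (sparse p \<alpha> y) * (cnj (v a) * s y a b * v b))"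
        by (intro sum.cong refl sum.swap)
      also have "\<dots> = (\<Sum>y\<le>N. \<Sum>a<d. \<Sum>b<d. of_real (sparse p \<alpha> y) * (cnj (v a) * s y a b * v b))" by (rule sum.swap)
      finally show ?thesis unfolding qform_def by (simp only: sum_distrib_left)
    qed
    have q0: "qform {..<d} (s 0) v = of_real T"
    proof -
      have "qform {..<d} (s 0) v = qform {..<d} (\<lambda>k k'. of_bool (k = k') * of_real (1 * t k)) v"
        unfolding qform_def by (intro sum.cong refl) (simp add: s0)
      thus ?thesis unfolding qd by simp
    qed
    have "Re (qform {..<d} (sa \<alpha>) v) = (1 - \<alpha>) * T + (\<Sum>y=1..N. \<alpha> * p y * Re (qform {..<d} (s y) v))"
    proof -
      have "(\<Sum>y=1..N. sparse p \<alpha> y * Re (qform {..<d} (s y) v)) = (\<Sum>y=1..N. \<alpha> * p y * Re (qform {..<d} (s y) v))"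
        by (intro sum.cong refl) (simp add: sparse_def)
      moreover have "Re (qform {..<d} (sa \<alpha>) v) = (\<Sum>y\<le>N. sparse p \<alpha> y * Re (qform {..<d} (s y) v))"
        unfolding qsa by simp
      ultimately show ?thesis unfolding sum_atMost_split by (simp add: q0 sparse_def)
    qed
    also have "(\<Sum>y=1..N. \<alpha> * p y * Re (qform {..<d} (s y) v)) \<le> (\<Sum>y=1..N. \<alpha> * p y * (K * T))"
      unfolding T_def using \<alpha> p0 by (intro sum_mono mult_left_mono qform_s_le K) auto
    also have "\<dots> = \<alpha> * K * T"
    proof -
      have "(\<Sum>y=1..N. \<alpha> * p y * (K * T)) = (\<Sum>y=1..N. p y) * (\<alpha> * K * T)"
        unfolding sum_distrib_right by (intro sum.cong refl) (simp add: mult_ac)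
      thus ?thesis unfolding p1 by simp
    qed
    also have "\<alpha> * K * T \<le> \<delta> * T"
      using \<delta> \<mu>0[of 0] unfolding T_def by (intro mult_right_mono sum_nonneg) auto
    finally have "Re (qform {..<d} (sa \<alpha>) v) \<le> (1 - \<alpha>) * T + \<delta> * T" by simp
    moreover have "0 \<le> \<alpha> * T" using \<alpha> \<mu>0[of 0] unfolding T_def by (intro mult_nonneg_nonneg sum_nonneg) auto
    ultimately show ?thesis unfolding qform_diff qd by (simp add: algebra_simps)
  qed
  from spectral_kernel_psd[OF herm this] that show ?thesis by blast
qed

text \<open>With \<open>h y\<close> the entropy of \<open>W y\<close>, \<open>B1\<close> is close to the mean of \<open>h y\<close> and \<open>B2\<close> to the mean of
  \<open>- h y - D (W y, W 0)\<close>, so the rank bound and the eigenvalue bound multiply to \<open>exp (- n \<alpha> Dbar)\<close>.\<close>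
lemma bob_projections:
  assumes \<epsilon>: "0 < \<epsilon>"
  shows "\<exists>\<kappa>>0. \<exists>a0>0. \<forall>n \<alpha>. 0 \<le> \<alpha> \<and> \<alpha> \<le> 1 \<and> \<alpha> \<le> a0 \<longrightarrow> (\<exists>P.
     (\<forall>x\<in>X n. proj {..<d ^ n} (P x)) \<and>
     (\<Sum>x\<in>X n. w \<alpha> n x * (1 - trp {..<d ^ n} (P x) (ent (chan_out W n x)))) \<le> 2 * exp (- \<kappa> * (real n * \<alpha>)) \<and>
     (\<forall>x\<in>X n. (\<Sum>x'\<in>X n. w \<alpha> n x' * trp {..<d ^ n} (P x) (ent (chan_out W n x'))) \<le> exp (real n * \<alpha> * (\<epsilon> - Dbar))))"
proof -
  \<comment> \<open>Each of the two thresholds takes a margin \<delta>, and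
    \<open>ln (1 + \<delta>)\<close> at most a third one; together three quarters of
    \<epsilon>.\<close>
  define \<delta> where "\<delta> = \<epsilon> / 4"
  have \<delta>: "0 < \<delta>" using \<epsilon> unfolding \<delta>_def by simp
  obtain K where K: "1 \<le> K" "\<And>k. k < d \<Longrightarrow> 0 < t k \<Longrightarrow> 1 \<le> K * t k" using support_constant by blast
  define B1 where "B1 = (\<Sum>y=1..N. p y * (\<Sum>j<d. \<mu> y j * ln (1 / \<mu> y j))) + \<delta>"
  define B2 where "B2 = (\<Sum>y=1..N. p y * (\<Sum>k<d. Re (s y k k) * ln ((1 + \<delta>) * t k))) + \<delta>"
  define p1e where "p1e n \<alpha> x = (\<Sum>j\<in>{j\<in>J n. (\<Prod>i<n. if x i = 0 then 1 else 1 / \<mu> (x i) (j i)) > exp (real n * \<alpha> * B1)}.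
      \<Prod>i<n. \<mu> (x i) (j i))" for n \<alpha> x
  define p2e where "p2e n \<alpha> x = (\<Sum>k\<in>{k\<in>J n. (\<Prod>i<n. if x i = 0 then 1 else (1 + \<delta>) * t (k i)) > exp (real n * \<alpha> * B2)}.
      \<Prod>i<n. Re (s (x i) (k i) (k i)))" for n \<alpha> x
  have "\<exists>\<kappa>>0. \<forall>n \<alpha>. 0 \<le> \<alpha> \<and> \<alpha> \<le> 1 \<longrightarrow> (\<Sum>x\<in>X n. w \<alpha> n x * p1e n \<alpha> x) \<le> exp (- \<kappa> * (real n * \<alpha>))"
    unfolding X_def w_def p1e_def J_def
    by (rule sparse_tail[OF p0 p1 _ _ _ _ \<delta> B1_def]) (auto intro: \<mu>0 \<mu>1)
  then obtain \<kappa>1 where \<kappa>1: "0 < \<kappa>1" and t1: "\<And>n \<alpha>. 0 \<le> \<alpha> \<Longrightarrow> \<alpha> \<le> 1 \<Longrightarrow>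
    (\<Sum>x\<in>X n. w \<alpha> n x * p1e n \<alpha> x) \<le> exp (- \<kappa>1 * (real n * \<alpha>))" by blast
  have "\<exists>\<kappa>>0. \<forall>n \<alpha>. 0 \<le> \<alpha> \<and> \<alpha> \<le> 1 \<longrightarrow> (\<Sum>x\<in>X n. w \<alpha> n x * p2e n \<alpha> x) \<le> exp (- \<kappa> * (real n * \<alpha>))"
    unfolding X_def w_def p2e_def J_def
  proof (rule sparse_tail[OF p0 p1 _ _ _ _ \<delta> B2_def])
    fix y k assume yk: "y \<in> {1..N}" "k < d" "0 < Re (s y k k)"
    hence "t k \<noteq> 0" using s_zero[of y k k] by auto
    thus "0 < (1 + \<delta>) * t k" using \<mu>0[of 0 k] yk(2) \<delta> by simp
  qed (use s_diag s_diag_sum \<mu>0[of 0] \<delta> in auto)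
  then obtain \<kappa>2 where \<kappa>2: "0 < \<kappa>2" and t2: "\<And>n \<alpha>. 0 \<le> \<alpha> \<Longrightarrow> \<alpha> \<le> 1 \<Longrightarrow>
    (\<Sum>x\<in>X n. w \<alpha> n x * p2e n \<alpha> x) \<le> exp (- \<kappa>2 * (real n * \<alpha>))" by blast
  have B12: "B1 + B2 \<le> \<epsilon> - Dbar"
  proof -
    have "(\<Sum>j<d. \<mu> y j * ln (1 / \<mu> y j)) + (\<Sum>k<d. Re (s y k k) * ln ((1 + \<delta>) * t k)) \<le> \<delta> - qrel_ent (W y) (W 0)"
      if y: "y \<le> N" for y
    proof -
      have "(\<Sum>j<d. \<mu> y j * ln (1 / \<mu> y j)) = - (\<Sum>j<d. \<mu> y j * ln_supp (\<mu> y j))"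
        unfolding sum_negf[symmetric]
      proof (intro sum.cong refl)
        fix j assume "j \<in> {..<d}"
        hence "0 \<le> \<mu> y j" using \<mu>0[OF y] by simp
        thus "\<mu> y j * ln (1 / \<mu> y j) = - (\<mu> y j * ln_supp (\<mu> y j))"
          by (cases "\<mu> y j = 0") (simp_all add: ln_supp_def ln_div)
      qed
      moreover have "(\<Sum>k<d. Re (s y k k) * ln ((1 + \<delta>) * t k)) = (\<Sum>k<d. Re (s y k k) * (ln (1 + \<delta>) + ln_supp (t k)))"
      proof (intro sum.cong refl)
        fix k assume "k \<in> {..<d}"
        hence k: "k < d" by simp
        show "Re (s y k k) * ln ((1 + \<delta>) * t k) = Re (s y k k) * (ln (1 + \<delta>) + ln_supp (t k))"
        proof (cases "t k = 0")
          case True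
          thus ?thesis using s_zero[OF y k k] by simp
        next
          case False
          hence "0 < t k" using \<mu>0[of 0 k] k by simp
          thus ?thesis using \<delta> by (simp add: ln_mult ln_supp_def)
        qed
      qed
      moreover have "\<dots> = ln (1 + \<delta>) + (\<Sum>k<d. Re (s y k k) * ln_supp (t k))"
        by (simp add: distrib_left sum.distrib sum_distrib_right[symmetric] s_diag_sum[OF y])
      moreover have "ln (1 + \<delta>) \<le> \<delta>" using \<delta> by (intro ln_add_one_self_le_self) simp
      ultimately show ?thesis unfolding qrel_ent_eq[OF y] by simp
    qed
    hence "(\<Sum>y=1..N. p y * ((\<Sum>j<d. \<mu> y j * ln (1 / \<mu> y j)) + (\<Sum>k<d. Re (s y k k) * ln ((1 + \<delta>) * t k))))
       \<le> (\<Sum>y=1..N. p y * (\<delta> - qrel_ent (W y) (W 0)))"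
      using p0 by (intro sum_mono mult_left_mono) auto
    also have "\<dots> = \<delta> - Dbar"
    proof -
      have "(\<Sum>y=1..N. p y * (\<delta> - qrel_ent (W y) (W 0))) = (\<Sum>y=1..N. p y) * \<delta> - Dbar"
        unfolding Dbar_def sum_distrib_right sum_subtractf[symmetric] by (simp add: right_diff_distrib)
      thus ?thesis unfolding p1 by simp
    qed
    finally show ?thesis using \<epsilon> unfolding B1_def B2_def \<delta>_def distrib_left sum.distrib by linarith
  qed
  define \<kappa> where "\<kappa> = min \<kappa>1 \<kappa>2"
  show ?thesis
  proof (rule exI[of _ \<kappa>], rule conjI[OF _ exI[of _ "\<delta> / K"]], goal_cases)
    case 1
    show ?case unfolding \<kappa>_def using \<kappa>1 \<kappa>2 by simp
  next
    case 2
    show ?case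
  proof (intro conjI allI impI)
    \<comment> \<open>For \<alpha> up to this value the average letter state stays below
      \<open>1 + \<delta>\<close> times the innocent state.\<close>
    show "0 < \<delta> / K" using \<delta> K by simp
    fix n :: nat and \<alpha> :: real assume "0 \<le> \<alpha> \<and> \<alpha> \<le> 1 \<and> \<alpha> \<le> \<delta> / K"
    hence \<alpha>: "0 \<le> \<alpha>" "\<alpha> \<le> 1" and "\<alpha> * K \<le> \<delta>" using K by (auto simp: field_simps)
    define g where "g = real n * \<alpha>"
    have g0: "0 \<le> g" unfolding g_def using \<alpha> by simp
    obtain Ua la where sas: "spectral {..<d} {..<d} (sa \<alpha>) Ua la" "\<And>j. j < d \<Longrightarrow> 0 \<le> la j" "(\<Sum>j<d. la j) = 1"
      using sa_spectral[OF \<alpha>] by blast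
    obtain Uc lc where C: "spectral {..<d} {..<d} (\<lambda>k k'. of_bool (k = k') * of_real ((1 + \<delta>) * t k) - sa \<alpha> k k') Uc lc"
      "\<And>j. j < d \<Longrightarrow> 0 \<le> lc j"
      using sa_dominated[OF \<alpha> K(2) _ \<open>\<alpha> * K \<le> \<delta>\<close>] K(1) by auto
    have ex: "\<exists>P. proj (J n) P \<and> 1 - trp (J n) P (sn n x) \<le> p1e n \<alpha> x + p2e n \<alpha> x \<and>
       trp (J n) P (\<lambda>a b. \<Prod>i<n. sa \<alpha> (a i) (b i)) \<le> exp (g * B1) * exp (g * B2)" if x: "x \<in> X n" for x
      unfolding p1e_def p2e_def J_def sn_def[abs_def] g_def
      by (rule tensor_test[OF _ _ _ _ sas C, where W = G])
         (use XN[OF x] s_spectral \<mu>0 \<mu>1 G0 \<delta> in auto)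
    hence "\<forall>x\<in>X n. \<exists>P. proj (J n) P \<and> 1 - trp (J n) P (sn n x) \<le> p1e n \<alpha> x + p2e n \<alpha> x \<and>
       trp (J n) P (\<lambda>a b. \<Prod>i<n. sa \<alpha> (a i) (b i)) \<le> exp (g * B1) * exp (g * B2)" by (intro ballI)
    from bchoice[OF this] obtain P where Pall: "\<forall>x\<in>X n. proj (J n) (P x) \<and> 1 - trp (J n) (P x) (sn n x) \<le> p1e n \<alpha> x + p2e n \<alpha> x \<and>
       trp (J n) (P x) (\<lambda>a b. \<Prod>i<n. sa \<alpha> (a i) (b i)) \<le> exp (g * B1) * exp (g * B2)" ..
    note P = bspec[OF Pall, THEN conjunct1] bspec[OF Pall, THEN conjunct2, THEN conjunct1]
      bspec[OF Pall, THEN conjunct2, THEN conjunct2]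
    define Q where "Q x = (\<lambda>a b. \<Sum>k\<in>J n. \<Sum>k'\<in>J n. B n a k * P x k k' * cnj (B n b k'))" for x
    have Qp: "proj {..<d ^ n} (Q x)" if "x \<in> X n" for x
      unfolding Q_def by (rule proj_change_basis(1)[OF Bonb P(1)[OF that]])
    have Qt: "trp {..<d ^ n} (Q x) (ent (chan_out W n x')) = trp (J n) (P x) (sn n x')" if "x \<in> X n" "x' \<in> X n" for x x'
    proof -
      have "(\<lambda>k k'. \<Sum>a<d ^ n. \<Sum>b<d ^ n. cnj (B n a k) * ent (chan_out W n x') a b * B n b k') = sn n x'"
        by (intro ext) (rule chan_coords[unfolded coords_def], rule XN[OF that(2)])
      thus ?thesis unfolding Q_def proj_change_basis(2)[OF Bonb P(1)[OF that(1)]] by simp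
    qed
    show "\<exists>P. (\<forall>x\<in>X n. proj {..<d ^ n} (P x)) \<and>
     (\<Sum>x\<in>X n. w \<alpha> n x * (1 - trp {..<d ^ n} (P x) (ent (chan_out W n x)))) \<le> 2 * exp (- \<kappa> * (real n * \<alpha>)) \<and>
     (\<forall>x\<in>X n. (\<Sum>x'\<in>X n. w \<alpha> n x' * trp {..<d ^ n} (P x) (ent (chan_out W n x'))) \<le> exp (real n * \<alpha> * (\<epsilon> - Dbar)))"
    proof (intro exI[of _ Q] conjI ballI Qp)
      have "(\<Sum>x\<in>X n. w \<alpha> n x * (1 - trp {..<d ^ n} (Q x) (ent (chan_out W n x))))
         \<le> (\<Sum>x\<in>X n. w \<alpha> n x * (p1e n \<alpha> x + p2e n \<alpha> x))"
        using P(2) by (intro sum_mono mult_left_mono w_prob(1)[OF \<alpha>]) (auto simp: Qt)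
      also have "\<dots> = (\<Sum>x\<in>X n. w \<alpha> n x * p1e n \<alpha> x) + (\<Sum>x\<in>X n. w \<alpha> n x * p2e n \<alpha> x)"
        by (simp add: distrib_left sum.distrib)
      also have "\<dots> \<le> exp (- \<kappa>1 * g) + exp (- \<kappa>2 * g)"
        unfolding g_def by (intro add_mono t1 t2 \<alpha>)
      also have "\<dots> \<le> exp (- \<kappa> * g) + exp (- \<kappa> * g)"
        using g0 unfolding \<kappa>_def by (intro add_mono) (auto intro!: mult_right_mono)
      finally show "(\<Sum>x\<in>X n. w \<alpha> n x * (1 - trp {..<d ^ n} (Q x) (ent (chan_out W n x)))) \<le> 2 * exp (- \<kappa> * (real n * \<alpha>))"
        unfolding g_def by simp
    next
      fix x assume x: "x \<in> X n"
      \<comment> \<open>The trace is linear, so the mean confusion with a random codeword is the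
        trace against the average state, a tensor power of \<open>sa\<close>.\<close>
      have "(\<Sum>x'\<in>X n. w \<alpha> n x' * trp {..<d ^ n} (Q x) (ent (chan_out W n x')))
         = (\<Sum>x'\<in>X n. w \<alpha> n x' * trp (J n) (P x) (sn n x'))"
        by (intro sum.cong refl) (simp add: Qt x)
      also have "\<dots> = Re (\<Sum>a\<in>J n. \<Sum>b\<in>J n. P x a b * (\<Sum>x'\<in>X n. of_real (w \<alpha> n x') * sn n x' b a))"
      proof -
        have "(\<Sum>a\<in>J n. \<Sum>b\<in>J n. P x a b * (\<Sum>x'\<in>X n. of_real (w \<alpha> n x') * sn n x' b a))
           = (\<Sum>a\<in>J n. \<Sum>b\<in>J n. \<Sum>x'\<in>X n. of_real (w \<alpha> n x') * (P x a b * sn n x' b a))"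
          by (simp add: sum_distrib_left mult_ac)
        also have "\<dots> = (\<Sum>a\<in>J n. \<Sum>x'\<in>X n. \<Sum>b\<in>J n. of_real (w \<alpha> n x') * (P x a b * sn n x' b a))"
          by (intro sum.cong refl sum.swap)
        also have "\<dots> = (\<Sum>x'\<in>X n. \<Sum>a\<in>J n. \<Sum>b\<in>J n. of_real (w \<alpha> n x') * (P x a b * sn n x' b a))"
          by (rule sum.swap)
        also have "\<dots> = (\<Sum>x'\<in>X n. of_real (w \<alpha> n x') * (\<Sum>a\<in>J n. \<Sum>b\<in>J n. P x a b * sn n x' b a))"
          by (simp only: sum_distrib_left)
        finally show ?thesis unfolding trp_def by simp
      qed
      also have "\<dots> = trp (J n) (P x) (\<lambda>a b. \<Prod>i<n. sa \<alpha> (a i) (b i))"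
        unfolding trp_def sn_average ..
      also have "\<dots> \<le> exp (g * (B1 + B2))" using P(3)[OF x] by (simp add: exp_add[symmetric] distrib_left)
      also have "\<dots> \<le> exp (g * (\<epsilon> - Dbar))" using B12 g0 by (simp add: mult_left_mono)
      finally show "(\<Sum>x'\<in>X n. w \<alpha> n x' * trp {..<d ^ n} (Q x) (ent (chan_out W n x'))) \<le> exp (real n * \<alpha> * (\<epsilon> - Dbar))"
        unfolding g_def .
    qed
  qed
  qed
qed

text \<open>The thresholds are opposite to Bob's: over the non-innocent positions the product of the
  eigenvalues of the state is bounded above and that of the innocent eigenvalues below, which is the
  ratio bound that \<open>trunc_chi2\<close> wants. At an innocent position a nonzero entry forces
  \<open>k i = j i\<close>, so there the two factors agree exactly. \<open>\<tau> x\<close> is the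
  price of truncating \<open>x\<close>, small on average.\<close>

lemma willie_truncation:
  assumes \<epsilon>: "0 < \<epsilon>"
  shows "\<exists>\<kappa>>0. \<forall>n \<alpha>. 0 \<le> \<alpha> \<and> \<alpha> \<le> 1 \<longrightarrow> (\<exists>A \<tau>.
     (\<forall>x\<in>X n. 0 \<le> \<tau> x \<and> (\<forall>u. onb (J n) {..<d ^ n} u \<longrightarrow>
        (\<Sum>i<d ^ n. cmod (qform (J n) (\<lambda>k k'. sn n x k k' - A x k k') (\<lambda>k. u k i))) \<le> \<tau> x) \<and>
        (\<Sum>k\<in>J n. \<Sum>k'\<in>J n. (cmod (A x k k'))\<^sup>2 / tn n k) \<le> exp (real n * \<alpha> * (Dbar + \<epsilon>)) \<and>
        (\<forall>k\<in>J n. \<forall>k'\<in>J n. tn n k = 0 \<longrightarrow> A x k k' = 0)) \<and>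
     (\<Sum>x\<in>X n. w \<alpha> n x * \<tau> x) \<le> 3 * exp (- \<kappa> * (real n * \<alpha>)))"
proof -
  define \<delta> where "\<delta> = \<epsilon> / 2"
  have \<delta>: "0 < \<delta>" using \<epsilon> unfolding \<delta>_def by simp
  define B1 where "B1 = (\<Sum>y=1..N. p y * (\<Sum>j<d. \<mu> y j * ln (\<mu> y j))) + \<delta>"
  define B2 where "B2 = (\<Sum>y=1..N. p y * (\<Sum>k<d. Re (s y k k) * ln (1 / t k))) + \<delta>"
  define p1e where "p1e n \<alpha> x = (\<Sum>j\<in>{j\<in>J n. (\<Prod>i<n. if x i = 0 then 1 else \<mu> (x i) (j i)) > exp (real n * \<alpha> * B1)}.
      \<Prod>i<n. \<mu> (x i) (j i))" for n \<alpha> x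
  define p2e where "p2e n \<alpha> x = (\<Sum>k\<in>{k\<in>J n. (\<Prod>i<n. if x i = 0 then 1 else 1 / t (k i)) > exp (real n * \<alpha> * B2)}.
      \<Prod>i<n. Re (s (x i) (k i) (k i)))" for n \<alpha> x
  have "\<exists>\<kappa>>0. \<forall>n \<alpha>. 0 \<le> \<alpha> \<and> \<alpha> \<le> 1 \<longrightarrow> (\<Sum>x\<in>X n. w \<alpha> n x * p1e n \<alpha> x) \<le> exp (- \<kappa> * (real n * \<alpha>))"
    unfolding X_def w_def p1e_def J_def
    by (rule sparse_tail[OF p0 p1 _ _ _ _ \<delta> B1_def]) (auto intro: \<mu>0 \<mu>1)
  then obtain \<kappa>1 where \<kappa>1: "0 < \<kappa>1" and t1: "\<And>n \<alpha>. 0 \<le> \<alpha> \<Longrightarrow> \<alpha> \<le> 1 \<Longrightarrow>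
    (\<Sum>x\<in>X n. w \<alpha> n x * p1e n \<alpha> x) \<le> exp (- \<kappa>1 * (real n * \<alpha>))" by blast
  have "\<exists>\<kappa>>0. \<forall>n \<alpha>. 0 \<le> \<alpha> \<and> \<alpha> \<le> 1 \<longrightarrow> (\<Sum>x\<in>X n. w \<alpha> n x * p2e n \<alpha> x) \<le> exp (- \<kappa> * (real n * \<alpha>))"
    unfolding X_def w_def p2e_def J_def
  proof (rule sparse_tail[OF p0 p1 _ _ _ _ \<delta> B2_def])
    fix y k assume yk: "y \<in> {1..N}" "k < d" "0 < Re (s y k k)"
    hence "t k \<noteq> 0" using s_zero[of y k k] by auto
    thus "0 < 1 / t k" using \<mu>0[of 0 k] yk(2) by simp
  qed (use s_diag s_diag_sum \<mu>0[of 0] in auto)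
  then obtain \<kappa>2 where \<kappa>2: "0 < \<kappa>2" and t2: "\<And>n \<alpha>. 0 \<le> \<alpha> \<Longrightarrow> \<alpha> \<le> 1 \<Longrightarrow>
    (\<Sum>x\<in>X n. w \<alpha> n x * p2e n \<alpha> x) \<le> exp (- \<kappa>2 * (real n * \<alpha>))" by blast
  have B12: "B1 + B2 = Dbar + \<epsilon>"
  proof -
    have "(\<Sum>j<d. \<mu> y j * ln (\<mu> y j)) + (\<Sum>k<d. Re (s y k k) * ln (1 / t k)) = qrel_ent (W y) (W 0)"
      if y: "y \<le> N" for y
    proof -
      have "(\<Sum>j<d. \<mu> y j * ln (\<mu> y j)) = (\<Sum>j<d. \<mu> y j * ln_supp (\<mu> y j))"
      proof (intro sum.cong refl)
        fix j assume "j \<in> {..<d}"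
        hence "0 \<le> \<mu> y j" using \<mu>0[OF y] by simp
        thus "\<mu> y j * ln (\<mu> y j) = \<mu> y j * ln_supp (\<mu> y j)"
          by (cases "\<mu> y j = 0") (simp_all add: ln_supp_def)
      qed
      moreover have "(\<Sum>k<d. Re (s y k k) * ln (1 / t k)) = - (\<Sum>k<d. Re (s y k k) * ln_supp (t k))"
        unfolding sum_negf[symmetric]
      proof (intro sum.cong refl)
        fix k assume "k \<in> {..<d}"
        hence k: "k < d" by simp
        show "Re (s y k k) * ln (1 / t k) = - (Re (s y k k) * ln_supp (t k))"
        proof (cases "t k = 0")
          case True
          thus ?thesis using s_zero[OF y k k] by simp
        next
          case False
          hence "0 < t k" using \<mu>0[of 0 k] k by simp
          thus ?thesis by (simp add: ln_div ln_supp_def)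
        qed
      qed
      ultimately show ?thesis unfolding qrel_ent_eq[OF y] by simp
    qed
    hence "(\<Sum>y=1..N. p y * ((\<Sum>j<d. \<mu> y j * ln (\<mu> y j)) + (\<Sum>k<d. Re (s y k k) * ln (1 / t k)))) = Dbar"
      unfolding Dbar_def by (intro sum.cong refl) auto
    thus ?thesis unfolding B1_def B2_def \<delta>_def distrib_left sum.distrib by linarith
  qed
  \<comment> \<open>Half of \<open>\<kappa>2\<close>, because the mass outside \<open>GK\<close>
    enters the distance under a square root.\<close>
  define \<kappa> where "\<kappa> = min \<kappa>1 (\<kappa>2 / 2)"
  show ?thesis
  proof (intro exI[of _ \<kappa>] conjI allI impI)
    show "0 < \<kappa>" unfolding \<kappa>_def using \<kappa>1 \<kappa>2 by simp
    fix n :: nat and \<alpha> :: real assume "0 \<le> \<alpha> \<and> \<alpha> \<le> 1"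
    hence \<alpha>: "0 \<le> \<alpha>" "\<alpha> \<le> 1" by auto
    define g where "g = real n * \<alpha>"
    have g0: "0 \<le> g" unfolding g_def using \<alpha> by simp
    define \<Psi> where "\<Psi> x = (\<lambda>k j. \<Prod>i<n. G (x i) (k i) (j i))" for x
    define m where "m x = (\<lambda>j. \<Prod>i<n. \<mu> (x i) (j i))" for x
    define GJ where "GJ x = {j\<in>J n. (\<Prod>i<n. if x i = 0 then 1 else \<mu> (x i) (j i)) \<le> exp (g * B1)}" for x
    \<comment> \<open>Coordinates with \<open>tn n k = 0\<close> are removed by hand, as
      \<open>1 / 0 = 0\<close> passes the threshold; support inclusion shows that they carry no
      mass.\<close>
    define GK where "GK x = {k\<in>J n. (\<Prod>i<n. if x i = 0 then 1 else 1 / t (k i)) \<le> exp (g * B2) \<and> tn n k \<noteq> 0}" for x :: "nat \<Rightarrow> nat"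
    define A where "A x = trunc (GJ x) (GK x) (m x) (\<Psi> x)" for x
    define \<tau> where "\<tau> x = p1e n \<alpha> x + 2 * sqrt (p2e n \<alpha> x)" for x
    have sps: "spectral (J n) (J n) (sn n x) (\<Psi> x) (m x)" if "x \<in> X n" for x
      unfolding \<Psi>_def m_def by (rule sn_spectral) (use XN[OF that] in auto)
    have mp: "\<And>j. j \<in> J n \<Longrightarrow> 0 \<le> m x j" "sum (m x) (J n) = 1" if "x \<in> X n" for x
      unfolding m_def using \<mu>n[of n x] XN[OF that] by auto
    have GJs: "GJ x \<subseteq> J n" for x unfolding GJ_def by auto
    have p1e: "(\<Sum>j\<in>J n - GJ x. m x j) = p1e n \<alpha> x" for x
      unfolding p1e_def m_def GJ_def g_def by (intro sum.cong) auto
    have Rs: "Re (sn n x k k) = (\<Prod>i<n. Re (s (x i) (k i) (k i)))" if "x \<in> X n" "k \<in> J n" for x k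
    proof -
      have "sn n x k k = of_real (\<Prod>i<n. Re (s (x i) (k i) (k i)))"
        unfolding sn_def of_real_prod by (intro prod.cong refl s_diag(2)) (use XN Jd that in auto)
      thus ?thesis by (simp only: Re_complex_of_real)
    qed
    have tz: "\<exists>i<n. t (k i) = 0" if "tn n k = 0" for k using that unfolding tn_def by (auto simp: prod_zero_iff)
    have p2e: "(\<Sum>k\<in>J n - GK x. Re (sn n x k k)) = p2e n \<alpha> x" if x: "x \<in> X n" for x
    proof -
      have "p2e n \<alpha> x = (\<Sum>k\<in>{k\<in>J n. (\<Prod>i<n. if x i = 0 then 1 else 1 / t (k i)) > exp (g * B2)}. Re (sn n x k k))"
        unfolding p2e_def g_def by (intro sum.cong refl) (use Rs[OF x] in auto)
      also have "\<dots> = (\<Sum>k\<in>J n - GK x. Re (sn n x k k))"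
      proof (rule sum.mono_neutral_left)
        show "\<forall>k\<in>J n - GK x - {k\<in>J n. (\<Prod>i<n. if x i = 0 then 1 else 1 / t (k i)) > exp (g * B2)}. Re (sn n x k k) = 0"
        proof
          fix k assume "k \<in> J n - GK x - {k\<in>J n. (\<Prod>i<n. if x i = 0 then 1 else 1 / t (k i)) > exp (g * B2)}"
          hence k: "k \<in> J n" "tn n k = 0" unfolding GK_def by auto
          then obtain i where i: "i < n" "t (k i) = 0" using tz by blast
          hence "s (x i) (k i) (k i) = 0" by (intro s_zero XN[OF x] Jd[OF k(1)]) auto
          hence "sn n x k k = 0" unfolding sn_def using i(1) by (auto simp: prod_zero_iff)
          thus "Re (sn n x k k) = 0" by simp
        qed
      qed (auto simp: Jfin GK_def)
      finally show ?thesis ..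
    qed
    have p1e0: "0 \<le> p1e n \<alpha> x" if "x \<in> X n" for x
      unfolding p1e[symmetric] using mp(1)[OF that] by (intro sum_nonneg) auto
    have p2e0: "0 \<le> p2e n \<alpha> x" if "x \<in> X n" for x
      unfolding p2e[OF that, symmetric]
    proof (intro sum_nonneg)
      fix k assume "k \<in> J n - GK x"
      hence k: "k \<in> J n" by simp
      show "0 \<le> Re (sn n x k k)"
        unfolding Rs[OF that k] using XN[OF that] Jd[OF k] by (intro prod_nonneg) (auto intro: s_diag)
    qed
    have chi: "(\<Sum>k\<in>J n. \<Sum>k'\<in>J n. (cmod (A x k k'))\<^sup>2 / tn n k) \<le> exp (g * (Dbar + \<epsilon>))" if x: "x \<in> X n" for x
      unfolding A_def
    proof (rule trunc_chi2[OF spectralD(1)[OF sps[OF x]] mp[OF x] GJs])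
      fix j k assume j: "j \<in> GJ x" and k: "k \<in> J n" "k \<in> GK x" and nz: "\<Psi> x k j \<noteq> 0"
      have jJ: "j \<in> J n" using j GJs by auto
      have tpos: "0 < tn n k" using tn_nonneg[OF k(1)] k(2) unfolding GK_def by auto
      have tp: "0 < t (k i)" if "i < n" for i
      proof -
        have "t (k i) \<noteq> 0"
        proof
          assume "t (k i) = 0"
          hence "tn n k = 0" unfolding tn_def using that by (intro prod_zero) auto
          thus False using tpos by simp
        qed
        thus ?thesis using \<mu>0[of 0 "k i"] Jd[OF k(1) that] by simp
      qed
      have same: "k i = j i" if "i < n" "x i = 0" for i
      proof -
        have "G (x i) (k i) (j i) \<noteq> 0" using nz that(1) unfolding \<Psi>_def by (auto simp: prod_zero_iff)
        thus ?thesis using G0[OF Jd[OF k(1) that(1)] Jd[OF jJ that(1)]] that(2) by (auto simp: of_bool_def split: if_splits)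
      qed
      \<comment> \<open>The innocent positions, where the eigenvalue of the state and the weight
        coincide.\<close>
      define t0 where "t0 = (\<Prod>i<n. if x i = 0 then t (k i) else 1)"
      have t0: "0 \<le> t0" unfolding t0_def using tp by (intro prod_nonneg) (auto intro: less_imp_le)
      have "m x j = t0 * (\<Prod>i<n. if x i = 0 then 1 else \<mu> (x i) (j i))"
        unfolding m_def t0_def prod.distrib[symmetric] by (intro prod.cong refl) (auto simp: same)
      also have "\<dots> \<le> t0 * exp (g * B1)" using j unfolding GJ_def by (intro mult_left_mono t0) auto
      also have "\<dots> \<le> t0 * exp (g * B1) * (exp (g * B2) * (\<Prod>i<n. if x i = 0 then 1 else t (k i)))"
      proof -
        have "1 = (\<Prod>i<n. if x i = 0 then 1 else 1 / t (k i)) * (\<Prod>i<n. if x i = 0 then 1 else t (k i))"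
          unfolding prod.distrib[symmetric] by (intro prod.neutral[symmetric]) (use tp in force)
        also have "\<dots> \<le> exp (g * B2) * (\<Prod>i<n. if x i = 0 then 1 else t (k i))"
          using k(2) tp unfolding GK_def by (intro mult_right_mono prod_nonneg) (auto intro: less_imp_le)
        finally have "1 \<le> exp (g * B2) * (\<Prod>i<n. if x i = 0 then 1 else t (k i))" .
        from mult_left_mono[OF this, of "t0 * exp (g * B1)"] t0 show ?thesis by simp
      qed
      also have "\<dots> = exp (g * (Dbar + \<epsilon>)) * (t0 * (\<Prod>i<n. if x i = 0 then 1 else t (k i)))"
        unfolding B12[symmetric] distrib_left exp_add by (simp add: mult_ac)
      also have "t0 * (\<Prod>i<n. if x i = 0 then 1 else t (k i)) = tn n k"
        unfolding t0_def tn_def prod.distrib[symmetric] by (intro prod.cong) auto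
      finally show "0 < tn n k \<and> m x j \<le> exp (g * (Dbar + \<epsilon>)) * tn n k" using tpos by simp
    qed (use tn_nonneg in auto)
    have dist: "(\<Sum>i<d ^ n. cmod (qform (J n) (\<lambda>k k'. sn n x k k' - A x k k') (\<lambda>k. u k i))) \<le> \<tau> x"
      if x: "x \<in> X n" and u: "onb (J n) {..<d ^ n} u" for x u
    proof -
      have "(\<Sum>i<d ^ n. cmod (qform (J n) (\<lambda>k k'. sn n x k k' - A x k k') (\<lambda>k. u k i)))
        \<le> (\<Sum>j\<in>J n - GJ x. m x j) + 2 * sqrt (\<Sum>k\<in>J n - GK x. Re (sn n x k k))"
        unfolding A_def by (rule trunc_distance[OF sps[OF x] _ _ GJs u]) (use mp[OF x] in auto)
      thus ?thesis unfolding \<tau>_def p1e p2e[OF x] .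
    qed
    have Az: "A x k k' = 0" if "tn n k = 0" for x k k'
      unfolding A_def trunc_def using that by (intro sum.neutral) (auto simp: GK_def)
    have tau: "(\<Sum>x\<in>X n. w \<alpha> n x * \<tau> x) \<le> 3 * exp (- \<kappa> * g)"
    proof -
      \<comment> \<open>Cauchy-Schwarz against the weights plays the role of Jensen's inequality for
        the square root.\<close>
      have "(\<Sum>x\<in>X n. w \<alpha> n x * sqrt (p2e n \<alpha> x)) = (\<Sum>x\<in>X n. sqrt (w \<alpha> n x) * sqrt (w \<alpha> n x * p2e n \<alpha> x))"
      proof (intro sum.cong refl)
        fix x assume "x \<in> X n"
        hence "sqrt (w \<alpha> n x) * sqrt (w \<alpha> n x) = w \<alpha> n x" using w_prob(1)[OF \<alpha>] by simp
        thus "w \<alpha> n x * sqrt (p2e n \<alpha> x) = sqrt (w \<alpha> n x) * sqrt (w \<alpha> n x * p2e n \<alpha> x)"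
          unfolding real_sqrt_mult by (metis mult.assoc)
      qed
      also have "\<dots> \<le> sqrt (\<Sum>x\<in>X n. (sqrt (w \<alpha> n x))\<^sup>2) * sqrt (\<Sum>x\<in>X n. (sqrt (w \<alpha> n x * p2e n \<alpha> x))\<^sup>2)"
        by (rule sum_cauchy_schwarz_sqrt)
      also have "(\<Sum>x\<in>X n. (sqrt (w \<alpha> n x))\<^sup>2) = 1"
        using w_prob[OF \<alpha>, where n = n] by simp
      also have "(\<Sum>x\<in>X n. (sqrt (w \<alpha> n x * p2e n \<alpha> x))\<^sup>2) = (\<Sum>x\<in>X n. w \<alpha> n x * p2e n \<alpha> x)"
        using w_prob(1)[OF \<alpha>] p2e0 by (intro sum.cong refl) simp
      finally have "(\<Sum>x\<in>X n. w \<alpha> n x * sqrt (p2e n \<alpha> x)) \<le> sqrt (\<Sum>x\<in>X n. w \<alpha> n x * p2e n \<alpha> x)" by simp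
      also have "\<dots> \<le> sqrt (exp (- \<kappa>2 * g))" unfolding g_def by (intro real_sqrt_le_mono t2 \<alpha>)
      also have "\<dots> = exp (- \<kappa>2 / 2 * g)"
        by (rule real_sqrt_unique) (simp_all add: power2_eq_square exp_add[symmetric])
      finally have 2: "(\<Sum>x\<in>X n. w \<alpha> n x * sqrt (p2e n \<alpha> x)) \<le> exp (- \<kappa>2 / 2 * g)" .
      have "(\<Sum>x\<in>X n. w \<alpha> n x * \<tau> x) = (\<Sum>x\<in>X n. w \<alpha> n x * p1e n \<alpha> x) + 2 * (\<Sum>x\<in>X n. w \<alpha> n x * sqrt (p2e n \<alpha> x))"
        unfolding \<tau>_def by (simp add: distrib_left sum.distrib sum_distrib_left mult_ac)
      also have "\<dots> \<le> exp (- \<kappa>1 * g) + 2 * exp (- \<kappa>2 / 2 * g)"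
        using t1[OF \<alpha>, of n] 2 unfolding g_def by linarith
      also have "\<dots> \<le> exp (- \<kappa> * g) + 2 * exp (- \<kappa> * g)"
      proof -
        have "\<kappa> * g \<le> \<kappa>1 * g" "\<kappa> * g \<le> \<kappa>2 / 2 * g"
          by (intro mult_right_mono[OF _ g0]; simp add: \<kappa>_def)+
        hence "exp (- \<kappa>1 * g) \<le> exp (- \<kappa> * g)" "exp (- \<kappa>2 / 2 * g) \<le> exp (- \<kappa> * g)" by simp_all
        thus ?thesis by linarith
      qed
      finally show ?thesis by simp
    qed
    show "\<exists>A \<tau>. (\<forall>x\<in>X n. 0 \<le> \<tau> x \<and> (\<forall>u. onb (J n) {..<d ^ n} u \<longrightarrow>
        (\<Sum>i<d ^ n. cmod (qform (J n) (\<lambda>k k'. sn n x k k' - A x k k') (\<lambda>k. u k i))) \<le> \<tau> x) \<and>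
        (\<Sum>k\<in>J n. \<Sum>k'\<in>J n. (cmod (A x k k'))\<^sup>2 / tn n k) \<le> exp (real n * \<alpha> * (Dbar + \<epsilon>)) \<and>
        (\<forall>k\<in>J n. \<forall>k'\<in>J n. tn n k = 0 \<longrightarrow> A x k k' = 0)) \<and>
     (\<Sum>x\<in>X n. w \<alpha> n x * \<tau> x) \<le> 3 * exp (- \<kappa> * (real n * \<alpha>))"
    proof (intro exI[of _ A] exI[of _ \<tau>] conjI ballI allI impI)
      fix x assume x: "x \<in> X n"
      show "0 \<le> \<tau> x" unfolding \<tau>_def using p1e0[OF x] p2e0[OF x] by simp
      show "(\<Sum>k\<in>J n. \<Sum>k'\<in>J n. (cmod (A x k k'))\<^sup>2 / tn n k) \<le> exp (real n * \<alpha> * (Dbar + \<epsilon>))"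
        using chi[OF x] unfolding g_def .
    qed (use dist Az tau in \<open>auto simp: g_def\<close>)
  qed
qed

end

section \<open>Existence of a good code\<close>

lemma qform_sum: "qform S (\<lambda>a b. \<Sum>l\<in>L. c l * F l a b) u = (\<Sum>l\<in>L. c l * qform S (F l) u)"
proof -
  have "qform S (\<lambda>a b. \<Sum>l\<in>L. c l * F l a b) u = (\<Sum>a\<in>S. \<Sum>b\<in>S. \<Sum>l\<in>L. c l * (cnj (u a) * F l a b * u b))"
    unfolding qform_def by (simp add: sum_distrib_left sum_distrib_right mult_ac)
  also have "\<dots> = (\<Sum>a\<in>S. \<Sum>l\<in>L. \<Sum>b\<in>S. c l * (cnj (u a) * F l a b * u b))"
    by (intro sum.cong refl sum.swap)
  also have "\<dots> = (\<Sum>l\<in>L. \<Sum>a\<in>S. \<Sum>b\<in>S. c l * (cnj (u a) * F l a b * u b))" by (rule sum.swap)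
  finally show ?thesis unfolding qform_def by (simp only: sum_distrib_left)
qed

lemma qform_cong: "(\<And>a b. a \<in> S \<Longrightarrow> b \<in> S \<Longrightarrow> A a b = B a b) \<Longrightarrow> qform S A u = qform S B u"
  unfolding qform_def by (intro sum.cong refl) auto

lemma spectral_qform_sum_le:
  assumes A: "spectral S I A U l" and l: "\<And>i. i \<in> I \<Longrightarrow> 0 \<le> l i" and u: "onb S I' u"
  shows "(\<Sum>i\<in>I'. cmod (qform S A (\<lambda>a. u a i))) \<le> sum l I"
proof -
  have "cmod (qform S A v) = (\<Sum>j\<in>I. l j * (cmod (\<Sum>a\<in>S. cnj (U a j) * v a))\<^sup>2)" for v
  proof -
    have "0 \<le> (\<Sum>j\<in>I. l j * (cmod (\<Sum>a\<in>S. cnj (U a j) * v a))\<^sup>2)"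
      by (intro sum_nonneg mult_nonneg_nonneg l) auto
    thus ?thesis unfolding qform_spectral[OF A] norm_of_real by simp
  qed
  hence "(\<Sum>i\<in>I'. cmod (qform S A (\<lambda>a. u a i))) = (\<Sum>j\<in>I. l j * (\<Sum>i\<in>I'. (cmod (\<Sum>a\<in>S. cnj (U a j) * u a i))\<^sup>2))"
    unfolding sum_distrib_left by (subst sum.swap) simp
  also have "\<dots> = sum l I"
    by (intro sum.cong refl) (simp add: overlap_sums(1)[OF spectralD(1)[OF A] u])
  finally show ?thesis by simp
qed

lemma onb_reindex_right:
  assumes "bij_betw h I' I" "onb S I U"
  shows "onb S I' (\<lambda>a i. U a (h i))"
  using onb_adjoint[OF onb_reindex[OF assms(1) onb_adjoint[OF assms(2)]]] by simp

lemma spectral_reindex_right: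
  assumes "bij_betw h I' I" "spectral S I A U l"
  shows "spectral S I' A (\<lambda>a i. U a (h i)) (\<lambda>i. l (h i))"
proof -
  have "A a b = (\<Sum>i\<in>I'. of_real (l (h i)) * U a (h i) * cnj (U b (h i)))" if "a \<in> S" "b \<in> S" for a b
    unfolding spectralD(4)[OF assms(2) that] by (rule sum.reindex_bij_betw[OF assms(1), symmetric])
  thus ?thesis unfolding spectral_def using onb_reindex_right[OF assms(1) spectralD(1)[OF assms(2)]] by blast
qed

lemma coords_spectral_diag:
  assumes "spectral S I A U l" "onb S K V"
  shows "coords S V A k k = of_real (\<Sum>i\<in>I. l i * (cmod (\<Sum>a\<in>S. cnj (U a i) * V a k))\<^sup>2)"
  using qform_spectral[OF assms(1), of "\<lambda>a. V a k"] unfolding qform_def coords_def .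

text \<open>A diagonal entry of a positive operator is a weighted sum of squared overlaps, so a zero
  entry kills each summand. Domination is thus read off entries, which are explicit for tensor
  powers while the eigenvectors are not.\<close>

lemma dominated_coords:
  assumes A: "spectral S I A U l" and l: "\<And>i. i \<in> I \<Longrightarrow> 0 \<le> l i" and V: "onb S K V"
    and z: "\<And>k. k \<in> K \<Longrightarrow> m k = 0 \<Longrightarrow> coords S V A k k = 0"
  shows "dominated S I K U l V m"
  unfolding dominated_def
proof (intro ballI impI)
  fix i k assume i: "i \<in> I" and k: "k \<in> K" and "m k = 0"
  hence "(\<Sum>i\<in>I. l i * (cmod (\<Sum>a\<in>S. cnj (U a i) * V a k))\<^sup>2) = 0"
    using z[OF k] unfolding coords_spectral_diag[OF A V] by (simp only: of_real_eq_0_iff)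
  hence "l i * (cmod (\<Sum>a\<in>S. cnj (U a i) * V a k))\<^sup>2 = 0"
    using i l spectralD(3)[OF A] by (subst (asm) sum_nonneg_eq_0_iff) auto
  thus "l i = 0 \<or> (\<Sum>a\<in>S. cnj (U a i) * V a k) = 0" by auto
qed

text \<open>The three quantities, each divided by its mean, have a sum with mean at most \<open>3\<close>, and a code
  attaining this satisfies all three bounds.\<close>
lemma code_selection:
  fixes X :: "'x set" and e2 :: "'x \<Rightarrow> 'x \<Rightarrow> real" and A :: "'x \<Rightarrow> 'k \<Rightarrow> 'k \<Rightarrow> complex" and M K :: nat
  defines "L \<equiv> {..<M} \<times> {..<K}"
  assumes X: "finite X" and w: "\<And>x. x \<in> X \<Longrightarrow> 0 \<le> w x" "sum w X = 1" and MK: "1 \<le> M" "1 \<le> K"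
    and e1: "\<And>x. x \<in> X \<Longrightarrow> 0 \<le> e1 x" "(\<Sum>x\<in>X. w x * e1 x) \<le> b1" "0 < b1"
    and e2: "\<And>x x'. x \<in> X \<Longrightarrow> x' \<in> X \<Longrightarrow> 0 \<le> e2 x x'" "\<And>x. x \<in> X \<Longrightarrow> (\<Sum>x'\<in>X. w x' * e2 x x') \<le> b2" "0 \<le> b2"
    and \<tau>: "\<And>x. x \<in> X \<Longrightarrow> 0 \<le> \<tau> x" "(\<Sum>x\<in>X. w x * \<tau> x) \<le> b3" "0 < b3"
    and A: "\<And>x. x \<in> X \<Longrightarrow> (\<Sum>k\<in>J. \<Sum>k'\<in>J. (cmod (A x k k'))\<^sup>2 / t k) \<le> E" "0 < E"
    and t: "\<And>k. k \<in> J \<Longrightarrow> 0 \<le> t k"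
  shows "\<exists>f\<in>PiE L (\<lambda>_. X).
     (\<Sum>k<K. \<Sum>m<M. e1 (f (m, k)) + (\<Sum>m'<m. e2 (f (m', k)) (f (m, k)))) \<le> 3 * (b1 + (real M - 1) * b2) * (real M * real K) \<and>
     (\<Sum>l\<in>L. \<tau> (f l)) \<le> 3 * b3 * card L \<and>
     (\<Sum>k\<in>J. \<Sum>k'\<in>J. (cmod ((\<Sum>l\<in>L. A (f l) k k') / of_nat (card L) - (\<Sum>x\<in>X. of_real (w x) * A x k k')))\<^sup>2 / t k) \<le> 3 * E / card L"
proof -
  have L: "finite L" "L \<noteq> {}"
  proof -
    show "finite L" unfolding L_def by simp
    have "(0, 0) \<in> L" unfolding L_def using MK by simp
    thus "L \<noteq> {}" by blast
  qed
  have cL: "real (card L) = real M * real K" unfolding L_def by simp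
  have cL0: "0 < real (card L)" unfolding cL using MK by simp
  note pe = L(1) X w
  \<comment> \<open>A message is tested only against earlier ones, at most \<open>M - 1\<close> of
    them; the term disappears for a code with a single message.\<close>
  define \<beta> where "\<beta> = b1 + (real M - 1) * b2"
  have M1: "0 \<le> (real M - 1) * b2" using MK e2(3) by (intro mult_nonneg_nonneg) auto
  have \<beta>: "0 < \<beta>" unfolding \<beta>_def using e1(3) M1 by linarith
  define Q1 where "Q1 f = (\<Sum>k<K. \<Sum>m<M. e1 (f (m, k)) + (\<Sum>m'<m. e2 (f (m', k)) (f (m, k))))" for f :: "nat \<times> nat \<Rightarrow> 'x"
  define Q2 where "Q2 f = (\<Sum>l\<in>L. \<tau> (f l))" for f
  define Q3 where "Q3 f = (\<Sum>k\<in>J. \<Sum>k'\<in>J. (1 / t k) * (cmod ((\<Sum>l\<in>L. A (f l) k k') / of_nat (card L) - (\<Sum>x\<in>X. of_real (w x) * A x k k')))\<^sup>2)" for f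
  have fX: "f (m, k) \<in> X" if "f \<in> PiE L (\<lambda>_. X)" "m < M" "k < K" for f m k using that unfolding L_def by (auto simp: PiE_iff)
  have fX': "f l \<in> X" if "f \<in> PiE L (\<lambda>_. X)" "l \<in> L" for f l using that by (auto simp: PiE_iff)
  have Q10: "0 \<le> Q1 f" if "f \<in> PiE L (\<lambda>_. X)" for f
    unfolding Q1_def using fX[OF that] by (intro sum_nonneg add_nonneg_nonneg) (auto intro!: e1 e2)
  have Q20: "0 \<le> Q2 f" if "f \<in> PiE L (\<lambda>_. X)" for f
    unfolding Q2_def using fX'[OF that] by (intro sum_nonneg) (auto intro!: \<tau>)
  have Q30: "0 \<le> Q3 f" for f unfolding Q3_def using t by (intro sum_nonneg mult_nonneg_nonneg) auto
  have E1: "pexp L X w Q1 \<le> \<beta> * card L"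
  proof -
    have "pexp L X w Q1 = (\<Sum>k<K. \<Sum>m<M. pexp L X w (\<lambda>f. e1 (f (m, k))) + (\<Sum>m'<m. pexp L X w (\<lambda>f. e2 (f (m', k)) (f (m, k)))))"
      unfolding Q1_def[abs_def] by (simp only: pexp_sum pexp_add)
    also have "\<dots> \<le> (\<Sum>k<K. \<Sum>m<M. \<beta>)"
    proof (intro sum_mono)
      fix k m assume "k \<in> {..<K}" "m \<in> {..<M}"
      hence mk: "m < M" "(m, k) \<in> L" and sub: "\<And>m'. m' < m \<Longrightarrow> (m', k) \<in> L" unfolding L_def by auto
      have 1: "pexp L X w (\<lambda>f. e1 (f (m, k))) \<le> b1"
        using pexp_marginal[OF pe mk(2), of e1] e1(2) by simp
      have "(\<Sum>m'<m. pexp L X w (\<lambda>f. e2 (f (m', k)) (f (m, k)))) \<le> (\<Sum>m'<m. b2)"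
      proof (intro sum_mono)
        fix m' assume "m' \<in> {..<m}"
        hence m': "m' < m" by simp
        have "pexp L X w (\<lambda>f. e2 (f (m', k)) (f (m, k))) = (\<Sum>x\<in>X. \<Sum>y\<in>X. w x * w y * e2 x y)"
          by (rule pexp_marginal2[OF pe sub[OF m'] mk(2)]) (use m' in auto)
        also have "\<dots> = (\<Sum>x\<in>X. w x * (\<Sum>y\<in>X. w y * e2 x y))" by (simp add: sum_distrib_left mult.assoc)
        also have "\<dots> \<le> (\<Sum>x\<in>X. w x * b2)" by (intro sum_mono mult_left_mono e2 w)
        also have "\<dots> = b2" unfolding sum_distrib_right[symmetric] w(2) by simp
        finally show "pexp L X w (\<lambda>f. e2 (f (m', k)) (f (m, k))) \<le> b2" .
      qed
      also have "\<dots> \<le> (real M - 1) * b2" using mk(1) e2(3) by (simp add: mult_right_mono)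
      finally show "pexp L X w (\<lambda>f. e1 (f (m, k))) + (\<Sum>m'<m. pexp L X w (\<lambda>f. e2 (f (m', k)) (f (m, k)))) \<le> \<beta>"
        unfolding \<beta>_def using 1 by linarith
    qed
    also have "\<dots> = \<beta> * card L" unfolding cL by simp
    finally show ?thesis .
  qed
  have E2: "pexp L X w Q2 \<le> b3 * card L"
  proof -
    have "pexp L X w Q2 = (\<Sum>l\<in>L. pexp L X w (\<lambda>f. \<tau> (f l)))" unfolding Q2_def[abs_def] by (rule pexp_sum)
    also have "\<dots> \<le> (\<Sum>l\<in>L. b3)" by (intro sum_mono) (simp add: pexp_marginal[OF pe] \<tau>)
    finally show ?thesis by (simp add: mult.commute)
  qed
  have E3: "pexp L X w Q3 \<le> E / card L"
  proof -
    have "pexp L X w Q3 = (\<Sum>k\<in>J. \<Sum>k'\<in>J. (1 / t k) * pexp L X w (\<lambda>f. (cmod ((\<Sum>l\<in>L. A (f l) k k') / of_nat (card L) - (\<Sum>x\<in>X. of_real (w x) * A x k k')))\<^sup>2))"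
      unfolding Q3_def[abs_def] by (simp only: pexp_sum pexp_cmult)
    also have "\<dots> \<le> (\<Sum>k\<in>J. \<Sum>k'\<in>J. (1 / t k) * ((\<Sum>x\<in>X. w x * (cmod (A x k k'))\<^sup>2) / card L))"
      by (intro sum_mono mult_left_mono pexp_variance_complex[OF pe L(2)]) (use t in auto)
    also have "\<dots> = (\<Sum>k\<in>J. \<Sum>k'\<in>J. \<Sum>x\<in>X. w x * ((cmod (A x k k'))\<^sup>2 / t k)) / card L"
      by (simp add: sum_divide_distrib sum_distrib_left mult_ac)
    also have "(\<Sum>k\<in>J. \<Sum>k'\<in>J. \<Sum>x\<in>X. w x * ((cmod (A x k k'))\<^sup>2 / t k)) = (\<Sum>k\<in>J. \<Sum>x\<in>X. \<Sum>k'\<in>J. w x * ((cmod (A x k k'))\<^sup>2 / t k))"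
      by (intro sum.cong refl sum.swap)
    also have "\<dots> = (\<Sum>x\<in>X. \<Sum>k\<in>J. \<Sum>k'\<in>J. w x * ((cmod (A x k k'))\<^sup>2 / t k))" by (rule sum.swap)
    also have "\<dots> = (\<Sum>x\<in>X. w x * (\<Sum>k\<in>J. \<Sum>k'\<in>J. (cmod (A x k k'))\<^sup>2 / t k))" by (simp only: sum_distrib_left)
    also have "\<dots> / card L \<le> (\<Sum>x\<in>X. w x * E) / card L"
      by (intro divide_right_mono sum_mono mult_left_mono A w) auto
    also have "(\<Sum>x\<in>X. w x * E) = E" unfolding sum_distrib_right[symmetric] w(2) by simp
    finally show ?thesis .
  qed
  define F where "F f = 1 / (\<beta> * card L) * Q1 f + (1 / (b3 * card L) * Q2 f + 1 / (E / card L) * Q3 f)" for f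
  have "pexp L X w F = 1 / (\<beta> * card L) * pexp L X w Q1 + (1 / (b3 * card L) * pexp L X w Q2 + 1 / (E / card L) * pexp L X w Q3)"
    unfolding F_def[abs_def] by (simp only: pexp_add pexp_cmult)
  also have "\<dots> \<le> 1 / (\<beta> * card L) * (\<beta> * card L) + (1 / (b3 * card L) * (b3 * card L) + 1 / (E / card L) * (E / card L))"
    using \<beta> \<tau>(3) A(2) cL0 by (intro add_mono mult_left_mono E1 E2 E3) auto
  also have "\<dots> = 3" using \<beta> \<tau>(3) A(2) cL0 by simp
  finally obtain f where f: "f \<in> PiE L (\<lambda>_. X)" and F: "F f \<le> 3" using pexp_witness[OF pe] by blast
  have n: "0 \<le> 1 / (\<beta> * card L) * Q1 f" "0 \<le> 1 / (b3 * card L) * Q2 f" "0 \<le> 1 / (E / card L) * Q3 f"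
    using Q10[OF f] Q20[OF f] Q30[of f] \<beta> \<tau>(3) A(2) by simp_all
  have "1 / (\<beta> * card L) * Q1 f \<le> 3" "1 / (b3 * card L) * Q2 f \<le> 3" "1 / (E / card L) * Q3 f \<le> 3"
    using F n unfolding F_def by linarith+
  hence "Q1 f \<le> 3 * \<beta> * card L" "Q2 f \<le> 3 * b3 * card L" "Q3 f \<le> 3 * E / card L"
    using \<beta> \<tau>(3) A(2) cL0 by (simp_all add: field_simps)
  thus ?thesis using f unfolding Q1_def Q2_def Q3_def \<beta>_def cL by (intro bexI[of _ f]) auto
qed

context cq_channel
begin

lemma tensor_pow_spectral:
  "tensor_pow (W 0) n \<in> carrier_mat (d ^ n) (d ^ n)"
  "spectral {..<d ^ n} {..<d ^ n} (ent (tensor_pow (W 0) n)) (\<lambda>a i. B n a (digits d n i)) (\<lambda>i. tn n (digits d n i))"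
proof -
  have c: "W 0 \<in> carrier_mat d d" using carrier by simp
  show "tensor_pow (W 0) n \<in> carrier_mat (d ^ n) (d ^ n)"
    unfolding tensor_pow_map by (rule digits(2)) (rule c)
  have "spectral {..<d ^ n} (PiE {..<n} (\<lambda>_. {..<d})) (ent (tensor_pow (W 0) n)) (B n) (tn n)"
    unfolding tensor_pow_map B_def[abs_def] tn_def[abs_def]
    by (rule tensor_list_spectral) (auto intro: c sp)
  from spectral_reindex_right[OF digits(1) this]
  show "spectral {..<d ^ n} {..<d ^ n} (ent (tensor_pow (W 0) n)) (\<lambda>a i. B n a (digits d n i)) (\<lambda>i. tn n (digits d n i))" .
qed

lemma digits_J: "i < d ^ n \<Longrightarrow> digits d n i \<in> J n"
  using digits(1)[of d n] unfolding J_def by (auto simp: bij_betw_def)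

text \<open>Bounds the logarithm of every nonzero innocent eigenvalue. Over \<open>n\<close> letters
  the bound grows linearly, one source of the factor \<open>n\<close> in the continuity
  estimate.\<close>

definition Clog :: real where "Clog = (\<Sum>k<d. \<bar>ln_supp (t k)\<bar>)"

lemma Clog_nonneg: "0 \<le> Clog" unfolding Clog_def by (intro sum_nonneg) auto

lemma ln_tn_bound:
  assumes "k \<in> J n"
  shows "\<bar>ln_supp (tn n k)\<bar> \<le> real n * Clog"
proof (cases "tn n k = 0")
  case True
  thus ?thesis using Clog_nonneg by (simp add: ln_supp_def)
next
  case False
  have tp: "0 < t (k i)" if "i < n" for i
  proof -
    have "t (k i) \<noteq> 0"
    proof
      assume "t (k i) = 0"
      hence "tn n k = 0" unfolding tn_def using that by (intro prod_zero) auto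
      thus False using False by simp
    qed
    thus ?thesis using \<mu>0[of 0 "k i"] Jd[OF assms that] by simp
  qed
  have "0 < tn n k" using False tn_nonneg[OF assms] by simp
  moreover have "ln (\<Prod>i<n. t (k i)) = (\<Sum>i<n. ln (t (k i)))"
    by (rule ln_prod) (use tp in force)+
  ultimately have "ln_supp (tn n k) = (\<Sum>i<n. ln_supp (t (k i)))"
    unfolding ln_supp_def tn_def using tp by simp
  hence "\<bar>ln_supp (tn n k)\<bar> \<le> (\<Sum>i<n. \<bar>ln_supp (t (k i))\<bar>)" by simp
  also have "\<dots> \<le> (\<Sum>i<n. Clog)"
    unfolding Clog_def by (intro sum_mono member_le_sum) (use Jd[OF assms] in auto)
  finally show ?thesis by simp
qed

definition mixk :: "nat \<Rightarrow> nat \<Rightarrow> complex" where "mixk k k' = (\<Sum>y=1..N. of_real (p y) * s y k k')"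
text \<open>The trace of the squared mixture \<open>mixk\<close> against the inverse innocent state,
  that is, one plus their chi-square divergence.\<close>

definition Cchi :: real where "Cchi = (\<Sum>k<d. \<Sum>k'<d. (cmod (mixk k k'))\<^sup>2 / t k)"

lemma Cchi_nonneg: "0 \<le> Cchi"
  unfolding Cchi_def using \<mu>0[of 0] by (intro sum_nonneg divide_nonneg_nonneg) auto

lemma sa_split: "k < d \<Longrightarrow> k' < d \<Longrightarrow> sa \<alpha> k k' = of_bool (k = k') * of_real ((1 - \<alpha>) * t k) + of_real \<alpha> * mixk k k'"
proof -
  assume k: "k < d" "k' < d"
  have "(\<Sum>y=1..N. of_real (sparse p \<alpha> y) * s y k k') = of_real \<alpha> * mixk k k'"
    unfolding mixk_def sum_distrib_left by (intro sum.cong refl) (simp add: sparse_def)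
  thus ?thesis unfolding sa_def sum_atMost_split s0[OF k] by (simp add: sparse_def mult_ac)
qed

lemma mixk_zero: "k < d \<Longrightarrow> k' < d \<Longrightarrow> t k = 0 \<Longrightarrow> mixk k k' = 0"
  unfolding mixk_def by (intro sum.neutral) (auto simp: s_zero)

lemma mixk_trace: "(\<Sum>k<d. Re (mixk k k)) = 1"
proof -
  have "(\<Sum>k<d. Re (mixk k k)) = (\<Sum>y=1..N. p y * (\<Sum>k<d. Re (s y k k)))"
    unfolding mixk_def Re_sum by (subst sum.swap) (simp add: sum_distrib_left)
  also have "\<dots> = (\<Sum>y=1..N. p y)" by (intro sum.cong refl) (simp add: s_diag_sum)
  finally show ?thesis unfolding p1 .
qed

text \<open>The mixture has trace 1, so on expanding the square the mixed term is
  \<open>2 * \<alpha> * (1 - \<alpha>)\<close> and everything linear in \<alpha> cancels. Hence the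
  last bound of the theorem has order \<gamma>^2.\<close>

lemma sa_chi2:
  assumes "0 \<le> \<alpha>" "\<alpha> \<le> 1"
  shows "(\<Sum>k<d. \<Sum>k'<d. (cmod (sa \<alpha> k k'))\<^sup>2 / t k) \<le> 1 + \<alpha>\<^sup>2 * Cchi"
proof -
  have row: "(\<Sum>k'<d. (cmod (sa \<alpha> k k'))\<^sup>2 / t k)
     = (1 - \<alpha>)\<^sup>2 * t k + 2 * \<alpha> * (1 - \<alpha>) * Re (mixk k k) + \<alpha>\<^sup>2 * (\<Sum>k'<d. (cmod (mixk k k'))\<^sup>2 / t k)" if k: "k < d" for k
  proof (cases "t k = 0")
    case True
    thus ?thesis using mixk_zero[OF k k] by simp
  next
    case False
    have "(cmod (sa \<alpha> k k'))\<^sup>2 = \<alpha>\<^sup>2 * (cmod (mixk k k'))\<^sup>2 + of_bool (k = k') * (((1 - \<alpha>) * t k)\<^sup>2 + 2 * ((1 - \<alpha>) * t k) * \<alpha> * Re (mixk k k))"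
      if "k' < d" for k'
    proof (cases "k = k'")
      case True
      thus ?thesis unfolding sa_split[OF k that] cmod_power2
        by (simp add: power2_eq_square algebra_simps)
    qed (simp add: sa_split[OF k that] norm_mult power_mult_distrib)
    hence "(\<Sum>k'<d. (cmod (sa \<alpha> k k'))\<^sup>2) = (\<Sum>k'<d. \<alpha>\<^sup>2 * (cmod (mixk k k'))\<^sup>2)
       + (\<Sum>k'<d. of_bool (k = k') * (((1 - \<alpha>) * t k)\<^sup>2 + 2 * ((1 - \<alpha>) * t k) * \<alpha> * Re (mixk k k)))"
      by (simp add: sum.distrib)
    also have "(\<Sum>k'<d. of_bool (k = k') * (((1 - \<alpha>) * t k)\<^sup>2 + 2 * ((1 - \<alpha>) * t k) * \<alpha> * Re (mixk k k)))
       = ((1 - \<alpha>) * t k)\<^sup>2 + 2 * ((1 - \<alpha>) * t k) * \<alpha> * Re (mixk k k)"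
      by (rule sum_of_bool_eq(2)) (use k in auto)
    finally have "(\<Sum>k'<d. (cmod (sa \<alpha> k k'))\<^sup>2) / t k = (\<alpha>\<^sup>2 * (\<Sum>k'<d. (cmod (mixk k k'))\<^sup>2)
       + (((1 - \<alpha>) * t k)\<^sup>2 + 2 * ((1 - \<alpha>) * t k) * \<alpha> * Re (mixk k k))) / t k"
      by (simp add: sum_distrib_left)
    also have "\<dots> = (1 - \<alpha>)\<^sup>2 * t k + 2 * \<alpha> * (1 - \<alpha>) * Re (mixk k k) + \<alpha>\<^sup>2 * ((\<Sum>k'<d. (cmod (mixk k k'))\<^sup>2) / t k)"
      using False by (simp add: power2_eq_square field_simps)
    finally show ?thesis by (simp add: sum_divide_distrib)
  qed
  have "(\<Sum>k<d. \<Sum>k'<d. (cmod (sa \<alpha> k k'))\<^sup>2 / t k)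
    = (1 - \<alpha>)\<^sup>2 * (\<Sum>k<d. t k) + 2 * \<alpha> * (1 - \<alpha>) * (\<Sum>k<d. Re (mixk k k)) + \<alpha>\<^sup>2 * Cchi"
    by (simp add: row sum.distrib sum_distrib_left Cchi_def)
  also have "\<dots> = 1 - \<alpha>\<^sup>2 + \<alpha>\<^sup>2 * Cchi"
    unfolding mixk_trace \<mu>1[of 0, simplified] by (simp add: power2_eq_square algebra_simps)
  finally show ?thesis by simp
qed

text \<open>The chi-square expression is multiplicative over tensor powers, and one letter
  contributes at most \<open>1 + \<alpha>^2 * Cchi\<close>.\<close>

lemma qrel_ent_rho_alpha_pow:
  assumes \<alpha>: "0 \<le> \<alpha>" "\<alpha> \<le> 1"
  shows "qrel_ent (tensor_pow (rho_alpha d N p W \<alpha>) n) (tensor_pow (W 0) n) \<le> exp (real n * \<alpha>\<^sup>2 * Cchi) - 1"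
proof -
  let ?R = "tensor_pow (rho_alpha d N p W \<alpha>) n"
  have dR: "density_op (d ^ n) ?R" by (rule rho_alpha_pow_density[OF \<alpha>])
  obtain Ur l where r: "spectral {..<d ^ n} {..<d ^ n} (ent ?R) Ur l" "\<And>i. i < d ^ n \<Longrightarrow> 0 \<le> l i" "(\<Sum>i<d ^ n. l i) = 1"
    using density_op_spectral[OF dR] by blast
  have c: "W 0 \<in> carrier_mat d d" using carrier by simp
  have T: "spectral {..<d ^ n} (J n) (ent (tensor_pow (W 0) n)) (B n) (tn n)"
    unfolding tensor_pow_map B_def[abs_def] tn_def[abs_def] J_def
    by (rule tensor_list_spectral) (auto intro: c sp)
  have dom: "dominated {..<d ^ n} {..<d ^ n} (J n) Ur l (B n) (tn n)"
  proof (rule dominated_coords[OF r(1) _ Bonb])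
    fix k assume k: "k \<in> J n" "tn n k = 0"
    then obtain i where i: "i < n" "t (k i) = 0" unfolding tn_def by (auto simp: prod_zero_iff)
    hence "sa \<alpha> (k i) (k i) = 0" using Jd[OF k(1) i(1)] unfolding sa_def by (intro sum.neutral) (auto simp: s_zero)
    thus "coords {..<d ^ n} (B n) (ent ?R) k k = 0"
      unfolding rho_alpha_pow_coords using i(1) by (intro prod_zero) auto
  qed (use r in auto)
  have "qrel_ent ?R (tensor_pow (W 0) n) = relent {..<d ^ n} {..<d ^ n} (J n) Ur l (B n) (tn n)"
    by (rule qrel_ent_spectral[OF density_op_carrier[OF dR] r(1) tensor_pow_spectral(1) T])
  also have "\<dots> \<le> (\<Sum>k\<in>J n. \<Sum>k'\<in>J n. (cmod (coords {..<d ^ n} (B n) (ent ?R) k k'))\<^sup>2 / tn n k) - (\<Sum>i<d ^ n. l i)"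
    unfolding coords_def using relent_le_chi2[OF r(1) Bonb dom] r(2) tn_nonneg by auto
  also have "(\<Sum>k\<in>J n. \<Sum>k'\<in>J n. (cmod (coords {..<d ^ n} (B n) (ent ?R) k k'))\<^sup>2 / tn n k)
     = (\<Sum>k\<in>J n. \<Sum>k'\<in>J n. \<Prod>i<n. (cmod (sa \<alpha> (k i) (k' i)))\<^sup>2 / t (k i))"
    unfolding rho_alpha_pow_coords tn_def
    by (intro sum.cong refl) (simp add: prod_norm[symmetric] prod_dividef prod_power_distrib)
  also have "\<dots> = (\<Sum>k\<in>J n. \<Prod>i<n. \<Sum>k'<d. (cmod (sa \<alpha> (k i) k'))\<^sup>2 / t (k i))"
    unfolding J_def by (intro sum.cong refl) (subst prod_sum_PiE, auto)
  also have "\<dots> = (\<Prod>i<n. \<Sum>k<d. \<Sum>k'<d. (cmod (sa \<alpha> k k'))\<^sup>2 / t k)"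
    unfolding J_def by (subst prod_sum_PiE) auto
  also have "\<dots> = (\<Sum>k<d. \<Sum>k'<d. (cmod (sa \<alpha> k k'))\<^sup>2 / t k) ^ n" by simp
  also have "\<dots> \<le> exp (\<alpha>\<^sup>2 * Cchi) ^ n"
  proof (rule power_mono)
    show "(\<Sum>k<d. \<Sum>k'<d. (cmod (sa \<alpha> k k'))\<^sup>2 / t k) \<le> exp (\<alpha>\<^sup>2 * Cchi)"
      using sa_chi2[OF \<alpha>] exp_ge_add_one_self[of "\<alpha>\<^sup>2 * Cchi"] by linarith
    show "0 \<le> (\<Sum>k<d. \<Sum>k'<d. (cmod (sa \<alpha> k k'))\<^sup>2 / t k)"
      using \<mu>0[of 0] by (intro sum_nonneg divide_nonneg_nonneg) auto
  qed
  also have "\<dots> = exp (real n * \<alpha>\<^sup>2 * Cchi)" by (simp add: exp_of_nat_mult[symmetric] mult_ac)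
  finally show ?thesis using r(3) by simp
qed

text \<open>Otherwise every letter of positive weight has relative entropy zero, hence equals the
  innocent state by the equality case of Klein's inequality, and \<open>p\<close> itself exhibits
  the innocent state as a mixture.\<close>

lemma Dbar_pos:
  assumes "\<not> is_mixture d N W"
  shows "0 < Dbar"
proof (rule ccontr)
  assume "\<not> 0 < Dbar"
  hence le: "Dbar \<le> 0" by simp
  have dom: "dominated {..<d} {..<d} {..<d} (U y) (\<mu> y) V t" if "y \<le> N" for y
    by (rule supp_dominated[OF carrier[OF that] sp[OF that] carrier sp supp[OF that]]) auto
  have rel: "qrel_ent (W y) (W 0) = relent {..<d} {..<d} {..<d} (U y) (\<mu> y) V t" if "y \<le> N" for y
    by (rule qrel_ent_spectral[OF carrier[OF that] sp[OF that] carrier sp]) auto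
  have ge: "0 \<le> qrel_ent (W y) (W 0)" if y: "y \<le> N" for y
    unfolding rel[OF y] using relent_ge[OF spectralD(1)[OF sp[OF y]] Vonb dom[OF y]] \<mu>0[OF y] \<mu>0[of 0] \<mu>1[OF y] \<mu>1[of 0] by auto
  have nn: "0 \<le> p y * qrel_ent (W y) (W 0)" if "y \<in> {1..N}" for y using p0 ge that by auto
  have "(\<Sum>y=1..N. p y * qrel_ent (W y) (W 0)) = 0"
    using le sum_nonneg[of "{1..N}" "\<lambda>y. p y * qrel_ent (W y) (W 0)"] nn unfolding Dbar_def by force
  hence z: "p y * qrel_ent (W y) (W 0) = 0" if "y \<in> {1..N}" for y
    using that nn by (subst (asm) sum_nonneg_eq_0_iff) auto
  have eq: "of_real (p y) * W y $$ (a, b) = of_real (p y) * W 0 $$ (a, b)" if y: "y \<in> {1..N}" and ab: "a < d" "b < d" for y a b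
  proof (cases "p y = 0")
    case False
    have yN: "y \<le> N" using y by simp
    have "qrel_ent (W y) (W 0) \<le> 0" using z[OF y] False by simp
    hence r0: "relent {..<d} {..<d} {..<d} (U y) (\<mu> y) V t \<le> 0" unfolding rel[OF yN] .
    have "W y $$ (a, b) = (\<Sum>i<d. complex_of_real (\<mu> y i) * U y a i * cnj (U y b i))"
      using spectralD(4)[OF sp[OF yN]] ab by simp
    also have "\<dots> = (\<Sum>k<d. of_real (t k) * V a k * cnj (V b k))"
    proof (rule onb_diag_eq[OF spectralD(1)[OF sp[OF yN]] Vonb])
      fix i k assume ik: "i \<in> {..<d}" "k \<in> {..<d}"
      show "(\<Sum>c<d. cnj (U y c i) * V c k) = 0 \<or> \<mu> y i = t k"
        by (rule relent_eq_zero[OF spectralD(1)[OF sp[OF yN]] Vonb dom[OF yN] _ _ _ r0 ik])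
           (use \<mu>0[OF yN] \<mu>0[of 0] \<mu>1[OF yN] \<mu>1[of 0] in auto)
    qed (use ab in auto)
    also have "\<dots> = W 0 $$ (a, b)" using spectralD(4)[OF sp[of 0]] ab by simp
    finally show ?thesis by simp
  qed simp
  have "W 0 = mat_sum d (\<lambda>x. complex_of_real (p x) \<cdot>\<^sub>m W x) {1..N}"
  proof (rule eq_matI)
    have c0: "W 0 \<in> carrier_mat d d" using carrier by simp
    fix a b assume "a < dim_row (mat_sum d (\<lambda>x. complex_of_real (p x) \<cdot>\<^sub>m W x) {1..N})"
      "b < dim_col (mat_sum d (\<lambda>x. complex_of_real (p x) \<cdot>\<^sub>m W x) {1..N})"
    hence ab: "a < d" "b < d" unfolding mat_sum_def by auto
    have "mat_sum d (\<lambda>x. complex_of_real (p x) \<cdot>\<^sub>m W x) {1..N} $$ (a, b) = (\<Sum>y=1..N. (of_real (p y) \<cdot>\<^sub>m W y) $$ (a, b))"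
      unfolding mat_sum_def using ab by simp
    also have "\<dots> = (\<Sum>y=1..N. of_real (p y) * W 0 $$ (a, b))"
    proof (intro sum.cong refl)
      fix y assume y: "y \<in> {1..N}"
      hence "(of_real (p y) \<cdot>\<^sub>m W y) $$ (a, b) = of_real (p y) * W y $$ (a, b)" using carrier[of y] ab by auto
      thus "(of_real (p y) \<cdot>\<^sub>m W y) $$ (a, b) = of_real (p y) * W 0 $$ (a, b)" using eq[OF y ab] by simp
    qed
    also have "\<dots> = W 0 $$ (a, b)" unfolding sum_distrib_right[symmetric] of_real_sum[symmetric] p1 by simp
    finally show "W 0 $$ (a, b) = mat_sum d (\<lambda>x. complex_of_real (p x) \<cdot>\<^sub>m W x) {1..N} $$ (a, b)" ..
  qed (use carrier[of 0] in \<open>auto simp: mat_sum_def\<close>)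
  hence "is_mixture d N W" unfolding is_mixture_def using p0 p1 by (intro exI[of _ p]) auto
  with assms show False ..
qed

text \<open>Here \<open>f\<close> is the code drawn and \<open>g\<close> the code used after an
  exchange on \<open>bad\<close>. The four terms are: exchanged indices, at most 2 each since states
  have trace norm 1; truncation of the drawn codewords; fluctuation \<open>Y\<close> of their
  truncated average around its mean; truncation inside that mean.\<close>

lemma codebook_distance:
  assumes \<alpha>: "0 \<le> \<alpha>" "\<alpha> \<le> 1" and L: "finite L" "L \<noteq> {}" and f: "\<And>l. l \<in> L \<Longrightarrow> f l \<in> X n" and g: "\<And>l. l \<in> L \<Longrightarrow> g l \<in> X n"
    and bad: "bad \<subseteq> L" "\<And>l. l \<in> L - bad \<Longrightarrow> g l = f l"
    and A: "\<And>x u. x \<in> X n \<Longrightarrow> onb (J n) {..<d ^ n} u \<Longrightarrow>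
        (\<Sum>i<d ^ n. cmod (qform (J n) (\<lambda>k k'. sn n x k k' - A x k k') (\<lambda>k. u k i))) \<le> \<tau> x"
      "\<And>x k k'. x \<in> X n \<Longrightarrow> k \<in> J n \<Longrightarrow> k' \<in> J n \<Longrightarrow> tn n k = 0 \<Longrightarrow> A x k k' = 0"
    and u: "onb {..<d ^ n} {..<d ^ n} u"
  shows "(\<Sum>i<d ^ n. cmod (qform {..<d ^ n} (\<lambda>a b. (\<Sum>l\<in>L. ent (chan_out W n (g l)) a b) / of_nat (card L)
        - ent (tensor_pow (rho_alpha d N p W \<alpha>) n) a b) (\<lambda>a. u a i)))
    \<le> 2 * card bad / card L + (\<Sum>l\<in>L. \<tau> (f l)) / card L
      + sqrt (\<Sum>k\<in>J n. \<Sum>k'\<in>J n. (cmod ((\<Sum>l\<in>L. A (f l) k k') / of_nat (card L) - (\<Sum>x\<in>X n. of_real (w \<alpha> n x) * A x k k')))\<^sup>2 / tn n k)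
      + (\<Sum>x\<in>X n. w \<alpha> n x * \<tau> x)"
proof -
  define c where "c = (1 / of_nat (card L) :: complex)"
  have cL: "0 < card L" using L by (simp add: card_gt_0_iff)
  have nc: "cmod c = 1 / card L" unfolding c_def by (simp add: norm_divide)
  define v where "v k i = (\<Sum>a<d ^ n. cnj (B n a k) * u a i)" for k i
  have v: "onb (J n) {..<d ^ n} v" unfolding v_def by (rule onb_overlap[OF Bonb u])
  define Y where "Y k k' = (\<Sum>l\<in>L. A (f l) k k') / of_nat (card L) - (\<Sum>x\<in>X n. of_real (w \<alpha> n x) * A x k k')" for k k'
  define q where "q A i = qform (J n) A (\<lambda>k. v k i)" for A :: "(nat \<Rightarrow> nat) \<Rightarrow> (nat \<Rightarrow> nat) \<Rightarrow> complex" and i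
  have chg: "qform {..<d ^ n} (ent M) (\<lambda>a. u a i) = q (coords {..<d ^ n} (B n) (ent M)) i" for M i
    unfolding q_def v_def coords_def[abs_def] by (rule qform_change_basis[OF Bonb, symmetric])
  have chan: "qform {..<d ^ n} (ent (chan_out W n x)) (\<lambda>a. u a i) = q (sn n x) i" if "x \<in> X n" for x i
  proof -
    have "coords {..<d ^ n} (B n) (ent (chan_out W n x)) = sn n x"
      by (intro ext chan_coords XN[OF that])
    thus ?thesis unfolding chg by simp
  qed
  have rho: "qform {..<d ^ n} (ent (tensor_pow (rho_alpha d N p W \<alpha>) n)) (\<lambda>a. u a i)
      = (\<Sum>x\<in>X n. of_real (w \<alpha> n x) * q (sn n x) i)" for i
  proof -
    have "coords {..<d ^ n} (B n) (ent (tensor_pow (rho_alpha d N p W \<alpha>) n)) = (\<lambda>k k'. \<Sum>x\<in>X n. of_real (w \<alpha> n x) * sn n x k k')"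
      by (intro ext) (simp only: rho_alpha_pow_coords sn_average)
    thus ?thesis unfolding chg by (simp only: q_def qform_sum)
  qed
  \<comment> \<open>The truncated operators are added and subtracted both in the empirical average
    and in the mean.\<close>
  have eqn: "qform {..<d ^ n} (\<lambda>a b. (\<Sum>l\<in>L. ent (chan_out W n (g l)) a b) / of_nat (card L)
        - ent (tensor_pow (rho_alpha d N p W \<alpha>) n) a b) (\<lambda>a. u a i)
      = (\<Sum>l\<in>L. c * (q (sn n (g l)) i - q (sn n (f l)) i)) + (\<Sum>l\<in>L. c * q (\<lambda>k k'. sn n (f l) k k' - A (f l) k k') i)
        + q Y i - (\<Sum>x\<in>X n. of_real (w \<alpha> n x) * q (\<lambda>k k'. sn n x k k' - A x k k') i)" for i
  proof -
    have "qform {..<d ^ n} (\<lambda>a b. (\<Sum>l\<in>L. ent (chan_out W n (g l)) a b) / of_nat (card L)) (\<lambda>a. u a i)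
       = qform {..<d ^ n} (\<lambda>a b. \<Sum>l\<in>L. c * ent (chan_out W n (g l)) a b) (\<lambda>a. u a i)"
      unfolding c_def by (intro qform_cong) (simp add: sum_divide_distrib)
    also have "\<dots> = (\<Sum>l\<in>L. c * q (sn n (g l)) i)"
      unfolding qform_sum by (intro sum.cong refl) (simp add: chan g)
    finally have 1: "qform {..<d ^ n} (\<lambda>a b. (\<Sum>l\<in>L. ent (chan_out W n (g l)) a b) / of_nat (card L)) (\<lambda>a. u a i)
       = (\<Sum>l\<in>L. c * q (sn n (g l)) i)" .
    have "q Y i = qform (J n) (\<lambda>k k'. (\<Sum>l\<in>L. c * A (f l) k k') - (\<Sum>x\<in>X n. of_real (w \<alpha> n x) * A x k k')) (\<lambda>k. v k i)"
      unfolding q_def Y_def c_def by (intro qform_cong) (simp add: sum_divide_distrib)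
    hence 2: "q Y i = (\<Sum>l\<in>L. c * q (A (f l)) i) - (\<Sum>x\<in>X n. of_real (w \<alpha> n x) * q (A x) i)"
      unfolding qform_diff qform_sum q_def .
    have 3: "q (\<lambda>k k'. sn n x k k' - A x k k') i = q (sn n x) i - q (A x) i" for x
      unfolding q_def by (rule qform_diff)
    show ?thesis unfolding qform_diff 1 2 3 rho
      by (simp add: right_diff_distrib sum_subtractf)
  qed
  have pt: "cmod (qform {..<d ^ n} (\<lambda>a b. (\<Sum>l\<in>L. ent (chan_out W n (g l)) a b) / of_nat (card L)
        - ent (tensor_pow (rho_alpha d N p W \<alpha>) n) a b) (\<lambda>a. u a i))
     \<le> (\<Sum>l\<in>bad. (1 / card L) * (cmod (q (sn n (g l)) i) + cmod (q (sn n (f l)) i)))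
       + (\<Sum>l\<in>L. (1 / card L) * cmod (q (\<lambda>k k'. sn n (f l) k k' - A (f l) k k') i))
       + cmod (q Y i) + (\<Sum>x\<in>X n. w \<alpha> n x * cmod (q (\<lambda>k k'. sn n x k k' - A x k k') i))" for i
  proof -
    have "(\<Sum>l\<in>L. c * (q (sn n (g l)) i - q (sn n (f l)) i)) = (\<Sum>l\<in>bad. c * (q (sn n (g l)) i - q (sn n (f l)) i))"
      by (rule sum.mono_neutral_right) (use L bad in auto)
    hence 1: "cmod (\<Sum>l\<in>L. c * (q (sn n (g l)) i - q (sn n (f l)) i))
       \<le> (\<Sum>l\<in>bad. (1 / card L) * (cmod (q (sn n (g l)) i) + cmod (q (sn n (f l)) i)))"
      by (auto intro!: order_trans[OF norm_sum] sum_mono mult_left_mono norm_triangle_ineq4 simp: norm_mult nc simp del: times_divide_eq_left)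
    have 2: "cmod (\<Sum>l\<in>L. c * q (\<lambda>k k'. sn n (f l) k k' - A (f l) k k') i)
       \<le> (\<Sum>l\<in>L. (1 / card L) * cmod (q (\<lambda>k k'. sn n (f l) k k' - A (f l) k k') i))"
      by (rule order_trans[OF norm_sum]) (simp add: norm_mult nc)
    have 3: "cmod (\<Sum>x\<in>X n. of_real (w \<alpha> n x) * q (\<lambda>k k'. sn n x k k' - A x k k') i)
       \<le> (\<Sum>x\<in>X n. w \<alpha> n x * cmod (q (\<lambda>k k'. sn n x k k' - A x k k') i))"
      by (rule order_trans[OF norm_sum]) (auto intro!: sum_mono mult_right_mono simp: norm_mult w_prob(1)[OF \<alpha>])
    have tri: "cmod (z1 + z2 + z3 - z4) \<le> cmod z1 + cmod z2 + cmod z3 + cmod z4" for z1 z2 z3 z4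
      by (intro order_trans[OF norm_triangle_ineq4] add_mono order_trans[OF norm_triangle_ineq] order_refl)
    show ?thesis unfolding eqn
      by (rule order_trans[OF tri]) (intro add_mono 1 2 3 order_refl)
  qed
  have sn1: "(\<Sum>i<d ^ n. cmod (q (sn n x) i)) \<le> 1" if x: "x \<in> X n" for x
    unfolding q_def using spectral_qform_sum_le[OF sn_spectral _ v, of x] \<mu>n[of n x] XN[OF x] by auto
  have Y: "(\<Sum>i<d ^ n. cmod (q Y i)) \<le> sqrt (\<Sum>k\<in>J n. \<Sum>k'\<in>J n. (cmod (Y k k'))\<^sup>2 / tn n k)"
  proof -
    have "(\<Sum>i<d ^ n. cmod (q Y i)) \<le> sqrt (\<Sum>k\<in>J n. tn n k) * sqrt (\<Sum>k\<in>J n. \<Sum>k'\<in>J n. (cmod (Y k k'))\<^sup>2 / tn n k)"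
      unfolding q_def
    proof (rule qform_weighted_bound[OF v tn_nonneg])
      fix k k' assume "k \<in> J n" "k' \<in> J n" "tn n k = 0"
      thus "Y k k' = 0" unfolding Y_def using A(2) f by simp
    qed
    thus ?thesis unfolding tn_sum by simp
  qed
  have "(\<Sum>i<d ^ n. cmod (qform {..<d ^ n} (\<lambda>a b. (\<Sum>l\<in>L. ent (chan_out W n (g l)) a b) / of_nat (card L)
        - ent (tensor_pow (rho_alpha d N p W \<alpha>) n) a b) (\<lambda>a. u a i)))
     \<le> (\<Sum>i<d ^ n. (\<Sum>l\<in>bad. (1 / card L) * (cmod (q (sn n (g l)) i) + cmod (q (sn n (f l)) i)))
       + (\<Sum>l\<in>L. (1 / card L) * cmod (q (\<lambda>k k'. sn n (f l) k k' - A (f l) k k') i))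
       + cmod (q Y i) + (\<Sum>x\<in>X n. w \<alpha> n x * cmod (q (\<lambda>k k'. sn n x k k' - A x k k') i)))"
    by (intro sum_mono pt)
  also have "\<dots> = (\<Sum>l\<in>bad. (1 / card L) * (\<Sum>i<d ^ n. cmod (q (sn n (g l)) i) + cmod (q (sn n (f l)) i)))
       + (\<Sum>l\<in>L. (1 / card L) * (\<Sum>i<d ^ n. cmod (q (\<lambda>k k'. sn n (f l) k k' - A (f l) k k') i)))
       + (\<Sum>i<d ^ n. cmod (q Y i)) + (\<Sum>x\<in>X n. w \<alpha> n x * (\<Sum>i<d ^ n. cmod (q (\<lambda>k k'. sn n x k k' - A x k k') i)))"
    unfolding sum_distrib_left unfolding sum.distrib
    by (intro arg_cong2[where f = "(+)"] sum.swap refl)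
  also have "\<dots> \<le> (\<Sum>l\<in>bad. (1 / card L) * (1 + 1)) + (\<Sum>l\<in>L. (1 / card L) * \<tau> (f l))
       + sqrt (\<Sum>k\<in>J n. \<Sum>k'\<in>J n. (cmod (Y k k'))\<^sup>2 / tn n k) + (\<Sum>x\<in>X n. w \<alpha> n x * \<tau> x)"
  proof (intro add_mono sum_mono mult_left_mono Y)
    fix l assume "l \<in> bad"
    hence "l \<in> L" using bad(1) by blast
    thus "(\<Sum>i<d ^ n. cmod (q (sn n (g l)) i) + cmod (q (sn n (f l)) i)) \<le> 1 + 1"
      unfolding sum.distrib by (intro add_mono sn1 f g)
  qed (auto simp: q_def intro: A(1) f v w_prob(1)[OF \<alpha>])
  finally show ?thesis unfolding Y_def by (simp add: sum_divide_distrib mult.commute)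
qed

end

locale covert_setup = bob: cq_channel dB N \<sigma> UB \<mu>B p + willie: cq_channel dW N \<rho> UW \<mu>W p
  for dB dW N \<sigma> \<rho> UB \<mu>B UW \<mu>W p
begin

text \<open>By Markov's inequality at most a fraction \<open>4 * \<beta> / \<theta>\<close> of the
  keys has an error bound above \<open>\<theta>\<close>, where 4 is the constant of the union bound.
  This is below 1, so some key is good, and its codewords replace those of the bad keys. Every
  exchanged index costs 2 in distance, whence \<open>8 * \<beta> / \<theta>\<close>.\<close>

lemma code_exists:
  fixes M K :: nat
  assumes \<alpha>: "0 \<le> \<alpha>" "\<alpha> \<le> 1" and MK: "1 \<le> M" "1 \<le> K"
    and P: "\<forall>x\<in>bob.X n. proj {..<dB ^ n} (P x)"
      "(\<Sum>x\<in>bob.X n. bob.w \<alpha> n x * (1 - trp {..<dB ^ n} (P x) (ent (chan_out \<sigma> n x)))) \<le> b1"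
      "\<forall>x\<in>bob.X n. (\<Sum>x'\<in>bob.X n. bob.w \<alpha> n x' * trp {..<dB ^ n} (P x) (ent (chan_out \<sigma> n x'))) \<le> b2"
    and b: "0 < b1" "0 \<le> b2" "0 < b3" "0 < E"
    and A: "\<forall>x\<in>willie.X n. 0 \<le> \<tau> x \<and> (\<forall>u. onb (willie.J n) {..<dW ^ n} u \<longrightarrow>
        (\<Sum>i<dW ^ n. cmod (qform (willie.J n) (\<lambda>k k'. willie.sn n x k k' - A x k k') (\<lambda>k. u k i))) \<le> \<tau> x) \<and>
        (\<Sum>k\<in>willie.J n. \<Sum>k'\<in>willie.J n. (cmod (A x k k'))\<^sup>2 / willie.tn n k) \<le> E \<and>
        (\<forall>k\<in>willie.J n. \<forall>k'\<in>willie.J n. willie.tn n k = 0 \<longrightarrow> A x k k' = 0)"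
      "(\<Sum>x\<in>willie.X n. willie.w \<alpha> n x * \<tau> x) \<le> b3"
    and \<beta>: "\<beta> = 3 * (b1 + (real M - 1) * b2)" and \<theta>: "4 * \<beta> < \<theta>"
    and e: "0 < e" "e < 1"
  shows "\<exists>cw \<Lambda>. coding_scheme N dB n M K cw \<Lambda> \<and> (\<forall>k<K. bob_error n \<sigma> M cw \<Lambda> k \<le> \<theta>) \<and>
    \<bar>qrel_ent (willie_avg dW n \<rho> M K cw) (tensor_pow (\<rho> 0) n)
      - qrel_ent (tensor_pow (rho_alpha dW N p \<rho> \<alpha>) n) (tensor_pow (\<rho> 0) n)\<bar>
    \<le> (8 * \<beta> / \<theta> + 3 * b3 + sqrt (3 * E / (real M * real K)) + b3) * (ln (real (dW ^ n) / e) + real n * willie.Clog) - ln (1 - e)"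
proof -
  define L where "L = {..<M} \<times> {..<K}"
  define D where "D = dW ^ n"
  define e1 where "e1 x = 1 - trp {..<dB ^ n} (P x) (ent (chan_out \<sigma> n x))" for x
  define e2 where "e2 x x' = trp {..<dB ^ n} (P x) (ent (chan_out \<sigma> n x'))" for x x'
  have dens: "density_op (dB ^ n) (chan_out \<sigma> n x)" if "x \<in> bob.X n" for x
    by (rule bob.chan_density) (rule bob.XN[OF that])
  have e10: "0 \<le> e1 x" if x: "x \<in> bob.X n" for x
  proof -
    obtain U l where s: "spectral {..<dB ^ n} {..<dB ^ n} (ent (chan_out \<sigma> n x)) U l"
      "\<And>i. i < dB ^ n \<Longrightarrow> 0 \<le> l i" "(\<Sum>i<dB ^ n. l i) = 1"
      using density_op_spectral[OF dens[OF x]] by blast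
    show ?thesis unfolding e1_def trp_proj_compl[OF s(1) bspec[OF P(1) x] s(3)]
      by (intro sum_nonneg mult_nonneg_nonneg nsq_nonneg) (use s(2) in auto)
  qed
  have e20: "0 \<le> e2 x x'" if x: "x \<in> bob.X n" "x' \<in> bob.X n" for x x'
  proof -
    obtain U l where s: "spectral {..<dB ^ n} {..<dB ^ n} (ent (chan_out \<sigma> n x')) U l"
      "\<And>i. i < dB ^ n \<Longrightarrow> 0 \<le> l i"
      using density_op_spectral[OF dens[OF x(2)]] by blast
    show ?thesis unfolding e2_def trp_proj[OF s(1) bspec[OF P(1) x(1)]]
      by (intro sum_nonneg mult_nonneg_nonneg nsq_nonneg) (use s(2) in auto)
  qed
  have cL: "real (card L) = real M * real K" unfolding L_def by simp
  have L: "finite L" "L \<noteq> {}"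
  proof -
    show "finite L" unfolding L_def by simp
    have "(0, 0) \<in> L" unfolding L_def using MK by simp
    thus "L \<noteq> {}" by blast
  qed
  have "\<exists>f\<in>PiE L (\<lambda>_. bob.X n).
     (\<Sum>k<K. \<Sum>m<M. e1 (f (m, k)) + (\<Sum>m'<m. e2 (f (m', k)) (f (m, k)))) \<le> 3 * (b1 + (real M - 1) * b2) * (real M * real K) \<and>
     (\<Sum>l\<in>L. \<tau> (f l)) \<le> 3 * b3 * card L \<and>
     (\<Sum>k\<in>willie.J n. \<Sum>k'\<in>willie.J n. (cmod ((\<Sum>l\<in>L. A (f l) k k') / of_nat (card L)
        - (\<Sum>x\<in>bob.X n. of_real (bob.w \<alpha> n x) * A x k k')))\<^sup>2 / willie.tn n k) \<le> 3 * E / card L"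
    unfolding L_def
    by (rule code_selection[OF bob.Xfin bob.w_prob[OF \<alpha>] MK e10 _ b(1) e20 _ b(2) _ _ b(3) _ b(4) willie.tn_nonneg])
       (use P A in \<open>auto simp: e1_def e2_def\<close>)
  then obtain f where fP: "f \<in> PiE L (\<lambda>_. bob.X n)"
    and f1: "(\<Sum>k<K. \<Sum>m<M. e1 (f (m, k)) + (\<Sum>m'<m. e2 (f (m', k)) (f (m, k)))) \<le> \<beta> * (real M * real K)"
    and f2: "(\<Sum>l\<in>L. \<tau> (f l)) \<le> 3 * b3 * card L"
    and f3: "(\<Sum>k\<in>willie.J n. \<Sum>k'\<in>willie.J n. (cmod ((\<Sum>l\<in>L. A (f l) k k') / of_nat (card L)
        - (\<Sum>x\<in>bob.X n. of_real (bob.w \<alpha> n x) * A x k k')))\<^sup>2 / willie.tn n k) \<le> 3 * E / card L"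
    unfolding \<beta> by blast
  have fX: "f (m, k) \<in> bob.X n" if "m < M" "k < K" for m k using fP that unfolding L_def by (auto simp: PiE_iff)
  define err where "err k = (\<Sum>m<M. 4 * (e1 (f (m, k)) + (\<Sum>m'<m. e2 (f (m', k)) (f (m, k))))) / M" for k
  define bd where "bd = {k. k < K \<and> \<theta> < err k}"
  have \<beta>0: "0 < \<beta>" unfolding \<beta> using b MK by (intro mult_pos_pos add_pos_nonneg mult_nonneg_nonneg) auto
  have \<theta>0: "0 < \<theta>" using \<beta>0 \<theta> by linarith
  have err0: "0 \<le> err k" if "k < K" for k
    unfolding err_def using that by (intro divide_nonneg_nonneg sum_nonneg mult_nonneg_nonneg add_nonneg_nonneg) (auto intro!: e10 e20 fX)
  have bdK: "bd \<subseteq> {..<K}" unfolding bd_def by auto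
  have finbd: "finite bd" using bdK by (rule finite_subset) simp
  have bd: "real (card bd) * \<theta> \<le> 4 * \<beta> * K"
  proof -
    have "real (card bd) * \<theta> = (\<Sum>k\<in>bd. \<theta>)" by simp
    also have "\<dots> \<le> (\<Sum>k\<in>bd. err k)" unfolding bd_def by (intro sum_mono) auto
    also have "\<dots> \<le> (\<Sum>k<K. err k)" using bdK err0 by (intro sum_mono2) auto
    also have "\<dots> = 4 / M * (\<Sum>k<K. \<Sum>m<M. e1 (f (m, k)) + (\<Sum>m'<m. e2 (f (m', k)) (f (m, k))))"
      unfolding err_def sum_divide_distrib[symmetric] sum_distrib_left[symmetric] by simp
    also have "\<dots> \<le> 4 / M * (\<beta> * (real M * real K))" by (intro mult_left_mono f1) auto
    also have "\<dots> = 4 * \<beta> * K" using MK by simp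
    finally show ?thesis .
  qed
  have "bd \<noteq> {..<K}"
  proof
    assume "bd = {..<K}"
    hence "real K * \<theta> \<le> real K * (4 * \<beta>)" using bd by (simp add: mult_ac)
    thus False using MK \<theta> by simp
  qed
  then obtain k0 where k0: "k0 < K" "k0 \<notin> bd" using bdK by blast
  define h where "h k = (if k \<in> bd then k0 else k)" for k
  have hK: "h k < K" if "k < K" for k using that k0 unfolding h_def by simp
  have herr: "err (h k) \<le> \<theta>" if "k < K" for k using that k0 unfolding h_def bd_def by (auto simp: not_less)
  define cw where "cw m k = f (m, h k)" for m k
  have cwX: "cw m k \<in> bob.X n" if "m < M" "k < K" for m k unfolding cw_def by (intro fX that hK)
  \<comment> \<open>The decoder is built from the codewords after the exchange, so a bad key also
    inherits the tests of the good one.\<close>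
  have "\<forall>k\<in>{..<K}. \<exists>\<Lambda>. (\<forall>m<M. psd_mat (dB ^ n) (\<Lambda> m)) \<and> mat_sum (dB ^ n) \<Lambda> {..<M} = 1\<^sub>m (dB ^ n) \<and>
     (\<forall>m<M. \<forall>A. density_op (dB ^ n) A \<longrightarrow> 1 - Re (mtrace (\<Lambda> m * A))
        \<le> 4 * ((1 - trp {..<dB ^ n} (P (cw m k)) (ent A)) + (\<Sum>j<m. trp {..<dB ^ n} (P (cw j k)) (ent A))))"
    by (intro ballI sequential_decoder MK) (use P(1) cwX in auto)
  from bchoice[OF this] obtain \<Lambda>' where \<Lambda>': "\<forall>k\<in>{..<K}. (\<forall>m<M. psd_mat (dB ^ n) (\<Lambda>' k m)) \<and> mat_sum (dB ^ n) (\<Lambda>' k) {..<M} = 1\<^sub>m (dB ^ n) \<and>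
     (\<forall>m<M. \<forall>A. density_op (dB ^ n) A \<longrightarrow> 1 - Re (mtrace (\<Lambda>' k m * A))
        \<le> 4 * ((1 - trp {..<dB ^ n} (P (cw m k)) (ent A)) + (\<Sum>j<m. trp {..<dB ^ n} (P (cw j k)) (ent A))))" ..
  define \<Lambda> where "\<Lambda> m k = \<Lambda>' k m" for m k
  have scheme: "coding_scheme N dB n M K cw \<Lambda>"
    unfolding coding_scheme_def \<Lambda>_def using MK \<Lambda>' bob.XN[OF cwX] by auto
  have berr: "bob_error n \<sigma> M cw \<Lambda> k \<le> \<theta>" if k: "k < K" for k
  proof -
    have "(\<Sum>m<M. 1 - Re (mtrace (\<Lambda> m k * chan_out \<sigma> n (cw m k))))
       \<le> (\<Sum>m<M. 4 * (e1 (f (m, h k)) + (\<Sum>m'<m. e2 (f (m', h k)) (f (m, h k)))))"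
    proof (intro sum_mono)
      fix m assume "m \<in> {..<M}"
      hence m: "m < M" by simp
      show "1 - Re (mtrace (\<Lambda> m k * chan_out \<sigma> n (cw m k))) \<le> 4 * (e1 (f (m, h k)) + (\<Sum>m'<m. e2 (f (m', h k)) (f (m, h k))))"
        using \<Lambda>' k m dens[OF cwX[OF m k]] unfolding \<Lambda>_def e1_def e2_def cw_def by auto
    qed
    hence "bob_error n \<sigma> M cw \<Lambda> k \<le> err (h k)"
      unfolding bob_error_def err_def by (simp add: divide_right_mono)
    thus ?thesis using herr[OF k] by linarith
  qed
  define g where "g = (\<lambda>(m, k). cw m k)"
  have gX: "g l \<in> bob.X n" if "l \<in> L" for l using that cwX unfolding L_def g_def by auto
  have fX': "f l \<in> bob.X n" if "l \<in> L" for l using that fP by (auto simp: PiE_iff)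
  define bad where "bad = {..<M} \<times> bd"
  have badL: "bad \<subseteq> L" unfolding bad_def L_def using bdK by auto
  have gf: "g l = f l" if "l \<in> L - bad" for l using that unfolding bad_def L_def g_def cw_def h_def by auto
  have avgc: "willie_avg dW n \<rho> M K cw \<in> carrier_mat D D" unfolding willie_avg_def mat_sum_def D_def by simp
  have avg: "willie_avg dW n \<rho> M K cw $$ (a, b) = (\<Sum>l\<in>L. ent (chan_out \<rho> n (g l)) a b) / of_nat (card L)" if "a < D" "b < D" for a b
  proof -
    have "(\<Sum>l\<in>L. (case l of (m, k) \<Rightarrow> chan_out \<rho> n (cw m k)) $$ (a, b)) = (\<Sum>l\<in>L. ent (chan_out \<rho> n (g l)) a b)"
      unfolding g_def by (intro sum.cong refl) (simp add: case_prod_unfold)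
    thus ?thesis unfolding willie_avg_def mat_sum_def using that
      by (simp add: D_def[symmetric] L_def[symmetric] cL[symmetric] del: of_real_mult)
  qed
  have wdens: "density_op D (chan_out \<rho> n x)" if "x \<in> bob.X n" for x
    unfolding D_def by (rule willie.chan_density) (rule willie.XN[OF that])
  have davg: "density_op D (willie_avg dW n \<rho> M K cw)"
  proof (rule density_op_mixture[where Y = L and w = "\<lambda>_. 1 / card L" and F = "\<lambda>l. chan_out \<rho> n (g l)"])
    show "(\<Sum>l\<in>L. 1 / real (card L)) = 1" using L by simp
    show "willie_avg dW n \<rho> M K cw $$ (a, b) = (\<Sum>l\<in>L. of_real (1 / card L) * chan_out \<rho> n (g l) $$ (a, b))" if "a < D" "b < D" for a b
      unfolding avg[OF that] by (simp add: sum_divide_distrib)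
  qed (use wdens gX avgc in auto)
  define \<eta> where "\<eta> = 8 * \<beta> / \<theta> + 3 * b3 + sqrt (3 * E / (real M * real K)) + b3"
  have tn: "(\<Sum>i<D. cmod (qform {..<D} (\<lambda>a b. ent (willie_avg dW n \<rho> M K cw) a b
       - ent (tensor_pow (rho_alpha dW N p \<rho> \<alpha>) n) a b) (\<lambda>a. u a i))) \<le> \<eta>" if u: "onb {..<D} {..<D} u" for u
  proof -
    have "(\<Sum>i<D. cmod (qform {..<D} (\<lambda>a b. ent (willie_avg dW n \<rho> M K cw) a b
       - ent (tensor_pow (rho_alpha dW N p \<rho> \<alpha>) n) a b) (\<lambda>a. u a i)))
      = (\<Sum>i<D. cmod (qform {..<D} (\<lambda>a b. (\<Sum>l\<in>L. ent (chan_out \<rho> n (g l)) a b) / of_nat (card L)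
       - ent (tensor_pow (rho_alpha dW N p \<rho> \<alpha>) n) a b) (\<lambda>a. u a i)))"
      by (intro sum.cong refl arg_cong[where f = cmod] qform_cong) (simp add: avg)
    also have "\<dots> \<le> 2 * card bad / card L + (\<Sum>l\<in>L. \<tau> (f l)) / card L
      + sqrt (\<Sum>k\<in>willie.J n. \<Sum>k'\<in>willie.J n. (cmod ((\<Sum>l\<in>L. A (f l) k k') / of_nat (card L)
          - (\<Sum>x\<in>willie.X n. of_real (willie.w \<alpha> n x) * A x k k')))\<^sup>2 / willie.tn n k)
      + (\<Sum>x\<in>willie.X n. willie.w \<alpha> n x * \<tau> x)"
      unfolding D_def
      by (rule willie.codebook_distance[OF \<alpha> L fX' gX badL gf _ _ u[unfolded D_def]]) (use A(1) in auto)
    also have "\<dots> \<le> \<eta>"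
      unfolding \<eta>_def
    proof (intro add_mono A(2))
      have "real (card bd) / K \<le> 4 * \<beta> / \<theta>" using bd \<theta>0 MK by (simp add: field_simps)
      moreover have "2 * real (card bad) / real (card L) = 2 * (real (card bd) / K)"
        unfolding cL bad_def card_cartesian_product using MK by simp
      ultimately show "2 * card bad / card L \<le> 8 * \<beta> / \<theta>" by simp
      show "(\<Sum>l\<in>L. \<tau> (f l)) / real (card L) \<le> 3 * b3" using f2 L by (simp add: divide_le_eq card_gt_0_iff)
    qed (use f3 in \<open>simp add: cL[symmetric]\<close>)
    finally show ?thesis .
  qed
  note T = willie.tensor_pow_spectral[of n, folded D_def]
  have "\<bar>qrel_ent (willie_avg dW n \<rho> M K cw) (tensor_pow (\<rho> 0) n)
      - qrel_ent (tensor_pow (rho_alpha dW N p \<rho> \<alpha>) n) (tensor_pow (\<rho> 0) n)\<bar>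
    \<le> \<eta> * (ln (real D / e) + real n * willie.Clog) - ln (1 - e)"
  proof (rule qrel_ent_continuity[OF davg _ T e tn tn[OF spectralD(1)[OF T(2)]]])
    show "density_op D (tensor_pow (rho_alpha dW N p \<rho> \<alpha>) n)"
      unfolding D_def by (rule willie.rho_alpha_pow_density[OF \<alpha>])
    fix k assume "k \<in> {..<D}"
    thus "\<bar>ln_supp (willie.tn n (digits dW n k))\<bar> \<le> real n * willie.Clog"
      unfolding D_def by (intro willie.ln_tn_bound willie.digits_J) simp
  qed (use willie.Clog_nonneg in auto)
  thus ?thesis using scheme berr unfolding \<eta>_def D_def by blast
qed

end

section \<open>From random codes to the theorem: code sizes, constants and asymptotics\<close>

lemma cq_channel_exists:
  assumes W: "\<forall>x\<le>N. density_op d (W x)" and supp: "\<forall>x\<le>N. supp (W x) \<subseteq> supp (W 0)"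
    and p: "\<forall>y\<in>{1..N}. 0 \<le> p y" "(\<Sum>y=1..N. p y) = 1"
  obtains U \<mu> where "cq_channel d N W U \<mu> p"
proof -
  have "\<forall>x\<in>{..N}. \<exists>z. spectral {..<d} {..<d} (ent (W x)) (fst z) (snd z) \<and> (\<forall>i<d. 0 \<le> snd z i) \<and> (\<Sum>i<d. snd z i) = 1"
  proof
    fix x assume "x \<in> {..N}"
    hence "density_op d (W x)" using W by simp
    from density_op_spectral[OF this] obtain U l where
      "spectral {..<d} {..<d} (ent (W x)) U l" "\<And>i. i < d \<Longrightarrow> 0 \<le> l i" "(\<Sum>i<d. l i) = 1" by blast
    thus "\<exists>z. spectral {..<d} {..<d} (ent (W x)) (fst z) (snd z) \<and> (\<forall>i<d. 0 \<le> snd z i) \<and> (\<Sum>i<d. snd z i) = 1"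
      by (intro exI[of _ "(U, l)"]) auto
  qed
  from bchoice[OF this] obtain z where z: "\<forall>x\<in>{..N}. spectral {..<d} {..<d} (ent (W x)) (fst (z x)) (snd (z x)) \<and>
    (\<forall>i<d. 0 \<le> snd (z x) i) \<and> (\<Sum>i<d. snd (z x) i) = 1" ..
  have "cq_channel d N W (\<lambda>x. fst (z x)) (\<lambda>x. snd (z x)) p"
    by unfold_locales (use W supp p z in auto)
  thus ?thesis by (rule that)
qed

text \<open>The lower bound makes \<open>M * K\<close> large enough against Willie's variance; the
  bound on the ceiling minus 1 serves Bob's confusion term, which carries the factor
  \<open>M - 1\<close>.\<close>

lemma nat_ceiling_exp: "exp x \<le> real (nat \<lceil>exp x\<rceil>)" "real (nat \<lceil>exp x\<rceil>) - 1 \<le> exp x" "1 \<le> nat \<lceil>exp x\<rceil>"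
  for x :: real
proof -
  have "real (nat \<lceil>exp x\<rceil>) = of_int \<lceil>exp x\<rceil>" using exp_gt_zero[of x] by (intro of_nat_nat) (simp add: less_trans[OF _ exp_gt_zero])
  thus 1: "exp x \<le> real (nat \<lceil>exp x\<rceil>)" and "real (nat \<lceil>exp x\<rceil>) - 1 \<le> exp x" by linarith+
  have "0 < real (nat \<lceil>exp x\<rceil>)" using 1 exp_gt_zero[of x] by linarith
  thus "1 \<le> nat \<lceil>exp x\<rceil>" by linarith
qed

theorem theorem4:
  fixes N dB dW :: nat
    and \<sigma> \<rho> :: "nat \<Rightarrow> complex mat"
    and p :: "nat \<Rightarrow> real"
    and \<gamma> :: "nat \<Rightarrow> real"
  assumes bob_states: "\<forall>x\<le>N. density_op dB (\<sigma> x)"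
    and willie_states: "\<forall>x\<le>N. density_op dW (\<rho> x)"
    and supp_bob: "\<forall>x\<le>N. supp (\<sigma> x) \<subseteq> supp (\<sigma> 0)"
    and supp_willie: "\<forall>x\<le>N. supp (\<rho> x) \<subseteq> supp (\<rho> 0)"
    and not_mix: "\<not> is_mixture dW N \<rho>"
    and p_nonneg: "\<forall>x\<in>{1..N}. 0 \<le> p x"
    and p_sum: "(\<Sum>x=1..N. p x) = 1"
    and gamma_o1: "\<gamma> \<longlonglongrightarrow> 0"
    and gamma_omega: "filterlim (\<lambda>n. sqrt (real n) * \<gamma> n / ln (real n)) at_top sequentially"
  shows "\<forall>s. 0 < s \<and> s < 1 \<longrightarrow>
    (\<exists>s1 s2 s3 :: real. 0 < s1 \<and> 0 < s2 \<and> 0 < s3 \<and>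
      (\<forall>\<^sub>F n in sequentially.
         \<exists>M K cw \<Lambda>.
           coding_scheme N dB n M K cw \<Lambda> \<and>
           M = nat \<lceil>exp ((1 - s) * \<gamma> n * sqrt (real n) *
                     (\<Sum>x=1..N. p x * qrel_ent (\<sigma> x) (\<sigma> 0)))\<rceil> \<and>
           K = nat \<lceil>exp (\<gamma> n * sqrt (real n) *
                     max 0 (\<Sum>x=1..N. p x * ((1 + s) * qrel_ent (\<rho> x) (\<rho> 0)
                                             - (1 - s) * qrel_ent (\<sigma> x) (\<sigma> 0))))\<rceil> \<and>
           (\<forall>k<K. bob_error n \<sigma> M cw \<Lambda> k \<le> exp (- s1 * \<gamma> n * sqrt (real n))) \<and>
           \<bar>qrel_ent (willie_avg dW n \<rho> M K cw) (tensor_pow (\<rho> 0) n)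
            - qrel_ent (tensor_pow (rho_alpha dW N p \<rho> (\<gamma> n / sqrt (real n))) n) (tensor_pow (\<rho> 0) n)\<bar>
              \<le> exp (- s2 * \<gamma> n * sqrt (real n)) \<and>
           qrel_ent (tensor_pow (rho_alpha dW N p \<rho> (\<gamma> n / sqrt (real n))) n) (tensor_pow (\<rho> 0) n)
              \<le> s3 * (\<gamma> n)\<^sup>2))"
proof (intro allI impI)
  fix s :: real assume s: "0 < s \<and> s < 1"
  obtain UB \<mu>B where bobc: "cq_channel dB N \<sigma> UB \<mu>B p"
    using cq_channel_exists[OF bob_states supp_bob p_nonneg p_sum] by blast
  obtain UW \<mu>W where williec: "cq_channel dW N \<rho> UW \<mu>W p"
    using cq_channel_exists[OF willie_states supp_willie p_nonneg p_sum] by blast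
  interpret covert_setup dB dW N \<sigma> \<rho> UB \<mu>B UW \<mu>W p
    using bobc williec by (rule covert_setup.intro)
  define DB where "DB = bob.Dbar"
  define DW where "DW = willie.Dbar"
  have DW: "0 < DW" unfolding DW_def by (rule willie.Dbar_pos[OF not_mix])
  have R: "(\<Sum>x=1..N. p x * ((1 + s) * qrel_ent (\<rho> x) (\<rho> 0) - (1 - s) * qrel_ent (\<sigma> x) (\<sigma> 0)))
     = (1 + s) * DW - (1 - s) * DB"
    unfolding DW_def DB_def bob.Dbar_def willie.Dbar_def sum_distrib_left sum_subtractf[symmetric]
    by (intro sum.cong refl) (simp add: algebra_simps)
  \<comment> \<open>Half of the slack \<open>s * DB\<close>. If \<open>DB\<close> is not positive
    there will be one message and no confusion, and any positive value serves.\<close>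
  define \<epsilon>B where "\<epsilon>B = (if 0 < DB then s * DB / 2 else 1)"
  have \<epsilon>B: "0 < \<epsilon>B" unfolding \<epsilon>B_def using s by simp
  define \<epsilon>W where "\<epsilon>W = s * DW / 2"
  have \<epsilon>W: "0 < \<epsilon>W" unfolding \<epsilon>W_def using s DW by simp
  obtain \<kappa>B a0 where \<kappa>B: "0 < \<kappa>B" "0 < a0" and bobP: "\<forall>n \<alpha>. 0 \<le> \<alpha> \<and> \<alpha> \<le> 1 \<and> \<alpha> \<le> a0 \<longrightarrow> (\<exists>P.
     (\<forall>x\<in>bob.X n. proj {..<dB ^ n} (P x)) \<and>
     (\<Sum>x\<in>bob.X n. bob.w \<alpha> n x * (1 - trp {..<dB ^ n} (P x) (ent (chan_out \<sigma> n x)))) \<le> 2 * exp (- \<kappa>B * (real n * \<alpha>)) \<and>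
     (\<forall>x\<in>bob.X n. (\<Sum>x'\<in>bob.X n. bob.w \<alpha> n x' * trp {..<dB ^ n} (P x) (ent (chan_out \<sigma> n x'))) \<le> exp (real n * \<alpha> * (\<epsilon>B - DB))))"
    using bob.bob_projections[OF \<epsilon>B] unfolding DB_def by blast
  obtain \<kappa>W where \<kappa>W: "0 < \<kappa>W" and willieA: "\<forall>n \<alpha>. 0 \<le> \<alpha> \<and> \<alpha> \<le> 1 \<longrightarrow> (\<exists>A \<tau>.
     (\<forall>x\<in>willie.X n. 0 \<le> \<tau> x \<and> (\<forall>u. onb (willie.J n) {..<dW ^ n} u \<longrightarrow>
        (\<Sum>i<dW ^ n. cmod (qform (willie.J n) (\<lambda>k k'. willie.sn n x k k' - A x k k') (\<lambda>k. u k i))) \<le> \<tau> x) \<and>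
        (\<Sum>k\<in>willie.J n. \<Sum>k'\<in>willie.J n. (cmod (A x k k'))\<^sup>2 / willie.tn n k) \<le> exp (real n * \<alpha> * (DW + \<epsilon>W)) \<and>
        (\<forall>k\<in>willie.J n. \<forall>k'\<in>willie.J n. willie.tn n k = 0 \<longrightarrow> A x k k' = 0)) \<and>
     (\<Sum>x\<in>willie.X n. willie.w \<alpha> n x * \<tau> x) \<le> 3 * exp (- \<kappa>W * (real n * \<alpha>)))"
    using willie.willie_truncation[OF \<epsilon>W] unfolding DW_def by blast
  \<comment> \<open>For positive \<open>DB\<close> the exponent of the confusion term is
    \<open>(1 - s) * DB + \<epsilon>B - DB = - c1\<close>.\<close>
  define c1 where "c1 = (if 0 < DB then s * DB / 2 else 1)"
  define c2 where "c2 = min \<kappa>B c1"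
  \<comment> \<open>Decay rate of Willie's distance: \<open>c2 / 2\<close> from the fraction of bad
    keys, \<open>\<kappa>W\<close> from truncation, and \<open>s * DW / 4\<close> from the square
    root of a variance of order \<open>exp (- (s * DW / 2) * g)\<close>.\<close>
  define c3 where "c3 = min (c2 / 2) (min \<kappa>W (s * DW / 4))"
  have c1: "0 < c1" unfolding c1_def using s by simp
  have c2: "0 < c2" "c2 \<le> \<kappa>B" "c2 \<le> c1" unfolding c2_def using c1 \<kappa>B by auto
  have c3: "0 < c3" "c3 \<le> c2 / 2" "c3 \<le> \<kappa>W" "c3 \<le> s * DW / 4" unfolding c3_def using c2 \<kappa>W s DW by auto
  have dW: "1 \<le> dW"
  proof (rule ccontr)
    assume "\<not> 1 \<le> dW"
    hence "dW = 0" by simp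
    thus False using willie.\<mu>1[of 0] by simp
  qed
  \<comment> \<open>86 = 72 + 9 + 2 + 3 adds the four contributions to the distance in units of
    \<open>e\<close>; the final 2 comes from \<open>- ln (1 - e) <= 2 * e\<close>.\<close>
  define H where "H = 86 * (ln dW + c3 + willie.Clog) + 2"
  \<comment> \<open>The bounds 1 and \<open>a0\<close> make \<alpha> admissible; the third keeps
    \<open>\<gamma>^2 * Cchi\<close> at most 1, where \<open>exp x <= 1 + x + x^2\<close>.\<close>
  define \<gamma>0 where "\<gamma>0 = min (min 1 a0) (1 / (1 + willie.Cchi))"
  have \<gamma>0: "0 < \<gamma>0" unfolding \<gamma>0_def using \<kappa>B willie.Cchi_nonneg by simp
  \<comment> \<open>\<open>4 / c3\<close> yields \<open>n^2 <= exp (c3 / 2 * g)\<close>, which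
    absorbs the polynomial factor; \<open>72 / c2\<close> yields
    \<open>36 * \<theta> < 1\<close>.\<close>
  define Z where "Z = max (4 / c3) (72 / c2)"
  have ev: "\<forall>\<^sub>F n in sequentially. 3 \<le> n \<and> H \<le> real n \<and> \<gamma> n < \<gamma>0 \<and> Z \<le> sqrt (real n) * \<gamma> n / ln (real n)"
  proof (intro eventually_conj)
    show "\<forall>\<^sub>F n in sequentially. 3 \<le> n" by (rule eventually_ge_at_top)
    show "\<forall>\<^sub>F n in sequentially. H \<le> real n"
      using filterlim_real_sequentially unfolding filterlim_at_top by blast
    show "\<forall>\<^sub>F n in sequentially. \<gamma> n < \<gamma>0" by (rule order_tendstoD(2)[OF gamma_o1 \<gamma>0])
    show "\<forall>\<^sub>F n in sequentially. Z \<le> sqrt (real n) * \<gamma> n / ln (real n)"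
      using gamma_omega unfolding filterlim_at_top by blast
  qed
  have main: "\<exists>M K cw \<Lambda>.
           coding_scheme N dB n M K cw \<Lambda> \<and>
           M = nat \<lceil>exp ((1 - s) * \<gamma> n * sqrt (real n) *
                     (\<Sum>x=1..N. p x * qrel_ent (\<sigma> x) (\<sigma> 0)))\<rceil> \<and>
           K = nat \<lceil>exp (\<gamma> n * sqrt (real n) *
                     max 0 (\<Sum>x=1..N. p x * ((1 + s) * qrel_ent (\<rho> x) (\<rho> 0)
                                             - (1 - s) * qrel_ent (\<sigma> x) (\<sigma> 0))))\<rceil> \<and>
           (\<forall>k<K. bob_error n \<sigma> M cw \<Lambda> k \<le> exp (- (c2 / 2) * \<gamma> n * sqrt (real n))) \<and>
           \<bar>qrel_ent (willie_avg dW n \<rho> M K cw) (tensor_pow (\<rho> 0) n)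
            - qrel_ent (tensor_pow (rho_alpha dW N p \<rho> (\<gamma> n / sqrt (real n))) n) (tensor_pow (\<rho> 0) n)\<bar>
              \<le> exp (- (c3 / 2) * \<gamma> n * sqrt (real n)) \<and>
           qrel_ent (tensor_pow (rho_alpha dW N p \<rho> (\<gamma> n / sqrt (real n))) n) (tensor_pow (\<rho> 0) n)
              \<le> (2 * willie.Cchi + 1) * (\<gamma> n)\<^sup>2"
    if n: "3 \<le> n \<and> H \<le> real n \<and> \<gamma> n < \<gamma>0 \<and> Z \<le> sqrt (real n) * \<gamma> n / ln (real n)" for n
  proof -
    define \<alpha> where "\<alpha> = \<gamma> n / sqrt (real n)"
    define g where "g = \<gamma> n * sqrt (real n)"
    have n3: "3 \<le> real n" using n by simp
    have sq: "1 \<le> sqrt (real n)" using n3 by simp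
    have lnn: "1 \<le> ln (real n)"
    proof -
      have "exp 1 \<le> real n" using exp_le n3 by linarith
      hence "ln (exp 1) \<le> ln (real n)" using n3 by (subst ln_le_cancel_iff) auto
      thus ?thesis by simp
    qed
    have Z0: "0 < Z" unfolding Z_def using c3 by (simp add: less_max_iff_disj)
    have gln: "Z * ln (real n) \<le> g" using n lnn unfolding g_def by (simp add: le_divide_eq mult.commute)
    hence gZ: "Z \<le> g" using mult_left_mono[OF lnn, of Z] Z0 by linarith
    have g0: "0 < g" using gZ Z0 by linarith
    \<comment> \<open>The sign of \<gamma> comes from the growth condition.\<close>
    have \<gamma>pos: "0 < \<gamma> n" using g0 sq unfolding g_def by (simp add: zero_less_mult_iff)
    have \<gamma>le: "\<gamma> n \<le> 1" "\<gamma> n \<le> a0" "\<gamma> n * (1 + willie.Cchi) \<le> 1"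
      using n willie.Cchi_nonneg unfolding \<gamma>0_def by (auto simp: less_divide_eq)
    have \<alpha>\<gamma>: "\<alpha> \<le> \<gamma> n" unfolding \<alpha>_def using \<gamma>pos sq by (simp add: divide_le_eq mult_left_le[of 1])
    have \<alpha>: "0 \<le> \<alpha>" "\<alpha> \<le> 1" "\<alpha> \<le> a0" using \<gamma>pos \<gamma>le \<alpha>\<gamma> unfolding \<alpha>_def by auto
    have n\<alpha>: "real n * \<alpha> = g" unfolding \<alpha>_def g_def using sq real_sqrt_mult_self[of "real n"] by (simp add: field_simps)
    have n\<alpha>2: "real n * \<alpha>\<^sup>2 = (\<gamma> n)\<^sup>2" unfolding \<alpha>_def power_divide using n3 by simp
    have gn: "g \<le> real n"
    proof -
      have "g \<le> 1 * sqrt (real n)" unfolding g_def using \<gamma>le(1) by (rule mult_right_mono) simp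
      also have "\<dots> \<le> sqrt (real n) * sqrt (real n)" using sq by (intro mult_right_mono) auto
      also have "\<dots> = real n" by simp
      finally show ?thesis .
    qed
    define M where "M = nat \<lceil>exp ((1 - s) * g * DB)\<rceil>"
    define K where "K = nat \<lceil>exp (g * max 0 ((1 + s) * DW - (1 - s) * DB))\<rceil>"
    have MK: "1 \<le> M" "1 \<le> K" unfolding M_def K_def by (rule nat_ceiling_exp)+
    obtain P where P: "\<forall>x\<in>bob.X n. proj {..<dB ^ n} (P x)"
     "(\<Sum>x\<in>bob.X n. bob.w \<alpha> n x * (1 - trp {..<dB ^ n} (P x) (ent (chan_out \<sigma> n x)))) \<le> 2 * exp (- \<kappa>B * g)"
     "\<forall>x\<in>bob.X n. (\<Sum>x'\<in>bob.X n. bob.w \<alpha> n x' * trp {..<dB ^ n} (P x) (ent (chan_out \<sigma> n x'))) \<le> exp (g * (\<epsilon>B - DB))"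
      using bobP[rule_format, of \<alpha> n] \<alpha> unfolding n\<alpha> by blast
    obtain A \<tau> where A: "\<forall>x\<in>willie.X n. 0 \<le> \<tau> x \<and> (\<forall>u. onb (willie.J n) {..<dW ^ n} u \<longrightarrow>
        (\<Sum>i<dW ^ n. cmod (qform (willie.J n) (\<lambda>k k'. willie.sn n x k k' - A x k k') (\<lambda>k. u k i))) \<le> \<tau> x) \<and>
        (\<Sum>k\<in>willie.J n. \<Sum>k'\<in>willie.J n. (cmod (A x k k'))\<^sup>2 / willie.tn n k) \<le> exp (g * (DW + \<epsilon>W)) \<and>
        (\<forall>k\<in>willie.J n. \<forall>k'\<in>willie.J n. willie.tn n k = 0 \<longrightarrow> A x k k' = 0)"
     "(\<Sum>x\<in>willie.X n. willie.w \<alpha> n x * \<tau> x) \<le> 3 * exp (- \<kappa>W * g)"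
      using willieA[rule_format, of \<alpha> n] \<alpha> unfolding n\<alpha> by blast
    define \<beta> where "\<beta> = 3 * (2 * exp (- \<kappa>B * g) + (real M - 1) * exp (g * (\<epsilon>B - DB)))"
    \<comment> \<open>The square root of the decay of \<beta>: Markov's inequality at this level
      leaves both the error of the good keys and the fraction of bad keys exponentially
      small.\<close>
    define \<theta> where "\<theta> = exp (- (c2 / 2) * g)"
    \<comment> \<open>\<open>e\<close> is the scale of the distance and also the mixing weight in
      the continuity estimate, so \<open>ln (1 / e)\<close> is only linear in
      \<open>g\<close>.\<close>
    define e where "e = exp (- c3 * g)"
    have cmp: "exp (- a * g) \<le> exp (- b * g)" if "b \<le> a" for a b
      using mult_right_mono[OF that less_imp_le[OF g0]] by simp
    have Mb: "(real M - 1) * exp (g * (\<epsilon>B - DB)) \<le> exp (- c1 * g)"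
    proof (cases "0 < DB")
      case True
      have "(real M - 1) * exp (g * (\<epsilon>B - DB)) \<le> exp ((1 - s) * g * DB) * exp (g * (\<epsilon>B - DB))"
        unfolding M_def by (intro mult_right_mono nat_ceiling_exp) auto
      also have "\<dots> = exp (- c1 * g)"
        unfolding exp_add[symmetric] c1_def \<epsilon>B_def using True by (simp add: field_simps)
      finally show ?thesis .
    next
      case False
      \<comment> \<open>The ceiling gives exactly one message here, and the factor
        \<open>M - 1\<close> removes the confusion term.\<close>
      have "(1 - s) * g * DB \<le> 0" using False s g0 by (intro mult_nonneg_nonpos) auto
      hence "exp ((1 - s) * g * DB) \<le> 1" by simp
      hence "\<lceil>exp ((1 - s) * g * DB)\<rceil> \<le> 1" by (simp add: ceiling_le_iff)
      hence "M = 1" using MK(1) unfolding M_def by linarith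
      thus ?thesis by simp
    qed
    have \<beta>le: "\<beta> \<le> 9 * exp (- c2 * g)"
    proof -
      have "2 * exp (- \<kappa>B * g) + (real M - 1) * exp (g * (\<epsilon>B - DB)) \<le> 3 * exp (- c2 * g)"
        using Mb cmp[OF c2(2)] cmp[OF c2(3)] by linarith
      from mult_left_mono[OF this, of 3] show ?thesis unfolding \<beta>_def by simp
    qed
    have \<theta>2: "exp (- c2 * g) = \<theta> * \<theta>" unfolding \<theta>_def exp_add[symmetric] by simp
    have \<theta>0: "0 < \<theta>" unfolding \<theta>_def by simp
    have \<theta>36: "36 * \<theta> < 1"
    proof -
      have "72 / c2 \<le> g" using gZ unfolding Z_def by simp
      hence "36 \<le> c2 / 2 * g" using c2(1) by (simp add: field_simps)
      hence "36 < exp (c2 / 2 * g)" using exp_ge_add_one_self[of "c2 / 2 * g"] by linarith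
      thus ?thesis unfolding \<theta>_def by (simp add: exp_minus field_simps)
    qed
    have \<beta>\<theta>: "4 * \<beta> \<le> 36 * \<theta> * \<theta>" using \<beta>le unfolding \<theta>2 by simp
    hence "4 * \<beta> < \<theta>" using mult_strict_right_mono[OF \<theta>36 \<theta>0] by simp
    have "4 / c3 \<le> g" using gZ unfolding Z_def by simp
    hence gc3: "4 \<le> c3 * g" using c3(1) by (simp add: field_simps)
    have e: "0 < e" "e \<le> 1 / 2"
    proof -
      have "2 \<le> exp (c3 * g)" using exp_ge_add_one_self[of "c3 * g"] gc3 by linarith
      thus "e \<le> 1 / 2" unfolding e_def by (simp add: exp_minus field_simps)
    qed (simp add: e_def)
    obtain cw \<Lambda> where scheme: "coding_scheme N dB n M K cw \<Lambda>" and berr: "\<forall>k<K. bob_error n \<sigma> M cw \<Lambda> k \<le> \<theta>"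
      and rel: "\<bar>qrel_ent (willie_avg dW n \<rho> M K cw) (tensor_pow (\<rho> 0) n)
      - qrel_ent (tensor_pow (rho_alpha dW N p \<rho> \<alpha>) n) (tensor_pow (\<rho> 0) n)\<bar>
      \<le> (8 * \<beta> / \<theta> + 3 * (3 * exp (- \<kappa>W * g)) + sqrt (3 * exp (g * (DW + \<epsilon>W)) / (real M * real K)) + 3 * exp (- \<kappa>W * g))
         * (ln (real (dW ^ n) / e) + real n * willie.Clog) - ln (1 - e)"
      using code_exists[OF \<alpha>(1,2) MK P _ _ _ _ A \<beta>_def \<open>4 * \<beta> < \<theta>\<close> e(1)] e(2) by force
    have t1: "8 * \<beta> / \<theta> \<le> 72 * e"
    proof -
      have "8 * \<beta> / \<theta> \<le> 72 * \<theta>" using \<beta>\<theta> \<theta>0 by (simp add: divide_le_eq)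
      also have "\<dots> \<le> 72 * e" unfolding \<theta>_def e_def using cmp[OF c3(2)] by simp
      finally show ?thesis .
    qed
    have t2: "exp (- \<kappa>W * g) \<le> e" unfolding e_def by (rule cmp[OF c3(3)])
    have t3: "sqrt (3 * exp (g * (DW + \<epsilon>W)) / (real M * real K)) \<le> 2 * e"
    proof -
      \<comment> \<open>The positive part is at least the bracket itself, so the exponents of
        \<open>M\<close> and \<open>K\<close> add up to at least \<open>(1 + s) * DW\<close> in
        units of \<open>g\<close>.\<close>
      have "exp (g * ((1 + s) * DW)) \<le> exp ((1 - s) * g * DB + g * max 0 ((1 + s) * DW - (1 - s) * DB))"
      proof -
        have "(1 + s) * DW \<le> (1 - s) * DB + max 0 ((1 + s) * DW - (1 - s) * DB)" by simp
        from mult_left_mono[OF this less_imp_le[OF g0]] show ?thesis by (simp add: distrib_left mult_ac)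
      qed
      also have "\<dots> \<le> real M * real K"
        unfolding exp_add M_def K_def by (intro mult_mono nat_ceiling_exp of_nat_0_le_iff exp_ge_zero)
      finally have MKge: "exp (g * ((1 + s) * DW)) \<le> real M * real K" .
      have "3 * exp (g * (DW + \<epsilon>W)) / (real M * real K) \<le> 3 * exp (g * (DW + \<epsilon>W)) / exp (g * ((1 + s) * DW))"
        using MKge MK by (intro divide_left_mono) auto
      also have "\<dots> = 3 * exp (- (s * DW / 2) * g)"
        unfolding times_divide_eq_right[symmetric] exp_diff[symmetric] \<epsilon>W_def by (simp add: field_simps)
      \<comment> \<open>4 in place of 3 makes the bound a perfect square.\<close>
      also have "\<dots> \<le> 4 * exp (- (2 * c3) * g)"
      proof -
        have "exp (- (s * DW / 2) * g) \<le> exp (- (2 * c3) * g)" by (rule cmp) (use c3(4) in simp)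
        thus ?thesis using exp_gt_zero[of "- (2 * c3) * g"] by linarith
      qed
      also have "\<dots> = (2 * e)\<^sup>2"
        unfolding e_def power_mult_distrib exp_of_nat_mult[symmetric] by (simp add: mult.assoc)
      finally have "3 * exp (g * (DW + \<epsilon>W)) / (real M * real K) \<le> (2 * e)\<^sup>2" .
      thus ?thesis using e(1) by (intro real_le_lsqrt) auto
    qed
    have lnD: "ln (real (dW ^ n) / e) = real n * ln dW + c3 * g"
      unfolding e_def using dW by (simp add: ln_div ln_realpow)
    have lnD0: "0 \<le> ln (real (dW ^ n) / e) + real n * willie.Clog"
      unfolding lnD using dW c3(1) g0 willie.Clog_nonneg by (intro add_nonneg_nonneg mult_nonneg_nonneg) auto
    have "- ln (1 - e) \<le> 2 * e"
    proof -
      have "2 * e\<^sup>2 \<le> e" using e by (simp add: power2_eq_square)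
      thus ?thesis using ln_one_minus_pos_lower_bound[of e] e by linarith
    qed
    moreover have "(8 * \<beta> / \<theta> + 3 * (3 * exp (- \<kappa>W * g)) + sqrt (3 * exp (g * (DW + \<epsilon>W)) / (real M * real K)) + 3 * exp (- \<kappa>W * g))
         * (ln (real (dW ^ n) / e) + real n * willie.Clog) \<le> (86 * e) * (ln (real (dW ^ n) / e) + real n * willie.Clog)"
      using t1 t2 t3 by (intro mult_right_mono lnD0) linarith
    ultimately have "\<bar>qrel_ent (willie_avg dW n \<rho> M K cw) (tensor_pow (\<rho> 0) n)
      - qrel_ent (tensor_pow (rho_alpha dW N p \<rho> \<alpha>) n) (tensor_pow (\<rho> 0) n)\<bar>
      \<le> (86 * e) * (real n * ln dW + c3 * g + real n * willie.Clog) + 2 * e"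
      using rel unfolding lnD by linarith
    also have "\<dots> \<le> e * (H * real n)"
    proof -
      \<comment> \<open>\<open>g <= n\<close> and \<open>1 <= n\<close> turn every summand into a
        multiple of \<open>n\<close>.\<close>
      have "86 * (real n * ln dW + c3 * g + real n * willie.Clog) + 2 \<le> 86 * (real n * ln dW + c3 * real n + real n * willie.Clog) + 2 * real n"
        using n3 gn c3(1) by (intro add_mono mult_left_mono) auto
      also have "\<dots> = H * real n" unfolding H_def by (simp add: algebra_simps)
      finally have "e * (86 * (real n * ln dW + c3 * g + real n * willie.Clog) + 2) \<le> e * (H * real n)"
        using e(1) by (intro mult_left_mono) auto
      thus ?thesis by (simp add: algebra_simps)
    qed
    also have "\<dots> \<le> e * exp (c3 / 2 * g)"
    proof -
      \<comment> \<open>For large \<open>n\<close> the constant \<open>H\<close> is absorbed into a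
        second factor \<open>n\<close>, and the square of \<open>n\<close> into half of the
        exponential decay.\<close>
      have "H * real n \<le> real n * real n" using n by (intro mult_right_mono) auto
      also have "\<dots> = exp (2 * ln (real n))"
        unfolding mult_2 exp_add using n3 by simp
      also have "\<dots> \<le> exp (c3 / 2 * g)"
      proof -
        have "4 / c3 * ln (real n) \<le> Z * ln (real n)" using lnn unfolding Z_def by (intro mult_right_mono) auto
        also note gln
        finally have "4 / c3 * ln (real n) \<le> g" .
        hence "2 * ln (real n) \<le> c3 / 2 * g" using c3(1) by (simp add: field_simps)
        thus ?thesis by simp
      qed
      finally show ?thesis using e(1) by (intro mult_left_mono) auto
    qed
    also have "\<dots> = exp (- (c3 / 2) * g)" unfolding e_def exp_add[symmetric] by (simp add: field_simps)
    finally have relf: "\<bar>qrel_ent (willie_avg dW n \<rho> M K cw) (tensor_pow (\<rho> 0) n)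
      - qrel_ent (tensor_pow (rho_alpha dW N p \<rho> \<alpha>) n) (tensor_pow (\<rho> 0) n)\<bar> \<le> exp (- (c3 / 2) * g)" .
    have chi: "qrel_ent (tensor_pow (rho_alpha dW N p \<rho> \<alpha>) n) (tensor_pow (\<rho> 0) n) \<le> (2 * willie.Cchi + 1) * (\<gamma> n)\<^sup>2"
    proof -
      have x: "0 \<le> (\<gamma> n)\<^sup>2 * willie.Cchi" using willie.Cchi_nonneg by simp
      have "(\<gamma> n)\<^sup>2 * willie.Cchi \<le> \<gamma> n * (1 + willie.Cchi)"
        unfolding power2_eq_square mult.assoc using \<gamma>le(1) \<gamma>pos willie.Cchi_nonneg
        by (intro mult_left_mono) (auto intro: order_trans[OF mult_right_mono[OF \<gamma>le(1) willie.Cchi_nonneg]])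
      hence x1: "(\<gamma> n)\<^sup>2 * willie.Cchi \<le> 1" using \<gamma>le(3) by linarith
      have "qrel_ent (tensor_pow (rho_alpha dW N p \<rho> \<alpha>) n) (tensor_pow (\<rho> 0) n) \<le> exp ((\<gamma> n)\<^sup>2 * willie.Cchi) - 1"
        using willie.qrel_ent_rho_alpha_pow[OF \<alpha>(1,2), of n] unfolding n\<alpha>2 .
      also have "\<dots> \<le> (\<gamma> n)\<^sup>2 * willie.Cchi + ((\<gamma> n)\<^sup>2 * willie.Cchi)\<^sup>2" using exp_bound[OF x x1] by linarith
      also have "\<dots> \<le> (\<gamma> n)\<^sup>2 * willie.Cchi + (\<gamma> n)\<^sup>2 * willie.Cchi"
        using x x1 by (simp add: power2_eq_square[of "(\<gamma> n)\<^sup>2 * willie.Cchi"] mult_left_le)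
      also have "\<dots> \<le> (2 * willie.Cchi + 1) * (\<gamma> n)\<^sup>2" by (simp add: algebra_simps)
      finally show ?thesis .
    qed
    have "M = nat \<lceil>exp ((1 - s) * \<gamma> n * sqrt (real n) * (\<Sum>x=1..N. p x * qrel_ent (\<sigma> x) (\<sigma> 0)))\<rceil>"
      unfolding M_def g_def DB_def bob.Dbar_def by (simp add: mult.assoc)
    moreover have "K = nat \<lceil>exp (\<gamma> n * sqrt (real n) * max 0 (\<Sum>x=1..N. p x * ((1 + s) * qrel_ent (\<rho> x) (\<rho> 0)
        - (1 - s) * qrel_ent (\<sigma> x) (\<sigma> 0))))\<rceil>"
      unfolding K_def g_def R ..
    ultimately show ?thesis
      using scheme berr relf chi unfolding \<theta>_def g_def \<alpha>_def mult.assoc[symmetric] by (intro exI conjI)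
  qed
  show "\<exists>s1 s2 s3 :: real. 0 < s1 \<and> 0 < s2 \<and> 0 < s3 \<and>
      (\<forall>\<^sub>F n in sequentially.
         \<exists>M K cw \<Lambda>.
           coding_scheme N dB n M K cw \<Lambda> \<and>
           M = nat \<lceil>exp ((1 - s) * \<gamma> n * sqrt (real n) *
                     (\<Sum>x=1..N. p x * qrel_ent (\<sigma> x) (\<sigma> 0)))\<rceil> \<and>
           K = nat \<lceil>exp (\<gamma> n * sqrt (real n) *
                     max 0 (\<Sum>x=1..N. p x * ((1 + s) * qrel_ent (\<rho> x) (\<rho> 0)
                                             - (1 - s) * qrel_ent (\<sigma> x) (\<sigma> 0))))\<rceil> \<and>
           (\<forall>k<K. bob_error n \<sigma> M cw \<Lambda> k \<le> exp (- s1 * \<gamma> n * sqrt (real n))) \<and>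
           \<bar>qrel_ent (willie_avg dW n \<rho> M K cw) (tensor_pow (\<rho> 0) n)
            - qrel_ent (tensor_pow (rho_alpha dW N p \<rho> (\<gamma> n / sqrt (real n))) n) (tensor_pow (\<rho> 0) n)\<bar>
              \<le> exp (- s2 * \<gamma> n * sqrt (real n)) \<and>
           qrel_ent (tensor_pow (rho_alpha dW N p \<rho> (\<gamma> n / sqrt (real n))) n) (tensor_pow (\<rho> 0) n)
              \<le> s3 * (\<gamma> n)\<^sup>2)"
  proof (intro exI conjI)
    show "0 < c2 / 2" "0 < c3 / 2" using c2 c3 by auto
    show "0 < 2 * willie.Cchi + 1" using willie.Cchi_nonneg by linarith
  qed (rule eventually_mono[OF ev main])
qed

end
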